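(* Let $X^4 = S^4$ (standard round metric) or $X^4=\mathbb{CP}^2$ (Fubini--Study metric), let $L^2 \subset X^4$ be an oriented immersed surface, and equip $M^7=\Lambda^2_-(T^*X^4)$ with the Bryant--Salamon $\mathrm{G}_2$-structure. Let $E, F\subset \Lambda^2_-(T^*X)|_L$ be the complementary subbundles of rank $1$ and $2$ over $L$ determined by $L$, let $\sigma\in\Gamma(F)$ and $\eta \in \Gamma(E)$ be smooth sections, and let $$E+\sigma = \{(p,\eta'+\sigma(p)) \mid p\in L,\ \eta'\in E_p\},\qquad \eta+F = \{(p,\eta(p)+\sigma') \mid p\in L,\ \sigma'\in F_p\}.$$ Then: 1. The submanifold $E+\sigma$ is associative in $\Lambda^2_-(T^*X^4)$ if and only if $L^2$ is minimal in $X^4$ and $\sigma$ is a holomorphic section of $F$. 2. The submanifold $\eta+F$ is coassociative in $\Lambda^2_-(T^*X^4)$ if and only if $L^2$ is negative superminimal in $X^4$ and $\eta$ is parallel with respect to the connection $\nabla^E$ on $E$ induced by the Levi-Civita connection on $X^4$.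
   Context: $X^4$ carries its standard orientation. Objects on $X$ are pulled back to $L$ along the immersion. Bundles $E,F$. Let $(e_1,e_2,\nu_3,\nu_4)$ be an oriented local orthonormal frame of $TX|_L$ with $(e_1,e_2)$ an oriented frame of $TL$ and $(\nu_3,\nu_4)$ a frame of the normal bundle $NL$, with dual coframe $(e^1,e^2,\nu^3,\nu^4)$. Then $\Lambda^2_-(T^*X)|_L$ is locally trivialized by the anti-self-dual forms $$f^1=e^1\wedge e^2-\nu^3\wedge\nu^4,\quad f^2=e^1\wedge\nu^3-\nu^4\wedge e^2,\quad f^3=e^1\wedge\nu^4-e^2\wedge\nu^3.$$ The form $f^1=\mathrm{vol}_L-*_X\mathrm{vol}_L$ is independent of the frame; $E=\mathrm{span}\{f^1\}$ and $F=E^\perp$, locally $F=\mathrm{span}\{f^2,f^3\}$. Bryant--Salamon structure. The Levi-Civita connection of $X$ induces a connection $\nabla$ on $\pi: M=\Lambda^2_-(T^*X)\to X$ and a splitting $TM=\mathcal{H}\oplus\mathcal{V}$, $\mathcal{H}_\omega\cong T_{\pi(\omega)}X$, $\mathcal{V}_\omega\cong \Lambda^2_-(T^*_{\pi(\omega)}X)$. With $r$ the radial coordinate in the fibers, there are positive functions $u=u(r),v=v(r)$ (fixed, found by Bryant and Salamon) such that $g_M=u^2g_{\mathcal H}\oplus v^2g_{\mathcal V}$ is a complete metric with holonomy equal to $\mathrm{G}_2$ and parallel fundamental $3$-form $\varphi=v^3\,\mathrm{vol}_{\mathcal V}+u^2v\,d\theta$, where $\theta_\omega=\pi^*\omega$.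 Writing $\bar e^i,\bar\nu^j$ for the horizontal $1$-forms dual to the horizontal lifts of $e_i,\nu_j$, and $\check f_k$ for the vertical $1$-forms dual to the vertical lifts of $f^k$ (with $g_{\mathcal V}$ normalized so that these are orthonormal), over $L$ one has $$\varphi=v^3\check f_1\wedge\check f_2\wedge\check f_3+u^2v\,\check f_1\wedge(\bar e^1\wedge\bar e^2-\bar\nu^3\wedge\bar\nu^4)+u^2v\,\check f_2\wedge(\bar e^1\wedge\bar\nu^3-\bar\nu^4\wedge\bar e^2)+u^2v\,\check f_3\wedge(\bar e^1\wedge\bar\nu^4-\bar e^2\wedge\bar\nu^3).$$ Let $\psi=*\varphi$. A $3$-dimensional (resp. $4$-dimensional) immersed submanifold $N$ of $M$ is associative (resp. coassociative) if, for a suitable orientation of $N$, $\varphi|_N=\mathrm{vol}_N$ (resp. $\psi|_N=\mathrm{vol}_N$). Second fundamental form. For a normal field $\nu$, $A^\nu(w)=(\nabla_w\nu)^T$ for $w\in TL$ (tangential part of the Levi-Civita derivative). $L$ is minimal if $\mathrm{Tr}\,A^\nu=0$ for all $\nu$. Let $J_Te_1=e_2$, $J_Te_2=-e_1$ on $TL$ and $J_N\nu_3=\nu_4$, $J_N\nu_4=-\nu_3$ on $NL$. $L$ is negative superminimal if $A^{J_N\nu}=-J_TA^\nu$ for all normal vector fields $\nu$. Connections and holomorphicity. Let $\pi_E,\pi_F$ be the orthogonal projections of $\Lambda^2_-(T^*X)|_L=E\oplus F$; set $\nabla^E=\pi_E\circ\nabla$ and $\nabla^F=\pi_F\circ\nabla$.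 $F$ has the complex structure $J_Ff^2=f^3$, $J_Ff^3=-f^2$, which is $\nabla^F$-parallel, so $F$ is a holomorphic line bundle over the Riemann surface $(L,J_T)$ with $\bar\partial_F=(\nabla^F)^{0,1}$. A section $\sigma$ is holomorphic if $\bar\partial_F\sigma=0$, i.e. $\nabla^F_{e_1}\sigma+J_F(\nabla^F_{e_2}\sigma)=0$ for every local oriented orthonormal frame $(e_1,e_2)$ of $TL$. *)

theory Defs
  imports "HOL-Analysis.Analysis"
begin

section \<open>Smooth maps\<close>

text \<open>For an open set S in a finite-dimensional space these are the usual classes
  of k times continuously differentiable, respectively infinitely differentiable, maps.\<close>

primrec Ck_on :: "nat \<Rightarrow> 'a::real_normed_vector set \<Rightarrow> ('a \<Rightarrow> 'b::real_normed_vector) \<Rightarrow> bool" where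
  "Ck_on 0 S f \<longleftrightarrow> continuous_on S f"
| "Ck_on (Suc k) S f \<longleftrightarrow>
     (\<forall>x\<in>S. f differentiable (at x)) \<and> (\<forall>v. Ck_on k S (\<lambda>x. frechet_derivative f (at x) v))"

definition smooth_on :: "'a::real_normed_vector set \<Rightarrow> ('a \<Rightarrow> 'b::real_normed_vector) \<Rightarrow> bool" where
  "smooth_on S f \<longleftrightarrow> (\<forall>k. Ck_on k S f)"


section \<open>Oriented surfaces\<close>

text \<open>A surface structure on a (Hausdorff, second countable) type is given by local
  parametrizations \<open>(U, k)\<close>, that is, inverses of charts.\<close>

type_synonym 'l params = "((real^2) set \<times> (real^2 \<Rightarrow> 'l)) set"

definition oriented_surface :: "'l::topological_space params \<Rightarrow> bool" where
  "oriented_surface A \<longleftrightarrow>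
     (\<Union>(U, k)\<in>A. k ` U) = UNIV \<and>
     (\<forall>(U, k)\<in>A. open U \<and> open (k ` U) \<and> homeomorphism U (k ` U) k (inv_into U k)) \<and>
     (\<forall>(U, k)\<in>A. \<forall>(V, m)\<in>A.
        smooth_on (U \<inter> k -` (m ` V)) (inv_into V m \<circ> k) \<and>
        (\<forall>x\<in>U \<inter> k -` (m ` V).
           det (matrix (frechet_derivative (inv_into V m \<circ> k) (at x))) > 0))"

definition smooth_along :: "'l params \<Rightarrow> ('l \<Rightarrow> 'w::real_normed_vector) \<Rightarrow> bool" where
  "smooth_along A Y \<longleftrightarrow> (\<forall>(U, k)\<in>A. smooth_on U (Y \<circ> k))"


section \<open>Oriented Riemannian four-manifolds in Euclidean space\<close>

text \<open>The ambient manifold \<open>X\<close> is a submanifold of a Euclidean space with the induced metric;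
  its orientation is recorded by its Riemannian volume form.\<close>

record 'v riem4 =
  points :: "'v set"
  volform :: "'v \<Rightarrow> 'v \<Rightarrow> 'v \<Rightarrow> 'v \<Rightarrow> 'v \<Rightarrow> real"

definition tangent :: "'v::euclidean_space riem4 \<Rightarrow> 'v \<Rightarrow> 'v set" where
  "tangent X x = {w. \<exists>\<epsilon>>0. \<exists>\<gamma>. smooth_on {-\<epsilon><..<\<epsilon>} \<gamma> \<and> \<gamma> ` {-\<epsilon><..<\<epsilon>} \<subseteq> points X \<and>
      \<gamma> 0 = x \<and> (\<gamma> has_vector_derivative w) (at (0::real))}"

definition oproj :: "('w \<Rightarrow> 'w \<Rightarrow> real) \<Rightarrow> 'w set \<Rightarrow> 'w::ab_group_add \<Rightarrow> 'w" where
  "oproj ip S w = (THE y. y \<in> S \<and> (\<forall>z\<in>S. ip (w - y) z = 0))"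

abbreviation tproj :: "'v::euclidean_space riem4 \<Rightarrow> 'v \<Rightarrow> 'v \<Rightarrow> 'v" where
  "tproj X x \<equiv> oproj inner (tangent X x)"

definition oframe :: "'v::euclidean_space riem4 \<Rightarrow> 'v \<Rightarrow> 'v^4 \<Rightarrow> bool" where
  "oframe X x e \<longleftrightarrow> (\<forall>i. e$i \<in> tangent X x) \<and>
     (\<forall>i j. e$i \<bullet> e$j = (if i = j then 1 else 0)) \<and>
     volform X x (e$1) (e$2) (e$3) (e$4) = 1"

subsection \<open>The round four-sphere\<close>

definition S4 :: "(real^5) riem4" where
  "S4 = \<lparr> points = sphere 0 1, volform = (\<lambda>x a b c d. det (vector [x, a, b, c, d] :: real^5^5)) \<rparr>"

subsection \<open>The complex projective plane\<close>

text \<open>A complex line in \<open>\<complex>\<^sup>3\<close> spanned by a unit vector z is represented by the orthogonal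
  projection \<open>z z\<^sup>*\<close> onto it. The metric induced from the inner product
  \<open>Re tr (A B\<^sup>*)\<close> on matrices is the Fubini--Study metric; the normalization is that of the
  Kaehler form i d d-bar log |z|^2 (holomorphic sectional curvature 2, scalar curvature 12),
  i.e. twice the quotient metric of the unit sphere \<open>S\<^sup>5\<close>;
  see \<open>line_proj_eq_iff\<close>, \<open>line_proj_metric\<close> and \<open>CP2_J_line_proj\<close> below. The complex structure on the tangent
  space at P is \<open>A \<mapsto> \<i> (A P - P A)\<close>, and the volume form is half the square of the
  Kaehler form, so that CP2 carries its complex orientation.\<close>

definition line_proj :: "complex^3 \<Rightarrow> complex^3^3" where
  "line_proj z = (\<chi> i j. z$i * cnj (z$j))"

definition CP2_J :: "complex^3^3 \<Rightarrow> complex^3^3 \<Rightarrow> complex^3^3" where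
  "CP2_J P A = (\<chi> i j. \<i> * (A ** P - P ** A)$i$j)"

definition kaehler :: "complex^3^3 \<Rightarrow> complex^3^3 \<Rightarrow> complex^3^3 \<Rightarrow> real" where
  "kaehler P A B = CP2_J P A \<bullet> B"

definition CP2 :: "(complex^3^3) riem4" where
  "CP2 = \<lparr> points = line_proj ` sphere 0 1,
           volform = (\<lambda>P a b c d. kaehler P a b * kaehler P c d - kaehler P a c * kaehler P b d
                                  + kaehler P a d * kaehler P b c) \<rparr>"

definition cdot :: "complex^3 \<Rightarrow> complex^3 \<Rightarrow> complex" where
  "cdot z w = (\<Sum>i\<in>UNIV. z$i * cnj (w$i))"

lemma cdot_self: "cdot z z = of_real ((norm z)\<^sup>2)"
  unfolding cdot_def power2_norm_eq_inner inner_vec_def of_real_sum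
  by (rule sum.cong) (auto simp: complex_eq_iff inner_complex_def)

lemma cdot_cnj: "cdot z w = cnj (cdot w z)"
  by (simp add: cdot_def mult.commute)

lemma line_proj_eq_iff:
  assumes "norm z = 1" "norm w = 1"
  shows "line_proj z = line_proj w \<longleftrightarrow> (\<exists>c. norm c = 1 \<and> (\<forall>i. z$i = c * w$i))"
proof
  assume *: "line_proj z = line_proj w"
  have e: "z$i * cnj (z$j) = w$i * cnj (w$j)" for i j
    using arg_cong[OF *, of "\<lambda>m. m$i$j"] by (simp add: line_proj_def)
  have zi: "z$i = cdot z w * w$i" for i
  proof -
    have zz: "(\<Sum>j\<in>UNIV. z$j * cnj (z$j)) = 1" and ww: "(\<Sum>j\<in>UNIV. w$j * cnj (w$j)) = 1"
      using cdot_self[of z] cdot_self[of w] assms by (simp_all add: cdot_def)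
    have "z$i = (\<Sum>j\<in>UNIV. (z$i * cnj (z$j)) * z$j)"
    proof -
      have "(\<Sum>j\<in>UNIV. (z$i * cnj (z$j)) * z$j) = z$i * (\<Sum>j\<in>UNIV. z$j * cnj (z$j))"
        unfolding sum_distrib_left by (rule sum.cong) simp_all
      then show ?thesis by (simp only: zz mult_1_right)
    qed
    also have "\<dots> = (\<Sum>j\<in>UNIV. (w$i * cnj (w$j)) * z$j)" by (simp add: e)
    also have "\<dots> = cdot z w * w$i"
      unfolding cdot_def sum_distrib_right by (rule sum.cong) simp_all
    finally show ?thesis .
  qed
  have "norm (z$i) = norm (cdot z w) * norm (w$i)" for i by (metis zi norm_mult)
  then have "norm z = norm (cdot z w) * norm w"
    unfolding norm_vec_def by (simp add: L2_set_right_distrib)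
  then show "\<exists>c. norm c = 1 \<and> (\<forall>i. z$i = c * w$i)" using assms zi by auto
next
  assume "\<exists>c. norm c = 1 \<and> (\<forall>i. z$i = c * w$i)"
  then obtain c where c: "norm c = 1" "\<And>i. z$i = c * w$i" by auto
  then have "c * cnj c = 1" by (simp add: complex_norm_square[symmetric])
  have "z$i * cnj (z$j) = (c * cnj c) * (w$i * cnj (w$j))" for i j by (simp add: c mult_ac)
  then show "line_proj z = line_proj w"
    by (simp add: line_proj_def vec_eq_iff \<open>c * cnj c = 1\<close>)
qed

definition line_proj' :: "complex^3 \<Rightarrow> complex^3 \<Rightarrow> complex^3^3" where
  "line_proj' z w = (\<chi> i j. w$i * cnj (z$j) + z$i * cnj (w$j))"

lemma line_proj_has_derivative: "(line_proj has_derivative line_proj' z) (at z)"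
proof -
  have bl: "bounded_linear (\<lambda>x::complex^3. x$i)" for i by (rule bounded_linear_vec_nth)
  have d: "((\<lambda>x::complex^3. x$i) has_derivative (\<lambda>x. x$i)) (at z)" for i
    by (rule bounded_linear.has_derivative[OF bl has_derivative_ident])
  have e: "((\<lambda>z. z$i * cnj (z$j)) has_derivative (\<lambda>w. w$i * cnj (z$j) + z$i * cnj (w$j))) (at z)"
    for i j
    using has_derivative_mult[OF d[of i] bounded_linear.has_derivative[OF bounded_linear_cnj d[of j]]]
    by (simp add: add.commute)
  have vec: "(f has_derivative f') (at z)"
    if "\<And>i. ((\<lambda>x. f x $ i) has_derivative (\<lambda>x. f' x $ i)) (at z)"
    for f f' :: "complex^3 \<Rightarrow> 'b::euclidean_space^3"
  proof (subst has_derivative_componentwise_within, rule ballI)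
    fix a :: "'b^3" assume "a \<in> Basis"
    then obtain i b where "a = axis i b" by (auto simp: Basis_vec_def)
    then show "((\<lambda>x. f x \<bullet> a) has_derivative (\<lambda>x. f' x \<bullet> a)) (at z)"
      using has_derivative_inner_left[OF that[of i], of b] by (simp add: inner_axis)
  qed
  show ?thesis
    by (rule vec, rule vec) (simp add: line_proj_def line_proj'_def e)
qed

lemma CP2_J_line_proj:
  assumes "norm z = 1" "cdot w z = 0"
  shows "CP2_J (line_proj z) (line_proj' z w) = line_proj' z (\<chi> i. \<i> * w$i)"
proof -
  have zz: "(\<Sum>j\<in>UNIV. z$j * cnj (z$j)) = 1" and wz: "(\<Sum>j\<in>UNIV. w$j * cnj (z$j)) = 0"
    using assms cdot_self[of z] by (simp_all add: cdot_def)
  have zw: "(\<Sum>j\<in>UNIV. z$j * cnj (w$j)) = 0"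
    using arg_cong[OF wz, of cnj] by (simp add: mult.commute)
  have "(line_proj' z w ** line_proj z)$i$j = w$i * cnj (z$j)" for i j
  proof -
    have "(line_proj' z w ** line_proj z)$i$j
        = w$i * cnj (z$j) * (\<Sum>k\<in>UNIV. z$k * cnj (z$k)) + z$i * cnj (z$j) * (\<Sum>k\<in>UNIV. z$k * cnj (w$k))"
      by (simp add: matrix_matrix_mult_def line_proj_def line_proj'_def sum_distrib_left
          sum.distrib[symmetric] algebra_simps)
    then show ?thesis by (simp add: zz zw)
  qed
  moreover have "(line_proj z ** line_proj' z w)$i$j = z$i * cnj (w$j)" for i j
  proof -
    have "(line_proj z ** line_proj' z w)$i$j
        = z$i * cnj (z$j) * (\<Sum>k\<in>UNIV. w$k * cnj (z$k)) + z$i * cnj (w$j) * (\<Sum>k\<in>UNIV. z$k * cnj (z$k))"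
      by (simp add: matrix_matrix_mult_def line_proj_def line_proj'_def sum_distrib_left
          sum.distrib[symmetric] algebra_simps)
    then show ?thesis by (simp add: zz wz)
  qed
  ultimately show ?thesis
    by (simp add: CP2_J_def line_proj'_def vec_eq_iff algebra_simps)
qed

lemma line_proj_metric:
  assumes "norm z = 1" "cdot w z = 0" "cdot w' z = 0"
  shows "line_proj' z w \<bullet> line_proj' z w' = 2 * (w \<bullet> w')"
proof -
  have zz: "cdot z z = 1" using assms cdot_self[of z] by simp
  have c: "a \<bullet> b = Re (a * cnj b)" for a b :: complex by (simp add: inner_complex_def)
  have z1: "cdot z w = 0" "cdot z w' = 0"
    using assms by (simp_all add: cdot_def) (metis (no_types, lifting) complex_cnj_cnj complex_cnj_mult complex_cnj_zero cnj_sum mult.commute sum.cong)+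
  have "line_proj' z w \<bullet> line_proj' z w' =
    Re (\<Sum>i\<in>UNIV. \<Sum>j\<in>UNIV. (w$i * cnj (z$j) + z$i * cnj (w$j)) * cnj (w'$i * cnj (z$j) + z$i * cnj (w'$j)))"
    by (simp only: inner_vec_def c line_proj'_def vec_lambda_beta Re_sum)
  also have "(\<Sum>i\<in>UNIV. \<Sum>j\<in>UNIV. (w$i * cnj (z$j) + z$i * cnj (w$j)) * cnj (w'$i * cnj (z$j) + z$i * cnj (w'$j)))
     = (\<Sum>i\<in>UNIV. \<Sum>j\<in>UNIV. (w$i * cnj (w'$i)) * (z$j * cnj (z$j)))
      + (\<Sum>i\<in>UNIV. \<Sum>j\<in>UNIV. (w$i * cnj (z$i)) * (w'$j * cnj (z$j)))
      + (\<Sum>i\<in>UNIV. \<Sum>j\<in>UNIV. (z$i * cnj (w'$i)) * (z$j * cnj (w$j)))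
      + (\<Sum>i\<in>UNIV. \<Sum>j\<in>UNIV. (z$i * cnj (z$i)) * (w'$j * cnj (w$j)))"
    by (simp add: sum.distrib[symmetric] algebra_simps)
  also have "\<dots> = cdot w w' * cdot z z + cdot w z * cdot w' z + cdot z w' * cdot z w + cdot z z * cdot w' w"
    by (simp only: sum_product[symmetric] cdot_def)
  also have "\<dots> = cdot w w' + cdot w' w" using assms z1 zz by simp
  also have "Re (cdot w w' + cdot w' w) = 2 * (w \<bullet> w')"
    by (simp add: cdot_def inner_vec_def c sum_distrib_left sum.distrib[symmetric] mult_ac)
  finally show ?thesis .
qed

section \<open>Anti-self-dual two-forms\<close>

text \<open>A 2-form on \<open>T\<^sub>x X\<close> is represented by its extension to the ambient space that vanishes
  on normal vectors.\<close>

type_synonym 'v form2 = "'v \<Rightarrow>\<^sub>L 'v \<Rightarrow>\<^sub>L real"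

abbreviation ev :: "'v::euclidean_space form2 \<Rightarrow> 'v \<Rightarrow> 'v \<Rightarrow> real" where
  "ev \<omega> a b \<equiv> blinfun_apply (blinfun_apply \<omega> a) b"

definition form2_of :: "('v \<Rightarrow> 'v \<Rightarrow> real) \<Rightarrow> 'v::euclidean_space form2" where
  "form2_of h = Blinfun (\<lambda>a. Blinfun (\<lambda>b. h a b))"

definition wedge :: "'v \<Rightarrow> 'v \<Rightarrow> 'v::euclidean_space form2" where
  "wedge a b = form2_of (\<lambda>y z. (a \<bullet> y) * (b \<bullet> z) - (a \<bullet> z) * (b \<bullet> y))"

definition forms2 :: "'v::euclidean_space riem4 \<Rightarrow> 'v \<Rightarrow> 'v form2 set" where
  "forms2 X x = {\<omega>. (\<forall>a b. ev \<omega> a b = - ev \<omega> b a) \<and>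
      (\<forall>a b. ev \<omega> a b = ev \<omega> (tproj X x a) (tproj X x b))}"

text \<open>\<open>(* \<omega>)(e\<^sub>3, e\<^sub>4) = \<omega>(e\<^sub>1, e\<^sub>2)\<close> for every oriented orthonormal frame, so the condition says
  \<open>* \<omega> = - \<omega>\<close>.\<close>

definition asd :: "'v::euclidean_space riem4 \<Rightarrow> 'v \<Rightarrow> 'v form2 set" where
  "asd X x = {\<omega> \<in> forms2 X x. \<forall>e. oframe X x e \<longrightarrow>
      ev \<omega> (e$1) (e$2) = - ev \<omega> (e$3) (e$4)}"

definition f1 :: "'v^4 \<Rightarrow> 'v::euclidean_space form2" where
  "f1 e = wedge (e$1) (e$2) - wedge (e$3) (e$4)"

definition f2 :: "'v^4 \<Rightarrow> 'v::euclidean_space form2" where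
  "f2 e = wedge (e$1) (e$3) - wedge (e$4) (e$2)"

definition f3 :: "'v^4 \<Rightarrow> 'v::euclidean_space form2" where
  "f3 e = wedge (e$1) (e$4) - wedge (e$2) (e$3)"

text \<open>The fibre metric for which \<open>f1 e, f2 e, f3 e\<close> are orthonormal: one quarter of the sum
  of the products of the matrix entries in an orthonormal basis.\<close>

definition inner2 :: "'v::euclidean_space form2 \<Rightarrow> 'v form2 \<Rightarrow> real" where
  "inner2 \<alpha> \<beta> = (1/4) * (\<Sum>a\<in>Basis. \<Sum>b\<in>Basis. ev \<alpha> a b * ev \<beta> a b)"


section \<open>The Levi-Civita connection\<close>

text \<open>By the Gauss formula, the Levi-Civita derivative of a tangent field is the tangential part
  of its derivative in the ambient Euclidean space. The following lemma is the corresponding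
  identity in a local parametrization \<open>\<kappa>\<close> of \<open>X\<close> with second derivative \<open>B\<close>: it identifies the
  tangential part of the derivative of a coordinate field with the Christoffel symbols of the
  first kind of the induced metric g.\<close>

lemma tangential_derivative_christoffel:
  fixes \<kappa> :: "'a::euclidean_space \<Rightarrow> 'v::euclidean_space"
  assumes B: "\<And>i. ((\<lambda>y. frechet_derivative \<kappa> (at y) i) has_derivative (\<lambda>h. B h i)) (at x)"
    and sym: "\<And>h i. B h i = B i h"
  defines "g \<equiv> (\<lambda>i j y. frechet_derivative \<kappa> (at y) i \<bullet> frechet_derivative \<kappa> (at y) j)"
  shows "B i j \<bullet> frechet_derivative \<kappa> (at x) l =
    (frechet_derivative (g j l) (at x) i + frechet_derivative (g i l) (at x) j
      - frechet_derivative (g i j) (at x) l) / 2"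
proof -
  have "(g i j has_derivative (\<lambda>h. frechet_derivative \<kappa> (at x) i \<bullet> B h j
          + B h i \<bullet> frechet_derivative \<kappa> (at x) j)) (at x)" for i j
    unfolding g_def by (rule has_derivative_inner[OF B B])
  then have "frechet_derivative (g i j) (at x) =
      (\<lambda>h. frechet_derivative \<kappa> (at x) i \<bullet> B h j + B h i \<bullet> frechet_derivative \<kappa> (at x) j)" for i j
    by (rule frechet_derivative_at[symmetric])
  then show ?thesis
    by (simp add: sym[of l i] sym[of l j] sym[of j i] inner_commute)
qed

text \<open>For a 2-form the Leibniz rule and the Gauss formula say that its covariant derivative is the
  restriction to the tangent space of its ambient derivative \<open>\<beta>\<close>.\<close>

definition restrict2 :: "'v::euclidean_space riem4 \<Rightarrow> 'v \<Rightarrow> 'v form2 \<Rightarrow> 'v form2" where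
  "restrict2 X x \<beta> = form2_of (\<lambda>a b. ev \<beta> (tproj X x a) (tproj X x b))"


section \<open>The Bryant--Salamon structure\<close>

text \<open>The total space is the set of all \<open>(x, \<omega>)\<close> with \<open>x\<close> in \<open>X\<close> and \<open>\<omega> \<in> asd X x\<close>.
  A tangent vector \<open>(a, \<beta>)\<close> to it at \<open>(x, \<omega>)\<close>, that is, the velocity of a curve
  \<open>(x(t), \<omega>(t))\<close>, has horizontal component \<open>a\<close> and vertical component the covariant derivative
  \<open>restrict2 X x \<beta>\<close> of \<open>\<omega>(t)\<close>. The tensors below are written on
  \<open>T\<^sub>x X \<oplus> \<Lambda>\<^sup>2\<^sub>-(T\<^sup>*\<^sub>x X)\<close>, to which the tangent space is thereby identified. With respect to
  an oriented orthonormal frame, \<open>phi\<close> is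
  \<open>v\<^sup>3 f\<^sub>1 \<and> f\<^sub>2 \<and> f\<^sub>3 + u\<^sup>2 v (f\<^sub>1 \<and> f\<^sup>1 + f\<^sub>2 \<and> f\<^sup>2 + f\<^sub>3 \<and> f\<^sup>3)\<close>, where the lower indices
  denote vertical 1-forms and the upper ones horizontal 2-forms.

  With the normalization in which \<open>f\<^sup>1, f\<^sup>2, f\<^sup>3\<close> are orthonormal and for scalar curvature 12,
  which both S4 and CP2 have, the form \<open>phi\<close> is closed and coclosed with \<open>u v = 1\<close> if and only
  if \<open>u\<^sup>3 u' = r\<close>; this gives the complete Bryant--Salamon metrics for \<open>c > 0\<close>.\<close>

definition radius :: "'v::euclidean_space form2 \<Rightarrow> real" where
  "radius \<omega> = sqrt (inner2 \<omega> \<omega>)"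

definition bs_u :: "real \<Rightarrow> 'v::euclidean_space form2 \<Rightarrow> real" where
  "bs_u c \<omega> = (2 * (radius \<omega>)\<^sup>2 + c) powr (1/4)"

definition bs_v :: "real \<Rightarrow> 'v::euclidean_space form2 \<Rightarrow> real" where
  "bs_v c \<omega> = (2 * (radius \<omega>)\<^sup>2 + c) powr (-1/4)"

definition bs_metric ::
  "real \<Rightarrow> 'v::euclidean_space \<times> 'v form2 \<Rightarrow> 'v \<times> 'v form2 \<Rightarrow> 'v \<times> 'v form2 \<Rightarrow> real" where
  "bs_metric c q \<xi> \<zeta> = (bs_u c (snd q))\<^sup>2 * (fst \<xi> \<bullet> fst \<zeta>) + (bs_v c (snd q))\<^sup>2 * inner2 (snd \<xi>) (snd \<zeta>)"

definition some_oframe :: "'v::euclidean_space riem4 \<Rightarrow> 'v \<Rightarrow> 'v^4" where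
  "some_oframe X x = (SOME e. oframe X x e)"

definition vol_V ::
  "'v::euclidean_space riem4 \<Rightarrow> 'v \<Rightarrow> 'v form2 \<Rightarrow> 'v form2 \<Rightarrow> 'v form2 \<Rightarrow> real" where
  "vol_V X x \<alpha> \<beta> \<gamma> =
     (let e = some_oframe X x; co = (\<lambda>\<tau>. vector [inner2 \<tau> (f1 e), inner2 \<tau> (f2 e), inner2 \<tau> (f3 e)])
      in det (vector [co \<alpha>, co \<beta>, co \<gamma>] :: real^3^3))"

definition phi ::
  "'v::euclidean_space riem4 \<Rightarrow> real \<Rightarrow> 'v \<times> 'v form2
     \<Rightarrow> 'v \<times> 'v form2 \<Rightarrow> 'v \<times> 'v form2 \<Rightarrow> 'v \<times> 'v form2 \<Rightarrow> real" where
  "phi X c q \<xi> \<zeta> \<rho> =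
     (bs_v c (snd q))^3 * vol_V X (fst q) (snd \<xi>) (snd \<zeta>) (snd \<rho>)
     + (bs_u c (snd q))\<^sup>2 * bs_v c (snd q) *
       (ev (snd \<xi>) (fst \<zeta>) (fst \<rho>) + ev (snd \<zeta>) (fst \<rho>) (fst \<xi>)
        + ev (snd \<rho>) (fst \<xi>) (fst \<zeta>))"

text \<open>The Hodge dual of \<open>phi\<close>. If \<open>b\<close> is an oriented orthonormal basis then
  \<open>(* \<phi>)(w\<^sub>1, ..., w\<^sub>4)\<close> is the sum of \<open>\<phi>(b\<^sub>i, b\<^sub>j, b\<^sub>k) vol(b\<^sub>i, b\<^sub>j, b\<^sub>k, w\<^sub>1, ..., w\<^sub>4)\<close> over
  all i, j, k, divided by 3!. Reversing the orientation of the total space changes \<open>psi\<close> to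
  \<open>- psi\<close>, which does not affect the notion of a coassociative submanifold.\<close>

definition bs_basis ::
  "'v::euclidean_space riem4 \<Rightarrow> real \<Rightarrow> 'v \<times> 'v form2 \<Rightarrow> ('v \<times> 'v form2)^7" where
  "bs_basis X c q = (let e = some_oframe X (fst q); u = bs_u c (snd q); v = bs_v c (snd q) in
     vector [(0, f1 e /\<^sub>R v), (0, f2 e /\<^sub>R v), (0, f3 e /\<^sub>R v),
             (e$1 /\<^sub>R u, 0), (e$2 /\<^sub>R u, 0), (e$3 /\<^sub>R u, 0), (e$4 /\<^sub>R u, 0)])"

definition psi ::
  "'v::euclidean_space riem4 \<Rightarrow> real \<Rightarrow> 'v \<times> 'v form2
     \<Rightarrow> 'v \<times> 'v form2 \<Rightarrow> 'v \<times> 'v form2 \<Rightarrow> 'v \<times> 'v form2 \<Rightarrow> 'v \<times> 'v form2 \<Rightarrow> real" where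
  "psi X c q w1 w2 w3 w4 =
     (let b = bs_basis X c q; co = (\<lambda>w. (\<chi> l. bs_metric c q (b$l) w)) in
      (\<Sum>i\<in>UNIV. \<Sum>j\<in>UNIV. \<Sum>k\<in>UNIV. phi X c q (b$i) (b$j) (b$k) *
         det (vector [co (b$i), co (b$j), co (b$k), co w1, co w2, co w3, co w4] :: real^7^7)) / 6)"


section \<open>Surfaces immersed in X\<close>

definition immersed ::
  "'v::euclidean_space riem4 \<Rightarrow> 'l params \<Rightarrow> ('l \<Rightarrow> 'v) \<Rightarrow> bool" where
  "immersed X A \<iota> \<longleftrightarrow> range \<iota> \<subseteq> points X \<and> smooth_along A \<iota> \<and>
     (\<forall>(U, k)\<in>A. \<forall>x\<in>U. inj (frechet_derivative (\<iota> \<circ> k) (at x)))"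

text \<open>Tangent vectors to \<open>L\<close> at p are identified with their images in \<open>T X\<close>.\<close>

definition tangentL :: "'l params \<Rightarrow> ('l \<Rightarrow> 'v::euclidean_space) \<Rightarrow> 'l \<Rightarrow> 'v set" where
  "tangentL A \<iota> p = {frechet_derivative (\<iota> \<circ> k) (at x) h | U k x h. (U, k) \<in> A \<and> x \<in> U \<and> k x = p}"

definition oframeL :: "'l params \<Rightarrow> ('l \<Rightarrow> 'v::euclidean_space) \<Rightarrow> 'l \<Rightarrow> 'v \<Rightarrow> 'v \<Rightarrow> bool" where
  "oframeL A \<iota> p e1 e2 \<longleftrightarrow> norm e1 = 1 \<and> norm e2 = 1 \<and> e1 \<bullet> e2 = 0 \<and>
     (\<exists>U k x h1 h2. (U, k) \<in> A \<and> x \<in> U \<and> k x = p \<and> det (vector [h1, h2] :: real^2^2) > 0 \<and>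
        frechet_derivative (\<iota> \<circ> k) (at x) h1 = e1 \<and> frechet_derivative (\<iota> \<circ> k) (at x) h2 = e2)"

definition adapted ::
  "'v::euclidean_space riem4 \<Rightarrow> 'l params \<Rightarrow> ('l \<Rightarrow> 'v) \<Rightarrow> 'l \<Rightarrow> 'v^4 \<Rightarrow> bool" where
  "adapted X A \<iota> p e \<longleftrightarrow> oframe X (\<iota> p) e \<and> oframeL A \<iota> p (e$1) (e$2)"

definition J_T :: "'v::euclidean_space riem4 \<Rightarrow> 'l params \<Rightarrow> ('l \<Rightarrow> 'v) \<Rightarrow> 'l \<Rightarrow> 'v \<Rightarrow> 'v" where
  "J_T X A \<iota> p w = (THE w'. \<exists>e. adapted X A \<iota> p e \<and> w' = (w \<bullet> e$1) *\<^sub>R e$2 - (w \<bullet> e$2) *\<^sub>R e$1)"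

definition J_N :: "'v::euclidean_space riem4 \<Rightarrow> 'l params \<Rightarrow> ('l \<Rightarrow> 'v) \<Rightarrow> 'l \<Rightarrow> 'v \<Rightarrow> 'v" where
  "J_N X A \<iota> p w = (THE w'. \<exists>e. adapted X A \<iota> p e \<and> w' = (w \<bullet> e$3) *\<^sub>R e$4 - (w \<bullet> e$4) *\<^sub>R e$3)"

text \<open>The derivative at p of a map on \<open>L\<close> with values in a vector space, in the direction \<open>w \<in> T\<^sub>p L\<close>.\<close>

definition deriv_along ::
  "'l params \<Rightarrow> ('l \<Rightarrow> 'v::euclidean_space) \<Rightarrow> ('l \<Rightarrow> 'w::real_normed_vector) \<Rightarrow> 'l \<Rightarrow> 'v \<Rightarrow> 'w" where
  "deriv_along A \<iota> Y p w = (THE d. \<exists>U k x h. (U, k) \<in> A \<and> x \<in> U \<and> k x = p \<and>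
     frechet_derivative (\<iota> \<circ> k) (at x) h = w \<and> frechet_derivative (Y \<circ> k) (at x) h = d)"

definition nabla_T ::
  "'v::euclidean_space riem4 \<Rightarrow> 'l params \<Rightarrow> ('l \<Rightarrow> 'v) \<Rightarrow> ('l \<Rightarrow> 'v) \<Rightarrow> 'l \<Rightarrow> 'v \<Rightarrow> 'v" where
  "nabla_T X A \<iota> Y p w = tproj X (\<iota> p) (deriv_along A \<iota> Y p w)"

definition nabla_forms ::
  "'v::euclidean_space riem4 \<Rightarrow> 'l params \<Rightarrow> ('l \<Rightarrow> 'v) \<Rightarrow> ('l \<Rightarrow> 'v form2) \<Rightarrow> 'l \<Rightarrow> 'v \<Rightarrow> 'v form2" where
  "nabla_forms X A \<iota> \<sigma> p w = restrict2 X (\<iota> p) (deriv_along A \<iota> \<sigma> p w)"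

subsection \<open>Second fundamental form\<close>

definition normal_field ::
  "'v::euclidean_space riem4 \<Rightarrow> 'l params \<Rightarrow> ('l \<Rightarrow> 'v) \<Rightarrow> ('l \<Rightarrow> 'v) \<Rightarrow> bool" where
  "normal_field X A \<iota> \<nu> \<longleftrightarrow> smooth_along A \<nu> \<and>
     (\<forall>p. \<nu> p \<in> tangent X (\<iota> p) \<and> (\<forall>w\<in>tangentL A \<iota> p. \<nu> p \<bullet> w = 0))"

definition shape ::
  "'v::euclidean_space riem4 \<Rightarrow> 'l params \<Rightarrow> ('l \<Rightarrow> 'v) \<Rightarrow> ('l \<Rightarrow> 'v) \<Rightarrow> 'l \<Rightarrow> 'v \<Rightarrow> 'v" where
  "shape X A \<iota> \<nu> p w = oproj inner (tangentL A \<iota> p) (nabla_T X A \<iota> \<nu> p w)"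

definition minimal :: "'v::euclidean_space riem4 \<Rightarrow> 'l params \<Rightarrow> ('l \<Rightarrow> 'v) \<Rightarrow> bool" where
  "minimal X A \<iota> \<longleftrightarrow> (\<forall>\<nu>. normal_field X A \<iota> \<nu> \<longrightarrow> (\<forall>p e1 e2. oframeL A \<iota> p e1 e2 \<longrightarrow>
     shape X A \<iota> \<nu> p e1 \<bullet> e1 + shape X A \<iota> \<nu> p e2 \<bullet> e2 = 0))"

definition negative_superminimal ::
  "'v::euclidean_space riem4 \<Rightarrow> 'l params \<Rightarrow> ('l \<Rightarrow> 'v) \<Rightarrow> bool" where
  "negative_superminimal X A \<iota> \<longleftrightarrow> (\<forall>\<nu>. normal_field X A \<iota> \<nu> \<longrightarrow> (\<forall>p. \<forall>w\<in>tangentL A \<iota> p.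
     shape X A \<iota> (\<lambda>p'. J_N X A \<iota> p' (\<nu> p')) p w = - J_T X A \<iota> p (shape X A \<iota> \<nu> p w)))"

subsection \<open>The bundles E and F\<close>

definition E_fib :: "'v::euclidean_space riem4 \<Rightarrow> 'l params \<Rightarrow> ('l \<Rightarrow> 'v) \<Rightarrow> 'l \<Rightarrow> 'v form2 set" where
  "E_fib X A \<iota> p = span {f1 e | e. adapted X A \<iota> p e}"

definition F_fib :: "'v::euclidean_space riem4 \<Rightarrow> 'l params \<Rightarrow> ('l \<Rightarrow> 'v) \<Rightarrow> 'l \<Rightarrow> 'v form2 set" where
  "F_fib X A \<iota> p = {\<omega> \<in> asd X (\<iota> p). \<forall>\<tau>\<in>E_fib X A \<iota> p. inner2 \<omega> \<tau> = 0}"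

definition smooth_section ::
  "'l params \<Rightarrow> ('l \<Rightarrow> 'v::euclidean_space form2 set) \<Rightarrow> ('l \<Rightarrow> 'v form2) \<Rightarrow> bool" where
  "smooth_section A B \<sigma> \<longleftrightarrow> smooth_along A \<sigma> \<and> (\<forall>p. \<sigma> p \<in> B p)"

definition nabla_E ::
  "'v::euclidean_space riem4 \<Rightarrow> 'l params \<Rightarrow> ('l \<Rightarrow> 'v) \<Rightarrow> ('l \<Rightarrow> 'v form2) \<Rightarrow> 'l \<Rightarrow> 'v \<Rightarrow> 'v form2" where
  "nabla_E X A \<iota> \<eta> p w = oproj inner2 (E_fib X A \<iota> p) (nabla_forms X A \<iota> \<eta> p w)"

definition nabla_F ::
  "'v::euclidean_space riem4 \<Rightarrow> 'l params \<Rightarrow> ('l \<Rightarrow> 'v) \<Rightarrow> ('l \<Rightarrow> 'v form2) \<Rightarrow> 'l \<Rightarrow> 'v \<Rightarrow> 'v form2" where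
  "nabla_F X A \<iota> \<sigma> p w = oproj inner2 (F_fib X A \<iota> p) (nabla_forms X A \<iota> \<sigma> p w)"

definition J_F :: "'v::euclidean_space riem4 \<Rightarrow> 'l params \<Rightarrow> ('l \<Rightarrow> 'v) \<Rightarrow> 'l \<Rightarrow> 'v form2 \<Rightarrow> 'v form2" where
  "J_F X A \<iota> p \<tau> = (THE \<tau>'. \<exists>e. adapted X A \<iota> p e \<and>
     \<tau>' = inner2 \<tau> (f2 e) *\<^sub>R f3 e - inner2 \<tau> (f3 e) *\<^sub>R f2 e)"

definition parallel_E :: "'v::euclidean_space riem4 \<Rightarrow> 'l params \<Rightarrow> ('l \<Rightarrow> 'v) \<Rightarrow> ('l \<Rightarrow> 'v form2) \<Rightarrow> bool" where
  "parallel_E X A \<iota> \<eta> \<longleftrightarrow> (\<forall>p. \<forall>w\<in>tangentL A \<iota> p. nabla_E X A \<iota> \<eta> p w = 0)"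

definition holomorphic_F :: "'v::euclidean_space riem4 \<Rightarrow> 'l params \<Rightarrow> ('l \<Rightarrow> 'v) \<Rightarrow> ('l \<Rightarrow> 'v form2) \<Rightarrow> bool" where
  "holomorphic_F X A \<iota> \<sigma> \<longleftrightarrow> (\<forall>p e1 e2. oframeL A \<iota> p e1 e2 \<longrightarrow>
     nabla_F X A \<iota> \<sigma> p e1 + J_F X A \<iota> p (nabla_F X A \<iota> \<sigma> p e2) = 0)"


section \<open>Calibrated submanifolds of the total space\<close>

text \<open>A submanifold fibred over the immersed surface is given as a set \<open>N\<close> of pairs
  \<open>(p, \<omega>)\<close> with \<open>p\<close> in the abstract surface, immersed in the total space by
  \<open>(p, \<omega>) \<mapsto> (\<iota> p, \<omega>)\<close>. Its tangent space is spanned by the velocities of curves in \<open>N\<close>, written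
  in terms of their horizontal and vertical components.\<close>

definition tangent_sub ::
  "'v::euclidean_space riem4 \<Rightarrow> 'l params \<Rightarrow> ('l \<Rightarrow> 'v) \<Rightarrow> ('l \<times> 'v form2) set
     \<Rightarrow> 'l \<times> 'v form2 \<Rightarrow> ('v \<times> 'v form2) set" where
  "tangent_sub X A \<iota> N n = {(a, restrict2 X (\<iota> (fst n)) \<beta>) | a \<beta>.
     \<exists>U k \<epsilon> \<gamma> \<omega>. (U, k) \<in> A \<and> \<epsilon> > (0::real) \<and>
       smooth_on {-\<epsilon><..<\<epsilon>} \<gamma> \<and> smooth_on {-\<epsilon><..<\<epsilon>} \<omega> \<and>
       (\<forall>t\<in>{-\<epsilon><..<\<epsilon>}. \<gamma> t \<in> U \<and> (k (\<gamma> t), \<omega> t) \<in> N) \<and> (k (\<gamma> 0), \<omega> 0) = n \<and>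
       ((\<lambda>t. \<iota> (k (\<gamma> t))) has_vector_derivative a) (at 0) \<and>
       (\<omega> has_vector_derivative \<beta>) (at 0)}"

definition basis_of :: "'w::real_vector set \<Rightarrow> 'w^'k \<Rightarrow> bool" where
  "basis_of T b \<longleftrightarrow> inj (($) b) \<and> independent (range (($) b)) \<and> span (range (($) b)) = T"

text \<open>An orientation assigns to every point the set of positively oriented bases of the tangent
  space, in a locally continuous way.\<close>

definition orientation ::
  "'n::topological_space set \<Rightarrow> ('n \<Rightarrow> 'w::real_normed_vector set) \<Rightarrow> ('n \<Rightarrow> ('w^'k) set) \<Rightarrow> bool" where
  "orientation N T Or \<longleftrightarrow>
     (\<forall>n\<in>N. Or n \<noteq> {} \<and> (\<forall>b\<in>Or n. basis_of (T n) b \<and>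
        (\<forall>b'. b' \<in> Or n \<longleftrightarrow>
           (\<exists>C::real^'k^'k. det C > 0 \<and> (\<forall>i. b'$i = (\<Sum>j\<in>UNIV. C$i$j *\<^sub>R b$j)))))) \<and>
     (\<forall>n\<in>N. \<exists>W b. open W \<and> n \<in> W \<and> continuous_on (N \<inter> W) b \<and> (\<forall>m\<in>N \<inter> W. b m \<in> Or m))"

text \<open>The volume form of an oriented Riemannian manifold takes the value \<open>sqrt (det (g(b\<^sub>i, b\<^sub>j)))\<close> on
  a positively oriented basis \<open>b\<close>.\<close>

definition calibrated ::
  "'v::euclidean_space riem4 \<Rightarrow> real \<Rightarrow> 'l::topological_space params \<Rightarrow> ('l \<Rightarrow> 'v)
     \<Rightarrow> ('v \<times> 'v form2 \<Rightarrow> ('v \<times> 'v form2)^'k \<Rightarrow> real) \<Rightarrow> ('l \<times> 'v form2) set \<Rightarrow> bool" where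
  "calibrated X c A \<iota> \<Phi> N \<longleftrightarrow> (\<exists>Or. orientation N (tangent_sub X A \<iota> N) Or \<and>
     (\<forall>(p, \<omega>)\<in>N. \<forall>b\<in>Or (p, \<omega>).
        \<Phi> (\<iota> p, \<omega>) b = sqrt (det (\<chi> i j. bs_metric c (\<iota> p, \<omega>) (b$i) (b$j)))))"

definition associative ::
  "'v::euclidean_space riem4 \<Rightarrow> real \<Rightarrow> 'l::topological_space params \<Rightarrow> ('l \<Rightarrow> 'v)
     \<Rightarrow> ('l \<times> 'v form2) set \<Rightarrow> bool" where
  "associative X c A \<iota> N \<longleftrightarrow>
     calibrated X c A \<iota> (\<lambda>q (b::('v \<times> 'v form2)^3). phi X c q (b$1) (b$2) (b$3)) N"

definition coassociative ::
  "'v::euclidean_space riem4 \<Rightarrow> real \<Rightarrow> 'l::topological_space params \<Rightarrow> ('l \<Rightarrow> 'v)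
     \<Rightarrow> ('l \<times> 'v form2) set \<Rightarrow> bool" where
  "coassociative X c A \<iota> N \<longleftrightarrow>
     calibrated X c A \<iota> (\<lambda>q (b::('v \<times> 'v form2)^4). psi X c q (b$1) (b$2) (b$3) (b$4)) N"

definition E_plus ::
  "'v::euclidean_space riem4 \<Rightarrow> 'l params \<Rightarrow> ('l \<Rightarrow> 'v) \<Rightarrow> ('l \<Rightarrow> 'v form2) \<Rightarrow> ('l \<times> 'v form2) set" where
  "E_plus X A \<iota> \<sigma> = {(p, \<eta>' + \<sigma> p) | p \<eta>'. \<eta>' \<in> E_fib X A \<iota> p}"

definition plus_F ::
  "'v::euclidean_space riem4 \<Rightarrow> 'l params \<Rightarrow> ('l \<Rightarrow> 'v) \<Rightarrow> ('l \<Rightarrow> 'v form2) \<Rightarrow> ('l \<times> 'v form2) set" where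
  "plus_F X A \<iota> \<eta> = {(p, \<eta> p + \<sigma>') | p \<sigma>'. \<sigma>' \<in> F_fib X A \<iota> p}"

end

theory Submission imports Defs begin

text \<open>In a local oriented adapted frame e with connection coefficients
  \<open>\<Gamma>\<^sub>i\<^sub>j = \<langle>\<nabla> e\<^sub>i, e\<^sub>j\<rangle>\<close> one has
  \<open>\<nabla> f\<^sup>1 = (\<Gamma>\<^sub>2\<^sub>3 - \<Gamma>\<^sub>1\<^sub>4) f\<^sup>2 + (\<Gamma>\<^sub>2\<^sub>4 + \<Gamma>\<^sub>1\<^sub>3) f\<^sup>3\<close>,
  so both minimality and negative superminimality are conditions on the derivative of \<open>f\<^sup>1\<close> along \<open>L\<close>.

  At the point \<open>s f\<^sup>1 + \<sigma>\<close> the tangent space of \<open>E + \<sigma>\<close> is spanned by \<open>f\<^sup>1\<close> and the vectors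
  \<open>(e\<^sub>i, \<tau>\<^sub>i)\<close>, where \<open>\<tau>\<^sub>i\<close> is the F-part of \<open>\<nabla> (s f\<^sup>1 + \<sigma>)\<close> along \<open>e\<^sub>i\<close>. Comparing \<open>\<phi>\<close> with the
  Gram determinant, the calibration condition becomes the Cauchy--Riemann equation
  \<open>\<tau>\<^sub>1 + J \<tau>\<^sub>2 = 0\<close>. It is affine in s: the linear part vanishes exactly if L is minimal, and the
  constant part exactly if \<open>\<sigma>\<close> is holomorphic.

  The tangent space of \<open>\<eta> + F\<close> at \<open>\<eta> + \<tau>\<close> is spanned by \<open>f\<^sup>2\<close>, \<open>f\<^sup>3\<close> and the vectors
  \<open>(e\<^sub>i, t\<^sub>i f\<^sup>1)\<close>, and the Gram determinant exceeds the square of \<open>*\<phi>\<close> by a positive combination of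
  \<open>t\<^sub>1\<^sup>2\<close> and \<open>t\<^sub>2\<^sup>2\<close>. So the calibration condition is \<open>t\<^sub>1 = t\<^sub>2 = 0\<close>, again affine in \<open>\<tau>\<close>: the constant part
  vanishes exactly if \<open>\<eta>\<close> is parallel, and the linear part exactly if L is negative
  superminimal.\<close>


section \<open>Smooth maps on open sets\<close>

text \<open>As they stand, the notions compared are wrapped in choices: \<open>associative\<close>
  and \<open>coassociative\<close> ask for some orientation, \<open>phi\<close> and
  \<open>psi\<close> use the arbitrary frame \<open>some_oframe\<close>, and \<open>J_T\<close>,
  \<open>J_N\<close>, \<open>J_F\<close> and \<open>deriv_along\<close> are unique-choice terms over
  frames or charts. Most of the work removes these choices. Orientation: a calibrated tangent space
  forces, on any explicit basis, only an equation between squares; conversely, a continuous local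
  basis on which the form is positive and has the right value yields an orientation. Frames: through
  each point, with prescribed value there, passes a smooth adapted frame, and every notion is
  rewritten in its coefficients \<open>\<Gamma>\<close>. That \<open>phi\<close> and
  \<open>psi\<close> may be evaluated in this frame rests on the frame-free triple product
  \<open>comp2\<close> and on invariance of traces. The two conditions on each side separate because
  a fibre of E or F is a whole vector space, so the affine parameter takes all values. Traces appear
  in the associative case because second derivatives of \<open>\<iota>\<close> commute. The manifold
  \<open>X\<close> enters through the locale \<open>ambient\<close>, verified for \<open>S4\<close>
  and \<open>CP2\<close> at the end.\<close>

lemma frechet_works:
  "f differentiable (at x) \<Longrightarrow> (f has_derivative frechet_derivative f (at x)) (at x)"
  by (simp add: frechet_derivative_works)

lemma frechet_eqI: "(f has_derivative D) (at x) \<Longrightarrow> frechet_derivative f (at x) = D"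
  using frechet_derivative_at by fastforce

lemma frechet_cong:
  assumes "open S" "x \<in> S" "\<And>y. y \<in> S \<Longrightarrow> f y = g y" "f differentiable (at x)"
  shows "g differentiable (at x)" "frechet_derivative g (at x) = frechet_derivative f (at x)"
proof -
  have "(g has_derivative frechet_derivative f (at x)) (at x)"
    by (rule has_derivative_transform_within_open[OF frechet_works[OF assms(4)] assms(1,2)])
      (simp add: assms(3))
  then show "g differentiable (at x)" "frechet_derivative g (at x) = frechet_derivative f (at x)"
    by (auto simp: differentiable_def frechet_eqI)
qed

text \<open>Derivatives are those of the full space, so an equality on \<open>S\<close> reaches them
  only because \<open>S\<close> is open; outside \<open>S\<close> the two functions may
  differ.\<close>

lemma Ck_on_cong:
  assumes "open S" "\<And>y. y \<in> S \<Longrightarrow> f y = g y" "Ck_on k S f"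
  shows "Ck_on k S g"
  using assms(2,3)
proof (induction k arbitrary: f g)
  case 0
  then show ?case by (simp cong: continuous_on_cong)
next
  case (Suc k)
  note c = frechet_cong[OF assms(1) _ Suc.prems(1)]
  show ?case
  proof (simp, intro conjI ballI allI)
    show "g differentiable at x" if "x \<in> S" for x
      using c(1)[OF that] Suc.prems(2) that by auto
    show "Ck_on k S (\<lambda>x. frechet_derivative g (at x) v)" for v
      by (rule Suc.IH[of "\<lambda>x. frechet_derivative f (at x) v"]) (use c(2) Suc.prems(2) in auto)
  qed
qed

lemma Ck_on_subset: "Ck_on k S f \<Longrightarrow> T \<subseteq> S \<Longrightarrow> Ck_on k T f"
  by (induction k arbitrary: f) (auto intro: continuous_on_subset)

text \<open>Lets smoothness of a globally defined object be checked in frames that exist only near a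
  point.\<close>

lemma Ck_on_local:
  assumes "\<And>x. x \<in> S \<Longrightarrow> \<exists>T. open T \<and> x \<in> T \<and> Ck_on k T f"
  shows "Ck_on k S f"
  using assms
proof (induction k arbitrary: f)
  case 0
  show ?case
    unfolding Ck_on.simps
  proof (rule continuous_at_imp_continuous_on, rule ballI)
    fix x assume "x \<in> S"
    then obtain T where "open T" "x \<in> T" "continuous_on T f" using 0[of x] by auto
    then show "isCont f x" by (simp add: continuous_on_eq_continuous_at)
  qed
next
  case (Suc k)
  show ?case
  proof (simp, intro conjI ballI allI)
    show "f differentiable at x" if "x \<in> S" for x using Suc.prems[OF that] by auto
    show "Ck_on k S (\<lambda>x. frechet_derivative f (at x) v)" for v
      by (rule Suc.IH) (use Suc.prems in fastforce)
  qed
qed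

lemma Ck_on_SucD: "Ck_on (Suc k) S f \<Longrightarrow> Ck_on k S f"
proof (induction k arbitrary: f)
  case 0
  then show ?case
    by (auto intro!: continuous_at_imp_continuous_on differentiable_imp_continuous_within)
next
  case (Suc k)
  show ?case
    unfolding Ck_on.simps(2)[of k]
    using Suc.prems Suc.IH by simp
qed

lemma Ck_on_const: "Ck_on k S (\<lambda>x. c)"
  by (induction k arbitrary: c) auto

lemma Ck_on_bounded_linear:
  assumes "bounded_linear L" shows "Ck_on k S L"
proof (cases k)
  case 0
  then show ?thesis using assms by (simp add: linear_continuous_on)
next
  case (Suc k)
  have "frechet_derivative L (at x) = L" for x
    by (rule frechet_eqI) (rule bounded_linear_imp_has_derivative[OF assms])
  then show ?thesis
    using assms by (simp add: Suc Ck_on_const bounded_linear_imp_differentiable)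
qed

lemma Ck_on_add:
  assumes "open S" "Ck_on k S f" "Ck_on k S g"
  shows "Ck_on k S (\<lambda>x. f x + g x)"
  using assms(2,3)
proof (induction k arbitrary: f g)
  case 0
  then show ?case by (auto intro: continuous_intros)
next
  case (Suc j)
  show ?case
  proof (simp, intro conjI ballI allI)
    show "(\<lambda>x. f x + g x) differentiable at x" if "x \<in> S" for x using Suc.prems that by auto
    have "frechet_derivative f (at x) v + frechet_derivative g (at x) v
        = frechet_derivative (\<lambda>x. f x + g x) (at x) v" if "x \<in> S" for x v
      by (subst frechet_eqI[OF has_derivative_add[OF frechet_works frechet_works]])
        (use Suc.prems that in auto)
    then show "Ck_on j S (\<lambda>x. frechet_derivative (\<lambda>x. f x + g x) (at x) v)" for v
      by (rule Ck_on_cong[OF assms(1)]) (use Suc in auto)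
  qed
qed

text \<open>The Leibniz rule produces products of one derivative with one undifferentiated factor;
  \<open>Ck_on_SucD\<close> lowers the order of the latter, so that the induction hypothesis applies
  to both terms. One proof serves scalar multiples, inner products, wedge products and matrix
  products.\<close>

lemma Ck_on_bilinear:
  assumes "bounded_bilinear B" "open S" "Ck_on k S f" "Ck_on k S g"
  shows "Ck_on k S (\<lambda>x. B (f x) (g x))"
  using assms(3,4)
proof (induction k arbitrary: f g)
  case 0
  then show ?case
    using bounded_bilinear.continuous_on[OF assms(1)] by auto
next
  case (Suc k)
  have d: "((\<lambda>x. B (f x) (g x)) has_derivative
      (\<lambda>v. B (f x) (frechet_derivative g (at x) v) + B (frechet_derivative f (at x) v) (g x))) (at x)"
    if "x \<in> S" for x
    by (rule bounded_bilinear.FDERIV[OF assms(1) frechet_works frechet_works]) (use Suc.prems that in auto)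
  show ?case
  proof (simp, intro conjI ballI allI)
    show "(\<lambda>x. B (f x) (g x)) differentiable at x" if "x \<in> S" for x
      using d[OF that] by (auto simp: differentiable_def)
    fix v
    show "Ck_on k S (\<lambda>x. frechet_derivative (\<lambda>x. B (f x) (g x)) (at x) v)"
    proof (rule Ck_on_cong[OF assms(2)])
      show "Ck_on k S (\<lambda>x. B (f x) (frechet_derivative g (at x) v) + B (frechet_derivative f (at x) v) (g x))"
        using Suc.prems Ck_on_SucD[OF Suc.prems(1)] Ck_on_SucD[OF Suc.prems(2)]
        by (intro Ck_on_add[OF assms(2)] Suc.IH) auto
    qed (simp add: frechet_eqI[OF d])
  qed
qed

lemma smooth_on_cong:
  "open S \<Longrightarrow> (\<And>y. y \<in> S \<Longrightarrow> f y = g y) \<Longrightarrow> smooth_on S f \<Longrightarrow> smooth_on S g"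
  unfolding smooth_on_def using Ck_on_cong by blast

lemma smooth_on_subset: "smooth_on S f \<Longrightarrow> T \<subseteq> S \<Longrightarrow> smooth_on T f"
  unfolding smooth_on_def using Ck_on_subset by blast

lemma smooth_on_local:
  "(\<And>x. x \<in> S \<Longrightarrow> \<exists>T. open T \<and> x \<in> T \<and> smooth_on T f) \<Longrightarrow> smooth_on S f"
  unfolding smooth_on_def by (meson Ck_on_local)

lemma smooth_on_const: "smooth_on S (\<lambda>x. c)"
  by (simp add: smooth_on_def Ck_on_const)

lemma smooth_on_linear: "bounded_linear L \<Longrightarrow> smooth_on S L"
  by (simp add: smooth_on_def Ck_on_bounded_linear)

lemma smooth_on_bilinear:
  "bounded_bilinear B \<Longrightarrow> open S \<Longrightarrow> smooth_on S f \<Longrightarrow> smooth_on S g \<Longrightarrow> smooth_on S (\<lambda>x. B (f x) (g x))"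
  by (simp add: smooth_on_def Ck_on_bilinear)

lemmas smooth_on_mult = smooth_on_bilinear[OF bounded_bilinear_mult]
lemmas smooth_on_scaleR = smooth_on_bilinear[OF bounded_bilinear_scaleR]
lemmas smooth_on_inner = smooth_on_bilinear[OF bounded_bilinear_inner]

text \<open>A linear map is a bilinear map \<open>r *\<^sub>R L y\<close> whose first factor is held
  at the constant 1.\<close>

lemma smooth_on_compose_linear:
  assumes "bounded_linear L" "open S" "smooth_on S f"
  shows "smooth_on S (\<lambda>x. L (f x))"
proof -
  have "bounded_bilinear (\<lambda>(r::real) y. r *\<^sub>R L y)"
    by (rule bounded_bilinear.comp[OF bounded_bilinear_scaleR bounded_linear_ident assms(1)])
  from smooth_on_bilinear[OF this assms(2) smooth_on_const[of _ 1] assms(3)] show ?thesis by simp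
qed

lemma smooth_on_differentiable: "smooth_on S f \<Longrightarrow> x \<in> S \<Longrightarrow> f differentiable (at x)"
  unfolding smooth_on_def by (metis Ck_on.simps(2))

lemma smooth_on_deriv: "smooth_on S f \<Longrightarrow> smooth_on S (\<lambda>x. frechet_derivative f (at x) v)"
  unfolding smooth_on_def by (metis Ck_on.simps(2))

lemma smooth_on_continuous: "smooth_on S f \<Longrightarrow> continuous_on S f"
  unfolding smooth_on_def using Ck_on.simps(1) by blast

lemma smooth_on_add:
  assumes "open S" "smooth_on S f" "smooth_on S g"
  shows "smooth_on S (\<lambda>x. f x + g x)"
  using assms by (simp add: smooth_on_def Ck_on_add)

lemma smooth_on_minus: "open S \<Longrightarrow> smooth_on S f \<Longrightarrow> smooth_on S (\<lambda>x. - f x)"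
  by (rule smooth_on_compose_linear[OF bounded_linear_minus[OF bounded_linear_ident]])

lemma smooth_on_diff:
  "open S \<Longrightarrow> smooth_on S f \<Longrightarrow> smooth_on S g \<Longrightarrow> smooth_on S (\<lambda>x. f x - g x)"
  using smooth_on_add[of S f "\<lambda>x. - g x"] smooth_on_minus[of S g] by simp

lemma smooth_on_sum:
  "open S \<Longrightarrow> (\<And>i. i \<in> I \<Longrightarrow> smooth_on S (f i)) \<Longrightarrow> smooth_on S (\<lambda>x. \<Sum>i\<in>I. f i x)"
  by (induction I rule: infinite_finite_induct) (auto intro: smooth_on_const smooth_on_add)

lemma smooth_on_prod:
  fixes f :: "'i \<Rightarrow> 'a::real_normed_vector \<Rightarrow> real"
  shows "open S \<Longrightarrow> (\<And>i. i \<in> I \<Longrightarrow> smooth_on S (f i)) \<Longrightarrow> smooth_on S (\<lambda>x. \<Prod>i\<in>I. f i x)"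
  by (induction I rule: infinite_finite_induct) (auto intro: smooth_on_const smooth_on_mult)

text \<open>With r = f^(-1/2) the derivative is -1/2 r^3 f', a polynomial in r and f', so the
  induction on the order closes on r itself. This is what makes normalized fields smooth.\<close>

lemma smooth_on_inverse_sqrt:
  fixes f :: "'a::real_normed_vector \<Rightarrow> real"
  assumes S: "open S" and f: "smooth_on S f" and pos: "\<And>x. x \<in> S \<Longrightarrow> f x > 0"
  shows "smooth_on S (\<lambda>x. 1 / sqrt (f x))"
proof -
  let ?r = "\<lambda>x. 1 / sqrt (f x)"
  have d: "(?r has_derivative (\<lambda>v. (- 1/2) * (?r x * (?r x * (?r x * frechet_derivative f (at x) v))))) (at x)"
    if x: "x \<in> S" for x
  proof -
    have "(?r has_derivative (\<lambda>v. - 1 * (inverse (sqrt (f x)) * (inverse (sqrt (f x)) / 2 * frechet_derivative f (at x) v) * inverse (sqrt (f x))))) (at x)"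
      by (rule derivative_eq_intros frechet_works smooth_on_differentiable[OF f x] refl
          | use pos[OF x] in \<open>simp add: field_simps\<close>)+
    then show ?thesis by (rule has_derivative_eq_rhs) (simp add: fun_eq_iff field_simps)
  qed
  show ?thesis
    unfolding smooth_on_def
  proof
    fix k show "Ck_on k S ?r"
    proof (induction k)
      case 0
      have "continuous_on S f" by (rule smooth_on_continuous[OF f])
      moreover have "sqrt (f x) \<noteq> 0" if "x \<in> S" for x using pos[OF that] by simp
      ultimately show ?case by (auto intro!: continuous_intros dest: pos)
    next
      case (Suc k)
      show ?case
      proof (simp, intro conjI ballI allI)
        show "?r differentiable at x" if "x \<in> S" for x
          using d[OF that] by (auto simp: differentiable_def)
        fix v
        have fd: "Ck_on k S (\<lambda>x. frechet_derivative f (at x) v)"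
          using smooth_on_deriv[OF f] by (simp add: smooth_on_def)
        have "Ck_on k S (\<lambda>x. (- 1/2) * (?r x * (?r x * (?r x * frechet_derivative f (at x) v))))"
          by (intro Ck_on_bilinear[OF bounded_bilinear_mult S] Ck_on_const Suc.IH fd)
        then show "Ck_on k S (\<lambda>x. frechet_derivative ?r (at x) v)"
          by (rule Ck_on_cong[OF S, rotated]) (use frechet_eqI[OF d] in auto)
      qed
    qed
  qed
qed

text \<open>Affine curves suffice to produce velocity vectors. For them the derivative keeps its
  form at every order, since the inner derivative is the constant \<open>h\<close>.\<close>

lemma smooth_on_line:
  assumes "smooth_on S f" "open I" "\<And>t. t \<in> I \<Longrightarrow> x + t *\<^sub>R h \<in> S"
  shows "smooth_on I (\<lambda>t::real. f (x + t *\<^sub>R h))"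
  unfolding smooth_on_def
proof
  fix k
  have "Ck_on k S f" using assms by (simp add: smooth_on_def)
  then show "Ck_on k I (\<lambda>t. f (x + t *\<^sub>R h))"
  proof (induction k arbitrary: f)
    case 0
    then show ?case
      by (auto intro!: continuous_on_compose2[of S f I "\<lambda>t. x + t *\<^sub>R h"] continuous_intros assms(3))
  next
    case (Suc k)
    have d: "((\<lambda>t. f (x + t *\<^sub>R h)) has_derivative (\<lambda>s. frechet_derivative f (at (x + t *\<^sub>R h)) (s *\<^sub>R h))) (at t)"
      if "t \<in> I" for t
    proof -
      have "((\<lambda>t. x + t *\<^sub>R h) has_derivative (\<lambda>s. s *\<^sub>R h)) (at t)"
        by (auto intro!: derivative_eq_intros)
      moreover have "(f has_derivative frechet_derivative f (at (x + t *\<^sub>R h))) (at (x + t *\<^sub>R h))"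
        by (rule frechet_works) (use Suc.prems assms(3) that in auto)
      ultimately show ?thesis by (rule has_derivative_compose)
    qed
    have lin: "frechet_derivative f (at (x + t *\<^sub>R h)) (s *\<^sub>R h) = s *\<^sub>R frechet_derivative f (at (x + t *\<^sub>R h)) h"
      if "t \<in> I" for t s
      using Suc.prems assms(3) that linear_frechet_derivative[of f "at (x + t *\<^sub>R h)"]
      by (auto simp: linear_cmul)
    show ?case
    proof (simp, intro conjI ballI allI)
      show "(\<lambda>t. f (x + t *\<^sub>R h)) differentiable at t" if "t \<in> I" for t
        using d[OF that] by (auto simp: differentiable_def)
      fix s
      have "Ck_on k I (\<lambda>t. frechet_derivative f (at (x + t *\<^sub>R h)) h)"
        by (rule Suc.IH) (use Suc.prems in auto)
      then have "Ck_on k I (\<lambda>t. s *\<^sub>R frechet_derivative f (at (x + t *\<^sub>R h)) h)"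
        by (intro Ck_on_bilinear[OF bounded_bilinear_scaleR assms(2)] Ck_on_const)
      then show "Ck_on k I (\<lambda>t. frechet_derivative (\<lambda>t. f (x + t *\<^sub>R h)) (at t) s)"
        by (rule Ck_on_cong[OF assms(2), rotated]) (auto simp: frechet_eqI[OF d] lin)
    qed
  qed
qed

subsection \<open>Symmetry of second derivatives\<close>

text \<open>Two applications of the mean value theorem: in direction \<open>u\<close> to the
  difference of \<open>f\<close> over the step \<open>t *\<^sub>R w\<close>, and in direction
  \<open>w\<close> to the resulting difference of derivatives. The intermediate point stays in the
  parallelogram of the two steps.\<close>

lemma second_difference:
  fixes f :: "'a::real_normed_vector \<Rightarrow> real"
  assumes f: "smooth_on S f" and t: "t > 0"
    and S: "\<And>y. norm (y - x) \<le> t * (norm u + norm w) \<Longrightarrow> y \<in> S"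
  shows "\<exists>y. norm (y - x) \<le> t * (norm u + norm w) \<and>
    f (x + t *\<^sub>R u + t *\<^sub>R w) - f (x + t *\<^sub>R u) - f (x + t *\<^sub>R w) + f x
     = t * t * frechet_derivative (\<lambda>z. frechet_derivative f (at z) u) (at y) w"
proof -
  let ?Du = "\<lambda>z. frechet_derivative f (at z) u"
  have dist: "norm (x + a *\<^sub>R u + b *\<^sub>R w - x) \<le> t * (norm u + norm w)"
    if "0 \<le> a" "a \<le> t" "0 \<le> b" "b \<le> t" for a b
  proof -
    have "norm (x + a *\<^sub>R u + b *\<^sub>R w - x) \<le> norm (a *\<^sub>R u) + norm (b *\<^sub>R w)"
      using norm_triangle_ineq[of "a *\<^sub>R u" "b *\<^sub>R w"] by simp
    also have "\<dots> \<le> t * norm u + t * norm w"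
      using that by (auto intro!: add_mono mult_right_mono)
    finally show ?thesis by (simp add: algebra_simps)
  qed
  have inS: "x + a *\<^sub>R u + b *\<^sub>R w \<in> S" if "0 \<le> a" "a \<le> t" "0 \<le> b" "b \<le> t" for a b
    by (rule S[OF dist[OF that]])
  have along: "((\<lambda>s. g (c + s *\<^sub>R h)) has_real_derivative frechet_derivative g (at (c + s *\<^sub>R h)) h) (at s)"
    if "g differentiable (at (c + s *\<^sub>R h))" for g :: "'a \<Rightarrow> real" and c h s
  proof -
    have "((\<lambda>s. c + s *\<^sub>R h) has_derivative (\<lambda>r. r *\<^sub>R h)) (at s)"
      by (auto intro!: derivative_eq_intros)
    from has_derivative_compose[OF this frechet_works[OF that]]
    show ?thesis
      unfolding has_field_derivative_def
      by (rule has_derivative_eq_rhs)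
        (simp add: fun_eq_iff linear_cmul[OF linear_frechet_derivative[OF that]])
  qed
  define g where "g = (\<lambda>s. f (x + t *\<^sub>R w + s *\<^sub>R u) - f (x + s *\<^sub>R u))"
  have "(g has_real_derivative ?Du (x + t *\<^sub>R w + s *\<^sub>R u) - ?Du (x + s *\<^sub>R u)) (at s)"
    if "0 \<le> s" "s \<le> t" for s
    unfolding g_def
    by (rule DERIV_diff[OF along[where g=f and h=u] along[where g=f and h=u]];
        rule smooth_on_differentiable[OF f])
      (use inS[of s t] inS[of s 0] that t in \<open>simp_all add: add_ac\<close>)
  then obtain a where a: "0 < a" "a < t" "g t - g 0 = (t - 0) * (?Du (x + t *\<^sub>R w + a *\<^sub>R u) - ?Du (x + a *\<^sub>R u))"
    using MVT2[OF t, of g "\<lambda>s. ?Du (x + t *\<^sub>R w + s *\<^sub>R u) - ?Du (x + s *\<^sub>R u)"] by auto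
  define k where "k = (\<lambda>r. ?Du (x + a *\<^sub>R u + r *\<^sub>R w))"
  have "(k has_real_derivative frechet_derivative ?Du (at (x + a *\<^sub>R u + r *\<^sub>R w)) w) (at r)"
    if "0 \<le> r" "r \<le> t" for r
    unfolding k_def
    by (rule along[where g="?Du" and h=w], rule smooth_on_differentiable[OF smooth_on_deriv[OF f]])
      (use inS[of a r] that a in simp)
  then obtain b where b: "0 < b" "b < t" "k t - k 0 = (t - 0) * frechet_derivative ?Du (at (x + a *\<^sub>R u + b *\<^sub>R w)) w"
    using MVT2[OF t, of k "\<lambda>r. frechet_derivative ?Du (at (x + a *\<^sub>R u + r *\<^sub>R w)) w"] by auto
  have "f (x + t *\<^sub>R u + t *\<^sub>R w) - f (x + t *\<^sub>R u) - f (x + t *\<^sub>R w) + f x = g t - g 0"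
    by (simp add: g_def add_ac)
  also have "\<dots> = t * (k t - k 0)" using a by (simp add: k_def add_ac)
  also have "\<dots> = t * t * frechet_derivative ?Du (at (x + a *\<^sub>R u + b *\<^sub>R w)) w" using b by simp
  finally show ?thesis
    using dist[of a b] a b by (intro exI[of _ "x + a *\<^sub>R u + b *\<^sub>R w"]) auto
qed

text \<open>The second difference is symmetric in \<open>u\<close> and \<open>w\<close>. Divided by
  the square of the step it tends to either mixed derivative, because the intermediate points tend
  to \<open>x\<close> and the second derivatives are continuous.\<close>

lemma mixed_derivatives_real:
  fixes f :: "'a::real_normed_vector \<Rightarrow> real"
  assumes "open S" and f: "smooth_on S f" and "x \<in> S"
  shows "frechet_derivative (\<lambda>z. frechet_derivative f (at z) u) (at x) w
       = frechet_derivative (\<lambda>z. frechet_derivative f (at z) w) (at x) u"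
proof -
  define D where "D = (\<lambda>u w y. frechet_derivative (\<lambda>z. frechet_derivative f (at z) u) (at y) w)"
  obtain r where r: "r > 0" "\<And>y. norm (y - x) < r \<Longrightarrow> y \<in> S"
    using assms(1,3) unfolding open_dist by (metis dist_norm)
  define m where "m = norm u + norm w"
  have m: "m \<ge> 0" by (simp add: m_def)
  \<comment> \<open>Step sizes tending to 0 for which the whole parallelogram stays in the ball of
    radius \<open>r\<close>; the summand 1 in \<open>m + 1\<close> covers the case
    \<open>u = w = 0\<close>.\<close>
  define tn where "tn = (\<lambda>n::nat. r / ((m + 1) * (real n + 2)))"
  have tn: "tn n > 0" "tn n * m < r" for n
  proof -
    show "tn n > 0" using r m by (simp add: tn_def)
    have "m < (m + 1) * (real n + 2)" using m by (simp add: algebra_simps) (smt (verit) mult_nonneg_nonneg of_nat_0_le_iff)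
    then show "tn n * m < r" using r m by (simp add: tn_def pos_divide_less_eq)
  qed
  have lim: "(\<lambda>n. tn n * m) \<longlonglongrightarrow> 0"
  proof -
    have "(\<lambda>n. (r * m / (m+1)) * (1 / (real n + 2))) \<longlonglongrightarrow> (r * m / (m+1)) * 0"
      by (intro tendsto_mult tendsto_const) (use LIMSEQ_ignore_initial_segment[OF lim_1_over_n, of 2] in \<open>simp add: add.commute\<close>)
    then show ?thesis by (simp add: tn_def field_simps)
  qed
  define Q where "Q = (\<lambda>u w n. f (x + tn n *\<^sub>R u + tn n *\<^sub>R w) - f (x + tn n *\<^sub>R u) - f (x + tn n *\<^sub>R w) + f x)"
  have half: "(\<lambda>n. Q u w n / (tn n * tn n)) \<longlonglongrightarrow> D u w x" if um: "norm u + norm w = m" for u w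
  proof -
    have "\<forall>n. \<exists>y. norm (y - x) \<le> tn n * m \<and> Q u w n = tn n * tn n * D u w y"
      unfolding Q_def D_def um[symmetric]
      by (intro allI second_difference[OF f]) (use tn r um in \<open>auto intro: le_less_trans\<close>)
    then obtain y where y: "\<And>n. norm (y n - x) \<le> tn n * m" "\<And>n. Q u w n = tn n * tn n * D u w (y n)"
      by metis
    have "y \<longlonglongrightarrow> x"
      by (rule LIM_zero_cancel, rule Lim_null_comparison[OF _ lim]) (use y(1) in auto)
    moreover have "isCont (D u w) x"
      using smooth_on_continuous[OF smooth_on_deriv[OF smooth_on_deriv[OF f]]] assms
      by (simp add: D_def continuous_on_eq_continuous_at)
    ultimately have "(\<lambda>n. D u w (y n)) \<longlonglongrightarrow> D u w x" by (rule isCont_tendsto_compose[rotated])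
    moreover have "D u w (y n) = Q u w n / (tn n * tn n)" for n using y(2)[of n] tn(1)[of n] by simp
    ultimately show ?thesis by simp
  qed
  have "Q u w n = Q w u n" for n by (simp add: Q_def add_ac)
  with half[of u w] half[of w u] have "D u w x = D w u x"
    by (auto simp: m_def add.commute intro: LIMSEQ_unique)
  then show ?thesis by (simp add: D_def)
qed

lemma frechet_inner:
  assumes "f differentiable (at x)"
  shows "frechet_derivative (\<lambda>x. f x \<bullet> b) (at x) v = frechet_derivative f (at x) v \<bullet> b"
  by (subst frechet_eqI[OF has_derivative_inner_left[OF frechet_works[OF assms]]]) simp

text \<open>The mean value argument concerns real functions, hence the passage to
  components.\<close>

lemma mixed_derivatives:
  fixes f :: "'a::real_normed_vector \<Rightarrow> 'v::euclidean_space"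
  assumes S: "open S" and f: "smooth_on S f" and x: "x \<in> S"
  shows "frechet_derivative (\<lambda>z. frechet_derivative f (at z) u) (at x) w
       = frechet_derivative (\<lambda>z. frechet_derivative f (at z) w) (at x) u"
proof (rule euclidean_eqI)
  fix b :: 'v
  have fb: "smooth_on S (\<lambda>z. f z \<bullet> b)" by (rule smooth_on_inner[OF S f smooth_on_const])
  have *: "frechet_derivative (\<lambda>z. frechet_derivative (\<lambda>z. f z \<bullet> b) (at z) u) (at x) w
      = frechet_derivative (\<lambda>z. frechet_derivative f (at z) u) (at x) w \<bullet> b" for u w
  proof -
    have d: "(\<lambda>z. frechet_derivative f (at z) u \<bullet> b) differentiable (at x)"
      by (rule smooth_on_differentiable[OF smooth_on_inner[OF S smooth_on_deriv[OF f] smooth_on_const] x])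
    have "frechet_derivative (\<lambda>z. frechet_derivative (\<lambda>z. f z \<bullet> b) (at z) u) (at x)
       = frechet_derivative (\<lambda>z. frechet_derivative f (at z) u \<bullet> b) (at x)"
      by (rule frechet_cong(2)[OF S x _ d]) (simp add: frechet_inner smooth_on_differentiable[OF f])
    then show ?thesis
      by (simp add: frechet_inner smooth_on_differentiable[OF smooth_on_deriv[OF f] x])
  qed
  show "frechet_derivative (\<lambda>z. frechet_derivative f (at z) u) (at x) w \<bullet> b
       = frechet_derivative (\<lambda>z. frechet_derivative f (at z) w) (at x) u \<bullet> b"
    using mixed_derivatives_real[OF S fb x, of u w] by (simp add: *)
qed

section \<open>Multilinear algebra\<close>

lemma exhaust_5: "x = 1 \<or> x = 2 \<or> x = 3 \<or> x = 4 \<or> x = 5" for x :: 5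
proof (induct x)
  case (of_int z)
  then have "0 \<le> z" and "z < 5" by simp_all
  then have "z = 0 \<or> z = 1 \<or> z = 2 \<or> z = 3 \<or> z = 4" by arith
  then show ?case by auto
qed

lemma exhaust_7: "x = 1 \<or> x = 2 \<or> x = 3 \<or> x = 4 \<or> x = 5 \<or> x = 6 \<or> x = 7" for x :: 7
proof (induct x)
  case (of_int z)
  then have "0 \<le> z" and "z < 7" by simp_all
  then have "z = 0 \<or> z = 1 \<or> z = 2 \<or> z = 3 \<or> z = 4 \<or> z = 5 \<or> z = 6" by arith
  then show ?case by auto
qed

lemma forall_5: "(\<forall>i::5. P i) \<longleftrightarrow> P 1 \<and> P 2 \<and> P 3 \<and> P 4 \<and> P 5"
  by (metis exhaust_5)

lemma forall_7: "(\<forall>i::7. P i) \<longleftrightarrow> P 1 \<and> P 2 \<and> P 3 \<and> P 4 \<and> P 5 \<and> P 6 \<and> P 7"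
  by (metis exhaust_7)

lemma UNIV_7: "UNIV = {1, 2, 3, 4, 5, 6, 7::7}"
  using exhaust_7 by auto

lemma sum_7: "sum f (UNIV::7 set) = f 1 + f 2 + f 3 + f 4 + f 5 + f 6 + f 7"
  unfolding UNIV_7 by (simp add: ac_simps)

lemma vector_4 [simp]:
  "(vector [a, b, c, d] :: 'a::zero^4) $ 1 = a" "(vector [a, b, c, d] :: 'a^4) $ 2 = b"
  "(vector [a, b, c, d] :: 'a^4) $ 3 = c" "(vector [a, b, c, d] :: 'a^4) $ 4 = d"
  unfolding vector_def by simp_all

lemma vector_5 [simp]:
  "(vector [a, b, c, d, e] :: 'a::zero^5) $ 1 = a" "(vector [a, b, c, d, e] :: 'a^5) $ 2 = b"
  "(vector [a, b, c, d, e] :: 'a^5) $ 3 = c" "(vector [a, b, c, d, e] :: 'a^5) $ 4 = d"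
  "(vector [a, b, c, d, e] :: 'a^5) $ 5 = e"
  unfolding vector_def by simp_all

lemma vector_7 [simp]:
  "(vector [a, b, c, d, e, f, g] :: 'a::zero^7) $ 1 = a"
  "(vector [a, b, c, d, e, f, g] :: 'a^7) $ 2 = b"
  "(vector [a, b, c, d, e, f, g] :: 'a^7) $ 3 = c"
  "(vector [a, b, c, d, e, f, g] :: 'a^7) $ 4 = d"
  "(vector [a, b, c, d, e, f, g] :: 'a^7) $ 5 = e"
  "(vector [a, b, c, d, e, f, g] :: 'a^7) $ 6 = f"
  "(vector [a, b, c, d, e, f, g] :: 'a^7) $ 7 = g"
  unfolding vector_def by simp_all

text \<open>The other rows are compared through equations between rows; in this form the rule, like
  the next two, applies directly to matrices written with \<open>vector\<close>.\<close>

lemma det_rows_add: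
  fixes A :: "real^'n^'n"
  assumes "C $ k = A $ k + B $ k" "\<forall>i. i \<noteq> k \<longrightarrow> A $ i = C $ i" "\<forall>i. i \<noteq> k \<longrightarrow> B $ i = C $ i"
  shows "det C = det A + det B"
proof -
  have "det (\<chi> i. if i = k then A $ k + B $ k else C $ i)
      = det (\<chi> i. if i = k then A $ k else C $ i) + det (\<chi> i. if i = k then B $ k else C $ i)"
    by (rule det_row_add)
  moreover have "(\<chi> i. if i = k then A $ k + B $ k else C $ i) = C"
    "(\<chi> i. if i = k then A $ k else C $ i) = A" "(\<chi> i. if i = k then B $ k else C $ i) = B"
    using assms by (auto simp: vec_eq_iff)
  ultimately show ?thesis by simp
qed

lemma det_rows_scale:
  fixes A :: "real^'n^'n"
  assumes "C $ k = r *\<^sub>R A $ k" "\<forall>i. i \<noteq> k \<longrightarrow> A $ i = C $ i"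
  shows "det C = r * det A"
proof -
  have "det (\<chi> i. if i = k then r *s A $ k else C $ i) = r * det (\<chi> i. if i = k then A $ k else C $ i)"
    by (rule det_row_mul)
  moreover have "(\<chi> i. if i = k then r *s A $ k else C $ i) = C"
    "(\<chi> i. if i = k then A $ k else C $ i) = A"
    using assms by (auto simp: vec_eq_iff scalar_mult_eq_scaleR)
  ultimately show ?thesis by simp
qed

lemma det_rows_swap:
  fixes A :: "real^'n^'n"
  assumes "k \<noteq> l" "C $ k = A $ l" "C $ l = A $ k" "\<forall>i. i \<noteq> k \<longrightarrow> i \<noteq> l \<longrightarrow> C $ i = A $ i"
  shows "det C = - det A"
proof -
  have "det (\<chi> i. A $ (Transposition.transpose k l i)) = of_int (sign (Transposition.transpose k l)) * det A"
    by (rule det_permute_rows) (simp add: permutes_swap_id)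
  moreover have "(\<chi> i. A $ (Transposition.transpose k l i)) = C"
    using assms by (auto simp: vec_eq_iff Transposition.transpose_def)
  ultimately show ?thesis using assms(1) by (simp add: sign_swap_id)
qed

text \<open>Alternation is only required on a subset, since the volume form of the projective plane is
  alternating on tangent vectors but not on all ambient vectors.\<close>

definition alt3 :: "'a::real_vector set \<Rightarrow> ('a \<Rightarrow> 'a \<Rightarrow> 'a \<Rightarrow> real) \<Rightarrow> bool" where
  "alt3 T G \<longleftrightarrow>
     (\<forall>b c. linear (\<lambda>a. G a b c)) \<and> (\<forall>a c. linear (\<lambda>b. G a b c)) \<and> (\<forall>a b. linear (\<lambda>c. G a b c)) \<and>
     (\<forall>a\<in>T. \<forall>b\<in>T. \<forall>c\<in>T. G b a c = - G a b c \<and> G a c b = - G a b c)"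

definition alt4 :: "'a::real_vector set \<Rightarrow> ('a \<Rightarrow> 'a \<Rightarrow> 'a \<Rightarrow> 'a \<Rightarrow> real) \<Rightarrow> bool" where
  "alt4 T G \<longleftrightarrow>
     (\<forall>b c d. linear (\<lambda>a. G a b c d)) \<and> (\<forall>a c d. linear (\<lambda>b. G a b c d)) \<and>
     (\<forall>a b d. linear (\<lambda>c. G a b c d)) \<and> (\<forall>a b c. linear (\<lambda>d. G a b c d)) \<and>
     (\<forall>a\<in>T. \<forall>b\<in>T. \<forall>c\<in>T. \<forall>d\<in>T.
        G b a c d = - G a b c d \<and> G a c b d = - G a b c d \<and> G a b d c = - G a b c d)"

lemma alt3_linear:
  assumes "alt3 T F"
  shows "linear (\<lambda>a. F a b c)" "linear (\<lambda>b. F a b c)" "linear (\<lambda>c. F a b c)"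
  using assms unfolding alt3_def by blast+

lemma alt3_swap:
  assumes "alt3 T F" "a \<in> T" "b \<in> T" "c \<in> T"
  shows "F b a c = - F a b c" "F a c b = - F a b c"
  using assms unfolding alt3_def by blast+

lemma alt3_zero:
  assumes "alt3 T F" "p \<in> T" "q \<in> T"
  shows "F p p q = 0" "F q p p = 0" "F p q p = 0"
proof -
  show 1: "F p p q = 0" "F q p p = 0"
    using alt3_swap(1)[OF assms(1) assms(2,2,3)] alt3_swap(2)[OF assms(1) assms(3,2,2)] by auto
  show "F p q p = 0" using alt3_swap(2)[OF assms(1) assms(2,2,3)] 1 by simp
qed

lemma alt4_linear:
  assumes "alt4 T F"
  shows "linear (\<lambda>a. F a b c d)" "linear (\<lambda>b. F a b c d)" "linear (\<lambda>c. F a b c d)" "linear (\<lambda>d. F a b c d)"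
  using assms unfolding alt4_def by blast+

lemma alt4_swap:
  assumes "alt4 T F" "a \<in> T" "b \<in> T" "c \<in> T" "d \<in> T"
  shows "F b a c d = - F a b c d" "F a c b d = - F a b c d" "F a b d c = - F a b c d"
  using assms unfolding alt4_def by blast+

lemma alt4_zero:
  assumes "alt4 T F" "p \<in> T" "q \<in> T" "r \<in> T"
  shows "F p p q r = 0" "F p q p r = 0" "F p q r p = 0" "F q p p r = 0" "F q p r p = 0" "F q r p p = 0"
proof -
  note s = alt4_swap[OF assms(1)]
  show 1: "F p p q r = 0" "F q p p r = 0" "F q r p p = 0"
    using s(1)[of p p q r] s(2)[of q p p r] s(3)[of q r p p] assms by auto
  show 2: "F p q p r = 0" "F q p r p = 0"
    using s(2)[of p p q r] s(3)[of q p p r] 1 assms by auto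
  show "F p q r p = 0" using s(3)[of p q p r] 2 assms by auto
qed

text \<open>The difference of the two forms vanishes on all triples of generators, by alternation,
  and then on the span, by linearity in one slot after the other. It is the tool for comparing forms
  known on a single frame.\<close>

lemma alt3_eq:
  assumes G: "alt3 T G" and H: "alt3 T H" and T: "T = span {u, v, w}" and eq: "G u v w = H u v w"
    and abc: "a \<in> T" "b \<in> T" "c \<in> T"
  shows "G a b c = H a b c"
proof -
  have in_T: "u \<in> T" "v \<in> T" "w \<in> T" unfolding T by (auto intro: span_base)
  define K where "K = (\<lambda>a b c. G a b c - H a b c)"
  have K: "alt3 T K"
    unfolding alt3_def
  proof (intro conjI allI ballI)
    fix a b c assume T: "a \<in> T" "b \<in> T" "c \<in> T"
    show "K b a c = - K a b c" "K a c b = - K a b c"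
      using alt3_swap[OF G T] alt3_swap[OF H T] unfolding K_def by linarith+
  qed (auto simp: K_def intro!: linear_compose_sub alt3_linear[OF G] alt3_linear[OF H])
  note z = alt3_zero[OF K] and s = alt3_swap[OF K]
  let ?E = "{u, v, w}"
  have q1: "K u v w = 0" using eq by (simp add: K_def)
  have q2: "K v u w = 0" using s(1)[of u v w] q1 in_T by simp
  have q3: "K u w v = 0" using s(2)[of u v w] q1 in_T by simp
  have q4: "K v w u = 0" using s(2)[of v u w] q2 in_T by simp
  have q5: "K w u v = 0" using s(1)[of u w v] q3 in_T by simp
  have q6: "K w v u = 0" using s(2)[of w u v] q5 in_T by simp
  have base: "K x y r = 0" if "x \<in> ?E" "y \<in> ?E" "r \<in> ?E" for x y r
    using that by (elim insertE emptyE; simp add: z in_T q1 q2 q3 q4 q5 q6)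
  note kl = alt3_linear[OF K]
  have 2: "K x y c = 0" if "x \<in> ?E" "y \<in> ?E" for x y
    by (rule linear_eq_0_on_span[where b="?E", OF kl(3) base]) (use abc T that in auto)
  have 3: "K x b c = 0" if "x \<in> ?E" for x
    by (rule linear_eq_0_on_span[where b="?E", OF kl(2) 2]) (use abc T that in auto)
  have "K a b c = 0"
    by (rule linear_eq_0_on_span[where b="?E", OF kl(1) 3]) (use abc T in auto)
  then show ?thesis by (simp add: K_def)
qed

lemma alt4_eq:
  assumes G: "alt4 T G" and H: "alt4 T H" and T: "T = span {e1, e2, e3, e4}"
    and eq: "G e1 e2 e3 e4 = H e1 e2 e3 e4"
    and abcd: "a \<in> T" "b \<in> T" "c \<in> T" "d \<in> T"
  shows "G a b c d = H a b c d"
proof -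
  have in_T: "e1 \<in> T" "e2 \<in> T" "e3 \<in> T" "e4 \<in> T" unfolding T by (auto intro: span_base)
  define K where "K = (\<lambda>a b c d. G a b c d - H a b c d)"
  have K: "alt4 T K"
    unfolding alt4_def
  proof (intro conjI allI ballI)
    fix a b c d assume T: "a \<in> T" "b \<in> T" "c \<in> T" "d \<in> T"
    show "K b a c d = - K a b c d" "K a c b d = - K a b c d" "K a b d c = - K a b c d"
      using alt4_swap[OF G T] alt4_swap[OF H T] unfolding K_def by linarith+
  qed (auto simp: K_def intro!: linear_compose_sub alt4_linear[OF G] alt4_linear[OF H])
  note z = alt4_zero[OF K] and s = alt4_swap[OF K]
  let ?E = "{e1, e2, e3, e4}"
  have q1: "K e1 e2 e3 e4 = 0" using eq by (simp add: K_def)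
  have p4: "K a b d c = 0" "K a c b d = 0" "K b a c d = 0"
    if "K a b c d = 0" "a \<in> T" "b \<in> T" "c \<in> T" "d \<in> T" for a b c d
    using s[of a b c d] that by simp_all
  have q2: "K e1 e3 e2 e4 = 0" by (rule p4(2)[OF q1 in_T(1,2,3,4)])
  have q3: "K e1 e2 e4 e3 = 0" by (rule p4(1)[OF q1 in_T(1,2,3,4)])
  have q4: "K e1 e3 e4 e2 = 0" by (rule p4(1)[OF q2 in_T(1,3,2,4)])
  have q5: "K e1 e4 e2 e3 = 0" by (rule p4(2)[OF q3 in_T(1,2,4,3)])
  have q6: "K e1 e4 e3 e2 = 0" by (rule p4(1)[OF q5 in_T(1,4,2,3)])
  \<comment> \<open>Permutations are sorted by the position of \<open>e1\<close>: those with
    \<open>e1\<close> in front come from the six equations above, and adjacent swaps move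
    \<open>e1\<close> to the other slots.\<close>
  have perm3: "K e1 x y t = 0" if "x \<in> ?E" "y \<in> ?E" "t \<in> ?E" for x y t
    using that by (elim insertE emptyE; simp add: z in_T q1 q2 q3 q4 q5 q6)
  have perm2: "K x e1 y t = 0" "K x y e1 t = 0" "K x y t e1 = 0"
    if "x \<in> ?E" "y \<in> ?E" "t \<in> ?E" for x y t
  proof -
    have T: "x \<in> T" "y \<in> T" "t \<in> T" using that in_T by auto
    show 1: "K x e1 y t = 0" using p4(3)[OF perm3[OF that]] in_T T by simp
    show 2: "K x y e1 t = 0" using p4(2)[OF 1] in_T T by simp
    show "K x y t e1 = 0" using p4(1)[OF 2] in_T T by simp
  qed
  have base: "K x y r t = 0" if "x \<in> ?E" "y \<in> ?E" "r \<in> ?E" "t \<in> ?E" for x y r t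
  proof (cases "x = e1 \<or> y = e1 \<or> r = e1 \<or> t = e1")
    case True
    then show ?thesis
      using perm3[OF that(2,3,4)] perm2(1)[OF that(1,3,4)] perm2(2)[OF that(1,2,4)] perm2(3)[OF that(1,2,3)]
      by auto
  next
    \<comment> \<open>Three generators in four slots: one is repeated.\<close>
    case False
    then have "x \<in> {e2, e3, e4}" "y \<in> {e2, e3, e4}" "r \<in> {e2, e3, e4}" "t \<in> {e2, e3, e4}"
      using that by auto
    then show ?thesis by (elim insertE emptyE; simp add: z in_T)
  qed
  note kl = alt4_linear[OF K]
  have 1: "K x y r d = 0" if "x \<in> ?E" "y \<in> ?E" "r \<in> ?E" for x y r
    by (rule linear_eq_0_on_span[where b="?E", OF kl(4) base]) (use abcd T that in auto)
  have 2: "K x y c d = 0" if "x \<in> ?E" "y \<in> ?E" for x y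
    by (rule linear_eq_0_on_span[where b="?E", OF kl(3) 1]) (use abcd T that in auto)
  have 3: "K x b c d = 0" if "x \<in> ?E" for x
    by (rule linear_eq_0_on_span[where b="?E", OF kl(2) 2]) (use abcd T that in auto)
  have "K a b c d = 0"
    by (rule linear_eq_0_on_span[where b="?E", OF kl(1) 3]) (use abcd T in auto)
  then show ?thesis by (simp add: K_def)
qed

section \<open>Determinants as alternating forms, and change of basis\<close>

definition det3 :: "real^3 \<Rightarrow> real^3 \<Rightarrow> real^3 \<Rightarrow> real" where
  "det3 a b c = det (vector [a, b, c] :: real^3^3)"

definition det4 :: "real^4 \<Rightarrow> real^4 \<Rightarrow> real^4 \<Rightarrow> real^4 \<Rightarrow> real" where
  "det4 a b c d = det (vector [a, b, c, d] :: real^4^4)"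

lemma alt3_det3: "alt3 UNIV det3"
  unfolding alt3_def det3_def
  by (intro conjI allI ballI linearI) (simp_all add: det_3 algebra_simps)

text \<open>A swap carries linearity from each slot to the next.\<close>

lemma alt4I:
  assumes l: "\<And>b c d. linear (\<lambda>a. G a b c d)"
    and s: "\<And>a b c d. G b a c d = - G a b c d" "\<And>a b c d. G a c b d = - G a b c d"
      "\<And>a b c d. G a b d c = - G a b c d"
  shows "alt4 UNIV G"
proof -
  have 2: "linear (\<lambda>b. G a b c d)" for a c d
    using linear_compose_neg[OF l[of a c d]] by (subst s(1)) simp
  have 3: "linear (\<lambda>c. G a b c d)" for a b d
    using linear_compose_neg[OF 2[of a b d]] by (subst s(2)) simp
  have 4: "linear (\<lambda>d. G a b c d)" for a b c
    using linear_compose_neg[OF 3[of a b c]] by (subst s(3)) simp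
  show ?thesis unfolding alt4_def
    by (intro conjI allI ballI l 2 3 4 s)
qed

lemma alt4_det4: "alt4 UNIV det4"
proof (rule alt4I)
  show "linear (\<lambda>a. det4 a b c d)" for b c d
  proof (rule linearI)
    show "det4 (a + a') b c d = det4 a b c d + det4 a' b c d" for a a'
      unfolding det4_def by (rule det_rows_add[of _ 1]) (simp_all add: forall_4)
    show "det4 (r *\<^sub>R a) b c d = r *\<^sub>R det4 a b c d" for r a
      unfolding det4_def real_scaleR_def
      by (rule det_rows_scale[of _ 1]) (simp_all add: forall_4)
  qed
  show "det4 b a c d = - det4 a b c d" for a b c d
    unfolding det4_def
    by (rule det_rows_swap[of 1 2]) (simp_all add: forall_4)
  show "det4 a c b d = - det4 a b c d" for a b c d
    unfolding det4_def
    by (rule det_rows_swap[of 2 3]) (simp_all add: forall_4)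
  show "det4 a b d c = - det4 a b c d" for a b c d
    unfolding det4_def
    by (rule det_rows_swap[of 3 4]) (simp_all add: forall_4)
qed

lemma span_axis: "span (range (\<lambda>i. axis i 1)) = (UNIV :: (real^'n) set)"
proof -
  have "(Basis :: (real^'n) set) = range (\<lambda>i. axis i 1)" by (auto simp: Basis_vec_def)
  then show ?thesis using span_Basis by metis
qed

lemma det4_axis: "det4 (axis 1 1) (axis 2 1) (axis 3 1) (axis 4 1) = 1"
proof -
  have "(vector [axis 1 1, axis 2 1, axis 3 1, axis 4 1] :: real^4^4) = mat 1"
    by (simp add: vec_eq_iff forall_4 mat_def axis_def)
  then show ?thesis by (simp add: det4_def)
qed

lemma det3_axis: "det3 (axis 1 1) (axis 2 1) (axis 3 1) = 1"
  by (simp add: det3_def det_3 axis_def)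

lemma vector_eta4: "A = vector [A$1, A$2, A$3, A$4]" for A :: "'a::zero^4"
  by (simp add: vec_eq_iff forall_4)

lemma vector_eta3: "A = vector [A$1, A$2, A$3]" for A :: "'a::zero^3"
  by (simp add: vec_eq_iff forall_3)

lemma linear_cmult: "linear f \<Longrightarrow> linear (\<lambda>x. c * f x :: real)"
  by (auto intro!: linearI simp: linear_add linear_cmul algebra_simps)

lemma alt3_scale: assumes G: "alt3 T G" shows "alt3 T (\<lambda>x y z. r * G x y z)"
  unfolding alt3_def
proof (intro conjI allI ballI)
  fix a b c assume T: "a \<in> T" "b \<in> T" "c \<in> T"
  show "r * G b a c = - (r * G a b c)" "r * G a c b = - (r * G a b c)"
    by (simp_all add: alt3_swap(1)[OF G T] alt3_swap(2)[OF G T])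
qed (rule linear_cmult, rule alt3_linear[OF G])+

lemma alt4_scale: assumes G: "alt4 T G" shows "alt4 T (\<lambda>x y z t. r * G x y z t)"
  unfolding alt4_def
proof (intro conjI allI ballI)
  fix a b c d assume T: "a \<in> T" "b \<in> T" "c \<in> T" "d \<in> T"
  show "r * G b a c d = - (r * G a b c d)" "r * G a c b d = - (r * G a b c d)"
    "r * G a b d c = - (r * G a b c d)"
    by (simp_all add: alt4_swap(1)[OF G T] alt4_swap(2)[OF G T] alt4_swap(3)[OF G T])
qed (rule linear_cmult, rule alt4_linear[OF G])+

lemma alt3_compose:
  assumes G: "alt3 T G" and L: "linear L" and LT: "\<And>x. x \<in> S \<Longrightarrow> L x \<in> T"
  shows "alt3 S (\<lambda>x y z. G (L x) (L y) (L z))"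
  unfolding alt3_def
proof (intro conjI allI ballI)
  fix a b c
  show "linear (\<lambda>a. G (L a) (L b) (L c))" by (rule linear_compose[OF L alt3_linear(1)[OF G], unfolded o_def])
  show "linear (\<lambda>b. G (L a) (L b) (L c))" by (rule linear_compose[OF L alt3_linear(2)[OF G], unfolded o_def])
  show "linear (\<lambda>c. G (L a) (L b) (L c))" by (rule linear_compose[OF L alt3_linear(3)[OF G], unfolded o_def])
  assume "a \<in> S" "b \<in> S" "c \<in> S"
  then show "G (L b) (L a) (L c) = - G (L a) (L b) (L c)" "G (L a) (L c) (L b) = - G (L a) (L b) (L c)"
    using alt3_swap[OF G LT LT LT] by blast+
qed

lemma alt4_compose:
  assumes G: "alt4 T G" and L: "linear L" and LT: "\<And>x. x \<in> S \<Longrightarrow> L x \<in> T"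
  shows "alt4 S (\<lambda>x y z t. G (L x) (L y) (L z) (L t))"
  unfolding alt4_def
proof (intro conjI allI ballI)
  fix a b c d
  show "linear (\<lambda>a. G (L a) (L b) (L c) (L d))" by (rule linear_compose[OF L alt4_linear(1)[OF G], unfolded o_def])
  show "linear (\<lambda>b. G (L a) (L b) (L c) (L d))" by (rule linear_compose[OF L alt4_linear(2)[OF G], unfolded o_def])
  show "linear (\<lambda>c. G (L a) (L b) (L c) (L d))" by (rule linear_compose[OF L alt4_linear(3)[OF G], unfolded o_def])
  show "linear (\<lambda>d. G (L a) (L b) (L c) (L d))" by (rule linear_compose[OF L alt4_linear(4)[OF G], unfolded o_def])
  assume "a \<in> S" "b \<in> S" "c \<in> S" "d \<in> S"
  then show "G (L b) (L a) (L c) (L d) = - G (L a) (L b) (L c) (L d)"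
    "G (L a) (L c) (L b) (L d) = - G (L a) (L b) (L c) (L d)"
    "G (L a) (L b) (L d) (L c) = - G (L a) (L b) (L c) (L d)"
    using alt4_swap[OF G LT LT LT LT] by blast+
qed

text \<open>In the rows of \<open>C\<close> both sides are alternating 3-forms on
  \<open>real^3\<close>, and they agree on the identity matrix.\<close>

lemma alt_change_3:
  fixes C :: "real^3^3" and b :: "'a::real_vector^3"
  assumes G: "alt3 T G" and T: "subspace T" and b: "\<And>i. b $ i \<in> T"
    and b': "\<And>i. b' $ i = (\<Sum>j\<in>UNIV. C $ i $ j *\<^sub>R b $ j)"
  shows "G (b'$1) (b'$2) (b'$3) = det C * G (b$1) (b$2) (b$3)"
proof -
  define L where "L = (\<lambda>x::real^3. \<Sum>j\<in>UNIV. x $ j *\<^sub>R b $ j)"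
  have L: "linear L" unfolding L_def by (rule linearI) (simp_all add: sum.distrib scaleR_add_left scaleR_sum_right)
  have LT: "L x \<in> T" for x unfolding L_def by (intro subspace_sum subspace_scale T b)
  have 1: "alt3 UNIV (\<lambda>x y z. G (L x) (L y) (L z))"
    by (rule alt3_compose[OF G L LT])
  have 2: "alt3 UNIV (\<lambda>x y z. G (b$1) (b$2) (b$3) * det3 x y z)"
    by (rule alt3_scale[OF alt3_det3])
  have "G (L (C$1)) (L (C$2)) (L (C$3)) = G (b$1) (b$2) (b$3) * det3 (C$1) (C$2) (C$3)"
  proof (rule alt3_eq[OF 1 2, of "axis 1 1" "axis 2 1" "axis 3 1"])
    show "UNIV = span {axis 1 1, axis 2 1, axis 3 1 :: real^3}"
      using span_axis[where 'n=3] by (simp add: UNIV_3)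
    show "G (L (axis 1 1)) (L (axis 2 1)) (L (axis 3 1)) = G (b $ 1) (b $ 2) (b $ 3) * det3 (axis 1 1) (axis 2 1) (axis 3 1)"
      by (simp add: det3_axis) (simp add: L_def sum_3 axis_def)
  qed auto
  then show ?thesis by (simp add: L_def b' det3_def vector_eta3[symmetric] mult.commute)
qed

lemma alt_change_4:
  fixes C :: "real^4^4" and b :: "'a::real_vector^4"
  assumes G: "alt4 T G" and T: "subspace T" and b: "\<And>i. b $ i \<in> T"
    and b': "\<And>i. b' $ i = (\<Sum>j\<in>UNIV. C $ i $ j *\<^sub>R b $ j)"
  shows "G (b'$1) (b'$2) (b'$3) (b'$4) = det C * G (b$1) (b$2) (b$3) (b$4)"
proof -
  define L where "L = (\<lambda>x::real^4. \<Sum>j\<in>UNIV. x $ j *\<^sub>R b $ j)"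
  have L: "linear L" unfolding L_def by (rule linearI) (simp_all add: sum.distrib scaleR_add_left scaleR_sum_right)
  have LT: "L x \<in> T" for x unfolding L_def by (intro subspace_sum subspace_scale T b)
  have 1: "alt4 UNIV (\<lambda>x y z t. G (L x) (L y) (L z) (L t))"
    by (rule alt4_compose[OF G L LT])
  have 2: "alt4 UNIV (\<lambda>x y z t. G (b$1) (b$2) (b$3) (b$4) * det4 x y z t)"
    by (rule alt4_scale[OF alt4_det4])
  have "G (L (C$1)) (L (C$2)) (L (C$3)) (L (C$4)) = G (b$1) (b$2) (b$3) (b$4) * det4 (C$1) (C$2) (C$3) (C$4)"
  proof (rule alt4_eq[OF 1 2, of "axis 1 1" "axis 2 1" "axis 3 1" "axis 4 1"])
    show "UNIV = span {axis 1 1, axis 2 1, axis 3 1, axis 4 1 :: real^4}"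
      using span_axis[where 'n=4] by (simp add: UNIV_4)
    show "G (L (axis 1 1)) (L (axis 2 1)) (L (axis 3 1)) (L (axis 4 1))
        = G (b $ 1) (b $ 2) (b $ 3) (b $ 4) * det4 (axis 1 1) (axis 2 1) (axis 3 1) (axis 4 1)"
      by (simp add: det4_axis) (simp add: L_def sum_4 axis_def)
  qed auto
  then show ?thesis by (simp add: L_def b' det4_def vector_eta4[symmetric] mult.commute)
qed

section \<open>Anti-self-dual forms in oriented frames\<close>

text \<open>\<open>Blinfun\<close> is meaningful only on bounded maps; in finite dimension linearity
  in each argument is enough.\<close>

lemma ev_form2_of:
  fixes h :: "'v::euclidean_space \<Rightarrow> 'v \<Rightarrow> real"
  assumes "\<And>b. linear (\<lambda>a. h a b)" "\<And>a. linear (\<lambda>b. h a b)"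
  shows "ev (form2_of h) a b = h a b"
proof -
  have 1: "bounded_linear (h a)" for a
    using assms(2) linear_conv_bounded_linear by auto
  then have 2: "blinfun_apply (Blinfun (h a)) = h a" for a
    by (simp add: bounded_linear_Blinfun_apply)
  have "linear (\<lambda>a. Blinfun (h a))"
    by (rule linearI; rule blinfun_eqI)
      (simp_all add: 2 blinfun.add_left blinfun.scaleR_left linear_add[OF assms(1)] linear_cmul[OF assms(1)])
  then have "bounded_linear (\<lambda>a. Blinfun (h a))"
    using linear_conv_bounded_linear by auto
  then show ?thesis by (simp add: form2_of_def bounded_linear_Blinfun_apply 2)
qed

lemma ev_wedge: "ev (wedge a b) y z = (a \<bullet> y) * (b \<bullet> z) - (a \<bullet> z) * (b \<bullet> y)"
  unfolding wedge_def by (rule ev_form2_of) (auto intro!: linearI simp: algebra_simps inner_add_right)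

lemma form2_eqI: "(\<And>a b. ev \<alpha> a b = ev \<beta> a b) \<Longrightarrow> \<alpha> = \<beta>"
  by (intro blinfun_eqI)

lemmas ev_simps = blinfun.add_left blinfun.diff_left blinfun.scaleR_left blinfun.minus_left
  blinfun.zero_left blinfun.add_right blinfun.diff_right blinfun.scaleR_right blinfun.minus_right
  blinfun.zero_right

lemma wedge_bilinear: "bounded_bilinear (wedge :: 'v::euclidean_space \<Rightarrow> 'v \<Rightarrow> 'v form2)"
proof -
  have "bilinear (wedge :: 'v \<Rightarrow> 'v \<Rightarrow> 'v form2)"
    unfolding bilinear_def
    by (auto intro!: linearI form2_eqI simp: ev_wedge ev_simps inner_simps algebra_simps)
  then show ?thesis by (simp add: bilinear_conv_bounded_bilinear)
qed

lemmas wedge_simps = bounded_bilinear.add_left[OF wedge_bilinear] bounded_bilinear.add_right[OF wedge_bilinear]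
  bounded_bilinear.scaleR_left[OF wedge_bilinear] bounded_bilinear.scaleR_right[OF wedge_bilinear]
  bounded_bilinear.minus_left[OF wedge_bilinear] bounded_bilinear.minus_right[OF wedge_bilinear]
  bounded_bilinear.diff_left[OF wedge_bilinear] bounded_bilinear.diff_right[OF wedge_bilinear]

section \<open>The inner product of two-forms\<close>

lemma inner2_add_left: "inner2 (a + b) c = inner2 a c + inner2 b c"
  by (simp add: inner2_def ev_simps algebra_simps sum.distrib)

lemma inner2_scale_left: "inner2 (r *\<^sub>R a) c = r * inner2 a c"
  by (simp add: inner2_def ev_simps sum_distrib_left mult_ac)

lemma inner2_commute: "inner2 a b = inner2 b a"
  by (simp add: inner2_def mult.commute)

lemma inner2_add_right: "inner2 c (a + b) = inner2 c a + inner2 c b"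
  by (metis inner2_add_left inner2_commute)

lemma inner2_scale_right: "inner2 c (r *\<^sub>R a) = r * inner2 c a"
  by (metis inner2_scale_left inner2_commute)

lemma linear_inner2: "linear (\<lambda>a. inner2 a b)" "linear (\<lambda>a. inner2 b a)"
  by (auto intro!: linearI simp: inner2_add_left inner2_scale_left inner2_add_right inner2_scale_right)

text \<open>Values on unit basis vectors are bounded by the operator norm. Boundedness makes the
  product rules for derivatives available for \<open>inner2\<close>.\<close>

lemma inner2_bilinear: "bounded_bilinear (inner2 :: 'v::euclidean_space form2 \<Rightarrow> _)"
proof (unfold_locales)
  show "\<exists>K. \<forall>\<alpha> \<beta>::'v form2. norm (inner2 \<alpha> \<beta>) \<le> norm \<alpha> * norm \<beta> * K"
  proof (intro exI allI)
    fix \<alpha> \<beta> :: "'v form2"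
    have ev_le: "\<bar>ev \<omega> a b\<bar> \<le> norm \<omega>" if "a \<in> Basis" "b \<in> Basis" for \<omega> :: "'v form2" and a b
      using order_trans[OF norm_blinfun[of "blinfun_apply \<omega> a" b]] norm_blinfun[of \<omega> a] that by simp
    have "\<bar>\<Sum>a\<in>Basis. \<Sum>b\<in>Basis. ev \<alpha> a b * ev \<beta> a b\<bar> \<le> (\<Sum>a\<in>(Basis::'v set). \<Sum>b\<in>(Basis::'v set). norm \<alpha> * norm \<beta>)"
      by (rule order_trans[OF sum_abs], rule sum_mono, rule order_trans[OF sum_abs], rule sum_mono)
        (auto simp: abs_mult intro!: mult_mono ev_le)
    then show "norm (inner2 \<alpha> \<beta>) \<le> norm \<alpha> * norm \<beta> * (1/4 * (real DIM('v) * real DIM('v)))"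
      by (simp add: inner2_def algebra_simps)
  qed
qed (simp_all add: inner2_add_left inner2_add_right inner2_scale_left inner2_scale_right)

lemma sum_Basis_ev:
  "(\<Sum>a\<in>Basis. (u \<bullet> a) * ev \<beta> a b) = ev \<beta> u b" "(\<Sum>b\<in>Basis. (u \<bullet> b) * ev \<beta> a b) = ev \<beta> a u"
proof -
  have "ev \<beta> (\<Sum>a\<in>Basis. (u \<bullet> a) *\<^sub>R a) b = (\<Sum>a\<in>Basis. (u \<bullet> a) * ev \<beta> a b)"
    by (simp add: blinfun.sum_left blinfun.sum_right blinfun.scaleR_left blinfun.scaleR_right)
  then show "(\<Sum>a\<in>Basis. (u \<bullet> a) * ev \<beta> a b) = ev \<beta> u b" by (simp add: euclidean_representation)
  have "ev \<beta> a (\<Sum>b\<in>Basis. (u \<bullet> b) *\<^sub>R b) = (\<Sum>b\<in>Basis. (u \<bullet> b) * ev \<beta> a b)"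
    by (simp add: blinfun.sum_right blinfun.scaleR_right)
  then show "(\<Sum>b\<in>Basis. (u \<bullet> b) * ev \<beta> a b) = ev \<beta> a u" by (simp add: euclidean_representation)
qed

text \<open>The Euclidean basis drops out: summing the coordinates of \<open>u\<close> and
  \<open>v\<close> against the form reassembles them as its arguments. Products with
  \<open>f1\<close>, \<open>f2\<close>, \<open>f3\<close> can therefore be read off from values on
  the frame.\<close>

lemma inner2_wedge: "inner2 \<beta> (wedge u v) = (ev \<beta> u v - ev \<beta> v u) / 4"
proof -
  have "(\<Sum>a\<in>Basis. \<Sum>b\<in>Basis. ev \<beta> a b * ev (wedge u v) a b)
     = (\<Sum>a\<in>Basis. (u \<bullet> a) * (\<Sum>b\<in>Basis. (v \<bullet> b) * ev \<beta> a b))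
       - (\<Sum>a\<in>Basis. (v \<bullet> a) * (\<Sum>b\<in>Basis. (u \<bullet> b) * ev \<beta> a b))"
    by (simp add: ev_wedge sum_distrib_left sum_subtractf[symmetric] algebra_simps)
  also have "\<dots> = ev \<beta> u v - ev \<beta> v u" by (simp add: sum_Basis_ev)
  finally show ?thesis by (simp add: inner2_def)
qed

lemma inner2_diff_left: "inner2 (a - b) c = inner2 a c - inner2 b c"
  by (rule linear_diff[OF linear_inner2(1)])

lemma inner2_diff_right: "inner2 c (a - b) = inner2 c a - inner2 c b"
  by (rule linear_diff[OF linear_inner2(2)])

lemma inner2_zero [simp]: "inner2 0 c = 0" "inner2 c 0 = 0"
  using linear_0[OF linear_inner2(1)] linear_0[OF linear_inner2(2)] by auto

text \<open>Definiteness holds for arbitrary bilinear forms, not only skew ones; it gives uniqueness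
  of projections along \<open>inner2\<close>.\<close>

lemma inner2_eq_0:
  assumes "inner2 \<alpha> \<alpha> = 0" shows "\<alpha> = 0"
proof -
  have "\<forall>a\<in>Basis. (\<Sum>b\<in>Basis. ev \<alpha> a b * ev \<alpha> a b) = 0"
    using assms by (subst sum_nonneg_eq_0_iff[symmetric]) (auto simp: inner2_def sum_nonneg)
  then have "\<forall>a\<in>Basis. \<forall>b\<in>Basis. ev \<alpha> a b = 0"
    by (simp add: sum_nonneg_eq_0_iff)
  then have *: "ev \<alpha> u b = 0" if "b \<in> Basis" for u b
    using that sum_Basis_ev(1)[of u \<alpha> b] by simp
  have "ev \<alpha> u v = 0" for u v
    using sum_Basis_ev(2)[of v \<alpha> u] * by simp
  then show ?thesis by (intro form2_eqI) simp
qed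

text \<open>The product of two anti-self-dual forms, regarded as skew endomorphisms, is the cross product up
  to a symmetric part. It serves to describe the vertical volume form without choosing a frame.\<close>

definition comp2 :: "'v::euclidean_space form2 \<Rightarrow> 'v form2 \<Rightarrow> 'v form2" where
  "comp2 \<alpha> \<beta> = form2_of (\<lambda>y z. \<Sum>c\<in>Basis. ev \<alpha> y c * ev \<beta> c z)"

lemma ev_comp2: "ev (comp2 \<alpha> \<beta>) y z = (\<Sum>c\<in>Basis. ev \<alpha> y c * ev \<beta> c z)"
  unfolding comp2_def
  by (rule ev_form2_of; rule linearI)
    (simp_all add: ev_simps algebra_simps sum.distrib sum_distrib_left)

lemma comp2_simps:
  "comp2 (a + b) c = comp2 a c + comp2 b c" "comp2 c (a + b) = comp2 c a + comp2 c b"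
  "comp2 (a - b) c = comp2 a c - comp2 b c" "comp2 c (a - b) = comp2 c a - comp2 c b"
  "comp2 (r *\<^sub>R a) c = r *\<^sub>R comp2 a c" "comp2 c (r *\<^sub>R a) = r *\<^sub>R comp2 c a"
  by (rule form2_eqI; simp add: ev_comp2 ev_simps algebra_simps sum.distrib sum_distrib_left sum_subtractf)+

lemma comp2_wedge: "ev (comp2 (wedge u v) \<beta>) y z = (u \<bullet> y) * ev \<beta> v z - (v \<bullet> y) * ev \<beta> u z"
proof -
  have "ev (comp2 (wedge u v) \<beta>) y z
     = (u \<bullet> y) * (\<Sum>c\<in>Basis. (v \<bullet> c) * ev \<beta> c z) - (v \<bullet> y) * (\<Sum>c\<in>Basis. (u \<bullet> c) * ev \<beta> c z)"
    by (simp add: ev_comp2 ev_wedge sum_distrib_left sum_subtractf[symmetric] algebra_simps)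
  then show ?thesis by (simp add: sum_Basis_ev)
qed

definition onf :: "'v::euclidean_space^4 \<Rightarrow> bool" where
  "onf e \<longleftrightarrow> (\<forall>i j. e$i \<bullet> e$j = (if i = j then 1 else 0))"

lemma onf_simps:
  assumes "onf e"
  shows "e$1 \<bullet> e$1 = 1" "e$2 \<bullet> e$2 = 1" "e$3 \<bullet> e$3 = 1" "e$4 \<bullet> e$4 = 1"
    "e$1 \<bullet> e$2 = 0" "e$1 \<bullet> e$3 = 0" "e$1 \<bullet> e$4 = 0" "e$2 \<bullet> e$1 = 0" "e$2 \<bullet> e$3 = 0" "e$2 \<bullet> e$4 = 0"
    "e$3 \<bullet> e$1 = 0" "e$3 \<bullet> e$2 = 0" "e$3 \<bullet> e$4 = 0" "e$4 \<bullet> e$1 = 0" "e$4 \<bullet> e$2 = 0" "e$4 \<bullet> e$3 = 0"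
  using assms by (simp_all add: onf_def)

lemma onfI:
  assumes "e$1 \<bullet> e$1 = 1" "e$2 \<bullet> e$2 = 1" "e$3 \<bullet> e$3 = 1" "e$4 \<bullet> e$4 = 1"
    "e$1 \<bullet> e$2 = 0" "e$1 \<bullet> e$3 = 0" "e$1 \<bullet> e$4 = 0" "e$2 \<bullet> e$3 = 0" "e$2 \<bullet> e$4 = 0" "e$3 \<bullet> e$4 = 0"
  shows "onf e"
  using assms by (simp add: onf_def forall_4 inner_commute)

lemma ev_f:
  "ev (f1 e) y z = (e$1 \<bullet> y) * (e$2 \<bullet> z) - (e$1 \<bullet> z) * (e$2 \<bullet> y) - ((e$3 \<bullet> y) * (e$4 \<bullet> z) - (e$3 \<bullet> z) * (e$4 \<bullet> y))"
  "ev (f2 e) y z = (e$1 \<bullet> y) * (e$3 \<bullet> z) - (e$1 \<bullet> z) * (e$3 \<bullet> y) - ((e$4 \<bullet> y) * (e$2 \<bullet> z) - (e$4 \<bullet> z) * (e$2 \<bullet> y))"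
  "ev (f3 e) y z = (e$1 \<bullet> y) * (e$4 \<bullet> z) - (e$1 \<bullet> z) * (e$4 \<bullet> y) - ((e$2 \<bullet> y) * (e$3 \<bullet> z) - (e$2 \<bullet> z) * (e$3 \<bullet> y))"
  by (simp_all add: f1_def f2_def f3_def ev_simps ev_wedge)

lemma inner2_f:
  "inner2 \<beta> (f1 e) = (ev \<beta> (e$1) (e$2) - ev \<beta> (e$2) (e$1) - ev \<beta> (e$3) (e$4) + ev \<beta> (e$4) (e$3)) / 4"
  "inner2 \<beta> (f2 e) = (ev \<beta> (e$1) (e$3) - ev \<beta> (e$3) (e$1) - ev \<beta> (e$4) (e$2) + ev \<beta> (e$2) (e$4)) / 4"
  "inner2 \<beta> (f3 e) = (ev \<beta> (e$1) (e$4) - ev \<beta> (e$4) (e$1) - ev \<beta> (e$2) (e$3) + ev \<beta> (e$3) (e$2)) / 4"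
  by (simp_all add: f1_def f2_def f3_def inner2_diff_right inner2_wedge add_divide_distrib diff_divide_distrib)

lemma f_orthonormal:
  assumes "onf e"
  shows "inner2 (f1 e) (f1 e) = 1" "inner2 (f2 e) (f2 e) = 1" "inner2 (f3 e) (f3 e) = 1"
    "inner2 (f1 e) (f2 e) = 0" "inner2 (f1 e) (f3 e) = 0" "inner2 (f2 e) (f1 e) = 0"
    "inner2 (f2 e) (f3 e) = 0" "inner2 (f3 e) (f1 e) = 0" "inner2 (f3 e) (f2 e) = 0"
  by (simp_all add: inner2_f ev_f onf_simps[OF assms])

text \<open>The quaternion relations of \<open>f1\<close>, \<open>f2\<close>, \<open>f3\<close>,
  regarded as skew endomorphisms.\<close>

lemma comp2_f:
  assumes e: "onf e"
  shows "comp2 (f1 e) (f2 e) = f3 e" "comp2 (f2 e) (f3 e) = f1 e" "comp2 (f3 e) (f1 e) = f2 e"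
    "comp2 (f2 e) (f1 e) = - f3 e" "comp2 (f3 e) (f2 e) = - f1 e" "comp2 (f1 e) (f3 e) = - f2 e"
  by (rule form2_eqI;
      simp add: f1_def[where e=e] f2_def[where e=e] f3_def[where e=e] comp2_simps ev_simps comp2_wedge;
      simp add: ev_wedge onf_simps[OF e] algebra_simps inner_commute)+

text \<open>All three squares equal minus the inner product on the span of the frame; being
  symmetric, this bilinear form is orthogonal to two-forms.\<close>

lemma comp2_f_self:
  assumes e: "onf e"
  shows "comp2 (f1 e) (f1 e) = comp2 (f2 e) (f2 e)" "comp2 (f3 e) (f3 e) = comp2 (f2 e) (f2 e)"
    "inner2 (comp2 (f2 e) (f2 e)) (f1 e) = 0" "inner2 (comp2 (f2 e) (f2 e)) (f2 e) = 0"
    "inner2 (comp2 (f2 e) (f2 e)) (f3 e) = 0"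
proof -
  show "comp2 (f1 e) (f1 e) = comp2 (f2 e) (f2 e)" "comp2 (f3 e) (f3 e) = comp2 (f2 e) (f2 e)"
    by (rule form2_eqI;
      simp add: f1_def[where e=e] f2_def[where e=e] f3_def[where e=e] comp2_simps ev_simps comp2_wedge;
      simp add: ev_wedge onf_simps[OF e] algebra_simps inner_commute)+
  have "ev (comp2 (f2 e) (f2 e)) y z = ev (comp2 (f2 e) (f2 e)) z y" for y z
    by (simp add: f2_def[where e=e] comp2_simps ev_simps comp2_wedge;
      simp add: ev_wedge onf_simps[OF e] algebra_simps inner_commute)
  then show "inner2 (comp2 (f2 e) (f2 e)) (f1 e) = 0" "inner2 (comp2 (f2 e) (f2 e)) (f2 e) = 0"
    "inner2 (comp2 (f2 e) (f2 e)) (f3 e) = 0"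
    by (simp_all add: inner2_f)
qed

definition asd_coords :: "'v::euclidean_space^4 \<Rightarrow> 'v form2 \<Rightarrow> real^3" where
  "asd_coords e \<tau> = vector [inner2 \<tau> (f1 e), inner2 \<tau> (f2 e), inner2 \<tau> (f3 e)]"

lemma linear_asd_coords: "linear (asd_coords e)"
  by (rule linearI) (simp_all add: asd_coords_def vec_eq_iff forall_3 inner2_add_left inner2_scale_left)

lemma vol_V_eq: "vol_V X x \<alpha> \<beta> \<gamma> = det3 (asd_coords (some_oframe X x) \<alpha>) (asd_coords (some_oframe X x) \<beta>) (asd_coords (some_oframe X x) \<gamma>)"
  by (simp add: vol_V_def asd_coords_def det3_def Let_def)

text \<open>By the quaternion relations both sides expand to the same triple product. The right side
  mentions no frame, so the left side cannot depend on \<open>e\<close>.\<close>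

lemma det3_asd_coords_eq_comp2:
  assumes e: "onf e"
    and a: "\<alpha> = a1 *\<^sub>R f1 e + a2 *\<^sub>R f2 e + a3 *\<^sub>R f3 e"
    and b: "\<beta> = b1 *\<^sub>R f1 e + b2 *\<^sub>R f2 e + b3 *\<^sub>R f3 e"
    and c: "\<gamma> = c1 *\<^sub>R f1 e + c2 *\<^sub>R f2 e + c3 *\<^sub>R f3 e"
  shows "det3 (asd_coords e \<alpha>) (asd_coords e \<beta>) (asd_coords e \<gamma>) = inner2 (comp2 \<alpha> \<beta>) \<gamma>"
proof -
  note s = inner2_add_left inner2_add_right inner2_diff_left inner2_scale_left inner2_scale_right f_orthonormal[OF e]
  have l: "det3 (asd_coords e \<alpha>) (asd_coords e \<beta>) (asd_coords e \<gamma>)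
      = a1*b2*c3 + a2*b3*c1 + a3*b1*c2 - a1*b3*c2 - a2*b1*c3 - a3*b2*c1"
    by (simp add: det3_def det_3 asd_coords_def a b c s)
  have m: "inner2 (- f1 e) t = - inner2 (f1 e) t" "inner2 (- f2 e) t = - inner2 (f2 e) t"
    "inner2 (- f3 e) t = - inner2 (f3 e) t" for t
    using inner2_scale_left[of "-1"] by auto
  have "inner2 (comp2 \<alpha> \<beta>) \<gamma> = a1*b2*c3 + a2*b3*c1 + a3*b1*c2 - a1*b3*c2 - a2*b1*c3 - a3*b2*c1"
    by (simp add: a b c comp2_simps comp2_f[OF e] comp2_f_self[OF e] s m) (simp add: algebra_simps)
  with l show ?thesis by simp
qed

section \<open>Frames of the ambient manifold\<close>

text \<open>The difference of two candidates lies in \<open>S\<close> and is orthogonal to itself.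
  The properties of \<open>ip\<close> are hypotheses because projections are taken both for the
  Euclidean product and for \<open>inner2\<close>.\<close>

lemma oproj_eqI:
  assumes "y \<in> S" "\<And>z. z \<in> S \<Longrightarrow> ip (w - y) z = 0"
    and "\<And>a b z. ip (a - b) z = ip a z - ip b z" "\<And>z. z \<in> S \<Longrightarrow> ip z z = (0::real) \<Longrightarrow> z = 0"
    and "\<And>a b. a \<in> S \<Longrightarrow> b \<in> S \<Longrightarrow> a - b \<in> S"
  shows "oproj ip S w = y"
  unfolding oproj_def
proof (rule the_equality)
  fix y' assume y': "y' \<in> S \<and> (\<forall>z\<in>S. ip (w - y') z = 0)"
  let ?d = "y' - y"
  have "?d \<in> S" using y' assms(1,5) by blast
  moreover from this have "ip ?d ?d = 0"
    using assms(2)[of ?d] y' by (simp add: assms(3))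
  ultimately show "y' = y" using assms(4)[of ?d] by simp
qed (use assms in auto)

lemma onf_expand:
  assumes e: "onf e" and w: "w \<in> span (range (($) e))"
  shows "w = (w \<bullet> e$1) *\<^sub>R e$1 + (w \<bullet> e$2) *\<^sub>R e$2 + (w \<bullet> e$3) *\<^sub>R e$3 + (w \<bullet> e$4) *\<^sub>R e$4"
proof (rule linear_eq_on_span[OF linear_id[unfolded id_def] _ _ w])
  show "linear (\<lambda>w. (w \<bullet> e$1) *\<^sub>R e$1 + (w \<bullet> e$2) *\<^sub>R e$2 + (w \<bullet> e$3) *\<^sub>R e$3 + (w \<bullet> e$4) *\<^sub>R e$4)"
    by (rule linearI) (simp_all add: inner_simps algebra_simps)
  fix v assume "v \<in> range (($) e)"
  then obtain i where "v = e $ i" by auto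
  then show "v = (v \<bullet> e$1) *\<^sub>R e$1 + (v \<bullet> e$2) *\<^sub>R e$2 + (v \<bullet> e$3) *\<^sub>R e$3 + (v \<bullet> e$4) *\<^sub>R e$4"
    using exhaust_4[of i] by (auto simp: onf_simps[OF e])
qed

lemma onf_sums_in_span: "a *\<^sub>R e$1 + b *\<^sub>R e$2 + c *\<^sub>R e$3 + d *\<^sub>R e$4 \<in> span (range (($) e))"
  by (intro span_add span_scale span_base) auto

lemma onf_independent:
  assumes "onf e" shows "independent (range (($) e))" "card (range (($) e)) = 4"
proof -
  have inj: "inj (($) e)"
  proof (rule injI)
    fix i j assume "e $ i = e $ j"
    then have "e $ i \<bullet> e $ j = 1" using assms by (simp add: onf_def)
    then show "i = j" using assms by (auto simp: onf_def split: if_splits)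
  qed
  then show "card (range (($) e)) = 4" by (simp add: card_image)
  show "independent (range (($) e))"
  proof (rule pairwise_orthogonal_independent)
    show "pairwise orthogonal (range (($) e))"
      using assms by (auto simp: pairwise_def orthogonal_def onf_def)
    show "0 \<notin> range (($) e)"
    proof
      assume "0 \<in> range (($) e)"
      then obtain i where "e $ i = 0" by auto
      then have "e $ i \<bullet> e $ i = 0" by simp
      moreover have "e $ i \<bullet> e $ i = 1" using assms by (simp add: onf_def)
      ultimately show False by simp
    qed
  qed
qed

lemma range_nth_4: "range (($) e) = {e$1, e$2, e$3, e$4}" for e :: "'a^4"
  by (auto simp: UNIV_4)

lemma unit_orthogonal_ex:
  fixes V :: "'v::euclidean_space set"
  assumes V: "subspace V" and S: "S \<subseteq> V" "finite S" "card S < dim V"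
  shows "\<exists>n\<in>V. n \<bullet> n = 1 \<and> (\<forall>s\<in>S. n \<bullet> s = 0)"
proof -
  have "dim S < dim V" using dim_le_card'[OF S(2)] S(3) by simp
  then have "span S \<subset> span V"
    using S(1) by (metis dim_span less_irrefl psubsetI span_mono)
  then obtain n where n: "n \<noteq> 0" "n \<in> span V" "\<And>y. y \<in> span S \<Longrightarrow> orthogonal n y"
    using orthogonal_to_subspace_exists_gen by metis
  have "n \<in> V" using n(2) span_eq_iff[THEN iffD2, OF V] by simp
  then have "n /\<^sub>R norm n \<in> V" by (simp add: subspace_scale V)
  moreover have "(n /\<^sub>R norm n) \<bullet> (n /\<^sub>R norm n) = 1"
    using n(1) by (simp add: dot_square_norm power2_eq_square)
  moreover have "\<forall>s\<in>S. (n /\<^sub>R norm n) \<bullet> s = 0"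
    using n(3) by (auto simp: orthogonal_def span_base)
  ultimately show ?thesis by blast
qed

text \<open>The properties through which the four-manifold enters: oriented frames spanning the
  tangent spaces, alternation of the volume form on tangent vectors, and smooth dependence of
  projection and volume form on the point. Smoothness is asked along maps from the plane, since it
  is applied in charts of \<open>L\<close>.\<close>

locale ambient =
  fixes X :: "'v::euclidean_space riem4"
  assumes frame_ex: "x \<in> points X \<Longrightarrow> \<exists>e. oframe X x e \<and> tangent X x = span (range (($) e))"
    and vol_alt: "x \<in> points X \<Longrightarrow> alt4 (tangent X x) (volform X x)"
    and smooth_tproj: "open S \<Longrightarrow> smooth_on S f \<Longrightarrow> f ` S \<subseteq> points X \<Longrightarrow> smooth_on S w
      \<Longrightarrow> smooth_on (S :: (real^2) set) (\<lambda>y. tproj X (f y) (w y))"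
    and smooth_vol: "open S \<Longrightarrow> smooth_on S f \<Longrightarrow> f ` S \<subseteq> points X \<Longrightarrow> smooth_on S a \<Longrightarrow> smooth_on S b
      \<Longrightarrow> smooth_on S c \<Longrightarrow> smooth_on S d \<Longrightarrow> smooth_on (S :: (real^2) set) (\<lambda>y. volform X (f y) (a y) (b y) (c y) (d y))"
begin

lemma oframe_onf: "oframe X x e \<Longrightarrow> onf e"
  by (simp add: oframe_def onf_def)

lemma oframe_vol: "oframe X x e \<Longrightarrow> volform X x (e$1) (e$2) (e$3) (e$4) = 1"
  by (simp add: oframe_def)

lemma oframe_tangent: "oframe X x e \<Longrightarrow> e $ i \<in> tangent X x"
  by (simp add: oframe_def)

text \<open>A dimension count: four orthonormal vectors in a space of dimension four.\<close>

lemma onf_span_tangent: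
  assumes x: "x \<in> points X" and e: "onf e" and eT: "\<And>i. e $ i \<in> tangent X x"
  shows "tangent X x = span (range (($) e))"
proof -
  obtain e0 where e0: "oframe X x e0" "tangent X x = span (range (($) e0))" using frame_ex[OF x] by auto
  have 1: "range (($) e) \<subseteq> tangent X x" using eT by auto
  have "dim (tangent X x) = 4"
    using onf_independent[OF oframe_onf[OF e0(1)]] by (simp add: e0(2) dim_eq_card_independent)
  then have "tangent X x \<subseteq> span (range (($) e))"
    using onf_independent[OF e] 1 by (intro card_ge_dim_independent) auto
  moreover have "span (range (($) e)) \<subseteq> tangent X x"
    using 1 by (metis e0(2) span_minimal subspace_span)
  ultimately show ?thesis by auto
qed

lemma oframe_span: "x \<in> points X \<Longrightarrow> oframe X x e \<Longrightarrow> tangent X x = span (range (($) e))"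
  by (rule onf_span_tangent) (auto intro: oframe_onf oframe_tangent)

lemma subspace_tangent: "x \<in> points X \<Longrightarrow> subspace (tangent X x)"
  using frame_ex subspace_span by metis

lemma oframe_expand:
  assumes "x \<in> points X" "oframe X x e" "w \<in> tangent X x"
  shows "w = (w \<bullet> e$1) *\<^sub>R e$1 + (w \<bullet> e$2) *\<^sub>R e$2 + (w \<bullet> e$3) *\<^sub>R e$3 + (w \<bullet> e$4) *\<^sub>R e$4"
  using assms onf_expand[OF oframe_onf] oframe_span by blast

lemma oframe_combination_in_tangent:
  assumes "x \<in> points X" "oframe X x e"
  shows "a *\<^sub>R e$1 + b *\<^sub>R e$2 + c *\<^sub>R e$3 + d *\<^sub>R e$4 \<in> tangent X x"
  using onf_sums_in_span oframe_span[OF assms] by metis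

lemma tproj_frame:
  assumes x: "x \<in> points X" and e: "oframe X x e"
  shows "tproj X x w = (w \<bullet> e$1) *\<^sub>R e$1 + (w \<bullet> e$2) *\<^sub>R e$2 + (w \<bullet> e$3) *\<^sub>R e$3 + (w \<bullet> e$4) *\<^sub>R e$4"
proof (rule oproj_eqI)
  note s = onf_simps[OF oframe_onf[OF e]]
  let ?y = "(w \<bullet> e$1) *\<^sub>R e$1 + (w \<bullet> e$2) *\<^sub>R e$2 + (w \<bullet> e$3) *\<^sub>R e$3 + (w \<bullet> e$4) *\<^sub>R e$4"
  show "?y \<in> tangent X x" by (rule oframe_combination_in_tangent[OF x e])
  fix z assume z: "z \<in> tangent X x"
  obtain a b c d where "z = a *\<^sub>R e$1 + b *\<^sub>R e$2 + c *\<^sub>R e$3 + d *\<^sub>R e$4"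
    using oframe_expand[OF x e z] by blast
  then show "(w - ?y) \<bullet> z = 0" by (simp add: inner_simps s inner_commute[of w] algebra_simps)
qed (auto simp: inner_diff_left subspace_diff[OF subspace_tangent[OF x]])

lemma tproj_in_tangent: "x \<in> points X \<Longrightarrow> tproj X x w \<in> tangent X x"
  using frame_ex[of x] by (auto simp: tproj_frame intro: oframe_combination_in_tangent)

lemma tproj_inner:
  assumes x: "x \<in> points X" and z: "z \<in> tangent X x"
  shows "z \<bullet> tproj X x w = z \<bullet> w" "tproj X x w \<bullet> z = w \<bullet> z"
proof -
  obtain e where e: "oframe X x e" using frame_ex[OF x] by auto
  note s = onf_simps[OF oframe_onf[OF e]]
  obtain a b c d where "z = a *\<^sub>R e$1 + b *\<^sub>R e$2 + c *\<^sub>R e$3 + d *\<^sub>R e$4"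
    using oframe_expand[OF x e z] by blast
  then show "z \<bullet> tproj X x w = z \<bullet> w"
    by (simp add: tproj_frame[OF x e] inner_simps s inner_commute[of w] algebra_simps)
  then show "tproj X x w \<bullet> z = w \<bullet> z" by (simp add: inner_commute)
qed

lemma tproj_tangent: "x \<in> points X \<Longrightarrow> z \<in> tangent X x \<Longrightarrow> tproj X x z = z"
  using frame_ex[of x] tproj_frame oframe_expand by (metis (no_types))

lemma linear_tproj: assumes "x \<in> points X" shows "linear (tproj X x)"
proof -
  obtain e where "oframe X x e" using frame_ex[OF assms] by auto
  then have "tproj X x = (\<lambda>w. (w \<bullet> e$1) *\<^sub>R e$1 + (w \<bullet> e$2) *\<^sub>R e$2 + (w \<bullet> e$3) *\<^sub>R e$3 + (w \<bullet> e$4) *\<^sub>R e$4)"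
    using tproj_frame[OF assms] by auto
  then show ?thesis by (auto intro!: linearI simp: inner_simps algebra_simps)
qed

lemma ev_restrict2:
  assumes x: "x \<in> points X"
  shows "ev (restrict2 X x \<beta>) a b = ev \<beta> (tproj X x a) (tproj X x b)"
  unfolding restrict2_def
  by (rule ev_form2_of; rule linearI)
    (simp_all add: linear_add[OF linear_tproj[OF x]] linear_cmul[OF linear_tproj[OF x]] ev_simps)

lemma restrict2_linear:
  assumes x: "x \<in> points X"
  shows "restrict2 X x (\<alpha> + \<beta>) = restrict2 X x \<alpha> + restrict2 X x \<beta>"
    "restrict2 X x (r *\<^sub>R \<alpha>) = r *\<^sub>R restrict2 X x \<alpha>"
    "restrict2 X x (\<alpha> - \<beta>) = restrict2 X x \<alpha> - restrict2 X x \<beta>"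
  by (rule form2_eqI; simp add: ev_restrict2[OF x] ev_simps)+

text \<open>The tangential projection is self-adjoint, so it passes from the arguments to the
  vectors defining the wedge product.\<close>

lemma restrict2_wedge:
  assumes x: "x \<in> points X"
  shows "restrict2 X x (wedge a b) = wedge (tproj X x a) (tproj X x b)"
proof (rule form2_eqI)
  have sym: "a \<bullet> tproj X x y = tproj X x a \<bullet> y" for a y
    using tproj_inner[OF x tproj_in_tangent[OF x]] by metis
  show "ev (restrict2 X x (wedge a b)) y z = ev (wedge (tproj X x a) (tproj X x b)) y z" for y z
    by (simp add: ev_restrict2[OF x] ev_wedge sym)
qed

lemma restrict2_forms2: "x \<in> points X \<Longrightarrow> \<omega> \<in> forms2 X x \<Longrightarrow> restrict2 X x \<omega> = \<omega>"
proof (rule form2_eqI)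
  fix a b assume "x \<in> points X" "\<omega> \<in> forms2 X x"
  then show "ev (restrict2 X x \<omega>) a b = ev \<omega> a b"
    unfolding forms2_def mem_Collect_eq by (subst ev_restrict2) metis+
qed

text \<open>The three forms are built from tangent vectors, so pairing with them ignores the
  projection. Later computations may thus use the ambient derivative of a form in place of its
  covariant derivative.\<close>

lemma inner2_restrict2:
  assumes x: "x \<in> points X" and e: "\<And>i. e $ i \<in> tangent X x"
  shows "inner2 (restrict2 X x \<beta>) (f1 e) = inner2 \<beta> (f1 e)"
    "inner2 (restrict2 X x \<beta>) (f2 e) = inner2 \<beta> (f2 e)"
    "inner2 (restrict2 X x \<beta>) (f3 e) = inner2 \<beta> (f3 e)"
  by (simp_all add: inner2_f ev_restrict2[OF x] tproj_tangent[OF x e])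

text \<open>By alternation the components of \<open>y\<close> and \<open>z\<close> along
  \<open>e$1\<close> and \<open>e$2\<close> contribute nothing, which leaves the area form of the
  plane of \<open>e$3\<close> and \<open>e$4\<close>. This formula serves both the Hodge star and
  the comparison of normal frames.\<close>

lemma vol_12:
  assumes x: "x \<in> points X" and e: "oframe X x e" and y: "y \<in> tangent X x" and z: "z \<in> tangent X x"
  shows "volform X x (e$1) (e$2) y z = (y \<bullet> e$3) * (z \<bullet> e$4) - (y \<bullet> e$4) * (z \<bullet> e$3)"
proof -
  note s = onf_simps[OF oframe_onf[OF e]]
  note l = alt4_linear[OF vol_alt[OF x]] and t = oframe_tangent[OF e]
  obtain a b c d where z': "z = a *\<^sub>R e$1 + b *\<^sub>R e$2 + c *\<^sub>R e$3 + d *\<^sub>R e$4"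
    using oframe_expand[OF x e z] by blast
  obtain a' b' c' d' where y': "y = a' *\<^sub>R e$1 + b' *\<^sub>R e$2 + c' *\<^sub>R e$3 + d' *\<^sub>R e$4"
    using oframe_expand[OF x e y] by blast
  define V where "V = volform X x (e$1) (e$2)"
  have V3: "V (p + q) w = V p w + V q w" "V (r *\<^sub>R p) w = r * V p w" for p q w r
    using linear_add[OF l(3)] linear_cmul[OF l(3)] by (simp_all add: V_def)
  have V4: "V w (p + q) = V w p + V w q" "V w (r *\<^sub>R p) = r * V w p" for p q w r
    using linear_add[OF l(4)] linear_cmul[OF l(4)] by (simp_all add: V_def)
  have V0: "V (e$1) w = 0" "V (e$2) w = 0" "V w (e$1) = 0" "V w (e$2) = 0" "V w w = 0"
    if "w \<in> tangent X x" for w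
    using alt4_zero[OF vol_alt[OF x]] t that by (simp_all add: V_def)
  have V34: "V (e$3) (e$4) = 1" "V (e$4) (e$3) = -1"
    using alt4_swap(3)[OF vol_alt[OF x] t[of 1] t[of 2] t[of 3] t[of 4]] oframe_vol[OF e] by (simp_all add: V_def)
  have "V y z = c' * d - d' * c"
    unfolding y' z' by (simp only: V3 V4) (simp add: V0 V34 t algebra_simps)
  moreover have "y \<bullet> e$3 = c'" "y \<bullet> e$4 = d'" "z \<bullet> e$3 = c" "z \<bullet> e$4 = d"
    by (simp_all add: y' z' inner_add_left s)
  ultimately show ?thesis by (simp add: V_def)
qed

lemma vol_123:
  assumes x: "x \<in> points X" and e: "oframe X x e" and z: "z \<in> tangent X x"
  shows "volform X x (e$1) (e$2) (e$3) z = z \<bullet> e$4"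
  by (simp add: vol_12[OF x e oframe_tangent[OF e] z] onf_simps[OF oframe_onf[OF e]])

text \<open>A 3-cycle is even, so the orientation is kept. The same cycle takes \<open>f1\<close> to
  \<open>f2\<close> and \<open>f2\<close> to \<open>f3\<close>, which reduces statements about all
  three forms to \<open>f1\<close>.\<close>

lemma oframe_cycle:
  assumes x: "x \<in> points X" and e: "oframe X x e"
  shows "oframe X x (vector [e$1, e$3, e$4, e$2])"
proof -
  note t = oframe_tangent[OF e]
  have "volform X x (e$1) (e$3) (e$4) (e$2) = 1"
    using alt4_swap(3)[OF vol_alt[OF x] t[of 1] t[of 3] t[of 2] t[of 4]]
      alt4_swap(2)[OF vol_alt[OF x] t[of 1] t[of 2] t[of 3] t[of 4]] oframe_vol[OF e] by simp
  then show ?thesis using e by (simp add: oframe_def forall_4 inner_commute)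
qed

lemma vol_pair_swap:
  assumes x: "x \<in> points X" and t: "a \<in> tangent X x" "b \<in> tangent X x" "c \<in> tangent X x" "d \<in> tangent X x"
  shows "volform X x a b c d = volform X x c d a b"
proof -
  note s = alt4_swap[OF vol_alt[OF x]]
  have "volform X x a b c d = - volform X x a c b d" using s(2)[OF t(1,3,2,4)] by simp
  also have "\<dots> = volform X x a c d b" using s(3)[OF t(1,3,2,4)] by simp
  also have "\<dots> = - volform X x c a d b" using s(1)[OF t(1,3,4,2)] by simp
  also have "\<dots> = volform X x c d a b" using s(2)[OF t(3,1,4,2)] by simp
  finally show ?thesis .
qed

text \<open>The Hodge star is frame independent: both sides evaluate the volume form on two vectors of one
  frame and two vectors of the other.\<close>

lemma f1_asd:
  assumes x: "x \<in> points X" and e: "oframe X x e"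
  shows "f1 e \<in> asd X x"
proof -
  have "ev (f1 e) a b = ev (f1 e) (tproj X x a) (tproj X x b)" for a b
    by (simp add: ev_f tproj_inner(1)[OF x oframe_tangent[OF e]])
  moreover have "ev (f1 e) a b = - ev (f1 e) b a" for a b by (simp add: ev_f)
  moreover have "ev (f1 e) (e'$1) (e'$2) = - ev (f1 e) (e'$3) (e'$4)" if e': "oframe X x e'" for e'
  proof -
    note t = oframe_tangent[OF e] and t' = oframe_tangent[OF e']
    have "volform X x (e$1) (e$2) (e'$3) (e'$4) = volform X x (e'$3) (e'$4) (e$1) (e$2)"
      by (rule vol_pair_swap[OF x t t t' t'])
    also have "oframe X x (vector [e'$3, e'$4, e'$1, e'$2])"
      using e' vol_pair_swap[OF x t' t' t' t', of 1 2 3 4] by (simp add: oframe_def forall_4 inner_commute)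
    from vol_12[OF x this t t] have "volform X x (e'$3) (e'$4) (e$1) (e$2)
      = (e$1 \<bullet> e'$1) * (e$2 \<bullet> e'$2) - (e$1 \<bullet> e'$2) * (e$2 \<bullet> e'$1)" by simp
    finally have 1: "(e'$3 \<bullet> e$3) * (e'$4 \<bullet> e$4) - (e'$3 \<bullet> e$4) * (e'$4 \<bullet> e$3)
       = (e$1 \<bullet> e'$1) * (e$2 \<bullet> e'$2) - (e$1 \<bullet> e'$2) * (e$2 \<bullet> e'$1)"
      by (simp add: vol_12[OF x e t' t'])
    have "volform X x (e$1) (e$2) (e'$1) (e'$2) = volform X x (e'$1) (e'$2) (e$1) (e$2)"
      by (rule vol_pair_swap[OF x t t t' t'])
    then have 2: "(e'$1 \<bullet> e$3) * (e'$2 \<bullet> e$4) - (e'$1 \<bullet> e$4) * (e'$2 \<bullet> e$3)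
       = (e$1 \<bullet> e'$3) * (e$2 \<bullet> e'$4) - (e$1 \<bullet> e'$4) * (e$2 \<bullet> e'$3)"
      by (simp add: vol_12[OF x e t' t'] vol_12[OF x e' t t])
    show ?thesis
      using 1 2 by (simp add: ev_f inner_commute) (simp add: inner_commute algebra_simps)
  qed
  ultimately show ?thesis unfolding asd_def forms2_def by blast
qed

section \<open>Frame expansion of anti-self-dual forms\<close>

lemma f2_eq_f1: "f2 e = f1 (vector [e$1, e$3, e$4, e$2])"
  by (simp add: f1_def f2_def)

lemma f3_eq_f1: "f3 e = f1 (vector [e$1, e$4, e$2, e$3])"
  by (simp add: f1_def f3_def)

lemma f_asd:
  assumes x: "x \<in> points X" and e: "oframe X x e"
  shows "f1 e \<in> asd X x" "f2 e \<in> asd X x" "f3 e \<in> asd X x"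
proof -
  show "f1 e \<in> asd X x" by (rule f1_asd[OF assms])
  show "f2 e \<in> asd X x"
    unfolding f2_eq_f1 by (rule f1_asd[OF x oframe_cycle[OF x e]])
  have "oframe X x (vector [e$1, e$4, e$2, e$3])"
    using oframe_cycle[OF x oframe_cycle[OF x e]] by simp
  then show "f3 e \<in> asd X x" unfolding f3_eq_f1 by (rule f1_asd[OF x])
qed

lemma asdI:
  assumes "\<And>a b. ev \<alpha> a b = - ev \<alpha> b a" "\<And>a b. ev \<alpha> a b = ev \<alpha> (tproj X x a) (tproj X x b)"
    and "\<And>e. oframe X x e \<Longrightarrow> ev \<alpha> (e$1) (e$2) = - ev \<alpha> (e$3) (e$4)"
  shows "\<alpha> \<in> asd X x"
  unfolding asd_def forms2_def mem_Collect_eq by (intro conjI allI impI assms)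

lemma asdD:
  assumes "\<alpha> \<in> asd X x"
  shows "ev \<alpha> a b = - ev \<alpha> b a" "ev \<alpha> a b = ev \<alpha> (tproj X x a) (tproj X x b)"
    and "oframe X x e \<Longrightarrow> ev \<alpha> (e$1) (e$2) = - ev \<alpha> (e$3) (e$4)"
  using assms unfolding asd_def forms2_def mem_Collect_eq by (blast+)

lemma subspace_asd: "subspace (asd X x)"
  unfolding subspace_def
proof (intro conjI ballI allI)
  show "0 \<in> asd X x" by (rule asdI) (simp_all add: ev_simps)
  fix \<alpha> \<beta> and r :: real
  assume a: "\<alpha> \<in> asd X x"
  show "r *\<^sub>R \<alpha> \<in> asd X x"
  proof (rule asdI)
    show "ev (r *\<^sub>R \<alpha>) b c = - ev (r *\<^sub>R \<alpha>) c b" for b c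
      using asdD(1)[OF a, of b c] by (simp add: ev_simps)
    show "ev (r *\<^sub>R \<alpha>) b c = ev (r *\<^sub>R \<alpha>) (tproj X x b) (tproj X x c)" for b c
      by (simp add: ev_simps) (use asdD(2)[OF a, of b c] in simp)
    show "ev (r *\<^sub>R \<alpha>) (e$1) (e$2) = - ev (r *\<^sub>R \<alpha>) (e$3) (e$4)" if "oframe X x e" for e
      using asdD(3)[OF a that] by (simp add: ev_simps)
  qed
  assume b: "\<beta> \<in> asd X x"
  show "\<alpha> + \<beta> \<in> asd X x"
  proof (rule asdI)
    show "ev (\<alpha> + \<beta>) c d = - ev (\<alpha> + \<beta>) d c" for c d
      using asdD(1)[OF a, of c d] asdD(1)[OF b, of c d] by (simp add: ev_simps)
    show "ev (\<alpha> + \<beta>) c d = ev (\<alpha> + \<beta>) (tproj X x c) (tproj X x d)" for c d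
      by (simp add: ev_simps) (use asdD(2)[OF a, of c d] asdD(2)[OF b, of c d] in linarith)
    show "ev (\<alpha> + \<beta>) (e$1) (e$2) = - ev (\<alpha> + \<beta>) (e$3) (e$4)" if "oframe X x e" for e
      using asdD(3)[OF a that] asdD(3)[OF b that] by (simp add: ev_simps)
  qed
qed

text \<open>The defining condition, applied to the frame and to its two cyclic rotations, gives
  three relations between complementary coefficients.\<close>

lemma asd_ev:
  assumes x: "x \<in> points X" and e: "oframe X x e" and a: "\<alpha> \<in> asd X x"
  shows "ev \<alpha> (e$1) (e$2) = inner2 \<alpha> (f1 e)" "ev \<alpha> (e$3) (e$4) = - inner2 \<alpha> (f1 e)"
    "ev \<alpha> (e$1) (e$3) = inner2 \<alpha> (f2 e)" "ev \<alpha> (e$4) (e$2) = - inner2 \<alpha> (f2 e)"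
    "ev \<alpha> (e$1) (e$4) = inner2 \<alpha> (f3 e)" "ev \<alpha> (e$2) (e$3) = - inner2 \<alpha> (f3 e)"
proof -
  have c2: "oframe X x (vector [e$1, e$4, e$2, e$3])"
    using oframe_cycle[OF x oframe_cycle[OF x e]] by simp
  have 1: "ev \<alpha> (e$1) (e$2) = - ev \<alpha> (e$3) (e$4)" by (rule asdD(3)[OF a e])
  have "oframe X x e' \<Longrightarrow> ev \<alpha> (e'$1) (e'$2) = - ev \<alpha> (e'$3) (e'$4)" for e'
    by (rule asdD(3)[OF a])
  from this[OF oframe_cycle[OF x e]] this[OF c2]
  have 2: "ev \<alpha> (e$1) (e$3) = - ev \<alpha> (e$4) (e$2)" and 3: "ev \<alpha> (e$1) (e$4) = - ev \<alpha> (e$2) (e$3)"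
    by simp_all
  have "ev \<alpha> a b = - ev \<alpha> b a" for a b by (rule asdD(1)[OF a])
  note anti = this
  have 4: "ev \<alpha> (e$2) (e$1) = - ev \<alpha> (e$1) (e$2)" "ev \<alpha> (e$4) (e$3) = - ev \<alpha> (e$3) (e$4)"
    "ev \<alpha> (e$3) (e$1) = - ev \<alpha> (e$1) (e$3)" "ev \<alpha> (e$2) (e$4) = - ev \<alpha> (e$4) (e$2)"
    "ev \<alpha> (e$4) (e$1) = - ev \<alpha> (e$1) (e$4)" "ev \<alpha> (e$3) (e$2) = - ev \<alpha> (e$2) (e$3)"
    by (rule anti)+
  show "ev \<alpha> (e$1) (e$2) = inner2 \<alpha> (f1 e)" "ev \<alpha> (e$3) (e$4) = - inner2 \<alpha> (f1 e)"
    "ev \<alpha> (e$1) (e$3) = inner2 \<alpha> (f2 e)" "ev \<alpha> (e$4) (e$2) = - inner2 \<alpha> (f2 e)"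
    "ev \<alpha> (e$1) (e$4) = inner2 \<alpha> (f3 e)" "ev \<alpha> (e$2) (e$3) = - inner2 \<alpha> (f3 e)"
    unfolding inner2_f 4 using 1 2 3 by simp_all
qed

lemma asd_expand:
  assumes x: "x \<in> points X" and e: "oframe X x e" and a: "\<alpha> \<in> asd X x"
  shows "\<alpha> = inner2 \<alpha> (f1 e) *\<^sub>R f1 e + inner2 \<alpha> (f2 e) *\<^sub>R f2 e + inner2 \<alpha> (f3 e) *\<^sub>R f3 e"
    (is "_ = ?r")
proof (rule form2_eqI)
  fix y z
  have anti: "ev \<alpha> a b = - ev \<alpha> b a" for a b by (rule asdD(1)[OF a])
  have self: "ev \<alpha> a a = 0" for a using anti[of a a] by simp
  have 4: "ev \<alpha> (e$2) (e$1) = - ev \<alpha> (e$1) (e$2)" "ev \<alpha> (e$4) (e$3) = - ev \<alpha> (e$3) (e$4)"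
    "ev \<alpha> (e$3) (e$1) = - ev \<alpha> (e$1) (e$3)" "ev \<alpha> (e$2) (e$4) = - ev \<alpha> (e$4) (e$2)"
    "ev \<alpha> (e$4) (e$1) = - ev \<alpha> (e$1) (e$4)" "ev \<alpha> (e$3) (e$2) = - ev \<alpha> (e$2) (e$3)"
    by (rule anti)+
  have "ev \<alpha> y z = ev \<alpha> (tproj X x y) (tproj X x z)" by (rule asdD(2)[OF a])
  also have "\<dots> = ev ?r y z"
    by (simp add: tproj_frame[OF x e] ev_simps self 4 asd_ev[OF x e a] ev_f inner_commute[of _ y] inner_commute[of _ z] algebra_simps)
  finally show "ev \<alpha> y z = ev ?r y z" .
qed

text \<open>The frame chosen in \<open>vol_V\<close> is removed by comparing both it and
  \<open>e\<close> with the frame-free triple product.\<close>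

lemma vol_V_frame:
  assumes x: "x \<in> points X" and e: "oframe X x e"
    and a: "\<alpha> \<in> asd X x" "\<beta> \<in> asd X x" "\<gamma> \<in> asd X x"
  shows "vol_V X x \<alpha> \<beta> \<gamma> = det3 (asd_coords e \<alpha>) (asd_coords e \<beta>) (asd_coords e \<gamma>)"
proof -
  have e0: "oframe X x (some_oframe X x)"
    unfolding some_oframe_def using frame_ex[OF x] by (metis someI_ex)
  have "det3 (asd_coords e \<alpha>) (asd_coords e \<beta>) (asd_coords e \<gamma>) = inner2 (comp2 \<alpha> \<beta>) \<gamma>" if "oframe X x e" for e
    by (rule det3_asd_coords_eq_comp2[OF oframe_onf[OF that]])
      (rule asd_expand[OF x that a(1)] asd_expand[OF x that a(2)] asd_expand[OF x that a(3)])+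
  from this[OF e] this[OF e0] show ?thesis by (simp add: vol_V_eq)
qed

text \<open>Coordinates in an oriented frame turn \<open>volform\<close> into a determinant and the
  vectors of \<open>e\<close> into the rows of an orthogonal matrix.\<close>

lemma vol_orthonormal:
  assumes x: "x \<in> points X" and e: "onf e" and eT: "\<And>i. e $ i \<in> tangent X x"
  shows "volform X x (e$1) (e$2) (e$3) (e$4) = 1 \<or> volform X x (e$1) (e$2) (e$3) (e$4) = -1"
proof -
  obtain e0 where e0: "oframe X x e0" using frame_ex[OF x] by auto
  note s0 = onf_simps[OF oframe_onf[OF e0]]
  define L where "L = (\<lambda>w. vector [w \<bullet> e0$1, w \<bullet> e0$2, w \<bullet> e0$3, w \<bullet> e0$4] :: real^4)"
  have L: "linear L" unfolding L_def by (rule linearI) (simp_all add: vec_eq_iff forall_4 inner_simps)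
  have "volform X x (e$1) (e$2) (e$3) (e$4) = det4 (L (e$1)) (L (e$2)) (L (e$3)) (L (e$4))"
  proof (rule alt4_eq[OF vol_alt[OF x] alt4_compose[OF alt4_det4 L]])
    show "tangent X x = span {e0 $ 1, e0 $ 2, e0 $ 3, e0 $ 4}"
      using oframe_span[OF x e0] by (simp add: range_nth_4)
    have "L (e0$1) = axis 1 1" "L (e0$2) = axis 2 1" "L (e0$3) = axis 3 1" "L (e0$4) = axis 4 1"
      by (simp_all add: L_def vec_eq_iff forall_4 s0 axis_def)
    then show "volform X x (e0 $ 1) (e0 $ 2) (e0 $ 3) (e0 $ 4)
        = det4 (L (e0 $ 1)) (L (e0 $ 2)) (L (e0 $ 3)) (L (e0 $ 4))"
      by (simp add: det4_axis oframe_vol[OF e0])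
  qed (auto simp: eT)
  moreover define M where "M = (vector [L (e$1), L (e$2), L (e$3), L (e$4)] :: real^4^4)"
  have "M $ i \<bullet> M $ j = (if i = j then 1 else 0)" for i j
  proof -
    have Mi: "M $ i = L (e $ i)" for i using exhaust_4[of i] by (auto simp: M_def)
    have "L a \<bullet> L b = a \<bullet> b" if "a \<in> tangent X x" for a b
    proof -
      have "a \<bullet> b = ((a \<bullet> e0$1) *\<^sub>R e0$1 + (a \<bullet> e0$2) *\<^sub>R e0$2 + (a \<bullet> e0$3) *\<^sub>R e0$3 + (a \<bullet> e0$4) *\<^sub>R e0$4) \<bullet> b"
        using oframe_expand[OF x e0 that] by simp
      then show ?thesis by (simp add: L_def inner_vec_def sum_4 inner_simps inner_commute)
    qed
    then show ?thesis using e eT by (simp add: Mi onf_def)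
  qed
  then have "M ** transpose M = mat 1"
    by (simp add: vec_eq_iff matrix_matrix_mult_def transpose_def mat_def inner_vec_def)
  then have "orthogonal_matrix M"
    by (simp add: orthogonal_matrix_def matrix_left_right_inverse)
  then have "det M = 1 \<or> det M = -1" by (rule det_orthogonal_matrix)
  ultimately show ?thesis by (simp add: det4_def M_def)
qed

lemma dim_tangent: assumes "x \<in> points X" shows "dim (tangent X x) = 4"
proof -
  obtain e where e: "oframe X x e" using frame_ex[OF assms] by auto
  show ?thesis
    using onf_independent[OF oframe_onf[OF e]] by (simp add: oframe_span[OF assms e] dim_eq_card_independent)
qed

text \<open>A unit vector normal to the three given ones exists by dimension; its sign is adjusted
  to the orientation.\<close>

lemma frame_completion3:
  assumes x: "x \<in> points X" and t: "a \<in> tangent X x" "b \<in> tangent X x" "c \<in> tangent X x"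
    and o: "a \<bullet> a = 1" "b \<bullet> b = 1" "c \<bullet> c = 1" "a \<bullet> b = 0" "a \<bullet> c = 0" "b \<bullet> c = 0"
  shows "\<exists>d. oframe X x (vector [a, b, c, d])"
proof -
  have "card {a, b, c} < 4" by (rule le_less_trans[OF card_insert_le_m1[of 3]]) (auto simp: card_insert_if)
  then obtain d where d: "d \<in> tangent X x" "d \<bullet> d = 1" "\<forall>s\<in>{a, b, c}. d \<bullet> s = 0"
    using unit_orthogonal_ex[OF subspace_tangent[OF x], of "{a, b, c}"] t by (auto simp: dim_tangent[OF x])
  let ?e = "vector [a, b, c, d] :: 'v^4"
  have "volform X x a b c d = 1 \<or> volform X x a b c d = -1"
    using vol_orthonormal[OF x onfI, of ?e] d t o forall_4[of "\<lambda>i. ?e $ i \<in> tangent X x"]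
    by (simp add: inner_commute)
  then show ?thesis
  proof
    assume "volform X x a b c d = 1"
    then have "oframe X x ?e" using d t o by (simp add: oframe_def forall_4 inner_commute)
    then show ?thesis by blast
  next
    assume v: "volform X x a b c d = -1"
    have "volform X x a b c (- d) = 1"
      using v linear_neg[OF alt4_linear(4)[OF vol_alt[OF x]]] by simp
    moreover have "- d \<in> tangent X x" using d(1) subspace_tangent[OF x] by (simp add: subspace_neg)
    ultimately have "oframe X x (vector [a, b, c, - d])"
      using d t o by (simp add: oframe_def forall_4 inner_commute)
    then show ?thesis by blast
  qed
qed

lemma frame_completion2:
  assumes x: "x \<in> points X" and t: "a \<in> tangent X x" "b \<in> tangent X x"
    and o: "a \<bullet> a = 1" "b \<bullet> b = 1" "a \<bullet> b = 0"
  shows "\<exists>c d. oframe X x (vector [a, b, c, d])"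
proof -
  have "card {a, b} < 4" by (auto simp: card_insert_if)
  then obtain c where c: "c \<in> tangent X x" "c \<bullet> c = 1" "\<forall>s\<in>{a, b}. c \<bullet> s = 0"
    using unit_orthogonal_ex[OF subspace_tangent[OF x], of "{a, b}"] t by (auto simp: dim_tangent[OF x])
  then show ?thesis using frame_completion3[OF x t c(1) o(1,2) c(2) o(3)] by (auto simp: inner_commute)
qed

end

section \<open>Calibrated tangent spaces\<close>

definition lincomb :: "'w::real_vector^'k \<Rightarrow> real^'k \<Rightarrow> 'w" where
  "lincomb b x = (\<Sum>j\<in>UNIV. x $ j *\<^sub>R b $ j)"

lemma linear_lincomb: "linear (lincomb b)"
  by (rule linearI) (simp_all add: lincomb_def scaleR_add_left sum.distrib scaleR_sum_right)

lemma lincomb_axis [simp]: "lincomb b (axis i 1) = b $ i"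
proof -
  have "lincomb b (axis i 1) = (\<Sum>j\<in>UNIV. if j = i then b $ i else 0)"
    unfolding lincomb_def by (rule sum.cong) (auto simp: axis_def)
  then show ?thesis by simp
qed

lemma span_range_lincomb: "span (range (($) b)) = range (lincomb b)"
proof (rule antisym)
  have "b $ i \<in> range (lincomb b)" for i by (metis lincomb_axis rangeI)
  then have "range (($) b) \<subseteq> range (lincomb b)" by auto
  then show "span (range (($) b)) \<subseteq> range (lincomb b)"
    by (rule span_minimal) (rule linear_subspace_image[OF linear_lincomb subspace_UNIV])
  show "range (lincomb b) \<subseteq> span (range (($) b))"
    unfolding lincomb_def by (intro image_subsetI span_sum span_scale span_base rangeI)
qed

text \<open>Spanning and independence become surjectivity and injectivity of one coordinate map, so
  that for the twisted bundles both can be read off from an explicit formula for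
  \<open>lincomb\<close>.\<close>

lemma basis_of_iff:
  "basis_of T b \<longleftrightarrow> T = range (lincomb b) \<and> (\<forall>x. lincomb b x = 0 \<longrightarrow> x = 0)"
proof
  assume b: "basis_of T b"
  then have inj: "inj (($) b)" and ind: "independent (range (($) b))" and sp: "span (range (($) b)) = T"
    by (auto simp: basis_of_def)
  have "x = 0" if "lincomb b x = 0" for x
  proof -
    define u where "u = (\<lambda>v. x $ (inv (($) b) v))"
    have "(\<Sum>v\<in>range (($) b). u v *\<^sub>R v) = lincomb b x"
      by (simp add: sum.reindex[OF inj] u_def lincomb_def inv_f_f[OF inj])
    then have "\<forall>v\<in>range (($) b). u v = 0"
      using ind that unfolding dependent_finite[OF finite_imageI[OF finite]] by metis
    then show "x = 0" by (auto simp: u_def inv_f_f[OF inj] vec_eq_iff)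
  qed
  then show "T = range (lincomb b) \<and> (\<forall>x. lincomb b x = 0 \<longrightarrow> x = 0)"
    using sp by (simp add: span_range_lincomb)
next
  assume r: "T = range (lincomb b) \<and> (\<forall>x. lincomb b x = 0 \<longrightarrow> x = 0)"
  have inj: "inj (($) b)"
  proof (rule injI)
    fix i j assume "b $ i = b $ j"
    then have "lincomb b (axis i 1 - axis j 1) = 0"
      by (simp add: linear_diff[OF linear_lincomb])
    then have "axis i 1 - axis j 1 = (0 :: real^'b)" using r by blast
    then show "i = j" by (metis axis_eq_axis eq_iff_diff_eq_0 zero_neq_one)
  qed
  have "independent (range (($) b))"
    unfolding dependent_finite[OF finite_imageI[OF finite]]
  proof
    assume "\<exists>u. (\<exists>v\<in>range (($) b). u v \<noteq> 0) \<and> (\<Sum>v\<in>range (($) b). u v *\<^sub>R v) = 0"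
    then obtain u i where u: "u (b $ i) \<noteq> (0::real)" "(\<Sum>v\<in>range (($) b). u v *\<^sub>R v) = 0" by auto
    have "lincomb b (\<chi> j. u (b $ j)) = 0"
      using u(2) by (simp add: sum.reindex[OF inj] lincomb_def)
    then have "(\<chi> j. u (b $ j)) = 0" using r by blast
    then show False using u(1) by (simp add: vec_eq_iff)
  qed
  then show "basis_of T b" using r inj by (simp add: basis_of_def span_range_lincomb)
qed

definition transform :: "real^'k^'k \<Rightarrow> 'w::real_vector^'k \<Rightarrow> 'w^'k" where
  "transform C b = (\<chi> i. \<Sum>j\<in>UNIV. C $ i $ j *\<^sub>R b $ j)"

lemma transform_nth: "transform C b $ i = lincomb b (C $ i)"
  by (simp add: transform_def lincomb_def)

lemma lincomb_transform: "lincomb (transform C b) x = lincomb b (x v* C)"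
proof -
  have "lincomb (transform C b) x = (\<Sum>i\<in>UNIV. \<Sum>j\<in>UNIV. (x $ i * C $ i $ j) *\<^sub>R b $ j)"
    by (simp add: lincomb_def transform_def scaleR_sum_right)
  also have "\<dots> = (\<Sum>j\<in>UNIV. \<Sum>i\<in>UNIV. (x $ i * C $ i $ j) *\<^sub>R b $ j)" by (rule sum.swap)
  also have "\<dots> = lincomb b (x v* C)"
    by (simp add: lincomb_def vector_matrix_mult_def scaleR_sum_left mult.commute)
  finally show ?thesis .
qed

lemma basis_of_transform_ex:
  assumes "basis_of T b" "\<And>i. b' $ i \<in> T"
  shows "\<exists>C. b' = transform C b"
proof -
  have "\<forall>i. \<exists>x. b' $ i = lincomb b x" using assms by (auto simp: basis_of_iff)
  then obtain f where "\<And>i. b' $ i = lincomb b (f i)" by metis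
  then have "b' = transform (\<chi> i. f i) b" by (simp add: vec_eq_iff transform_nth)
  then show ?thesis by blast
qed

lemma basis_of_transform:
  assumes b: "basis_of T b" and C: "det C \<noteq> 0"
  shows "basis_of T (transform C b)"
proof -
  obtain D where D: "C ** D = mat 1" "D ** C = mat 1"
    using C invertible_det_nz unfolding invertible_def by metis
  have "range (lincomb (transform C b)) = range (lincomb b)"
  proof
    show "range (lincomb (transform C b)) \<subseteq> range (lincomb b)" by (auto simp: lincomb_transform)
    have "lincomb b x = lincomb (transform C b) (x v* D)" for x
      by (simp add: lincomb_transform vector_matrix_mul_assoc D vector_matrix_mul_rid)
    then show "range (lincomb b) \<subseteq> range (lincomb (transform C b))" by auto
  qed
  moreover have "x = 0" if "lincomb (transform C b) x = 0" for x
  proof -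
    have "x v* C = 0" using that b by (simp add: lincomb_transform basis_of_iff)
    then have "(x v* C) v* D = 0 v* D" by simp
    then show ?thesis by (simp add: vector_matrix_mul_assoc D vector_matrix_mul_rid)
  qed
  ultimately show ?thesis using b by (auto simp: basis_of_iff)
qed

lemma basis_of_in: "basis_of T b \<Longrightarrow> b $ i \<in> T"
  unfolding basis_of_iff by (metis lincomb_axis rangeI)

text \<open>The Gram matrix \<open>G\<close> changes to
  \<open>C ** G ** transpose C\<close>.\<close>

lemma gram_transform:
  fixes g :: "'w::real_vector \<Rightarrow> 'w \<Rightarrow> real"
  assumes g: "\<And>y. linear (\<lambda>x. g x y)" "\<And>x. linear (\<lambda>y. g x y)"
  shows "det (\<chi> i j. g (transform C b $ i) (transform C b $ j)) = (det C)\<^sup>2 * det (\<chi> i j. g (b $ i) (b $ j))"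
proof -
  let ?G = "\<chi> i j. g (b $ i) (b $ j)"
  have "g (transform C b $ i) (transform C b $ j) = (\<Sum>l\<in>UNIV. \<Sum>k\<in>UNIV. C $ i $ k * (g (b $ k) (b $ l) * C $ j $ l))" for i j
    by (simp add: transform_def linear_sum[OF g(1)] linear_sum[OF g(2)] linear_cmul[OF g(1)] linear_cmul[OF g(2)]
        sum_distrib_left mult_ac)
  then have "(\<chi> i j. g (transform C b $ i) (transform C b $ j)) = C ** ?G ** transpose C"
    by (simp add: vec_eq_iff matrix_matrix_mult_def transpose_def sum_distrib_left mult_ac)
  then show ?thesis by (simp add: det_mul power2_eq_square)
qed

lemma linear_bs_metric: "linear (\<lambda>x. bs_metric c q x y)" "linear (\<lambda>y. bs_metric c q x y)"
  by (rule linearI; simp add: bs_metric_def inner_simps inner2_add_left inner2_scale_left inner2_add_right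
      inner2_scale_right algebra_simps)+

lemma bs_metric_commute: "bs_metric c q x y = bs_metric c q y x"
  by (simp add: bs_metric_def inner_commute inner2_commute)

abbreviation gram_det :: "real \<Rightarrow> 'v::euclidean_space \<times> 'v form2 \<Rightarrow> ('v \<times> 'v form2)^'k \<Rightarrow> real" where
  "gram_det c q b \<equiv> det (\<chi> i j. bs_metric c q (b $ i) (b $ j))"

text \<open>The determinant rule stands for alternation in any number of arguments, so that the
  associative and the coassociative case share the two criteria that follow.\<close>

definition calib_value :: "'w::real_vector set \<Rightarrow> ('w^'k \<Rightarrow> real) \<Rightarrow> bool" where
  "calib_value T \<Phi> \<longleftrightarrow> (\<forall>C b. (\<forall>i. b $ i \<in> T) \<longrightarrow> \<Phi> (transform C b) = det C * \<Phi> b)"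

text \<open>In passing from a positively oriented basis to \<open>B\<close>, the form scales by a
  determinant and the root of the Gram determinant by its modulus; since \<open>B\<close> may be
  negatively oriented, only squares can be compared. The absolute value appears because the square
  of \<open>sqrt y\<close> is the modulus of \<open>y\<close> for every real
  \<open>y\<close>.\<close>

lemma calibrated_necessary:
  fixes B :: "('v::euclidean_space \<times> 'v form2)^'k"
  assumes cal: "calibrated X c A \<iota> \<Phi> N" and n: "(p, \<omega>) \<in> N"
    and B: "basis_of (tangent_sub X A \<iota> N (p, \<omega>)) B"
    and \<Phi>: "calib_value (tangent_sub X A \<iota> N (p, \<omega>)) (\<Phi> (\<iota> p, \<omega>))"
  shows "(\<Phi> (\<iota> p, \<omega>) B)\<^sup>2 = \<bar>gram_det c (\<iota> p, \<omega>) B\<bar>"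
proof -
  obtain Or where Or: "orientation N (tangent_sub X A \<iota> N) Or"
    "\<forall>b\<in>Or (p, \<omega>). \<Phi> (\<iota> p, \<omega>) b = sqrt (gram_det c (\<iota> p, \<omega>) b)"
    using cal n unfolding calibrated_def by fastforce
  then obtain b where b: "b \<in> Or (p, \<omega>)" "basis_of (tangent_sub X A \<iota> N (p, \<omega>)) b"
    using n unfolding orientation_def by blast
  obtain C where C: "B = transform C b" using basis_of_transform_ex[OF b(2) basis_of_in[OF B]] by auto
  have "\<Phi> (\<iota> p, \<omega>) B = det C * sqrt (gram_det c (\<iota> p, \<omega>) b)"
    using \<Phi> Or(2) b basis_of_in[OF b(2)] by (simp add: C calib_value_def)
  then have "(\<Phi> (\<iota> p, \<omega>) B)\<^sup>2 = (det C)\<^sup>2 * \<bar>gram_det c (\<iota> p, \<omega>) b\<bar>"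
    by (simp add: power2_eq_square)
  also have "\<dots> = \<bar>gram_det c (\<iota> p, \<omega>) B\<bar>"
    unfolding C by (simp add: gram_transform[OF linear_bs_metric] abs_mult)
  finally show ?thesis .
qed

text \<open>The bases on which \<open>\<Phi>\<close> is positive form an orientation.\<close>

lemma calibrated_sufficient:
  fixes \<Phi> :: "'v::euclidean_space \<times> 'v form2 \<Rightarrow> ('v \<times> 'v form2)^'k \<Rightarrow> real"
    and A :: "'l::topological_space params"
  assumes \<Phi>: "\<And>p \<omega>. (p, \<omega>) \<in> N \<Longrightarrow> calib_value (tangent_sub X A \<iota> N (p, \<omega>)) (\<Phi> (\<iota> p, \<omega>))"
    and loc: "\<And>p \<omega>. (p, \<omega>) \<in> N \<Longrightarrow> \<exists>W b. open W \<and> (p, \<omega>) \<in> W \<and> continuous_on (N \<inter> W) b \<and>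
      (\<forall>(p', \<omega>')\<in>N \<inter> W. basis_of (tangent_sub X A \<iota> N (p', \<omega>')) (b (p', \<omega>')) \<and>
         \<Phi> (\<iota> p', \<omega>') (b (p', \<omega>')) > 0 \<and>
         \<Phi> (\<iota> p', \<omega>') (b (p', \<omega>')) = sqrt (gram_det c (\<iota> p', \<omega>') (b (p', \<omega>'))))"
  shows "calibrated X c A \<iota> \<Phi> N"
proof -
  define T where "T = tangent_sub X A \<iota> N"
  define P where "P = (\<lambda>(p, \<omega>). \<Phi> (\<iota> p, \<omega>))"
  define Or where "Or = (\<lambda>n. {b. basis_of (T n) b \<and> P n b > 0})"
  have cv: "P n (transform C b) = det C * P n b" if "n \<in> N" "\<And>i. b $ i \<in> T n" for n C b
    using \<Phi>[of "fst n" "snd n"] that by (simp add: P_def T_def calib_value_def case_prod_beta)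
  have loc': "\<exists>W b. open W \<and> n \<in> W \<and> continuous_on (N \<inter> W) b \<and>
      (\<forall>m\<in>N \<inter> W. b m \<in> Or m \<and> P m (b m) = sqrt (gram_det c (\<iota> (fst m), snd m) (b m)))" if "n \<in> N" for n
  proof -
    obtain W b where "open W" "(fst n, snd n) \<in> W" "continuous_on (N \<inter> W) b"
      "\<forall>(p', \<omega>')\<in>N \<inter> W. basis_of (tangent_sub X A \<iota> N (p', \<omega>')) (b (p', \<omega>')) \<and>
         \<Phi> (\<iota> p', \<omega>') (b (p', \<omega>')) > 0 \<and>
         \<Phi> (\<iota> p', \<omega>') (b (p', \<omega>')) = sqrt (gram_det c (\<iota> p', \<omega>') (b (p', \<omega>')))"
      using loc[of "fst n" "snd n"] \<open>n \<in> N\<close> by auto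
    moreover from this(4) have "b m \<in> Or m \<and> P m (b m) = sqrt (gram_det c (\<iota> (fst m), snd m) (b m))"
      if "m \<in> N \<inter> W" for m
      using that by (cases m) (force simp: Or_def P_def T_def)
    ultimately show ?thesis by (intro exI[of _ W] exI[of _ b]) auto
  qed
  have "orientation N (tangent_sub X A \<iota> N) Or"
    unfolding orientation_def T_def[symmetric]
  proof (intro conjI ballI allI)
    fix n assume n: "n \<in> N"
    from loc'[OF n] n show "Or n \<noteq> {}" by blast
    from loc'[OF n] show "\<exists>W b. open W \<and> n \<in> W \<and> continuous_on (N \<inter> W) b \<and> (\<forall>m\<in>N \<inter> W. b m \<in> Or m)"
      by blast
    fix b assume b: "b \<in> Or n"
    then have bT: "basis_of (T n) b" and pos: "P n b > 0" by (auto simp: Or_def)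
    show "basis_of (T n) b" by (rule bT)
    fix b' :: "('v \<times> 'v form2)^'k"
    have eq: "(\<exists>C. det C > 0 \<and> (\<forall>i. b' $ i = (\<Sum>j\<in>UNIV. C $ i $ j *\<^sub>R b $ j))) \<longleftrightarrow> (\<exists>C. det C > 0 \<and> b' = transform C b)"
      by (simp add: transform_def vec_eq_iff)
    show "b' \<in> Or n \<longleftrightarrow> (\<exists>C. det C > 0 \<and> (\<forall>i. b' $ i = (\<Sum>j\<in>UNIV. C $ i $ j *\<^sub>R b $ j)))"
      unfolding eq
    proof
      assume b': "b' \<in> Or n"
      then obtain C where C: "b' = transform C b"
        using basis_of_transform_ex[OF bT] basis_of_in[of "T n" b'] by (auto simp: Or_def)
      have "P n b' = det C * P n b" unfolding C by (rule cv[OF n basis_of_in[OF bT]])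
      then have "det C > 0" using b' pos by (simp add: Or_def zero_less_mult_iff)
      with C show "\<exists>C. det C > 0 \<and> b' = transform C b" by blast
    next
      assume "\<exists>C. det C > 0 \<and> b' = transform C b"
      then obtain C where C: "det C > 0" "b' = transform C b" by blast
      then show "b' \<in> Or n"
        using basis_of_transform[OF bT, of C] cv[OF n basis_of_in[OF bT], of C] pos by (simp add: Or_def)
    qed
  qed
  moreover have "\<Phi> (\<iota> p, \<omega>) b = sqrt (gram_det c (\<iota> p, \<omega>) b)" if n: "(p, \<omega>) \<in> N" and b: "b \<in> Or (p, \<omega>)" for p \<omega> b
  proof -
    obtain W B where W: "(p, \<omega>) \<in> W"
      "\<forall>m\<in>N \<inter> W. B m \<in> Or m \<and> P m (B m) = sqrt (gram_det c (\<iota> (fst m), snd m) (B m))"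
      using loc'[OF n] by blast
    define b0 where "b0 = B (p, \<omega>)"
    have "B (p, \<omega>) \<in> Or (p, \<omega>)" "P (p, \<omega>) (B (p, \<omega>)) = sqrt (gram_det c (\<iota> p, \<omega>) (B (p, \<omega>)))"
      using W(2)[rule_format, of "(p, \<omega>)"] W(1) n by simp_all
    then have b0: "basis_of (T (p, \<omega>)) b0" "P (p, \<omega>) b0 > 0" "P (p, \<omega>) b0 = sqrt (gram_det c (\<iota> p, \<omega>) b0)"
      unfolding Or_def b0_def by blast+
    have bT: "basis_of (T (p, \<omega>)) b" "P (p, \<omega>) b > 0" using b by (auto simp: Or_def)
    obtain C where C: "b = transform C b0" using basis_of_transform_ex[OF b0(1) basis_of_in[OF bT(1)]] by auto
    have PC: "P (p, \<omega>) b = det C * P (p, \<omega>) b0" unfolding C by (rule cv[OF n basis_of_in[OF b0(1)]])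
    then have "det C > 0" using bT(2) b0(2) by (simp add: zero_less_mult_iff)
    \<comment> \<open>Positivity of the determinant is what allows it to leave the square root
      without a modulus.\<close>
    then have "sqrt (gram_det c (\<iota> p, \<omega>) b) = det C * sqrt (gram_det c (\<iota> p, \<omega>) b0)"
      unfolding C by (simp add: gram_transform[OF linear_bs_metric] real_sqrt_mult)
    then show ?thesis using PC b0(3) by (simp add: P_def)
  qed
  ultimately show ?thesis unfolding calibrated_def by (intro exI[of _ Or]) auto
qed

lemma calib_value_3:
  assumes "alt3 T G" "subspace T" "S \<subseteq> T"
  shows "calib_value S (\<lambda>b :: 'a::real_vector^3. G (b$1) (b$2) (b$3))"
  unfolding calib_value_def
proof (intro allI impI)
  fix C :: "real^3^3" and b :: "'a^3" assume "\<forall>i. b $ i \<in> S"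
  then have "b $ i \<in> T" for i using assms(3) by blast
  then show "G (transform C b $ 1) (transform C b $ 2) (transform C b $ 3) = det C * G (b $ 1) (b $ 2) (b $ 3)"
    by (intro alt_change_3[OF assms(1,2)]) (auto simp: transform_def)
qed

lemma calib_value_4:
  assumes "alt4 T G" "subspace T" "S \<subseteq> T"
  shows "calib_value S (\<lambda>b :: 'a::real_vector^4. G (b$1) (b$2) (b$3) (b$4))"
  unfolding calib_value_def
proof (intro allI impI)
  fix C :: "real^4^4" and b :: "'a^4" assume "\<forall>i. b $ i \<in> S"
  then have "b $ i \<in> T" for i using assms(3) by blast
  then show "G (transform C b $ 1) (transform C b $ 2) (transform C b $ 3) (transform C b $ 4)
      = det C * G (b $ 1) (b $ 2) (b $ 3) (b $ 4)"
    by (intro alt_change_4[OF assms(1,2)]) (auto simp: transform_def)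
qed

section \<open>The Bryant--Salamon forms in an oriented frame\<close>

lemma alt3I:
  assumes l: "\<And>b c. linear (\<lambda>a. G a b c)"
    and s: "\<And>a b c. G b a c = - G a b c" "\<And>a b c. G a c b = - G a b c"
  shows "alt3 UNIV G"
proof -
  have 2: "linear (\<lambda>b. G a b c)" for a c
    using linear_compose_neg[OF l[of a c]] by (subst s(1)) simp
  have 3: "linear (\<lambda>c. G a b c)" for a b
    using linear_compose_neg[OF 2[of a b]] by (subst s(2)) simp
  show ?thesis unfolding alt3_def by (intro conjI allI ballI l 2 3 s)
qed

lemma alt4_sum:
  assumes G: "\<And>i. i \<in> I \<Longrightarrow> alt4 T (G i)"
  shows "alt4 T (\<lambda>x y z t. \<Sum>i\<in>I. G i x y z t :: real)"
  unfolding alt4_def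
proof (intro conjI allI ballI)
  fix a b c d assume T: "a \<in> T" "b \<in> T" "c \<in> T" "d \<in> T"
  show "(\<Sum>i\<in>I. G i b a c d) = - (\<Sum>i\<in>I. G i a b c d)"
    "(\<Sum>i\<in>I. G i a c b d) = - (\<Sum>i\<in>I. G i a b c d)"
    "(\<Sum>i\<in>I. G i a b d c) = - (\<Sum>i\<in>I. G i a b c d)"
    unfolding sum_negf[symmetric]
    using alt4_swap[OF G T] by (auto intro!: sum.cong)
qed (rule linear_compose_sum, rule ballI, rule alt4_linear[OF G], assumption)+

section \<open>The determinant behind \<open>psi\<close>, and contraction over orthonormal
  bases\<close>

definition det7 :: "real^7 \<Rightarrow> real^7 \<Rightarrow> real^7 \<Rightarrow> real^7 \<Rightarrow> real^7 \<Rightarrow> real^7 \<Rightarrow> real^7 \<Rightarrow> real" where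
  "det7 a b c d e f g = det (vector [a, b, c, d, e, f, g] :: real^7^7)"

text \<open>The first five swaps give alternation inside the block of the first three and the block
  of the last four rows; the last two sort the rows met in \<open>psi_value\<close>.\<close>

lemma det7_swap:
  "det7 b a c d e f g = - det7 a b c d e f g" "det7 a c b d e f g = - det7 a b c d e f g"
  "det7 a b c e d f g = - det7 a b c d e f g" "det7 a b c d f e g = - det7 a b c d e f g"
  "det7 a b c d e g f = - det7 a b c d e f g"
  "det7 a f c d e b g = - det7 a b c d e f g" "det7 a b g d e f c = - det7 a b c d e f g"
  unfolding det7_def
        apply (rule det_rows_swap[of 1 2]; simp add: forall_7)
       apply (rule det_rows_swap[of 2 3]; simp add: forall_7)
      apply (rule det_rows_swap[of 4 5]; simp add: forall_7)
     apply (rule det_rows_swap[of 5 6]; simp add: forall_7)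
    apply (rule det_rows_swap[of 6 7]; simp add: forall_7)
   apply (rule det_rows_swap[of 2 6]; simp add: forall_7)
  apply (rule det_rows_swap[of 3 7]; simp add: forall_7)
  done

lemma det7_linear: "linear (\<lambda>a. det7 a b c d e f g)" "linear (\<lambda>d. det7 a b c d e f g)"
   apply (rule linearI)
    apply (unfold det7_def real_scaleR_def)
    apply (rule det_rows_add[of _ 1]; simp add: forall_7)
   apply (rule det_rows_scale[of _ 1]; simp add: forall_7)
  apply (rule linearI)
   apply (unfold det7_def real_scaleR_def)
   apply (rule det_rows_add[of _ 4]; simp add: forall_7)
  apply (rule det_rows_scale[of _ 4]; simp add: forall_7)
  done

lemma det7_alt: "alt3 UNIV (\<lambda>a b c. det7 a b c d e f g)" "alt4 UNIV (\<lambda>d e f g. det7 a b c d e f g)"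
  by (rule alt3I; rule det7_linear det7_swap) (rule alt4I; rule det7_linear det7_swap)

lemma det7_eq_0:
  assumes "(vector [a, b, c, d, e, f, g] :: real^7^7) $ i = vector [a, b, c, d, e, f, g] $ j" "i \<noteq> j"
  shows "det7 a b c d e f g = 0"
  unfolding det7_def
  by (rule det_identical_rows[OF assms(2)]) (simp add: row_def assms(1))

lemma det7_axis: "det7 (axis 1 1) (axis 2 1) (axis 3 1) (axis 4 1) (axis 5 1) (axis 6 1) (axis 7 1) = 1"
proof -
  have "(vector [axis 1 1, axis 2 1, axis 3 1, axis 4 1, axis 5 1, axis 6 1, axis 7 1] :: real^7^7) = mat 1"
    by (simp add: vec_eq_iff forall_7 mat_def axis_def)
  then show ?thesis by (simp add: det7_def)
qed

text \<open>The transition matrix between the two orthonormal bases is orthogonal, which is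
  \<open>gg\<close>; hence the trace of a bilinear form is the same in both.\<close>

lemma contraction_invariant:
  fixes b b' :: "'w::real_vector^'n"
  assumes K: "\<And>y. linear (\<lambda>x. K x y)" "\<And>x. linear (\<lambda>y. K x y :: real)"
    and G: "\<And>x. linear (\<lambda>y. G x y :: real)"
    and on: "\<And>i j. G (b$i) (b$j) = (if i = j then 1 else 0)"
    and b': "\<And>i. b' $ i = (\<Sum>j\<in>UNIV. G (b$j) (b'$i) *\<^sub>R b $ j)"
    and b: "\<And>i. b $ i = (\<Sum>j\<in>UNIV. G (b$i) (b'$j) *\<^sub>R b' $ j)"
  shows "(\<Sum>i\<in>UNIV. K (b'$i) (b'$i)) = (\<Sum>i\<in>UNIV. K (b$i) (b$i))"
proof -
  have gg: "(\<Sum>i\<in>UNIV. G (b$j) (b'$i) * G (b$k) (b'$i)) = (if j = k then 1 else 0)" for j k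
  proof -
    have "G (b$j) (b$k) = G (b$j) (\<Sum>i\<in>UNIV. G (b$k) (b'$i) *\<^sub>R b' $ i)"
      using b[of k] by simp
    also have "\<dots> = (\<Sum>i\<in>UNIV. G (b$j) (b'$i) * G (b$k) (b'$i))"
      by (simp add: linear_sum[OF G] linear_cmul[OF G] mult.commute)
    finally show ?thesis using on[of j k] by simp
  qed
  have "K (b'$i) (b'$i) = (\<Sum>j\<in>UNIV. \<Sum>k\<in>UNIV. (G (b$j) (b'$i) * G (b$k) (b'$i)) * K (b$j) (b$k))" for i
  proof -
    have "K (b'$i) (b'$i) = K (\<Sum>j\<in>UNIV. G (b$j) (b'$i) *\<^sub>R b $ j) (\<Sum>k\<in>UNIV. G (b$k) (b'$i) *\<^sub>R b $ k)"
      using b'[of i] by simp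
    also have "\<dots> = (\<Sum>j\<in>UNIV. \<Sum>k\<in>UNIV. (G (b$j) (b'$i) * G (b$k) (b'$i)) * K (b$j) (b$k))"
      by (simp add: linear_sum[OF K(1)] linear_sum[OF K(2)] linear_cmul[OF K(1)] linear_cmul[OF K(2)]
          sum_distrib_left mult_ac) (subst sum.swap, simp add: mult_ac)
    finally show ?thesis .
  qed
  then have "(\<Sum>i\<in>UNIV. K (b'$i) (b'$i)) = (\<Sum>i\<in>UNIV. \<Sum>j\<in>UNIV. \<Sum>k\<in>UNIV. (G (b$j) (b'$i) * G (b$k) (b'$i)) * K (b$j) (b$k))"
    by simp
  also have "\<dots> = (\<Sum>j\<in>UNIV. \<Sum>i\<in>UNIV. \<Sum>k\<in>UNIV. (G (b$j) (b'$i) * G (b$k) (b'$i)) * K (b$j) (b$k))"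
    by (rule sum.swap)
  also have "\<dots> = (\<Sum>j\<in>UNIV. \<Sum>k\<in>UNIV. \<Sum>i\<in>UNIV. (G (b$j) (b'$i) * G (b$k) (b'$i)) * K (b$j) (b$k))"
    by (intro sum.cong refl sum.swap)
  also have "\<dots> = (\<Sum>j\<in>UNIV. \<Sum>k\<in>UNIV. (if j = k then 1 else 0) * K (b$j) (b$k))"
    by (simp only: sum_distrib_right[symmetric] gg)
  also have "\<dots> = (\<Sum>j\<in>UNIV. \<Sum>k\<in>UNIV. if j = k then K (b$j) (b$k) else 0)"
    by (intro sum.cong refl) auto
  also have "\<dots> = (\<Sum>j\<in>UNIV. K (b$j) (b$j))" by simp
  finally show ?thesis .
qed

lemma bs_u_pos: "c > 0 \<Longrightarrow> bs_u c \<omega> > 0" and bs_v_pos: "c > 0 \<Longrightarrow> bs_v c \<omega> > 0"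
  unfolding bs_u_def bs_v_def by (simp_all add: add_nonneg_pos less_imp_neq[symmetric])

text \<open>\<open>bs_basis\<close> with the chosen frame replaced by a variable one.\<close>

definition bs_frame :: "'v::euclidean_space^4 \<Rightarrow> real \<Rightarrow> 'v \<times> 'v form2 \<Rightarrow> ('v \<times> 'v form2)^7" where
  "bs_frame e c q = vector [(0, f1 e /\<^sub>R bs_v c (snd q)), (0, f2 e /\<^sub>R bs_v c (snd q)), (0, f3 e /\<^sub>R bs_v c (snd q)),
     (e$1 /\<^sub>R bs_u c (snd q), 0), (e$2 /\<^sub>R bs_u c (snd q), 0), (e$3 /\<^sub>R bs_u c (snd q), 0), (e$4 /\<^sub>R bs_u c (snd q), 0)]"

definition bs_coords :: "('v::euclidean_space \<times> 'v form2)^7 \<Rightarrow> real \<Rightarrow> 'v \<times> 'v form2 \<Rightarrow> 'v \<times> 'v form2 \<Rightarrow> real^7" where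
  "bs_coords b c q w = (\<chi> l. bs_metric c q (b $ l) w)"

lemma linear_bs_coords: "linear (bs_coords b c q)"
  by (rule linearI) (simp_all add: bs_coords_def vec_eq_iff linear_add[OF linear_bs_metric(2)] linear_cmul[OF linear_bs_metric(2)])

text \<open>The contraction defining \<open>psi\<close>, written in a variable basis
  \<open>b\<close> so that different bases can be compared.\<close>

definition psi_in :: "('v::euclidean_space \<times> 'v form2)^7 \<Rightarrow> 'v riem4 \<Rightarrow> real \<Rightarrow> 'v \<times> 'v form2
     \<Rightarrow> 'v \<times> 'v form2 \<Rightarrow> 'v \<times> 'v form2 \<Rightarrow> 'v \<times> 'v form2 \<Rightarrow> 'v \<times> 'v form2 \<Rightarrow> real" where
  "psi_in b X c q w1 w2 w3 w4 = (\<Sum>i\<in>UNIV. \<Sum>j\<in>UNIV. \<Sum>k\<in>UNIV. phi X c q (b$i) (b$j) (b$k) *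
     det7 (bs_coords b c q (b$i)) (bs_coords b c q (b$j)) (bs_coords b c q (b$k)) (bs_coords b c q w1) (bs_coords b c q w2) (bs_coords b c q w3) (bs_coords b c q w4)) / 6"

lemma psi_eq_psi_in: "psi X c q w1 w2 w3 w4 = psi_in (bs_frame (some_oframe X (fst q)) c q) X c q w1 w2 w3 w4"
  by (simp add: psi_def psi_in_def bs_basis_def Let_def bs_frame_def bs_coords_def det7_def)

text \<open>Unlike \<open>phi\<close>, \<open>psi\<close> alternates on all pairs and not only on
  tangent ones: its arguments enter only as rows of a determinant.\<close>

lemma alt4_psi: "alt4 UNIV (psi X c q)"
proof -
  let ?b = "bs_frame (some_oframe X (fst q)) c q"
  have "alt4 UNIV (\<lambda>w1 w2 w3 w4. (1/6) * (\<Sum>i\<in>UNIV. \<Sum>j\<in>UNIV. \<Sum>k\<in>UNIV. phi X c q (?b$i) (?b$j) (?b$k) *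
     det7 (bs_coords ?b c q (?b$i)) (bs_coords ?b c q (?b$j)) (bs_coords ?b c q (?b$k)) (bs_coords ?b c q w1) (bs_coords ?b c q w2) (bs_coords ?b c q w3) (bs_coords ?b c q w4)))"
    by (rule alt4_scale, (rule alt4_sum)+, rule alt4_scale, rule alt4_compose[OF det7_alt(2) linear_bs_coords]) simp
  moreover have "psi X c q = (\<lambda>w1 w2 w3 w4. (1/6) * (\<Sum>i\<in>UNIV. \<Sum>j\<in>UNIV. \<Sum>k\<in>UNIV. phi X c q (?b$i) (?b$j) (?b$k) *
     det7 (bs_coords ?b c q (?b$i)) (bs_coords ?b c q (?b$j)) (bs_coords ?b c q (?b$k)) (bs_coords ?b c q w1) (bs_coords ?b c q w2) (bs_coords ?b c q w3) (bs_coords ?b c q w4)))"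
    by (simp add: fun_eq_iff psi_eq_psi_in psi_in_def)
  ultimately show ?thesis by simp
qed

lemma phi_linear:
  "linear (\<lambda>\<xi>. phi X c q \<xi> \<zeta> \<rho>)" "linear (\<lambda>\<zeta>. phi X c q \<xi> \<zeta> \<rho>)" "linear (\<lambda>\<rho>. phi X c q \<xi> \<zeta> \<rho>)"
proof -
  let ?co = "\<lambda>w::'a \<times> 'a form2. asd_coords (some_oframe X (fst q)) (snd w)"
  have l: "linear ?co" by (rule linear_compose[OF linear_snd linear_asd_coords, unfolded o_def])
  have a: "alt3 UNIV (\<lambda>\<xi> \<zeta> \<rho>. det3 (?co \<xi>) (?co \<zeta>) (?co \<rho>))"
    by (rule alt3_compose[OF alt3_det3 l]) simp
  note s = linear_add[OF alt3_linear(1)[OF a]] linear_add[OF alt3_linear(2)[OF a]] linear_add[OF alt3_linear(3)[OF a]]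
    linear_cmul[OF alt3_linear(1)[OF a]] linear_cmul[OF alt3_linear(2)[OF a]] linear_cmul[OF alt3_linear(3)[OF a]]
  show "linear (\<lambda>\<xi>. phi X c q \<xi> \<zeta> \<rho>)" "linear (\<lambda>\<zeta>. phi X c q \<xi> \<zeta> \<rho>)" "linear (\<lambda>\<rho>. phi X c q \<xi> \<zeta> \<rho>)"
    unfolding phi_def vol_V_eq
    by (rule linearI; simp only: s; simp add: ev_simps algebra_simps)+
qed

section \<open>Independence of \<open>phi\<close> and \<open>psi\<close> from the oriented
  frame\<close>

context ambient
begin

abbreviation TT :: "'v \<Rightarrow> ('v \<times> 'v form2) set" where "TT x \<equiv> tangent X x \<times> asd X x"

lemma subspace_TT: "x \<in> points X \<Longrightarrow> subspace (TT x)"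
  by (rule subspace_Times[OF subspace_tangent subspace_asd])

lemma some_oframe_frame: "x \<in> points X \<Longrightarrow> oframe X x (some_oframe X x)"
  unfolding some_oframe_def using frame_ex by (metis someI_ex)

lemma phi_frame:
  assumes x: "x \<in> points X" and e: "oframe X x e" and "snd \<xi> \<in> asd X x" "snd \<zeta> \<in> asd X x" "snd \<rho> \<in> asd X x"
  shows "phi X c (x, \<omega>) \<xi> \<zeta> \<rho> =
     (bs_v c \<omega>)^3 * det3 (asd_coords e (snd \<xi>)) (asd_coords e (snd \<zeta>)) (asd_coords e (snd \<rho>))
     + (bs_u c \<omega>)\<^sup>2 * bs_v c \<omega> *
       (ev (snd \<xi>) (fst \<zeta>) (fst \<rho>) + ev (snd \<zeta>) (fst \<rho>) (fst \<xi>) + ev (snd \<rho>) (fst \<xi>) (fst \<zeta>))"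
  by (simp add: phi_def vol_V_frame[OF x e assms(3-5)])

text \<open>Restricted to \<open>TT\<close>, because the mixed terms change sign when the vertical
  parts are skew.\<close>

lemma alt3_phi: "alt3 (TT x) (phi X c (x, \<omega>))"
  unfolding alt3_def
proof (intro conjI allI ballI phi_linear)
  fix \<xi> \<zeta> \<rho> assume "\<xi> \<in> TT x" "\<zeta> \<in> TT x" "\<rho> \<in> TT x"
  then have a: "snd \<xi> \<in> asd X x" "snd \<zeta> \<in> asd X x" "snd \<rho> \<in> asd X x" by auto
  note d = alt3_swap[OF alt3_det3 UNIV_I UNIV_I UNIV_I]
  have s1: "ev (snd \<xi>) (fst \<rho>) (fst \<zeta>) = - ev (snd \<xi>) (fst \<zeta>) (fst \<rho>)"
    "ev (snd \<zeta>) (fst \<xi>) (fst \<rho>) = - ev (snd \<zeta>) (fst \<rho>) (fst \<xi>)"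
    "ev (snd \<rho>) (fst \<zeta>) (fst \<xi>) = - ev (snd \<rho>) (fst \<xi>) (fst \<zeta>)"
    by (rule asdD(1)[OF a(1)], rule asdD(1)[OF a(2)], rule asdD(1)[OF a(3)])
  let ?co = "\<lambda>w. asd_coords (some_oframe X x) (snd w)"
  show "phi X c (x, \<omega>) \<zeta> \<xi> \<rho> = - phi X c (x, \<omega>) \<xi> \<zeta> \<rho>"
    by (simp add: phi_def vol_V_eq s1 d(1)[of "?co \<xi>" "?co \<zeta>" "?co \<rho>"] algebra_simps)
  show "phi X c (x, \<omega>) \<xi> \<rho> \<zeta> = - phi X c (x, \<omega>) \<xi> \<zeta> \<rho>"
    by (simp add: phi_def vol_V_eq s1 d(2)[of "?co \<xi>" "?co \<zeta>" "?co \<rho>"] algebra_simps)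
qed

lemma bs_frame_orthonormal:
  assumes e: "oframe X x e" and c: "c > 0"
  shows "bs_metric c (x, \<omega>) (bs_frame e c (x, \<omega>) $ i) (bs_frame e c (x, \<omega>) $ j) = (if i = j then 1 else 0)"
proof -
  have "bs_u c \<omega> \<noteq> 0" "bs_v c \<omega> \<noteq> 0" using bs_u_pos[OF c, of \<omega>] bs_v_pos[OF c, of \<omega>] by auto
  then have "\<forall>i j. bs_metric c (x, \<omega>) (bs_frame e c (x, \<omega>) $ i) (bs_frame e c (x, \<omega>) $ j) = (if i = j then 1 else 0)"
    by (simp add: forall_7 bs_frame_def bs_metric_def inner2_scale_left inner2_scale_right
        f_orthonormal[OF oframe_onf[OF e]] onf_simps[OF oframe_onf[OF e]] power2_eq_square)
      (simp add: field_simps)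
  then show ?thesis by blast
qed

lemma bs_frame_in_TT: assumes "x \<in> points X" "oframe X x e" shows "bs_frame e c (x, \<omega>) $ i \<in> TT x"
proof -
  have "\<forall>i. bs_frame e c (x, \<omega>) $ i \<in> TT x"
    by (simp add: forall_7 bs_frame_def f_asd[OF assms] oframe_tangent[OF assms(2)]
        subspace_0[OF subspace_tangent[OF assms(1)]] subspace_0[OF subspace_asd]
        subspace_scale[OF subspace_tangent[OF assms(1)]] subspace_scale[OF subspace_asd])
  then show ?thesis by blast
qed

lemma bs_frame_expand:
  assumes x: "x \<in> points X" and e: "oframe X x e" and c: "c > 0" and w: "w \<in> TT x"
  shows "w = (\<Sum>l\<in>UNIV. bs_metric c (x, \<omega>) (bs_frame e c (x, \<omega>) $ l) w *\<^sub>R bs_frame e c (x, \<omega>) $ l)"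
proof -
  have nz: "bs_u c \<omega> \<noteq> 0" "bs_v c \<omega> \<noteq> 0" using bs_u_pos[OF c, of \<omega>] bs_v_pos[OF c, of \<omega>] by auto
  have r: "bs_u c \<omega> * bs_u c \<omega> * (inverse (bs_u c \<omega>) * y) * inverse (bs_u c \<omega>) = y"
    "bs_v c \<omega> * bs_v c \<omega> * (inverse (bs_v c \<omega>) * y) * inverse (bs_v c \<omega>) = y" for y
    using nz by (simp_all add: field_simps)
  have 1: "fst w = (fst w \<bullet> e$1) *\<^sub>R e$1 + (fst w \<bullet> e$2) *\<^sub>R e$2 + (fst w \<bullet> e$3) *\<^sub>R e$3 + (fst w \<bullet> e$4) *\<^sub>R e$4"
    using w by (intro oframe_expand[OF x e]) auto
  have 2: "snd w = inner2 (snd w) (f1 e) *\<^sub>R f1 e + inner2 (snd w) (f2 e) *\<^sub>R f2 e + inner2 (snd w) (f3 e) *\<^sub>R f3 e"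
    using w by (intro asd_expand[OF x e]) auto
  have "(\<Sum>l\<in>UNIV. bs_metric c (x, \<omega>) (bs_frame e c (x, \<omega>) $ l) w *\<^sub>R bs_frame e c (x, \<omega>) $ l)
     = ((fst w \<bullet> e$1) *\<^sub>R e$1 + (fst w \<bullet> e$2) *\<^sub>R e$2 + (fst w \<bullet> e$3) *\<^sub>R e$3 + (fst w \<bullet> e$4) *\<^sub>R e$4,
        inner2 (snd w) (f1 e) *\<^sub>R f1 e + inner2 (snd w) (f2 e) *\<^sub>R f2 e + inner2 (snd w) (f3 e) *\<^sub>R f3 e)"
    by (simp add: sum_7 bs_frame_def bs_metric_def inner2_scale_right inner_commute[of _ "fst w"]
        inner2_commute[of _ "snd w"] power2_eq_square r)
  then show ?thesis using 1 2 by (metis prod.collapse)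
qed

text \<open>The transition between two such bases is block diagonal. Alternation in the horizontal
  block leaves a factor \<open>volform\<close>, alternation in the vertical block a factor given by
  the triple product, and both are 1 on oriented frames.\<close>

lemma det7_bs_coords_frames:
  fixes \<omega> :: "'v form2"
  assumes x: "x \<in> points X" and e0: "oframe X x e0" and e: "oframe X x e" and c: "c > 0"
  defines "b \<equiv> bs_frame e0 c (x, \<omega>)" and "b' \<equiv> bs_frame e c (x, \<omega>)"
  shows "det7 (bs_coords b c (x, \<omega>) (b'$1)) (bs_coords b c (x, \<omega>) (b'$2)) (bs_coords b c (x, \<omega>) (b'$3)) (bs_coords b c (x, \<omega>) (b'$4))
     (bs_coords b c (x, \<omega>) (b'$5)) (bs_coords b c (x, \<omega>) (b'$6)) (bs_coords b c (x, \<omega>) (b'$7)) = 1"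
proof -
  define V where "V = (\<lambda>\<alpha>. bs_coords b c (x, \<omega>) (0, \<alpha> /\<^sub>R bs_v c \<omega>))"
  define H where "H = (\<lambda>a. bs_coords b c (x, \<omega>) (a /\<^sub>R bs_u c \<omega>, 0))"
  have V: "linear V" unfolding V_def
    by (rule linear_compose[OF _ linear_bs_coords, unfolded o_def]) (auto intro!: linearI simp: algebra_simps)
  have H: "linear H" unfolding H_def
    by (rule linear_compose[OF _ linear_bs_coords, unfolded o_def]) (auto intro!: linearI simp: algebra_simps)
  define F where "F = (\<lambda>\<alpha> \<beta> \<gamma> a1 a2 a3 a4. det7 (V \<alpha>) (V \<beta>) (V \<gamma>) (H a1) (H a2) (H a3) (H a4))"
  have F4: "alt4 (tangent X x) (F \<alpha> \<beta> \<gamma>)" for \<alpha> \<beta> \<gamma>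
    unfolding F_def by (rule alt4_compose[OF det7_alt(2) H]) simp
  have F3: "alt3 (asd X x) (\<lambda>\<alpha> \<beta> \<gamma>. F \<alpha> \<beta> \<gamma> a1 a2 a3 a4)" for a1 a2 a3 a4
    unfolding F_def by (rule alt3_compose[OF det7_alt(1) V]) simp
  have vol3: "alt3 (asd X x) (\<lambda>\<alpha> \<beta> \<gamma>. det3 (asd_coords e0 \<alpha>) (asd_coords e0 \<beta>) (asd_coords e0 \<gamma>))"
    by (rule alt3_compose[OF alt3_det3 linear_asd_coords]) simp
  note o0 = f_orthonormal[OF oframe_onf[OF e0]] and o = f_orthonormal[OF oframe_onf[OF e]]
  have d0: "det3 (asd_coords e0 (f1 e0)) (asd_coords e0 (f2 e0)) (asd_coords e0 (f3 e0)) = 1"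
    by (simp add: asd_coords_def o0 det3_def det_3)
  have "det3 (asd_coords e (f1 e)) (asd_coords e (f2 e)) (asd_coords e (f3 e)) = 1"
    by (simp add: asd_coords_def o det3_def det_3)
  \<comment> \<open>By \<open>vol_V_frame\<close> the determinant in the coordinates of
    \<open>e0\<close> equals the one in the coordinates of \<open>e\<close>, which is 1.\<close>
  then have d: "det3 (asd_coords e0 (f1 e)) (asd_coords e0 (f2 e)) (asd_coords e0 (f3 e)) = 1"
    using vol_V_frame[OF x e f_asd[OF x e]] vol_V_frame[OF x e0 f_asd[OF x e]] by simp
  have "F (f1 e) (f2 e) (f3 e) (e$1) (e$2) (e$3) (e$4)
      = F (f1 e) (f2 e) (f3 e) (e0$1) (e0$2) (e0$3) (e0$4) * volform X x (e$1) (e$2) (e$3) (e$4)"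
    by (rule alt4_eq[OF F4 alt4_scale[OF vol_alt[OF x]], of "e0$1" "e0$2" "e0$3" "e0$4"])
      (simp_all add: oframe_span[OF x e0] range_nth_4 oframe_vol[OF e0], simp_all add: oframe_span[OF x e0, symmetric] range_nth_4[symmetric] oframe_tangent[OF e])
  also have "\<dots> = F (f1 e) (f2 e) (f3 e) (e0$1) (e0$2) (e0$3) (e0$4)" by (simp add: oframe_vol[OF e])
  also have "\<dots> = F (f1 e0) (f2 e0) (f3 e0) (e0$1) (e0$2) (e0$3) (e0$4) * det3 (asd_coords e0 (f1 e)) (asd_coords e0 (f2 e)) (asd_coords e0 (f3 e))"
  proof (rule alt3_eq[OF F3 alt3_scale[OF vol3], of "f1 e0" "f2 e0" "f3 e0"])
    show "asd X x = span {f1 e0, f2 e0, f3 e0}"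
    proof
      show "asd X x \<subseteq> span {f1 e0, f2 e0, f3 e0}"
      proof
        fix \<alpha> assume "\<alpha> \<in> asd X x"
        from asd_expand[OF x e0 this] show "\<alpha> \<in> span {f1 e0, f2 e0, f3 e0}"
          by (rule ssubst[of _ _ "\<lambda>\<tau>. \<tau> \<in> span {f1 e0, f2 e0, f3 e0}"]) (intro span_add span_scale span_base; simp)
      qed
      show "span {f1 e0, f2 e0, f3 e0} \<subseteq> asd X x"
        by (rule span_minimal[OF _ subspace_asd]) (simp add: f_asd[OF x e0])
    qed
  qed (simp_all add: d0 f_asd[OF x e])
  also have "\<dots> = F (f1 e0) (f2 e0) (f3 e0) (e0$1) (e0$2) (e0$3) (e0$4)" by (simp add: d)
  also have "\<dots> = 1"
  proof -
    have ax: "bs_coords b c (x, \<omega>) (b $ i) = axis i 1" for i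
      by (simp add: bs_coords_def vec_eq_iff b_def bs_frame_orthonormal[OF e0 c] axis_def)
    have "F (f1 e0) (f2 e0) (f3 e0) (e0$1) (e0$2) (e0$3) (e0$4)
      = det7 (bs_coords b c (x, \<omega>) (b$1)) (bs_coords b c (x, \<omega>) (b$2)) (bs_coords b c (x, \<omega>) (b$3)) (bs_coords b c (x, \<omega>) (b$4))
     (bs_coords b c (x, \<omega>) (b$5)) (bs_coords b c (x, \<omega>) (b$6)) (bs_coords b c (x, \<omega>) (b$7))"
      by (simp add: F_def V_def H_def) (simp add: b_def bs_frame_def)
    then show ?thesis by (simp add: ax det7_axis)
  qed
  finally show ?thesis by (simp add: F_def V_def H_def b'_def bs_frame_def)
qed

text \<open>The two coordinate matrices differ by the factor \<open>?R\<close>, which has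
  determinant 1.\<close>

lemma det7_bs_coords_eq:
  fixes \<omega> :: "'v form2"
  assumes x: "x \<in> points X" and e0: "oframe X x e0" and e: "oframe X x e" and c: "c > 0"
  defines "b \<equiv> bs_frame e0 c (x, \<omega>)" and "b' \<equiv> bs_frame e c (x, \<omega>)"
  assumes w: "w1 \<in> TT x" "w2 \<in> TT x" "w3 \<in> TT x" "w4 \<in> TT x" "w5 \<in> TT x" "w6 \<in> TT x" "w7 \<in> TT x"
  shows "det7 (bs_coords b c (x, \<omega>) w1) (bs_coords b c (x, \<omega>) w2) (bs_coords b c (x, \<omega>) w3) (bs_coords b c (x, \<omega>) w4)
      (bs_coords b c (x, \<omega>) w5) (bs_coords b c (x, \<omega>) w6) (bs_coords b c (x, \<omega>) w7)
    = det7 (bs_coords b' c (x, \<omega>) w1) (bs_coords b' c (x, \<omega>) w2) (bs_coords b' c (x, \<omega>) w3) (bs_coords b' c (x, \<omega>) w4)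
      (bs_coords b' c (x, \<omega>) w5) (bs_coords b' c (x, \<omega>) w6) (bs_coords b' c (x, \<omega>) w7)"
proof -
  let ?q = "(x, \<omega>)"
  let ?M' = "vector [bs_coords b' c ?q w1, bs_coords b' c ?q w2, bs_coords b' c ?q w3, bs_coords b' c ?q w4, bs_coords b' c ?q w5, bs_coords b' c ?q w6, bs_coords b' c ?q w7] :: real^7^7"
  let ?M = "vector [bs_coords b c ?q w1, bs_coords b c ?q w2, bs_coords b c ?q w3, bs_coords b c ?q w4, bs_coords b c ?q w5, bs_coords b c ?q w6, bs_coords b c ?q w7] :: real^7^7"
  let ?R = "vector [bs_coords b c ?q (b'$1), bs_coords b c ?q (b'$2), bs_coords b c ?q (b'$3), bs_coords b c ?q (b'$4), bs_coords b c ?q (b'$5), bs_coords b c ?q (b'$6), bs_coords b c ?q (b'$7)] :: real^7^7"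
  have R: "det ?R = 1"
    using det7_bs_coords_frames[OF x e0 e c, of \<omega>] by (simp add: det7_def b_def b'_def)
  have row: "bs_coords b c ?q w $ l = (\<Sum>m\<in>UNIV. bs_coords b' c ?q w $ m * bs_coords b c ?q (b' $ m) $ l)" if "w \<in> TT x" for w l
  proof -
    have "bs_coords b c ?q w = bs_coords b c ?q (\<Sum>m\<in>UNIV. bs_metric c ?q (b' $ m) w *\<^sub>R b' $ m)"
      using bs_frame_expand[OF x e c that, of \<omega>] by (simp add: b'_def)
    also have "\<dots> = (\<Sum>m\<in>UNIV. bs_metric c ?q (b' $ m) w *\<^sub>R bs_coords b c ?q (b' $ m))"
      by (simp add: linear_sum[OF linear_bs_coords] linear_cmul[OF linear_bs_coords])
    finally show ?thesis by (simp add: bs_coords_def)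
  qed
  have "?M $ i $ l = (?M' ** ?R) $ i $ l" for i l
    using exhaust_7[of i]
    by (elim disjE) (simp_all add: matrix_matrix_mult_def sum_7 row w)
  then have "?M = ?M' ** ?R" by (simp add: vec_eq_iff)
  then have "det ?M = det ?M'" by (simp add: det_mul R)
  then show ?thesis by (simp add: det7_def)
qed

text \<open>The triple contraction is invariant one index at a time; exchanging the sums brings the
  index to be changed to the innermost place.\<close>

lemma psi_in_frames:
  fixes \<omega> :: "'v form2"
  assumes x: "x \<in> points X" and e0: "oframe X x e0" and e: "oframe X x e" and c: "c > 0"
    and w: "w1 \<in> TT x" "w2 \<in> TT x" "w3 \<in> TT x" "w4 \<in> TT x"
  shows "psi_in (bs_frame e0 c (x, \<omega>)) X c (x, \<omega>) w1 w2 w3 w4 = psi_in (bs_frame e c (x, \<omega>)) X c (x, \<omega>) w1 w2 w3 w4"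
proof -
  let ?q = "(x, \<omega>)"
  define b where "b = bs_frame e0 c ?q"
  define b' where "b' = bs_frame e c ?q"
  define D where "D = (\<lambda>p q r. det7 (bs_coords b c ?q p) (bs_coords b c ?q q) (bs_coords b c ?q r) (bs_coords b c ?q w1) (bs_coords b c ?q w2) (bs_coords b c ?q w3) (bs_coords b c ?q w4))"
  have D: "alt3 UNIV D" unfolding D_def by (rule alt3_compose[OF det7_alt(1) linear_bs_coords]) simp
  define \<phi> where "\<phi> = phi X c ?q"
  note \<phi>l = phi_linear[of X c ?q, folded \<phi>_def] and Dl = alt3_linear[OF D]
  have contract: "(\<Sum>i\<in>UNIV. K (b'$i) (b'$i)) = (\<Sum>i\<in>UNIV. K (b$i) (b$i))"
    if "\<And>y. linear (\<lambda>x. K x y)" "\<And>x. linear (\<lambda>y. K x y :: real)" for K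
  proof (rule contraction_invariant[OF that, where G = "bs_metric c ?q"])
    show "linear (bs_metric c ?q z)" for z by (rule linear_bs_metric)
    show "bs_metric c ?q (b $ i) (b $ j) = (if i = j then 1 else 0)" for i j
      unfolding b_def by (rule bs_frame_orthonormal[OF e0 c])
    show "b' $ i = (\<Sum>j\<in>UNIV. bs_metric c ?q (b $ j) (b' $ i) *\<^sub>R b $ j)" for i
      unfolding b_def b'_def by (rule bs_frame_expand[OF x e0 c bs_frame_in_TT[OF x e]])
    show "b $ i = (\<Sum>j\<in>UNIV. bs_metric c ?q (b $ i) (b' $ j) *\<^sub>R b' $ j)" for i
      unfolding b_def b'_def
      by (subst bs_metric_commute) (rule bs_frame_expand[OF x e c bs_frame_in_TT[OF x e0]])
  qed
  have prod: "linear (\<lambda>p. f p * k)" "linear (\<lambda>p. k * f p)" if "linear f" for f :: "'v \<times> 'v form2 \<Rightarrow> real" and k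
    using linear_cmult[OF that] by (simp_all add: mult.commute[of _ k])
  have "psi_in b' X c ?q w1 w2 w3 w4 = (\<Sum>i\<in>UNIV. \<Sum>j\<in>UNIV. \<Sum>k\<in>UNIV. \<phi> (b'$i) (b'$j) (b'$k) * D (b'$i) (b'$j) (b'$k)) / 6"
    using det7_bs_coords_eq[OF x e0 e c bs_frame_in_TT[OF x e] bs_frame_in_TT[OF x e] bs_frame_in_TT[OF x e] w, of \<omega>]
    by (simp add: psi_in_def D_def b_def b'_def \<phi>_def)
  also have "(\<Sum>i\<in>UNIV. \<Sum>j\<in>UNIV. \<Sum>k\<in>UNIV. \<phi> (b'$i) (b'$j) (b'$k) * D (b'$i) (b'$j) (b'$k))
    = (\<Sum>i\<in>UNIV. \<Sum>j\<in>UNIV. \<Sum>k\<in>UNIV. \<phi> (b'$i) (b'$j) (b$k) * D (b'$i) (b'$j) (b$k))"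
    by (intro sum.cong refl contract[of "\<lambda>p q. \<phi> _ _ p * D _ _ q"] prod \<phi>l Dl)
  also have "\<dots> = (\<Sum>i\<in>UNIV. \<Sum>k\<in>UNIV. \<Sum>j\<in>UNIV. \<phi> (b'$i) (b'$j) (b$k) * D (b'$i) (b'$j) (b$k))"
    by (intro sum.cong refl sum.swap)
  also have "\<dots> = (\<Sum>i\<in>UNIV. \<Sum>k\<in>UNIV. \<Sum>j\<in>UNIV. \<phi> (b'$i) (b$j) (b$k) * D (b'$i) (b$j) (b$k))"
    by (intro sum.cong refl contract[of "\<lambda>p q. \<phi> _ p _ * D _ q _"] prod \<phi>l Dl)
  also have "\<dots> = (\<Sum>i\<in>UNIV. \<Sum>j\<in>UNIV. \<Sum>k\<in>UNIV. \<phi> (b'$i) (b$j) (b$k) * D (b'$i) (b$j) (b$k))"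
    by (intro sum.cong refl sum.swap)
  also have "\<dots> = (\<Sum>j\<in>UNIV. \<Sum>i\<in>UNIV. \<Sum>k\<in>UNIV. \<phi> (b'$i) (b$j) (b$k) * D (b'$i) (b$j) (b$k))"
    by (rule sum.swap)
  also have "\<dots> = (\<Sum>j\<in>UNIV. \<Sum>k\<in>UNIV. \<Sum>i\<in>UNIV. \<phi> (b'$i) (b$j) (b$k) * D (b'$i) (b$j) (b$k))"
    by (intro sum.cong refl sum.swap)
  also have "\<dots> = (\<Sum>j\<in>UNIV. \<Sum>k\<in>UNIV. \<Sum>i\<in>UNIV. \<phi> (b$i) (b$j) (b$k) * D (b$i) (b$j) (b$k))"
    by (intro sum.cong refl contract[of "\<lambda>p q. \<phi> p _ _ * D q _ _"] prod \<phi>l Dl)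
  also have "\<dots> = (\<Sum>j\<in>UNIV. \<Sum>i\<in>UNIV. \<Sum>k\<in>UNIV. \<phi> (b$i) (b$j) (b$k) * D (b$i) (b$j) (b$k))"
    by (intro sum.cong refl sum.swap)
  also have "\<dots> = (\<Sum>i\<in>UNIV. \<Sum>j\<in>UNIV. \<Sum>k\<in>UNIV. \<phi> (b$i) (b$j) (b$k) * D (b$i) (b$j) (b$k))"
    by (rule sum.swap)
  finally show ?thesis by (simp add: psi_in_def D_def b_def b'_def \<phi>_def)
qed

text \<open>Only the triple 1, 6, 7 and its permutations contribute: it is complementary to 4, 5, 2,
  3, and \<open>phi\<close> equals -1 on it since \<open>f1\<close> is -1 on \<open>e$3\<close>,
  \<open>e$4\<close>. The terms linear in \<open>t1\<close> or \<open>t2\<close> replace 4 or 5 by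
  1, so their complementary triples are horizontal, where \<open>phi\<close> vanishes; the term with
  both has a repeated row. Hence the value does not depend on the vertical components.\<close>

lemma psi_value:
  fixes \<omega> :: "'v form2"
  assumes x: "x \<in> points X" and e: "oframe X x e" and c: "c > 0"
  shows "psi X c (x, \<omega>) (e$1, t1 *\<^sub>R f1 e) (e$2, t2 *\<^sub>R f1 e) (0, f2 e) (0, f3 e)
    = - ((bs_u c \<omega>)\<^sup>2 * (bs_v c \<omega>)\<^sup>2)"
proof -
  let ?q = "(x, \<omega>)"
  define u v where "u = bs_u c \<omega>" and "v = bs_v c \<omega>"
  have nz: "u \<noteq> 0" "v \<noteq> 0" using bs_u_pos[OF c, of \<omega>] bs_v_pos[OF c, of \<omega>] by (auto simp: u_def v_def)
  define b where "b = bs_frame e c ?q"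
  let ?ax = "\<lambda>i. axis i 1 :: real^7"
  note s = onf_simps[OF oframe_onf[OF e]]
  have ax: "bs_coords b c ?q (b $ i) = ?ax i" for i
    by (simp add: bs_coords_def vec_eq_iff b_def bs_frame_orthonormal[OF e c] axis_def)
  have b: "b $ 1 = (0, f1 e /\<^sub>R v)" "b $ 2 = (0, f2 e /\<^sub>R v)" "b $ 3 = (0, f3 e /\<^sub>R v)"
    "b $ 4 = (e$1 /\<^sub>R u, 0)" "b $ 5 = (e$2 /\<^sub>R u, 0)" "b $ 6 = (e$3 /\<^sub>R u, 0)" "b $ 7 = (e$4 /\<^sub>R u, 0)"
    by (simp_all add: b_def bs_frame_def u_def v_def)
  have w: "(e$1, t1 *\<^sub>R f1 e) = u *\<^sub>R b $ 4 + (v * t1) *\<^sub>R b $ 1" "(e$2, t2 *\<^sub>R f1 e) = u *\<^sub>R b $ 5 + (v * t2) *\<^sub>R b $ 1"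
    "(0, f2 e) = v *\<^sub>R b $ 2" "(0, f3 e) = v *\<^sub>R b $ 3"
    using nz by (simp_all add: b)
  have z: "0 \<in> tangent X x" "0 \<in> asd X x"
    using subspace_0[OF subspace_tangent[OF x]] subspace_0[OF subspace_asd] by auto
  have wT: "(e$1, t1 *\<^sub>R f1 e) \<in> TT x" "(e$2, t2 *\<^sub>R f1 e) \<in> TT x" "(0, f2 e) \<in> TT x" "(0, f3 e) \<in> TT x"
    using f_asd[OF x e] oframe_tangent[OF e] z by (simp_all add: subspace_scale[OF subspace_asd])
  define D where "D = (\<lambda>i j k. det7 (?ax i) (?ax j) (?ax k) (u *\<^sub>R ?ax 4 + (v * t1) *\<^sub>R ?ax 1)
     (u *\<^sub>R ?ax 5 + (v * t2) *\<^sub>R ?ax 1) (v *\<^sub>R ?ax 2) (v *\<^sub>R ?ax 3))"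
  note l4 = alt4_linear[OF det7_alt(2)]
  have D_expand: "D i j k = u * (u * (v * (v * det7 (?ax i) (?ax j) (?ax k) (?ax 4) (?ax 5) (?ax 2) (?ax 3))))
     + u * (v * t2 * (v * (v * det7 (?ax i) (?ax j) (?ax k) (?ax 4) (?ax 1) (?ax 2) (?ax 3))))
     + v * t1 * (u * (v * (v * det7 (?ax i) (?ax j) (?ax k) (?ax 1) (?ax 5) (?ax 2) (?ax 3))))
     + v * t1 * (v * t2 * (v * (v * det7 (?ax i) (?ax j) (?ax k) (?ax 1) (?ax 1) (?ax 2) (?ax 3))))" for i j k
    unfolding D_def
    by (simp only: linear_add[OF l4(1)] linear_cmul[OF l4(1)] linear_add[OF l4(2)] linear_cmul[OF l4(2)]
        linear_add[OF l4(3)] linear_cmul[OF l4(3)] linear_add[OF l4(4)] linear_cmul[OF l4(4)] real_scaleR_def)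
      (simp only: algebra_simps)
  have d0: "det7 a1 a2 a3 a4 a5 a6 a7 = 0"
    if "a1 = a2 \<or> a1 = a3 \<or> a1 = a4 \<or> a1 = a5 \<or> a1 = a6 \<or> a1 = a7 \<or> a2 = a3 \<or> a2 = a4 \<or> a2 = a5 \<or> a2 = a6 \<or> a2 = a7
      \<or> a3 = a4 \<or> a3 = a5 \<or> a3 = a6 \<or> a3 = a7 \<or> a4 = a5" for a1 a2 a3 a4 a5 a6 a7
    using that det7_eq_0[of a1 a2 a3 a4 a5 a6 a7 1 2] det7_eq_0[of a1 a2 a3 a4 a5 a6 a7 1 3] det7_eq_0[of a1 a2 a3 a4 a5 a6 a7 1 4]
      det7_eq_0[of a1 a2 a3 a4 a5 a6 a7 1 5] det7_eq_0[of a1 a2 a3 a4 a5 a6 a7 1 6] det7_eq_0[of a1 a2 a3 a4 a5 a6 a7 1 7]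
      det7_eq_0[of a1 a2 a3 a4 a5 a6 a7 2 3] det7_eq_0[of a1 a2 a3 a4 a5 a6 a7 2 4] det7_eq_0[of a1 a2 a3 a4 a5 a6 a7 2 5]
      det7_eq_0[of a1 a2 a3 a4 a5 a6 a7 2 6] det7_eq_0[of a1 a2 a3 a4 a5 a6 a7 2 7] det7_eq_0[of a1 a2 a3 a4 a5 a6 a7 3 4]
      det7_eq_0[of a1 a2 a3 a4 a5 a6 a7 3 5] det7_eq_0[of a1 a2 a3 a4 a5 a6 a7 3 6] det7_eq_0[of a1 a2 a3 a4 a5 a6 a7 3 7]
      det7_eq_0[of a1 a2 a3 a4 a5 a6 a7 4 5]
    by (elim disjE) simp_all
  have D0: "D i j k = 0" if "i \<in> {2, 3} \<or> j \<in> {2, 3} \<or> k \<in> {2, 3} \<or> i = j \<or> j = k \<or> i = k" for i j k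
  proof -
    have "det7 (?ax i) (?ax j) (?ax k) a4 a5 (?ax 2) (?ax 3) = 0" for a4 a5
      by (rule d0) (use that in auto)
    then show ?thesis by (simp add: D_expand)
  qed
  \<comment> \<open>Two transpositions, of 2 with 6 and of 3 with 7, sort the rows, so the sign is
    positive.\<close>
  have d1: "det7 (?ax 1) (?ax 6) (?ax 7) (?ax 4) (?ax 5) (?ax 2) (?ax 3) = 1"
    using det7_swap(6)[of "?ax 1" "?ax 6" "?ax 7" "?ax 4" "?ax 5" "?ax 2" "?ax 3"]
      det7_swap(7)[of "?ax 1" "?ax 2" "?ax 7" "?ax 4" "?ax 5" "?ax 6" "?ax 3"] det7_axis by simp
  have D167: "D 1 6 7 = u\<^sup>2 * v\<^sup>2"
    unfolding D_expand by (simp add: d1 d0 power2_eq_square)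
  have D145: "D 1 4 5 = 0" unfolding D_expand by (simp add: d0)
  have Da: "alt3 UNIV (\<lambda>a1 a2 a3. det7 a1 a2 a3 a4 a5 a6 a7)" for a4 a5 a6 a7 by (rule det7_alt)
  have Ds: "D j i k = - D i j k" "D i k j = - D i j k" for i j k
    unfolding D_def by (rule alt3_swap[OF Da UNIV_I UNIV_I UNIV_I])+
  define P where "P = (\<lambda>i j k. phi X c ?q (b$i) (b$j) (b$k))"
  have Ps: "P j i k = - P i j k" "P i k j = - P i j k" for i j k
    unfolding P_def b_def by (rule alt3_swap[OF alt3_phi] bs_frame_in_TT[OF x e])+
  have sa: "snd (b $ i) \<in> asd X x" for i using bs_frame_in_TT[OF x e, of c \<omega> i] by (auto simp: b_def mem_Times_iff)
  have Pf: "P i j k = v^3 * det3 (asd_coords e (snd (b$i))) (asd_coords e (snd (b$j))) (asd_coords e (snd (b$k)))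
     + u\<^sup>2 * v * (ev (snd (b$i)) (fst (b$j)) (fst (b$k)) + ev (snd (b$j)) (fst (b$k)) (fst (b$i)) + ev (snd (b$k)) (fst (b$i)) (fst (b$j)))" for i j k
    unfolding P_def by (simp add: phi_frame[OF x e sa sa sa] u_def v_def)
  have co0: "asd_coords e 0 = 0" by (simp add: asd_coords_def vec_eq_iff forall_3)
  have P1: "P 1 j k = u\<^sup>2 * v * ev (f1 e /\<^sub>R v) (fst (b$j)) (fst (b$k))" if "j \<in> {4,5,6,7}" "k \<in> {4,5,6,7}" for j k
  proof -
    have "snd (b$j) = 0" "snd (b$k) = 0" "fst (b$1) = 0" using that by (auto simp: b)
    then show ?thesis unfolding Pf by (simp add: co0 alt3_det3 det3_def det_3 ev_simps b(1))
  qed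
  have P0: "P i j k = 0" if "i \<in> {4,5,6,7}" "j \<in> {4,5,6,7}" "k \<in> {4,5,6,7}" for i j k
  proof -
    have "snd (b$i) = 0" "snd (b$j) = 0" "snd (b$k) = 0" using that by (auto simp: b)
    then show ?thesis unfolding Pf by (simp add: co0 det3_def det_3 ev_simps)
  qed
  have P167: "P 1 6 7 = -1"
    using nz by (simp add: P1) (simp add: b ev_simps ev_f s field_simps power2_eq_square)
  have P1_0: "P 1 4 6 = 0" "P 1 4 7 = 0" "P 1 5 6 = 0" "P 1 5 7 = 0"
    by (simp_all add: P1) (simp_all add: b ev_simps ev_f s)
  let ?good = "{(1,6,7), (1,7,6), (6,1,7), (6,7,1), (7,1,6), (7,6,1)} :: (7 \<times> 7 \<times> 7) set"
  \<comment> \<open>A product of two alternating families is symmetric, so its values on unordered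
    triples determine the sum.\<close>
  define S where "S = (\<lambda>i j k. P i j k * D i j k)"
  have Ss: "S j i k = S i j k" "S i k j = S i j k" for i j k
    unfolding S_def using Ds(1)[of j i k] Ds(2)[of i k j] Ps(1)[of j i k] Ps(2)[of i k j] by simp_all
  have S0: "S i j k = 0" if "i \<in> {2, 3} \<or> j \<in> {2, 3} \<or> k \<in> {2, 3} \<or> i = j \<or> j = k \<or> i = k" for i j k
    using D0[OF that] by (simp add: S_def)
  have S1: "S 1 4 5 = 0" "S 1 4 6 = 0" "S 1 4 7 = 0" "S 1 5 6 = 0" "S 1 5 7 = 0" "S 1 6 7 = - (u\<^sup>2 * v\<^sup>2)"
    by (simp_all add: S_def D145 P1_0 D167 P167)
  have S4: "S i j k = 0" if "i \<in> {4,5,6,7}" "j \<in> {4,5,6,7}" "k \<in> {4,5,6,7}" for i j k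
    using P0[OF that] by (simp add: S_def)
  have S1s: "S 1 5 4 = 0" "S 1 6 4 = 0" "S 1 7 4 = 0" "S 1 6 5 = 0" "S 1 7 5 = 0" "S 1 7 6 = - (u\<^sup>2 * v\<^sup>2)"
    using S1 Ss(2)[of 1] by metis+
  have S2s: "S j 1 k = S 1 j k" "S j k 1 = S 1 j k" for j k
    using Ss(1)[of 1 j k] Ss(2)[of j 1 k] by metis+
  have S: "S 1 j k = (if (j, k) = (6, 7) \<or> (j, k) = (7, 6) then - (u\<^sup>2 * v\<^sup>2) else 0)" for j k
    using exhaust_7[of j] exhaust_7[of k] by (elim disjE) (simp_all add: S0 S1 S1s)
  have Srow: "(\<Sum>j\<in>UNIV. \<Sum>k\<in>UNIV. S 1 j k) = - 2 * (u\<^sup>2 * v\<^sup>2)"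
    by (simp add: sum_7 S)
  have Srow4: "(\<Sum>j\<in>UNIV. \<Sum>k\<in>UNIV. S i j k) = 2 * (\<Sum>k\<in>UNIV. S 1 i k)" if "i \<in> {4,5,6,7}" for i
  proof -
    have "(\<Sum>k\<in>UNIV. S i j k) = S 1 i j" if j: "j \<noteq> 1" for j
    proof -
      have "S i j k = (if k = 1 then S 1 i j else 0)" for k
        using exhaust_7[of k] exhaust_7[of j] j S0[of i j k] S4[OF \<open>i \<in> _\<close>, of j k] S2s(2)[of i j] by auto
      then show ?thesis by simp
    qed
    then have "(\<Sum>k\<in>UNIV. S i j k) = (if j = 1 then (\<Sum>k\<in>UNIV. S 1 i k) else S 1 i j)" for j
      by (simp add: S2s(1))
    then have "(\<Sum>j\<in>UNIV. \<Sum>k\<in>UNIV. S i j k) = (\<Sum>j\<in>UNIV. (if j = 1 then (\<Sum>k\<in>UNIV. S 1 i k) else 0) + S 1 i j)"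
      by (intro sum.cong) (auto simp: S0)
    then show ?thesis by (simp add: sum.distrib)
  qed
  have Srow2: "(\<Sum>j\<in>UNIV. \<Sum>k\<in>UNIV. S i j k) = 0" if "i \<in> {2, 3}" for i
    using that by (simp add: S0)
  have total: "(\<Sum>i\<in>UNIV. \<Sum>j\<in>UNIV. \<Sum>k\<in>UNIV. S i j k) = - 6 * (u\<^sup>2 * v\<^sup>2)"
    by (subst sum_7) (simp add: Srow Srow2 Srow4, simp add: sum_7 S)
  have cw: "bs_coords b c ?q (u *\<^sub>R b $ 4 + (v * t1) *\<^sub>R b $ 1) = u *\<^sub>R ?ax 4 + (v * t1) *\<^sub>R ?ax 1"
     "bs_coords b c ?q (u *\<^sub>R b $ 5 + (v * t2) *\<^sub>R b $ 1) = u *\<^sub>R ?ax 5 + (v * t2) *\<^sub>R ?ax 1"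
     "bs_coords b c ?q (v *\<^sub>R b $ 2) = v *\<^sub>R ?ax 2" "bs_coords b c ?q (v *\<^sub>R b $ 3) = v *\<^sub>R ?ax 3"
    by (simp_all only: linear_add[OF linear_bs_coords] linear_cmul[OF linear_bs_coords] ax)
  have "psi X c ?q (e$1, t1 *\<^sub>R f1 e) (e$2, t2 *\<^sub>R f1 e) (0, f2 e) (0, f3 e)
      = psi_in b X c ?q (e$1, t1 *\<^sub>R f1 e) (e$2, t2 *\<^sub>R f1 e) (0, f2 e) (0, f3 e)"
    unfolding psi_eq_psi_in b_def fst_conv by (rule psi_in_frames[OF x some_oframe_frame[OF x] e c wT])
  also have "\<dots> = (\<Sum>i\<in>UNIV. \<Sum>j\<in>UNIV. \<Sum>k\<in>UNIV. S i j k) / 6"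
    unfolding psi_in_def w cw ax S_def P_def D_def ..
  finally show ?thesis by (simp add: total u_def v_def)
qed

end

section \<open>Immersed surfaces and adapted frames\<close>

text \<open>Normalization, written with the quotient covered by
  \<open>smooth_on_inverse_sqrt\<close>; \<open>gs2\<close> is the second Gram-Schmidt
  vector.\<close>

definition gs1 :: "'v::euclidean_space \<Rightarrow> 'v" where
  "gs1 a = (1 / sqrt (a \<bullet> a)) *\<^sub>R a"

definition gs2 :: "'v::euclidean_space \<Rightarrow> 'v \<Rightarrow> 'v" where
  "gs2 a b = gs1 (b - (b \<bullet> gs1 a) *\<^sub>R gs1 a)"

lemma gs1_unit: "a \<noteq> 0 \<Longrightarrow> gs1 a \<bullet> gs1 a = 1"
  by (simp add: gs1_def real_sqrt_mult_self field_simps)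

lemma gs1_of_unit: "a \<bullet> a = 1 \<Longrightarrow> gs1 a = a"
  by (simp add: gs1_def)

lemma smooth_on_gs1:
  assumes "open S" "smooth_on S f" "\<And>x. x \<in> S \<Longrightarrow> f x \<noteq> 0"
  shows "smooth_on S (\<lambda>x. gs1 (f x))"
  unfolding gs1_def using assms
  by (intro smooth_on_scaleR smooth_on_inverse_sqrt smooth_on_inner) auto

lemma det_vector_2: "det (vector [h, h'] :: real^2^2) = h$1 * h'$2 - h$2 * h'$1"
  by (simp add: det_2)

lemma cramer_2:
  fixes h1 h2 g :: "real^2"
  assumes "det (vector [h1, h2] :: real^2^2) > 0"
  shows "\<exists>r s. g = r *\<^sub>R h1 + s *\<^sub>R h2"
proof (intro exI)
  let ?D = "h1$1 * h2$2 - h1$2 * h2$1"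
  let ?r = "(g$1 * h2$2 - g$2 * h2$1) / ?D" and ?s = "(h1$1 * g$2 - h1$2 * g$1) / ?D"
  have D: "?D > 0" using assms by (simp add: det_vector_2)
  have "g$1 * ?D = (g$1 * h2$2 - g$2 * h2$1) * h1$1 + (h1$1 * g$2 - h1$2 * g$1) * h2$1"
    "g$2 * ?D = (g$1 * h2$2 - g$2 * h2$1) * h1$2 + (h1$1 * g$2 - h1$2 * g$1) * h2$2"
    by (simp_all add: algebra_simps)
  then have "g$1 = ((g$1 * h2$2 - g$2 * h2$1) * h1$1 + (h1$1 * g$2 - h1$2 * g$1) * h2$1) / ?D"
    "g$2 = ((g$1 * h2$2 - g$2 * h2$1) * h1$2 + (h1$1 * g$2 - h1$2 * g$1) * h2$2) / ?D"
    using D by (simp_all only: eq_divide_eq) auto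
  then show "g = ?r *\<^sub>R h1 + ?s *\<^sub>R h2"
    by (simp add: vec_eq_iff forall_2 add_divide_distrib)
qed

locale surface_in = ambient X for X :: "'v::euclidean_space riem4" +
  fixes A :: "'l::topological_space params" and \<iota> :: "'l \<Rightarrow> 'v"
  assumes surf: "oriented_surface A" and imm: "immersed X A \<iota>"
begin

lemma chart_cover: "\<exists>U k x. (U, k) \<in> A \<and> x \<in> U \<and> k x = p"
proof -
  have "p \<in> (\<Union>(U, k)\<in>A. k ` U)" using surf unfolding oriented_surface_def by blast
  then show ?thesis by auto
qed

lemma chart:
  assumes "(U, k) \<in> A"
  shows "open U" "open (k ` U)" "homeomorphism U (k ` U) k (inv_into U k)"
  using surf assms unfolding oriented_surface_def by fastforce+

lemma chart_continuous: "(U, k) \<in> A \<Longrightarrow> continuous_on U k"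
  using chart(3) homeomorphism_def by blast

lemma chart_inv: "(U, k) \<in> A \<Longrightarrow> x \<in> U \<Longrightarrow> inv_into U k (k x) = x"
  using chart(3) homeomorphism_apply1 by metis

lemma chart_open_image:
  assumes "(U, k) \<in> A" "open W" "W \<subseteq> U"
  shows "open (k ` W)"
proof -
  have "openin (top_of_set (k ` U)) (k ` W)"
    using homeomorphism_imp_open_map[OF chart(3)[OF assms(1)]] assms(2,3)
    by (metis open_subset)
  then show ?thesis using chart(2)[OF assms(1)] openin_open_trans by blast
qed

lemma \<iota>_points: "\<iota> p \<in> points X"
  using imm unfolding immersed_def by auto

lemma smooth_\<iota>: "smooth_along A \<iota>"
  using imm unfolding immersed_def by auto

lemma smooth_alongD: "smooth_along A Y \<Longrightarrow> (U, k) \<in> A \<Longrightarrow> smooth_on U (Y \<circ> k)"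
  unfolding smooth_along_def by auto

lemma smooth_along_differentiable:
  "smooth_along A Y \<Longrightarrow> (U, k) \<in> A \<Longrightarrow> x \<in> U \<Longrightarrow> (Y \<circ> k) differentiable (at x)"
  using smooth_alongD smooth_on_differentiable by blast

lemma smooth_along_has_derivative:
  "smooth_along A Y \<Longrightarrow> (U, k) \<in> A \<Longrightarrow> x \<in> U \<Longrightarrow>
    (Y \<circ> k has_derivative frechet_derivative (Y \<circ> k) (at x)) (at x)"
  using smooth_along_differentiable frechet_works by blast

lemma linear_frechet:
  "smooth_along A Y \<Longrightarrow> (U, k) \<in> A \<Longrightarrow> x \<in> U \<Longrightarrow> linear (frechet_derivative (Y \<circ> k) (at x))"
  using smooth_along_differentiable linear_frechet_derivative by blast

lemma inj_d\<iota>: "(U, k) \<in> A \<Longrightarrow> x \<in> U \<Longrightarrow> inj (frechet_derivative (\<iota> \<circ> k) (at x))"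
  using imm unfolding immersed_def by auto

text \<open>\<open>M\<close> is the derivative of the transition map and does not depend on
  \<open>Y\<close>; its determinant is positive because the atlas is oriented. The last conjunct is
  kept apart because the quantified \<open>Y\<close> has a fixed value type, which need not be that
  of \<open>\<iota>\<close>.\<close>

lemma transition:
  assumes k: "(U, k) \<in> A" "x \<in> U" and m: "(V, m) \<in> A" "y \<in> V" and eq: "k x = m y"
  shows "\<exists>M. linear M \<and> det (matrix M) > 0 \<and>
    (\<forall>Y :: 'l \<Rightarrow> 'w::real_normed_vector. smooth_along A Y \<longrightarrow>
       frechet_derivative (Y \<circ> k) (at x) = frechet_derivative (Y \<circ> m) (at y) \<circ> M) \<and>
    frechet_derivative (\<iota> \<circ> k) (at x) = frechet_derivative (\<iota> \<circ> m) (at y) \<circ> M"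
proof -
  let ?\<tau> = "inv_into V m \<circ> k"
  let ?W = "U \<inter> k -` (m ` V)"
  have W: "open ?W"
    using chart_continuous[OF k(1)] chart(1)[OF k(1)] chart(2)[OF m(1)]
    by (metis Int_commute continuous_on_open_vimage)
  have x: "x \<in> ?W" using k(2) m(2) eq by auto
  have s: "smooth_on ?W ?\<tau>" and d: "det (matrix (frechet_derivative ?\<tau> (at x))) > 0"
    using surf k m x unfolding oriented_surface_def by fastforce+
  have \<tau>: "m (?\<tau> z) = k z" if "z \<in> ?W" for z
    using that by (auto simp: f_inv_into_f)
  have \<tau>x: "?\<tau> x = y" using chart_inv[OF m] eq by simp
  have D: "(?\<tau> has_derivative frechet_derivative ?\<tau> (at x)) (at x)"
    by (rule frechet_works[OF smooth_on_differentiable[OF s x]])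
  have chain: "frechet_derivative (Y \<circ> k) (at x) = frechet_derivative (Y \<circ> m) (at y) \<circ> frechet_derivative ?\<tau> (at x)"
    if Y: "smooth_along A Y" for Y :: "'l \<Rightarrow> 'z::real_normed_vector"
  proof -
    have "(Y \<circ> m has_derivative frechet_derivative (Y \<circ> m) (at y)) (at (?\<tau> x))"
      unfolding \<tau>x by (rule smooth_along_has_derivative[OF Y m])
    from diff_chain_at[OF D this]
    have "(Y \<circ> k has_derivative frechet_derivative (Y \<circ> m) (at y) \<circ> frechet_derivative ?\<tau> (at x)) (at x)"
      by (rule has_derivative_transform_within_open[OF _ W x]) (use \<tau> in \<open>simp add: o_def\<close>)
    then show ?thesis by (rule frechet_eqI)
  qed
  have "linear (frechet_derivative ?\<tau> (at x))"
    by (rule linear_frechet_derivative[OF smooth_on_differentiable[OF s x]])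
  then show ?thesis using d chain chain[OF smooth_\<iota>] by blast
qed

text \<open>The unique choice is legitimate: since the differential of \<open>\<iota>\<close> is
  injective, the coordinate vectors of one tangent vector in two charts correspond under the
  transition, and then the derivatives of \<open>Y\<close> agree.\<close>

lemma deriv_along_chart:
  assumes Y: "smooth_along A Y" and k: "(U, k) \<in> A" "x \<in> U"
  shows "deriv_along A \<iota> Y (k x) (frechet_derivative (\<iota> \<circ> k) (at x) h) = frechet_derivative (Y \<circ> k) (at x) h"
  unfolding deriv_along_def
proof (rule the_equality)
  show "\<exists>V m y h'. (V, m) \<in> A \<and> y \<in> V \<and> m y = k x \<and>
     frechet_derivative (\<iota> \<circ> m) (at y) h' = frechet_derivative (\<iota> \<circ> k) (at x) h \<and>
     frechet_derivative (Y \<circ> m) (at y) h' = frechet_derivative (Y \<circ> k) (at x) h"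
    using k by blast
  fix d
  assume "\<exists>V m y h'. (V, m) \<in> A \<and> y \<in> V \<and> m y = k x \<and>
     frechet_derivative (\<iota> \<circ> m) (at y) h' = frechet_derivative (\<iota> \<circ> k) (at x) h \<and>
     frechet_derivative (Y \<circ> m) (at y) h' = d"
  then obtain V m y h' where m: "(V, m) \<in> A" "y \<in> V" "m y = k x"
    "frechet_derivative (\<iota> \<circ> m) (at y) h' = frechet_derivative (\<iota> \<circ> k) (at x) h"
    "frechet_derivative (Y \<circ> m) (at y) h' = d" by blast
  obtain M where M: "frechet_derivative (Y \<circ> m) (at y) = frechet_derivative (Y \<circ> k) (at x) \<circ> M"
    "frechet_derivative (\<iota> \<circ> m) (at y) = frechet_derivative (\<iota> \<circ> k) (at x) \<circ> M"
    using transition[OF m(1,2) k m(3)] Y by blast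
  have "M h' = h" using m(4) inj_d\<iota>[OF k] unfolding M(2) by (auto dest: injD)
  then show "d = frechet_derivative (Y \<circ> k) (at x) h" using m(5) M(1) by simp
qed

lemma tangentL_chart:
  assumes k: "(U, k) \<in> A" "x \<in> U"
  shows "tangentL A \<iota> (k x) = range (frechet_derivative (\<iota> \<circ> k) (at x))"
proof
  show "tangentL A \<iota> (k x) \<subseteq> range (frechet_derivative (\<iota> \<circ> k) (at x))"
  proof
    fix w assume "w \<in> tangentL A \<iota> (k x)"
    then obtain V m y h where m: "(V, m) \<in> A" "y \<in> V" "m y = k x" "w = frechet_derivative (\<iota> \<circ> m) (at y) h"
      unfolding tangentL_def by blast
    obtain M where "frechet_derivative (\<iota> \<circ> m) (at y) = frechet_derivative (\<iota> \<circ> k) (at x) \<circ> M"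
      using transition[OF m(1,2) k m(3)] by blast
    then show "w \<in> range (frechet_derivative (\<iota> \<circ> k) (at x))" using m(4) by auto
  qed
  show "range (frechet_derivative (\<iota> \<circ> k) (at x)) \<subseteq> tangentL A \<iota> (k x)"
    unfolding tangentL_def using k by blast
qed

text \<open>A change of chart multiplies the determinant of the coordinate vectors by a positive
  number, so a single chart decides the orientation of a frame.\<close>

lemma oframeL_chart:
  assumes k: "(U, k) \<in> A" "x \<in> U"
  shows "oframeL A \<iota> (k x) e1 e2 \<longleftrightarrow> norm e1 = 1 \<and> norm e2 = 1 \<and> e1 \<bullet> e2 = 0 \<and>
     (\<exists>h1 h2. det (vector [h1, h2] :: real^2^2) > 0 \<and>
        frechet_derivative (\<iota> \<circ> k) (at x) h1 = e1 \<and> frechet_derivative (\<iota> \<circ> k) (at x) h2 = e2)"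
proof
  assume o: "oframeL A \<iota> (k x) e1 e2"
  then obtain V m y h1 h2 where m: "(V, m) \<in> A" "y \<in> V" "m y = k x" "det (vector [h1, h2] :: real^2^2) > 0"
    "frechet_derivative (\<iota> \<circ> m) (at y) h1 = e1" "frechet_derivative (\<iota> \<circ> m) (at y) h2 = e2"
    unfolding oframeL_def by blast
  obtain M where M: "linear M" "det (matrix M) > 0"
    "frechet_derivative (\<iota> \<circ> m) (at y) = frechet_derivative (\<iota> \<circ> k) (at x) \<circ> M"
    using transition[OF m(1,2) k m(3)] by blast
  have "det (vector [M h1, M h2] :: real^2^2) = det (matrix M) * det (vector [h1, h2] :: real^2^2)"
  proof -
    have "M h = matrix M *v h" for h by (simp add: matrix_works M(1))
    then show ?thesis
      by (simp add: det_2 matrix_vector_mult_def sum_2 algebra_simps)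
  qed
  then have "det (vector [M h1, M h2] :: real^2^2) > 0" using M(2) m(4) by simp
  then show "norm e1 = 1 \<and> norm e2 = 1 \<and> e1 \<bullet> e2 = 0 \<and>
     (\<exists>h1 h2. det (vector [h1, h2] :: real^2^2) > 0 \<and>
        frechet_derivative (\<iota> \<circ> k) (at x) h1 = e1 \<and> frechet_derivative (\<iota> \<circ> k) (at x) h2 = e2)"
    using o m(5,6) M(3) unfolding oframeL_def by auto
next
  assume "norm e1 = 1 \<and> norm e2 = 1 \<and> e1 \<bullet> e2 = 0 \<and>
     (\<exists>h1 h2. det (vector [h1, h2] :: real^2^2) > 0 \<and>
        frechet_derivative (\<iota> \<circ> k) (at x) h1 = e1 \<and> frechet_derivative (\<iota> \<circ> k) (at x) h2 = e2)"
  then show "oframeL A \<iota> (k x) e1 e2" unfolding oframeL_def using k by blast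
qed

lemma line_in_open:
  assumes "open W" "x \<in> W"
  shows "\<exists>\<epsilon>>0. \<forall>t\<in>{-\<epsilon><..<\<epsilon>}. x + t *\<^sub>R h \<in> (W :: (real^2) set)"
proof -
  have "isCont (\<lambda>t. x + t *\<^sub>R h) (0::real)" by (intro continuous_intros)
  then have "\<forall>\<^sub>F t in at 0. x + t *\<^sub>R h \<in> W"
    using assms by (intro topological_tendstoD) (auto simp: isCont_def)
  then obtain \<epsilon> where "\<epsilon> > 0" "\<forall>t. t \<noteq> 0 \<and> dist t 0 < \<epsilon> \<longrightarrow> x + t *\<^sub>R h \<in> W"
    unfolding eventually_at by auto
  then show ?thesis using assms(2)
    by (intro exI[of _ \<epsilon>]) (auto simp: dist_real_def abs_less_iff, metis add.right_neutral scaleR_zero_left abs_less_iff minus_less_iff)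
qed

text \<open>\<open>tangent\<close> is defined by curves, so a tangent vector of \<open>L\<close> is
  realized by the image of a straight segment in a chart.\<close>

lemma tangentL_tangent: "tangentL A \<iota> p \<subseteq> tangent X (\<iota> p)"
proof
  fix w assume "w \<in> tangentL A \<iota> p"
  then obtain U k x h where k: "(U, k) \<in> A" "x \<in> U" "k x = p" and w: "w = frechet_derivative (\<iota> \<circ> k) (at x) h"
    unfolding tangentL_def by blast
  obtain \<epsilon> where \<epsilon>: "\<epsilon> > 0" "\<forall>t\<in>{-\<epsilon><..<\<epsilon>}. x + t *\<^sub>R h \<in> U"
    using line_in_open[OF chart(1)[OF k(1)] k(2)] by blast
  let ?\<gamma> = "\<lambda>t. (\<iota> \<circ> k) (x + t *\<^sub>R h)"
  have s: "smooth_on {-\<epsilon><..<\<epsilon>} ?\<gamma>"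
    by (rule smooth_on_line[OF smooth_alongD[OF smooth_\<iota> k(1)]]) (use \<epsilon> in auto)
  have "((\<lambda>t. x + t *\<^sub>R h) has_derivative (\<lambda>r. r *\<^sub>R h)) (at (0::real))"
    by (auto intro!: derivative_eq_intros)
  moreover have "(\<iota> \<circ> k has_derivative frechet_derivative (\<iota> \<circ> k) (at x)) (at (x + 0 *\<^sub>R h))"
    using smooth_along_has_derivative[OF smooth_\<iota> k(1,2)] by simp
  ultimately have "(?\<gamma> has_derivative (\<lambda>r. frechet_derivative (\<iota> \<circ> k) (at x) (r *\<^sub>R h))) (at 0)"
    by (rule has_derivative_compose)
  then have "(?\<gamma> has_vector_derivative w) (at 0)"
    by (simp add: has_vector_derivative_def linear_cmul[OF linear_frechet[OF smooth_\<iota> k(1,2)]] w)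
  moreover have "?\<gamma> 0 = \<iota> p" "?\<gamma> ` {-\<epsilon><..<\<epsilon>} \<subseteq> points X" using k(3) \<iota>_points by auto
  ultimately show "w \<in> tangent X (\<iota> p)" unfolding tangent_def using \<epsilon>(1) s by blast
qed

lemma oframeL_in_tangentL:
  assumes "oframeL A \<iota> p e1 e2" shows "e1 \<in> tangentL A \<iota> p" "e2 \<in> tangentL A \<iota> p"
  using assms unfolding oframeL_def tangentL_def by blast+

lemma oframeL_inner:
  assumes "oframeL A \<iota> p e1 e2" shows "e1 \<bullet> e1 = 1" "e2 \<bullet> e2 = 1" "e1 \<bullet> e2 = 0" "e2 \<bullet> e1 = 0"
  using assms unfolding oframeL_def by (auto simp: dot_square_norm inner_commute)

lemma oframeL_completion:
  assumes "oframeL A \<iota> p e1 e2"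
  shows "\<exists>e. adapted X A \<iota> p e \<and> e $ 1 = e1 \<and> e $ 2 = e2"
proof -
  obtain c d where "oframe X (\<iota> p) (vector [e1, e2, c, d])"
    using frame_completion2[OF \<iota>_points, of e1 p e2] oframeL_in_tangentL[OF assms] tangentL_tangent oframeL_inner[OF assms]
    by blast
  then show ?thesis
    using assms by (intro exI[of _ "vector [e1, e2, c, d]"]) (simp add: adapted_def)
qed

lemma adapted_frames:
  assumes "adapted X A \<iota> p e" shows "oframe X (\<iota> p) e" "oframeL A \<iota> p (e$1) (e$2)" "onf e"
  using assms oframe_onf unfolding adapted_def by auto

text \<open>The coordinate vectors of the Gram-Schmidt frame are kept explicit: their triangular
  shape shows that the orientation is preserved, and their formulas later give the fields
  \<open>H1\<close> and \<open>H2\<close> of a local frame.\<close>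

lemma gram_schmidt_oframeL:
  assumes k: "(U, k) \<in> A" "x \<in> U" and h: "det (vector [h1, h2] :: real^2^2) > 0"
  defines "d \<equiv> frechet_derivative (\<iota> \<circ> k) (at x)"
  defines "r \<equiv> 1 / sqrt (d h1 \<bullet> d h1)" and "s \<equiv> d h2 \<bullet> gs1 (d h1)"
  defines "b' \<equiv> d h2 - s *\<^sub>R gs1 (d h1)"
  shows "d h1 \<noteq> 0" "b' \<noteq> 0" "gs1 (d h1) = d (r *\<^sub>R h1)"
    "gs2 (d h1) (d h2) = d ((1 / sqrt (b' \<bullet> b')) *\<^sub>R (h2 - (s * r) *\<^sub>R h1))"
    "oframeL A \<iota> (k x) (gs1 (d h1)) (gs2 (d h1) (d h2))"
proof -
  have lin: "linear d" unfolding d_def by (rule linear_frechet[OF smooth_\<iota> k])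
  have inj: "inj d" unfolding d_def by (rule inj_d\<iota>[OF k])
  then have d0: "d z = 0 \<longleftrightarrow> z = 0" for z
    using linear_0[OF lin] by (metis injD)
  have D: "h1$1 * h2$2 - h1$2 * h2$1 > 0" using h by (simp add: det_vector_2)
  then have "h1 \<noteq> 0" by auto
  then show a: "d h1 \<noteq> 0" using d0 by simp
  show g1: "gs1 (d h1) = d (r *\<^sub>R h1)" by (simp add: gs1_def r_def linear_cmul[OF lin])
  have b'_eq: "b' = d (h2 - (s * r) *\<^sub>R h1)"
    by (simp add: b'_def g1 linear_cmul[OF lin] linear_diff[OF lin])
  have "h2 - (s * r) *\<^sub>R h1 \<noteq> 0"
  proof
    assume "h2 - (s * r) *\<^sub>R h1 = 0"
    then have "h2 = (s * r) *\<^sub>R h1" by simp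
    then show False using D by (simp add: algebra_simps)
  qed
  then show b: "b' \<noteq> 0" using d0 b'_eq by simp
  show g2: "gs2 (d h1) (d h2) = d ((1 / sqrt (b' \<bullet> b')) *\<^sub>R (h2 - (s * r) *\<^sub>R h1))"
    by (simp add: gs2_def s_def[symmetric] b'_def[symmetric]) (simp add: gs1_def b'_eq[symmetric] linear_cmul[OF lin] del: scaleR_right_diff_distrib)
  let ?r2 = "1 / sqrt (b' \<bullet> b')"
  have "r > 0" "?r2 > 0" using a b by (simp_all add: r_def)
  then have "det (vector [r *\<^sub>R h1, ?r2 *\<^sub>R (h2 - (s * r) *\<^sub>R h1)] :: real^2^2) > 0"
  proof -
    have "det (vector [r *\<^sub>R h1, ?r2 *\<^sub>R (h2 - (s * r) *\<^sub>R h1)] :: real^2^2) = r * ?r2 * (h1$1 * h2$2 - h1$2 * h2$1)"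
      unfolding det_vector_2 by (simp add: algebra_simps)
    then show ?thesis using D \<open>r > 0\<close> \<open>?r2 > 0\<close> by (metis mult_pos_pos)
  qed
  moreover have "gs1 (d h1) \<bullet> gs1 (d h1) = 1" by (rule gs1_unit[OF a])
  moreover have "gs2 (d h1) (d h2) \<bullet> gs2 (d h1) (d h2) = 1"
    unfolding gs2_def using gs1_unit[OF b] by (simp add: b'_def s_def)
  moreover have "gs1 (d h1) \<bullet> b' = 0"
    using \<open>gs1 (d h1) \<bullet> gs1 (d h1) = 1\<close> by (simp add: b'_def s_def inner_diff_right inner_commute)
  then have "gs1 (d h1) \<bullet> gs2 (d h1) (d h2) = 0"
    by (simp add: gs2_def s_def[symmetric] b'_def[symmetric]) (simp add: gs1_def[of b'])
  ultimately show "oframeL A \<iota> (k x) (gs1 (d h1)) (gs2 (d h1) (d h2))"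
    unfolding oframeL_chart[OF k] using g1 g2 by (auto simp: norm_eq_1 d_def)
qed

lemma adapted_ex: "\<exists>e. adapted X A \<iota> p e"
proof -
  obtain U k x where k: "(U, k) \<in> A" "x \<in> U" "k x = p" using chart_cover by blast
  have "det (vector [axis 1 1, axis 2 1] :: real^2^2) > 0" by (simp add: det_vector_2 axis_def)
  from gram_schmidt_oframeL(5)[OF k(1,2) this] show ?thesis using k(3) oframeL_completion by blast
qed

lemma oframeL_rotation:
  assumes o: "oframeL A \<iota> p e1 e2" and o': "oframeL A \<iota> p e1' e2'"
  shows "\<exists>a b. a\<^sup>2 + b\<^sup>2 = 1 \<and> e1' = a *\<^sub>R e1 + b *\<^sub>R e2 \<and> e2' = a *\<^sub>R e2 - b *\<^sub>R e1"
proof -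
  obtain U k x where k: "(U, k) \<in> A" "x \<in> U" "k x = p" using chart_cover by blast
  let ?d = "frechet_derivative (\<iota> \<circ> k) (at x)"
  have lin: "linear ?d" by (rule linear_frechet[OF smooth_\<iota> k(1,2)])
  obtain h1 h2 where h: "det (vector [h1, h2] :: real^2^2) > 0" "?d h1 = e1" "?d h2 = e2"
    using o oframeL_chart[OF k(1,2)] k(3) by blast
  obtain h1' h2' where h': "det (vector [h1', h2'] :: real^2^2) > 0" "?d h1' = e1'" "?d h2' = e2'"
    using o' oframeL_chart[OF k(1,2)] k(3) by blast
  define D where "D = h1$1 * h2$2 - h1$2 * h2$1"
  have D: "D > 0" using h(1) by (simp add: D_def det_vector_2)
  note expand = cramer_2[OF h(1)]
  obtain a b where ab: "h1' = a *\<^sub>R h1 + b *\<^sub>R h2" using expand by blast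
  obtain c d where cd: "h2' = c *\<^sub>R h1 + d *\<^sub>R h2" using expand by blast
  have e1': "e1' = a *\<^sub>R e1 + b *\<^sub>R e2" and e2': "e2' = c *\<^sub>R e1 + d *\<^sub>R e2"
    using ab cd h h' by (simp_all add: linear_add[OF lin] linear_cmul[OF lin] flip: h(2,3) h'(2,3))
  note i = oframeL_inner[OF o] and i' = oframeL_inner[OF o']
  have q: "a * a + b * b = 1" "c * c + d * d = 1" "a * c + b * d = 0"
    using i'(1) i'(2) i'(3) unfolding e1' e2' by (simp_all add: inner_simps i algebra_simps)
  have "det (vector [h1', h2'] :: real^2^2) = (a * d - b * c) * D"
    unfolding det_vector_2 ab cd D_def by (simp add: algebra_simps)
  then have pos: "a * d - b * c > 0" using h'(1) D by (simp add: zero_less_mult_iff)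
  have "(a * d - b * c) * (a * d - b * c) = (a * a + b * b) * (c * c + d * d) - (a * c + b * d) * (a * c + b * d)"
    by (simp add: algebra_simps)
  then have "(a * d - b * c) * (a * d - b * c) = 1" using q by simp
  then have det1: "a * d - b * c = 1" using pos square_eq_1_iff[of "a * d - b * c"] by auto
  \<comment> \<open>For orthonormal rows this sum of squares is 2 - 2 (a d - b c), so determinant
    one forces a rotation matrix.\<close>
  have "(a - d) * (a - d) + (b + c) * (b + c) = 0"
    using q det1 by (simp add: algebra_simps)
  then have "d = a" "c = - b" by (auto simp: sum_squares_eq_zero_iff)
  then show ?thesis using q(1) e1' e2' by (intro exI[of _ a] exI[of _ b]) (simp add: power2_eq_square)
qed

text \<open>The tangent planes agree, hence so do their orthogonal planes. Comparing the volume
  forms of both frames shows that the normal vectors differ by a rotation too, through an angle of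
  their own.\<close>

lemma adapted_rotation:
  assumes e: "adapted X A \<iota> p e" and e': "adapted X A \<iota> p e'"
  shows "\<exists>a b g h. a\<^sup>2 + b\<^sup>2 = 1 \<and> g\<^sup>2 + h\<^sup>2 = 1 \<and>
    e'$1 = a *\<^sub>R e$1 + b *\<^sub>R e$2 \<and> e'$2 = a *\<^sub>R e$2 - b *\<^sub>R e$1 \<and>
    e'$3 = g *\<^sub>R e$3 + h *\<^sub>R e$4 \<and> e'$4 = g *\<^sub>R e$4 - h *\<^sub>R e$3"
proof -
  note x = \<iota>_points[of p] and of = adapted_frames(1)[OF e] adapted_frames(1)[OF e']
  note s = onf_simps[OF adapted_frames(3)[OF e]] and s' = onf_simps[OF adapted_frames(3)[OF e']]
  obtain a b where ab: "a\<^sup>2 + b\<^sup>2 = 1" "e'$1 = a *\<^sub>R e$1 + b *\<^sub>R e$2" "e'$2 = a *\<^sub>R e$2 - b *\<^sub>R e$1"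
    using oframeL_rotation[OF adapted_frames(2)[OF e] adapted_frames(2)[OF e']] by blast
  have ab': "a * a + b * b = 1" using ab(1) by (simp add: power2_eq_square)
  have e1: "e$1 = a *\<^sub>R e'$1 - b *\<^sub>R e'$2" and e2: "e$2 = b *\<^sub>R e'$1 + a *\<^sub>R e'$2"
    unfolding ab(2,3) using ab' by (simp_all add: algebra_simps flip: scaleR_add_left)
  have perp: "e'$3 \<bullet> e$1 = 0" "e'$3 \<bullet> e$2 = 0" "e'$4 \<bullet> e$1 = 0" "e'$4 \<bullet> e$2 = 0"
    unfolding e1 e2 by (simp_all add: inner_simps s')
  define g h g' h' where "g = e'$3 \<bullet> e$3" "h = e'$3 \<bullet> e$4" "g' = e'$4 \<bullet> e$3" "h' = e'$4 \<bullet> e$4"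
  have e3: "e'$3 = g *\<^sub>R e$3 + h *\<^sub>R e$4" and e4: "e'$4 = g' *\<^sub>R e$3 + h' *\<^sub>R e$4"
    using oframe_expand[OF x of(1) oframe_tangent[OF of(2)], of 3] oframe_expand[OF x of(1) oframe_tangent[OF of(2)], of 4]
    by (simp_all add: perp g_h_g'_h'_def)
  have q: "g * g + h * h = 1" "g' * g' + h' * h' = 1"
    using s'(3) s'(4) unfolding e3 e4 by (simp_all add: inner_simps s)
  note l = alt4_linear[OF vol_alt[OF x]]
  have sw: "volform X (\<iota> p) (e$2) (e$1) (e'$3) (e'$4) = - volform X (\<iota> p) (e$1) (e$2) (e'$3) (e'$4)"
    by (rule alt4_swap(1)[OF vol_alt[OF x]]) (rule oframe_tangent[OF of(1)] oframe_tangent[OF of(2)])+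
  have "1 = volform X (\<iota> p) (e'$1) (e'$2) (e'$3) (e'$4)" by (simp add: oframe_vol[OF of(2)])
  also have "\<dots> = (a * a + b * b) * volform X (\<iota> p) (e$1) (e$2) (e'$3) (e'$4)"
    unfolding ab(2,3)
    by (simp only: linear_add[OF l(1)] linear_cmul[OF l(1)] linear_diff[OF l(2)] linear_cmul[OF l(2)])
      (simp add: sw alt4_zero(1)[OF vol_alt[OF x]] oframe_tangent[OF of(1)] oframe_tangent[OF of(2)] algebra_simps)
  also have "\<dots> = g * h' - h * g'"
    using ab' by (simp add: vol_12[OF x of(1) oframe_tangent[OF of(2)] oframe_tangent[OF of(2)]] g_h_g'_h'_def)
  finally have det1: "g * h' - h * g' = 1" by simp
  have "(g - h') * (g - h') + (h + g') * (h + g') = 0" using q det1 by (simp add: algebra_simps)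
  then have "h' = g" "g' = - h" by (auto simp: sum_squares_eq_zero_iff)
  then show ?thesis
    using ab q(1) e3 e4 by (intro exI[of _ a] exI[of _ b] exI[of _ g] exI[of _ h]) (simp add: power2_eq_square)
qed

text \<open>The pair \<open>f2\<close>, \<open>f3\<close> turns by the normal angle minus the
  tangential one, while \<open>f1\<close> is fixed. This is why all adapted frames give the same
  line \<open>E_fib\<close> and the same complex structure \<open>J_F\<close>.\<close>

lemma rotation_f:
  assumes "a\<^sup>2 + b\<^sup>2 = 1" "g\<^sup>2 + h\<^sup>2 = 1" and
    e': "e'$1 = a *\<^sub>R e$1 + b *\<^sub>R e$2" "e'$2 = a *\<^sub>R e$2 - b *\<^sub>R e$1"
    "e'$3 = g *\<^sub>R e$3 + h *\<^sub>R e$4" "e'$4 = g *\<^sub>R e$4 - h *\<^sub>R (e :: 'v^4)$3"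
  shows "f1 e' = f1 e" "f2 e' = (a * g + b * h) *\<^sub>R f2 e + (a * h - b * g) *\<^sub>R f3 e"
    "f3 e' = (a * g + b * h) *\<^sub>R f3 e - (a * h - b * g) *\<^sub>R f2 e" "(a * g + b * h)\<^sup>2 + (a * h - b * g)\<^sup>2 = 1"
proof -
  have ab: "a * a + b * b = 1" and gh: "g * g + h * h = 1" using assms by (auto simp: power2_eq_square)
  show "f1 e' = f1 e"
  proof (rule form2_eqI)
    fix y z
    have "ev (f1 e') y z = (a * a + b * b) * ((e$1 \<bullet> y) * (e$2 \<bullet> z) - (e$1 \<bullet> z) * (e$2 \<bullet> y))
       - (g * g + h * h) * ((e$3 \<bullet> y) * (e$4 \<bullet> z) - (e$3 \<bullet> z) * (e$4 \<bullet> y))"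
      by (simp add: ev_f e' inner_simps algebra_simps)
    then show "ev (f1 e') y z = ev (f1 e) y z" by (simp add: ab gh ev_f)
  qed
  show "f2 e' = (a * g + b * h) *\<^sub>R f2 e + (a * h - b * g) *\<^sub>R f3 e"
    by (rule form2_eqI) (simp add: ev_f e' inner_simps ev_simps algebra_simps)
  show "f3 e' = (a * g + b * h) *\<^sub>R f3 e - (a * h - b * g) *\<^sub>R f2 e"
    by (rule form2_eqI) (simp add: ev_f e' inner_simps ev_simps algebra_simps)
  have "(a * g + b * h)\<^sup>2 + (a * h - b * g)\<^sup>2 = (a * a + b * b) * (g * g + h * h)"
    by (simp add: power2_eq_square algebra_simps)
  then show "(a * g + b * h)\<^sup>2 + (a * h - b * g)\<^sup>2 = 1" by (simp add: ab gh)
qed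

end

lemma has_vector_derivative_frechet:
  assumes "(\<gamma> has_vector_derivative g) (at t)" "f differentiable (at (\<gamma> t))"
  shows "((\<lambda>s. f (\<gamma> s)) has_vector_derivative frechet_derivative f (at (\<gamma> t)) g) (at t)"
proof -
  from has_derivative_compose[OF assms(1)[unfolded has_vector_derivative_def] frechet_works[OF assms(2)]]
  show ?thesis
    unfolding has_vector_derivative_def
    by (simp add: linear_cmul[OF linear_frechet_derivative[OF assms(2)]])
qed

lemma has_vector_derivative_transform_near:
  assumes "(f has_vector_derivative f') (at (t::real))" "d > 0" "\<And>s. dist s t < d \<Longrightarrow> f s = g s"
  shows "(g has_vector_derivative f') (at t)"
  using has_derivative_transform_within[of f _ t UNIV d g] assms unfolding has_vector_derivative_def by auto

section \<open>Smooth local adapted frames\<close>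

context surface_in
begin

text \<open>\<open>H1\<close> and \<open>H2\<close> are the coordinate vectors of the two tangent
  fields. Only continuity is demanded of them, for the local bases that define an
  orientation.\<close>

definition lframe ::
  "(real^2) set \<Rightarrow> (real^2 \<Rightarrow> 'l) \<Rightarrow> (real^2) set \<Rightarrow> (real^2 \<Rightarrow> 'v^4) \<Rightarrow> (real^2 \<Rightarrow> real^2) \<Rightarrow> (real^2 \<Rightarrow> real^2) \<Rightarrow> bool" where
  "lframe U k W e H1 H2 \<longleftrightarrow> (U, k) \<in> A \<and> open W \<and> W \<subseteq> U \<and> (\<forall>i. smooth_on W (\<lambda>y. e y $ i)) \<and>
     (\<forall>y\<in>W. adapted X A \<iota> (k y) (e y)) \<and> continuous_on W H1 \<and> continuous_on W H2 \<and>
     (\<forall>y\<in>W. frechet_derivative (\<iota> \<circ> k) (at y) (H1 y) = e y $ 1 \<and> frechet_derivative (\<iota> \<circ> k) (at y) (H2 y) = e y $ 2)"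

lemma lframeD:
  assumes "lframe U k W e H1 H2"
  shows "(U, k) \<in> A" "open W" "W \<subseteq> U" "smooth_on W (\<lambda>y. e y $ i)" "continuous_on W H1" "continuous_on W H2"
    and "y \<in> W \<Longrightarrow> adapted X A \<iota> (k y) (e y)"
    and "y \<in> W \<Longrightarrow> frechet_derivative (\<iota> \<circ> k) (at y) (H1 y) = e y $ 1"
    and "y \<in> W \<Longrightarrow> frechet_derivative (\<iota> \<circ> k) (at y) (H2 y) = e y $ 2"
    and "y \<in> W \<Longrightarrow> y \<in> U"
  using assms unfolding lframe_def by blast+

text \<open>Gram--Schmidt applied to two coordinate fields and the projection of a constant vector; the
  fourth vector is determined by the volume form and depends smoothly on the other three.\<close>

lemma lframe_ex:
  assumes k: "(U, k) \<in> A" "x \<in> U" and e0: "adapted X A \<iota> (k x) e0"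
  shows "\<exists>W e H1 H2. lframe U k W e H1 H2 \<and> x \<in> W \<and> e x = e0"
proof -
  let ?d = "\<lambda>y. frechet_derivative (\<iota> \<circ> k) (at y)"
  note of0 = adapted_frames[OF e0]
  note s0 = onf_simps[OF of0(3)]
  obtain h1 h2 where h: "det (vector [h1, h2] :: real^2^2) > 0" "?d x h1 = e0$1" "?d x h2 = e0$2"
    using of0(2) oframeL_chart[OF k] by blast
  define e1 where "e1 = (\<lambda>y. gs1 (?d y h1))"
  define b' where "b' = (\<lambda>y. ?d y h2 - (?d y h2 \<bullet> e1 y) *\<^sub>R e1 y)"
  define e2 where "e2 = (\<lambda>y. gs1 (b' y))"
  have e2_eq: "e2 y = gs2 (?d y h1) (?d y h2)" for y by (simp add: e2_def b'_def gs2_def e1_def)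
  have U: "open U" by (rule chart(1)[OF k(1)])
  have sd: "smooth_on U (\<lambda>y. ?d y h)" for h by (rule smooth_on_deriv[OF smooth_alongD[OF smooth_\<iota> k(1)]])
  have nz1: "?d y h1 \<noteq> 0" if "y \<in> U" for y using gram_schmidt_oframeL(1)[OF k(1) that h(1)] .
  have nz2: "b' y \<noteq> 0" if "y \<in> U" for y
    using gram_schmidt_oframeL(2)[OF k(1) that h(1)] by (simp add: b'_def e1_def)
  have oL: "oframeL A \<iota> (k y) (e1 y) (e2 y)" if "y \<in> U" for y
    using gram_schmidt_oframeL(5)[OF k(1) that h(1)] by (simp add: e1_def e2_eq)
  have se1: "smooth_on U e1" unfolding e1_def by (rule smooth_on_gs1[OF U sd nz1])
  have sb': "smooth_on U b'" unfolding b'_def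
    by (intro smooth_on_diff smooth_on_scaleR smooth_on_inner U sd se1)
  have se2: "smooth_on U e2" unfolding e2_def by (rule smooth_on_gs1[OF U sb' nz2])
  \<comment> \<open>Normal part of the fixed ambient vector \<open>e0$3\<close>; it equals
    \<open>e0$3\<close> at \<open>x\<close>, so it is nonzero on a neighbourhood
    \<open>W\<close>.\<close>
  define n where "n = (\<lambda>y. tproj X (\<iota> (k y)) (e0$3) - (e0$3 \<bullet> e1 y) *\<^sub>R e1 y - (e0$3 \<bullet> e2 y) *\<^sub>R e2 y)"
  have s\<iota>: "smooth_on U (\<lambda>y. \<iota> (k y))" using smooth_alongD[OF smooth_\<iota> k(1)] by (simp add: o_def)
  have \<iota>U: "(\<lambda>y. \<iota> (k y)) ` U \<subseteq> points X" using \<iota>_points by auto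
  have sn: "smooth_on U n" unfolding n_def
    by (intro smooth_on_diff smooth_on_scaleR smooth_on_inner smooth_tproj U se1 se2 s\<iota> \<iota>U smooth_on_const)
  define W where "W = U \<inter> (\<lambda>y. n y \<bullet> n y) -` {0<..}"
  have W: "open W"
    unfolding W_def using U
    by (intro continuous_open_preimage continuous_intros smooth_on_continuous[OF sn]) auto
  have WU: "W \<subseteq> U" by (auto simp: W_def)
  define e3 where "e3 = (\<lambda>y. gs1 (n y))"
  have se3: "smooth_on W e3" unfolding e3_def
    by (rule smooth_on_gs1[OF W smooth_on_subset[OF sn WU]]) (auto simp: W_def)
  \<comment> \<open>The vector dual to the volume form with its first three slots filled, which is
    the fourth frame vector by \<open>vol_123\<close>. Basis vectors are projected first because
    that formula holds for tangent vectors.\<close>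
  define e4 where "e4 = (\<lambda>y. \<Sum>b\<in>Basis. volform X (\<iota> (k y)) (e1 y) (e2 y) (e3 y) (tproj X (\<iota> (k y)) b) *\<^sub>R b)"
  have \<iota>W: "(\<lambda>y. \<iota> (k y)) ` W \<subseteq> points X" using \<iota>_points by auto
  note subW = smooth_on_subset[OF _ WU]
  have se4: "smooth_on W e4" unfolding e4_def
    by (intro smooth_on_sum smooth_on_scaleR smooth_vol smooth_tproj W subW[OF se1] subW[OF se2] se3 subW[OF s\<iota>] \<iota>W smooth_on_const)
  define e where "e = (\<lambda>y. vector [e1 y, e2 y, e3 y, e4 y] :: 'v^4)"
  have e4_unique: "e4 y = d" if "y \<in> U" "oframe X (\<iota> (k y)) (vector [e1 y, e2 y, e3 y, d])" for y d
  proof -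
    let ?f = "vector [e1 y, e2 y, e3 y, d] :: 'v^4"
    have dT: "d \<in> tangent X (\<iota> (k y))" using oframe_tangent[OF that(2), of 4] by simp
    have "volform X (\<iota> (k y)) (e1 y) (e2 y) (e3 y) (tproj X (\<iota> (k y)) b) = d \<bullet> b" for b
      using vol_123[OF \<iota>_points that(2) tproj_in_tangent[OF \<iota>_points, where w=b]]
        tproj_inner(2)[OF \<iota>_points dT, where w=b] by (simp add: inner_commute)
    then show ?thesis by (simp add: e4_def euclidean_representation)
  qed
  have ad: "adapted X A \<iota> (k y) (e y)" if y: "y \<in> W" for y
  proof -
    have yU: "y \<in> U" using y WU by auto
    note o = oframeL_inner[OF oL[OF yU]]
    have t: "e1 y \<in> tangent X (\<iota> (k y))" "e2 y \<in> tangent X (\<iota> (k y))"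
      using oframeL_in_tangentL[OF oL[OF yU]] tangentL_tangent by auto
    have nn: "n y \<noteq> 0" using y by (auto simp: W_def)
    have nT: "n y \<in> tangent X (\<iota> (k y))" unfolding n_def
      by (intro subspace_diff subspace_scale subspace_tangent \<iota>_points t tproj_in_tangent)
    have n1: "e1 y \<bullet> n y = 0" "e2 y \<bullet> n y = 0"
      by (simp_all add: n_def inner_diff_right tproj_inner(1)[OF \<iota>_points t(1)] tproj_inner(1)[OF \<iota>_points t(2)] o inner_commute)
    have 3: "e3 y \<in> tangent X (\<iota> (k y))" "e3 y \<bullet> e3 y = 1" "e1 y \<bullet> e3 y = 0" "e2 y \<bullet> e3 y = 0"
      using nT n1 gs1_unit[OF nn] by (simp_all add: e3_def gs1_def[of "n y"] subspace_scale[OF subspace_tangent[OF \<iota>_points]])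
    obtain d where d: "oframe X (\<iota> (k y)) (vector [e1 y, e2 y, e3 y, d])"
      using frame_completion3[OF \<iota>_points t 3(1) o(1,2) 3(2) o(3) 3(3,4)] by blast
    then have "oframe X (\<iota> (k y)) (e y)" using e4_unique[OF yU d] by (simp add: e_def)
    then show ?thesis using oL[OF yU] by (simp add: adapted_def e_def)
  qed
  have ex: "e1 x = e0$1" "e2 x = e0$2"
    by (simp_all add: e1_def e2_def b'_def h gs1_of_unit s0)
  have nx: "n x = e0$3"
    by (simp add: n_def ex s0 tproj_tangent[OF \<iota>_points oframe_tangent[OF of0(1)]])
  have xW: "x \<in> W" using k(2) by (simp add: W_def nx s0)
  have ex3: "e3 x = e0$3" by (simp add: e3_def nx gs1_of_unit s0)
  have "oframe X (\<iota> (k x)) (vector [e1 x, e2 x, e3 x, e0$4])"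
    using of0(1) by (simp add: ex ex3 flip: vector_eta4)
  then have ex4: "e4 x = e0$4" by (rule e4_unique[OF k(2)])
  have ee0: "e x = e0" by (simp add: e_def ex ex3 ex4 flip: vector_eta4)
  define r where "r = (\<lambda>y. 1 / sqrt (?d y h1 \<bullet> ?d y h1))"
  define s where "s = (\<lambda>y. ?d y h2 \<bullet> e1 y)"
  define H1 where "H1 = (\<lambda>y. r y *\<^sub>R h1)"
  define H2 where "H2 = (\<lambda>y. (1 / sqrt (b' y \<bullet> b' y)) *\<^sub>R (h2 - (s y * r y) *\<^sub>R h1))"
  have H: "?d y (H1 y) = e1 y" "?d y (H2 y) = e2 y" if "y \<in> U" for y
    using gram_schmidt_oframeL(3,4)[OF k(1) that h(1)]
    by (simp_all add: H1_def H2_def r_def s_def e2_eq e1_def b'_def)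
  have sr: "smooth_on U r" unfolding r_def
    by (intro smooth_on_inverse_sqrt smooth_on_inner U sd) (use nz1 in auto)
  have ss: "smooth_on U s" unfolding s_def by (intro smooth_on_inner U sd se1)
  have sH1: "smooth_on U H1" unfolding H1_def by (intro smooth_on_scaleR U sr smooth_on_const)
  have sH2: "smooth_on U H2" unfolding H2_def
    by (intro smooth_on_scaleR smooth_on_diff smooth_on_mult smooth_on_inverse_sqrt smooth_on_inner U sb' ss sr smooth_on_const)
      (use nz2 in auto)
  have "lframe U k W e H1 H2"
    unfolding lframe_def
  proof (intro conjI allI ballI)
    fix i show "smooth_on W (\<lambda>y. e y $ i)"
      using exhaust_4[of i] subW[OF se1] subW[OF se2] se3 se4 by (auto simp: e_def)
  next
    fix y assume "y \<in> W"
    then have "y \<in> U" using WU by auto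
    then show "?d y (H1 y) = e y $ 1" "?d y (H2 y) = e y $ 2" using H by (simp_all add: e_def)
  qed (use k W WU ad smooth_on_continuous[OF subW[OF sH1]] smooth_on_continuous[OF subW[OF sH2]] in auto)
  then show ?thesis using xW ee0 by blast
qed

text \<open>The value of the frame at the point is prescribed, since \<open>minimal\<close> and
  \<open>holomorphic_F\<close> quantify over all oriented frames there.\<close>

lemma lframe_at:
  assumes "adapted X A \<iota> p e0"
  shows "\<exists>U k W e H1 H2 x. lframe U k W e H1 H2 \<and> x \<in> W \<and> k x = p \<and> e x = e0"
proof -
  obtain U k x where "(U, k) \<in> A" "x \<in> U" "k x = p" using chart_cover by blast
  then show ?thesis using lframe_ex[of U k x e0] assms by blast
qed

section \<open>Connection coefficients and the derivatives of the three forms\<close>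

definition oframe_field :: "(real^2 \<Rightarrow> 'l) \<Rightarrow> (real^2) set \<Rightarrow> (real^2 \<Rightarrow> 'v^4) \<Rightarrow> bool" where
  "oframe_field k W e \<longleftrightarrow> open W \<and> (\<forall>i. smooth_on W (\<lambda>y. e y $ i)) \<and> (\<forall>y\<in>W. oframe X (\<iota> (k y)) (e y))"

text \<open>The derivative is the ambient one along the chart vector \<open>h\<close>; pairing with
  the tangent vector \<open>e x $ j\<close> removes its normal component, so this is the Levi-Civita
  coefficient.\<close>

definition \<Gamma> :: "(real^2 \<Rightarrow> 'v^4) \<Rightarrow> real^2 \<Rightarrow> 4 \<Rightarrow> 4 \<Rightarrow> real^2 \<Rightarrow> real" where
  "\<Gamma> e x i j h = frechet_derivative (\<lambda>y. e y $ i) (at x) h \<bullet> e x $ j"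

lemma lframe_field: "lframe U k W e H1 H2 \<Longrightarrow> oframe_field k W e"
  unfolding oframe_field_def lframe_def adapted_def by blast

text \<open>The cycle destroys adaptedness, which is why \<open>oframe_field\<close> asks for
  oriented frames only.\<close>

lemma field_cycle:
  assumes "oframe_field k W e"
  shows "oframe_field k W (\<lambda>y. vector [e y $ 1, e y $ 3, e y $ 4, e y $ 2])"
  using assms unfolding oframe_field_def by (auto simp: forall_4 intro: oframe_cycle[OF \<iota>_points])

lemma field_differentiable:
  "oframe_field k W e \<Longrightarrow> x \<in> W \<Longrightarrow> (\<lambda>y. e y $ i) differentiable (at x)"
  unfolding oframe_field_def using smooth_on_differentiable by blast

lemma \<Gamma>_skew:
  assumes e: "oframe_field k W e" and x: "x \<in> W"
  shows "\<Gamma> e x i j h = - \<Gamma> e x j i h"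
proof -
  let ?D = "\<lambda>i. frechet_derivative (\<lambda>y. e y $ i) (at x)"
  have "((\<lambda>y. e y $ i \<bullet> e y $ j) has_derivative (\<lambda>h. e x $ i \<bullet> ?D j h + ?D i h \<bullet> e x $ j)) (at x)"
    by (rule has_derivative_inner[OF frechet_works[OF field_differentiable[OF e x]] frechet_works[OF field_differentiable[OF e x]]])
  moreover have "((\<lambda>y. e y $ i \<bullet> e y $ j) has_derivative (\<lambda>h. 0)) (at x)"
    by (rule has_derivative_transform_within_open[OF has_derivative_const[of "if i = j then 1 else 0"], of W])
      (use e x in \<open>auto simp: oframe_field_def oframe_def\<close>)
  ultimately have "(\<lambda>h. e x $ i \<bullet> ?D j h + ?D i h \<bullet> e x $ j) = (\<lambda>h. 0)" by (rule has_derivative_unique)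
  then have "e x $ i \<bullet> ?D j h + ?D i h \<bullet> e x $ j = 0" by meson
  then show ?thesis by (simp add: \<Gamma>_def inner_commute)
qed

lemma field_f_smooth:
  assumes e: "oframe_field k W e"
  shows "smooth_on W (\<lambda>y. f1 (e y))" "smooth_on W (\<lambda>y. f2 (e y))" "smooth_on W (\<lambda>y. f3 (e y))"
proof -
  have W: "open W" and s: "smooth_on W (\<lambda>y. e y $ i)" for i using e by (auto simp: oframe_field_def)
  note b = smooth_on_bilinear[OF wedge_bilinear W s s]
  show "smooth_on W (\<lambda>y. f1 (e y))" "smooth_on W (\<lambda>y. f2 (e y))" "smooth_on W (\<lambda>y. f3 (e y))"
    unfolding f1_def f2_def f3_def by (rule smooth_on_diff[OF W b b])+
qed

text \<open>Leibniz rule, with the derivative of each frame vector expanded in the frame. Rotations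
  inside the pairs (1,2) and (3,4) produce wedge products of a vector with itself and drop
  out.\<close>

lemma nabla_f1:
  assumes e: "oframe_field k W e" and x: "x \<in> W"
  shows "restrict2 X (\<iota> (k x)) (frechet_derivative (\<lambda>y. f1 (e y)) (at x) h)
    = (\<Gamma> e x 2 3 h - \<Gamma> e x 1 4 h) *\<^sub>R f2 (e x) + (\<Gamma> e x 2 4 h + \<Gamma> e x 1 3 h) *\<^sub>R f3 (e x)"
proof -
  have of: "oframe X (\<iota> (k x)) (e x)" using e x by (simp add: oframe_field_def)
  let ?D = "\<lambda>i. frechet_derivative (\<lambda>y. e y $ i) (at x)"
  let ?G = "\<Gamma> e x"
  have d: "((\<lambda>y. e y $ i) has_derivative ?D i) (at x)" for i
    by (rule frechet_works[OF field_differentiable[OF e x]])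
  have "((\<lambda>y. f1 (e y)) has_derivative (\<lambda>h. (wedge (e x$1) (?D 2 h) + wedge (?D 1 h) (e x$2))
      - (wedge (e x$3) (?D 4 h) + wedge (?D 3 h) (e x$4)))) (at x)"
    unfolding f1_def by (intro has_derivative_diff bounded_bilinear.FDERIV[OF wedge_bilinear] d)
  then have D: "frechet_derivative (\<lambda>y. f1 (e y)) (at x) h = (wedge (e x$1) (?D 2 h) + wedge (?D 1 h) (e x$2))
      - (wedge (e x$3) (?D 4 h) + wedge (?D 3 h) (e x$4))"
    by (simp add: frechet_eqI)
  have tD: "tproj X (\<iota> (k x)) (?D i h) = ?G i 1 h *\<^sub>R e x$1 + ?G i 2 h *\<^sub>R e x$2 + ?G i 3 h *\<^sub>R e x$3 + ?G i 4 h *\<^sub>R e x$4" for i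
    unfolding \<Gamma>_def by (rule tproj_frame[OF \<iota>_points of])
  have te: "tproj X (\<iota> (k x)) (e x $ i) = e x $ i" for i by (rule tproj_tangent[OF \<iota>_points oframe_tangent[OF of]])
  have self: "?G i i h = 0" for i using \<Gamma>_skew[OF e x, of i i h] by simp
  have sk: "?G 3 1 h = - ?G 1 3 h" "?G 3 2 h = - ?G 2 3 h" "?G 4 1 h = - ?G 1 4 h" "?G 4 2 h = - ?G 2 4 h"
    by (rule \<Gamma>_skew[OF e x])+
  show ?thesis
    unfolding D
    by (rule form2_eqI)
      (simp add: restrict2_linear[OF \<iota>_points] restrict2_wedge[OF \<iota>_points] tD te self sk ev_simps ev_wedge ev_f inner_add_left inner_scaleR_left inner_minus_left, simp add: algebra_simps)
qed

text \<open>For \<open>f1\<close> this is visible in the formula; cycling the frame carries it to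
  \<open>f2\<close> and \<open>f3\<close>.\<close>

lemma nabla_f_asd:
  assumes e: "oframe_field k W e" and x: "x \<in> W"
  shows "restrict2 X (\<iota> (k x)) (frechet_derivative (\<lambda>y. f1 (e y)) (at x) h) \<in> asd X (\<iota> (k x))"
    "restrict2 X (\<iota> (k x)) (frechet_derivative (\<lambda>y. f2 (e y)) (at x) h) \<in> asd X (\<iota> (k x))"
    "restrict2 X (\<iota> (k x)) (frechet_derivative (\<lambda>y. f3 (e y)) (at x) h) \<in> asd X (\<iota> (k x))"
proof -
  have 1: "restrict2 X (\<iota> (k x)) (frechet_derivative (\<lambda>y. f1 (e y)) (at x) h) \<in> asd X (\<iota> (k x))"
    if e: "oframe_field k W e" for e
  proof -
    have "oframe X (\<iota> (k x)) (e x)" using e x by (simp add: oframe_field_def)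
    from f_asd[OF \<iota>_points this] show ?thesis
      unfolding nabla_f1[OF e x] by (intro subspace_add subspace_scale subspace_asd)
  qed
  show "restrict2 X (\<iota> (k x)) (frechet_derivative (\<lambda>y. f1 (e y)) (at x) h) \<in> asd X (\<iota> (k x))" by (rule 1[OF e])
  show "restrict2 X (\<iota> (k x)) (frechet_derivative (\<lambda>y. f2 (e y)) (at x) h) \<in> asd X (\<iota> (k x))"
    unfolding f2_eq_f1 by (rule 1[OF field_cycle[OF e]])
  show "restrict2 X (\<iota> (k x)) (frechet_derivative (\<lambda>y. f3 (e y)) (at x) h) \<in> asd X (\<iota> (k x))"
    unfolding f3_eq_f1 using 1[OF field_cycle[OF field_cycle[OF e]]] by simp
qed

text \<open>The global unit section of \<open>E\<close>; by \<open>F1_eq\<close> the choice of frame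
  is immaterial.\<close>

definition F1 :: "'l \<Rightarrow> 'v form2" where "F1 p = f1 (SOME e. adapted X A \<iota> p e)"

lemma F1_eq:
  assumes "adapted X A \<iota> p e" shows "F1 p = f1 e"
proof -
  have "adapted X A \<iota> p (SOME e. adapted X A \<iota> p e)" using assms by (rule someI)
  from adapted_rotation[OF assms this] show ?thesis unfolding F1_def using rotation_f(1) by blast
qed

lemma F1_asd: "F1 p \<in> asd X (\<iota> p)"
proof -
  obtain e where e: "adapted X A \<iota> p e" using adapted_ex by blast
  show ?thesis unfolding F1_eq[OF e] by (rule f1_asd[OF \<iota>_points adapted_frames(1)[OF e]])
qed

lemma smooth_F1: "smooth_along A F1"
  unfolding smooth_along_def
proof (clarify, rule smooth_on_local)
  fix U k x assume k: "(U, k) \<in> A" "x \<in> U"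
  obtain e0 where "adapted X A \<iota> (k x) e0" using adapted_ex by blast
  then obtain W e H1 H2 where l: "lframe U k W e H1 H2" "x \<in> W" using lframe_ex[OF k] by blast
  have "smooth_on W (F1 \<circ> k)"
    by (rule smooth_on_cong[OF lframeD(2)[OF l(1)] _ field_f_smooth(1)[OF lframe_field[OF l(1)]]])
      (simp add: F1_eq[OF lframeD(7)[OF l(1)]])
  then show "\<exists>T. open T \<and> x \<in> T \<and> smooth_on T (F1 \<circ> k)" using lframeD(2)[OF l(1)] l(2) by blast
qed

lemma dF1_frame:
  assumes l: "lframe U k W e H1 H2" and x: "x \<in> W"
  shows "frechet_derivative (F1 \<circ> k) (at x) = frechet_derivative (\<lambda>y. f1 (e y)) (at x)"
  by (rule frechet_cong(2)[OF lframeD(2)[OF l] x])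
    (simp_all add: F1_eq[OF lframeD(7)[OF l]] smooth_on_differentiable[OF field_f_smooth(1)[OF lframe_field[OF l]] x])

lemma inner2_dF1:
  assumes l: "lframe U k W e H1 H2" and x: "x \<in> W"
  shows "inner2 (frechet_derivative (F1 \<circ> k) (at x) h) (f1 (e x)) = 0"
    "inner2 (frechet_derivative (F1 \<circ> k) (at x) h) (f2 (e x)) = \<Gamma> e x 2 3 h - \<Gamma> e x 1 4 h"
    "inner2 (frechet_derivative (F1 \<circ> k) (at x) h) (f3 (e x)) = \<Gamma> e x 2 4 h + \<Gamma> e x 1 3 h"
proof -
  note ad = adapted_frames[OF lframeD(7)[OF l x]]
  let ?d = "frechet_derivative (\<lambda>y. f1 (e y)) (at x) h"
  note r = inner2_restrict2[OF \<iota>_points oframe_tangent[OF ad(1)], of ?d]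
  have "inner2 ?d (f1 (e x)) = 0 \<and> inner2 ?d (f2 (e x)) = \<Gamma> e x 2 3 h - \<Gamma> e x 1 4 h
      \<and> inner2 ?d (f3 (e x)) = \<Gamma> e x 2 4 h + \<Gamma> e x 1 3 h"
    using r unfolding nabla_f1[OF lframe_field[OF l] x]
    by (simp add: inner2_add_left inner2_scale_left f_orthonormal[OF ad(3)])
  then show "inner2 (frechet_derivative (F1 \<circ> k) (at x) h) (f1 (e x)) = 0"
    "inner2 (frechet_derivative (F1 \<circ> k) (at x) h) (f2 (e x)) = \<Gamma> e x 2 3 h - \<Gamma> e x 1 4 h"
    "inner2 (frechet_derivative (F1 \<circ> k) (at x) h) (f3 (e x)) = \<Gamma> e x 2 4 h + \<Gamma> e x 1 3 h"
    unfolding dF1_frame[OF l x] by simp_all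
qed

text \<open>In a local frame the curve is a combination of \<open>f1\<close>, \<open>f2\<close>,
  \<open>f3\<close> with differentiable coefficients, and the covariant derivatives of these forms
  are again anti-self-dual.\<close>

lemma curve_asd:
  assumes l: "lframe U k W e H1 H2" and x: "x \<in> W"
    and \<gamma>: "(\<gamma> has_vector_derivative g) (at 0)" "\<gamma> 0 = x"
    and \<omega>: "(\<omega> has_vector_derivative \<beta>) (at 0)"
    and \<epsilon>: "\<epsilon> > 0" "\<And>t. t \<in> {-\<epsilon><..<\<epsilon>} \<Longrightarrow> \<omega> t \<in> asd X (\<iota> (k (\<gamma> t)))"
  shows "restrict2 X (\<iota> (k x)) \<beta> \<in> asd X (\<iota> (k x))"
proof -
  note f = lframe_field[OF l]
  have "(\<gamma> \<longlongrightarrow> x) (at 0)"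
    using has_derivative_continuous[OF \<gamma>(1)[unfolded has_vector_derivative_def]] \<gamma>(2)
    by (simp add: continuous_at)
  then have "\<forall>\<^sub>F t in at 0. \<gamma> t \<in> W"
    by (rule topological_tendstoD[OF _ lframeD(2)[OF l] x])
  then obtain \<delta> where "\<delta> > 0" "\<forall>t. t \<noteq> 0 \<and> dist t 0 < \<delta> \<longrightarrow> \<gamma> t \<in> W"
    unfolding eventually_at by auto
  then have \<delta>: "\<delta> > 0" "\<And>t. dist t 0 < \<delta> \<Longrightarrow> \<gamma> t \<in> W" using x \<gamma>(2) by metis+
  have prod: "((\<lambda>t. inner2 (\<omega> t) (\<phi> (\<gamma> t)) *\<^sub>R \<phi> (\<gamma> t)) has_vector_derivative
      inner2 (\<omega> 0) (\<phi> x) *\<^sub>R frechet_derivative \<phi> (at x) g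
      + (inner2 (\<omega> 0) (frechet_derivative \<phi> (at x) g) + inner2 \<beta> (\<phi> x)) *\<^sub>R \<phi> x) (at 0)"
    if "smooth_on W \<phi>" for \<phi>
  proof -
    have d: "((\<lambda>t. \<phi> (\<gamma> t)) has_vector_derivative frechet_derivative \<phi> (at x) g) (at 0)"
      using has_vector_derivative_frechet[OF \<gamma>(1), of \<phi>] smooth_on_differentiable[OF that x] \<gamma>(2) by simp
    from bounded_bilinear.has_vector_derivative[OF bounded_bilinear_scaleR
        bounded_bilinear.has_vector_derivative[OF inner2_bilinear \<omega> d] d]
    show ?thesis by (simp add: \<gamma>(2))
  qed
  note fs = field_f_smooth[OF f]
  let ?t = "\<lambda>t. inner2 (\<omega> t) (f1 (e (\<gamma> t))) *\<^sub>R f1 (e (\<gamma> t)) + inner2 (\<omega> t) (f2 (e (\<gamma> t))) *\<^sub>R f2 (e (\<gamma> t))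
    + inner2 (\<omega> t) (f3 (e (\<gamma> t))) *\<^sub>R f3 (e (\<gamma> t))"
  have "?t t = \<omega> t" if "dist t 0 < min \<delta> \<epsilon>" for t
  proof -
    have "\<omega> t \<in> asd X (\<iota> (k (\<gamma> t)))" by (rule \<epsilon>(2)) (use that in \<open>auto simp: dist_real_def\<close>)
    then show ?thesis
      using that by (intro asd_expand[symmetric, OF \<iota>_points adapted_frames(1)[OF lframeD(7)[OF l \<delta>(2)]]]) auto
  qed
  note eq = this
  have "0 < min \<delta> \<epsilon>" using \<epsilon>(1) \<delta>(1) by simp
  note sum = has_vector_derivative_transform_near[OF has_vector_derivative_add[OF
      has_vector_derivative_add[OF prod[OF fs(1)] prod[OF fs(2)]] prod[OF fs(3)]] this eq]
  \<comment> \<open>The derivative \<open>\<beta>\<close> occurs on the right too, inside scalar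
    coefficients; only the shape of the combination is used.\<close>
  from vector_derivative_unique_at[OF \<omega> sum]
  have \<beta>: "\<beta> = (inner2 (\<omega> 0) (f1 (e x)) *\<^sub>R frechet_derivative (\<lambda>y. f1 (e y)) (at x) g
      + (inner2 (\<omega> 0) (frechet_derivative (\<lambda>y. f1 (e y)) (at x) g) + inner2 \<beta> (f1 (e x))) *\<^sub>R f1 (e x))
     + (inner2 (\<omega> 0) (f2 (e x)) *\<^sub>R frechet_derivative (\<lambda>y. f2 (e y)) (at x) g
      + (inner2 (\<omega> 0) (frechet_derivative (\<lambda>y. f2 (e y)) (at x) g) + inner2 \<beta> (f2 (e x))) *\<^sub>R f2 (e x))
     + (inner2 (\<omega> 0) (f3 (e x)) *\<^sub>R frechet_derivative (\<lambda>y. f3 (e y)) (at x) g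
      + (inner2 (\<omega> 0) (frechet_derivative (\<lambda>y. f3 (e y)) (at x) g) + inner2 \<beta> (f3 (e x))) *\<^sub>R f3 (e x))" .
  note fa = f_asd[OF \<iota>_points adapted_frames(1)[OF lframeD(7)[OF l x]]]
  have rf: "restrict2 X (\<iota> (k x)) \<alpha> = \<alpha>" if "\<alpha> \<in> asd X (\<iota> (k x))" for \<alpha>
    using that by (intro restrict2_forms2[OF \<iota>_points]) (simp add: asd_def)
  show ?thesis
    by (subst \<beta>, simp only: restrict2_linear(1,2)[OF \<iota>_points] rf[OF fa(1)] rf[OF fa(2)] rf[OF fa(3)])
      (intro subspace_add[OF subspace_asd] subspace_scale[OF subspace_asd] nabla_f_asd[OF f x] fa)
qed

lemma line_curve:
  "((\<lambda>t. x + t *\<^sub>R h) has_vector_derivative h) (at (0::real))"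
  by (auto intro!: derivative_eq_intros)

lemma restrict2_derivative_asd:
  assumes Y: "smooth_along A Y" "\<And>p. Y p \<in> asd X (\<iota> p)" and k: "(U, k) \<in> A" "x \<in> U"
  shows "restrict2 X (\<iota> (k x)) (frechet_derivative (Y \<circ> k) (at x) h) \<in> asd X (\<iota> (k x))"
proof -
  obtain e0 where "adapted X A \<iota> (k x) e0" using adapted_ex by blast
  then obtain W e H1 H2 where l: "lframe U k W e H1 H2" "x \<in> W" using lframe_ex[OF k] by blast
  have D: "((\<lambda>t. (Y \<circ> k) (x + t *\<^sub>R h)) has_vector_derivative frechet_derivative (Y \<circ> k) (at x) h) (at 0)"
    using has_vector_derivative_frechet[OF line_curve, of "Y \<circ> k" x h] smooth_along_differentiable[OF Y(1) k] by simp
  show ?thesis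
    by (rule curve_asd[OF l line_curve[of x h] _ D zero_less_one]) (auto simp: Y(2))
qed

end

section \<open>Tangent spaces of the twisted bundles\<close>

lemma differentiable_has_vector_derivative:
  assumes "f differentiable (at (t::real))" shows "\<exists>g. (f has_vector_derivative g) (at t)"
  using assms vector_derivative_works by blast

context surface_in
begin

lemma lframe_det:
  assumes l: "lframe U k W e H1 H2" and x: "x \<in> W"
  shows "det (vector [H1 x, H2 x] :: real^2^2) > 0"
proof -
  note k = lframeD(1)[OF l] lframeD(10)[OF l x]
  obtain h1 h2 where h: "det (vector [h1, h2] :: real^2^2) > 0"
    "frechet_derivative (\<iota> \<circ> k) (at x) h1 = e x $ 1" "frechet_derivative (\<iota> \<circ> k) (at x) h2 = e x $ 2"
    using adapted_frames(2)[OF lframeD(7)[OF l x]] oframeL_chart[OF k] by blast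
  have "h1 = H1 x" "h2 = H2 x"
    using injD[OF inj_d\<iota>[OF k]] h(2,3) lframeD(8,9)[OF l x] by metis+
  then show ?thesis using h(1) by simp
qed

lemma lframe_d\<iota>:
  assumes l: "lframe U k W e H1 H2" and x: "x \<in> W"
  shows "frechet_derivative (\<iota> \<circ> k) (at x) (c1 *\<^sub>R H1 x + c2 *\<^sub>R H2 x) = c1 *\<^sub>R e x $ 1 + c2 *\<^sub>R e x $ 2"
proof -
  note lin = linear_frechet[OF smooth_\<iota> lframeD(1)[OF l] lframeD(10)[OF l x]]
  show ?thesis by (simp add: linear_add[OF lin] linear_cmul[OF lin] lframeD(8,9)[OF l x])
qed

lemma lframe_tangentL:
  assumes l: "lframe U k W e H1 H2" and x: "x \<in> W" and w: "w \<in> tangentL A \<iota> (k x)"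
  shows "\<exists>c1 c2. w = c1 *\<^sub>R e x $ 1 + c2 *\<^sub>R e x $ 2"
proof -
  obtain h where "w = frechet_derivative (\<iota> \<circ> k) (at x) h"
    using w tangentL_chart[OF lframeD(1)[OF l] lframeD(10)[OF l x]] by auto
  moreover obtain c1 c2 where "h = c1 *\<^sub>R H1 x + c2 *\<^sub>R H2 x"
    using cramer_2[OF lframe_det[OF l x]] by blast
  ultimately show ?thesis using lframe_d\<iota>[OF l x] by blast
qed

text \<open>A curve in \<open>tangent_sub\<close> may run in any chart; its derivatives are moved to
  the chart of the local frame.\<close>

lemma derivative_transfer:
  assumes Y: "smooth_along A Y" and k: "(U, k) \<in> A" "x \<in> U" and m: "(V, m) \<in> A" "y \<in> V" and "m y = k x"
    and "frechet_derivative (\<iota> \<circ> m) (at y) g = frechet_derivative (\<iota> \<circ> k) (at x) h"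
  shows "frechet_derivative (Y \<circ> m) (at y) g = frechet_derivative (Y \<circ> k) (at x) h"
  using deriv_along_chart[OF Y k, of h] deriv_along_chart[OF Y m, of g] assms(6,7) by simp

lemma E_fib_eq: "E_fib X A \<iota> p = range (\<lambda>r. r *\<^sub>R F1 p)"
proof -
  obtain e0 where e0: "adapted X A \<iota> p e0" using adapted_ex by blast
  have "f1 e = f1 e0" if "adapted X A \<iota> p e" for e using F1_eq[OF that] F1_eq[OF e0] by simp
  then have "{f1 e |e. adapted X A \<iota> p e} = {f1 e0}" using e0 by blast
  then have "{f1 e |e. adapted X A \<iota> p e} = {F1 p}" by (simp add: F1_eq[OF e0])
  then show ?thesis by (auto simp: E_fib_def span_singleton)
qed

lemma inner2_F1: "inner2 (F1 p) (F1 p) = 1"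
  using adapted_ex[of p] F1_eq[of p] f_orthonormal(1) adapted_frames(3) by metis

lemma F_fib_eq: "F_fib X A \<iota> p = {\<omega> \<in> asd X (\<iota> p). inner2 \<omega> (F1 p) = 0}"
proof -
  have "inner2 \<omega> (F1 p) = 0 \<longleftrightarrow> (\<forall>\<tau>\<in>E_fib X A \<iota> p. inner2 \<omega> \<tau> = 0)" for \<omega>
    by (simp add: E_fib_eq inner2_scale_right) (metis mult_1)
  then show ?thesis by (auto simp: F_fib_def)
qed

lemma E_plus_iff:
  assumes "\<sigma> p \<in> F_fib X A \<iota> p"
  shows "(p, \<omega>) \<in> E_plus X A \<iota> \<sigma> \<longleftrightarrow> \<omega> = inner2 \<omega> (F1 p) *\<^sub>R F1 p + \<sigma> p"
proof
  assume "(p, \<omega>) \<in> E_plus X A \<iota> \<sigma>"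
  then obtain r where "\<omega> = r *\<^sub>R F1 p + \<sigma> p" by (auto simp: E_plus_def E_fib_eq)
  moreover from this have "inner2 \<omega> (F1 p) = r"
    using assms by (simp add: F_fib_eq inner2_add_left inner2_scale_left inner2_F1)
  ultimately show "\<omega> = inner2 \<omega> (F1 p) *\<^sub>R F1 p + \<sigma> p" by simp
next
  assume "\<omega> = inner2 \<omega> (F1 p) *\<^sub>R F1 p + \<sigma> p"
  then show "(p, \<omega>) \<in> E_plus X A \<iota> \<sigma>" unfolding E_plus_def E_fib_eq by blast
qed

lemma E_plusI: "(p, r *\<^sub>R F1 p + \<sigma> p) \<in> E_plus X A \<iota> \<sigma>"
  unfolding E_plus_def E_fib_eq by blast

lemma plus_F_iff: "(p, \<omega>) \<in> plus_F X A \<iota> \<eta> \<longleftrightarrow> \<omega> - \<eta> p \<in> F_fib X A \<iota> p"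
proof
  assume "\<omega> - \<eta> p \<in> F_fib X A \<iota> p"
  then show "(p, \<omega>) \<in> plus_F X A \<iota> \<eta>" unfolding plus_F_def by (force intro: exI[of _ "\<omega> - \<eta> p"])
qed (auto simp: plus_F_def)

lemma restrict2_asd: "\<alpha> \<in> asd X (\<iota> p) \<Longrightarrow> restrict2 X (\<iota> p) \<alpha> = \<alpha>"
  by (intro restrict2_forms2[OF \<iota>_points]) (simp add: asd_def)

text \<open>Up to the projection, the vertical part of a tangent vector of \<open>E + \<sigma>\<close> at \<open>s f\<^sup>1 + \<sigma>\<close>.\<close>

definition dE :: "('l \<Rightarrow> 'v form2) \<Rightarrow> (real^2 \<Rightarrow> 'l) \<Rightarrow> real \<Rightarrow> real^2 \<Rightarrow> real^2 \<Rightarrow> 'v form2" where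
  "dE \<sigma> k s x h = s *\<^sub>R frechet_derivative (F1 \<circ> k) (at x) h + frechet_derivative (\<sigma> \<circ> k) (at x) h"

lemma linear_dE:
  assumes "smooth_along A \<sigma>" "(U, k) \<in> A" "x \<in> U" shows "linear (dE \<sigma> k s x)"
  unfolding dE_def
  by (intro linear_compose_add linear_compose_scale_right linear_frechet[OF smooth_F1 assms(2,3)] linear_frechet[OF assms])

text \<open>Along a curve in the bundle the form is a multiple of \<open>F1\<close> plus
  \<open>\<sigma>\<close>, the multiple being its inner product with \<open>F1\<close>; a velocity
  is thus given by a base direction and the derivative \<open>d\<close> of this multiple.
  Conversely, a line in the chart with an affine multiple realizes every such pair.\<close>

lemma tangent_E_plus:
  assumes l: "lframe U k W e H1 H2" and x: "x \<in> W" and \<sigma>: "smooth_section A (F_fib X A \<iota>) \<sigma>"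
    and \<omega>: "(k x, \<omega>) \<in> E_plus X A \<iota> \<sigma>"
  shows "tangent_sub X A \<iota> (E_plus X A \<iota> \<sigma>) (k x, \<omega>) =
    {(c1 *\<^sub>R e x $ 1 + c2 *\<^sub>R e x $ 2, d *\<^sub>R f1 (e x) + restrict2 X (\<iota> (k x)) (dE \<sigma> k (inner2 \<omega> (f1 (e x))) x (c1 *\<^sub>R H1 x + c2 *\<^sub>R H2 x)))
     | c1 c2 d. True}" (is "?L = ?R")
proof -
  note k = lframeD(1)[OF l] lframeD(10)[OF l x]
  have \<sigma>s: "smooth_along A \<sigma>" and \<sigma>F: "\<And>p. \<sigma> p \<in> F_fib X A \<iota> p" using \<sigma> by (auto simp: smooth_section_def)
  have Fe: "F1 (k x) = f1 (e x)" by (rule F1_eq[OF lframeD(7)[OF l x]])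
  define s where "s = inner2 \<omega> (f1 (e x))"
  have \<omega>_eq: "\<omega> = s *\<^sub>R F1 (k x) + \<sigma> (k x)"
    using \<omega> E_plus_iff[where \<sigma>=\<sigma>, OF \<sigma>F] by (simp add: s_def Fe)
  note rl = restrict2_linear[OF \<iota>_points]
  show ?thesis
  proof
    show "?L \<subseteq> ?R"
    proof
      fix n assume "n \<in> ?L"
      then obtain a \<beta> V m \<epsilon> \<gamma> w where n: "n = (a, restrict2 X (\<iota> (k x)) \<beta>)" and m: "(V, m) \<in> A" and \<epsilon>: "\<epsilon> > (0::real)"
        and sm: "smooth_on {-\<epsilon><..<\<epsilon>} \<gamma>" "smooth_on {-\<epsilon><..<\<epsilon>} w"
        and N: "\<forall>t\<in>{-\<epsilon><..<\<epsilon>}. \<gamma> t \<in> V \<and> (m (\<gamma> t), w t) \<in> E_plus X A \<iota> \<sigma>" and 0: "(m (\<gamma> 0), w 0) = (k x, \<omega>)"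
        and a: "((\<lambda>t. \<iota> (m (\<gamma> t))) has_vector_derivative a) (at 0)" and \<beta>: "(w has_vector_derivative \<beta>) (at 0)"
        unfolding tangent_sub_def by auto
      define y where "y = \<gamma> 0"
      have y: "y \<in> V" "m y = k x" using N \<epsilon> 0 by (auto simp: y_def)
      obtain g where \<gamma>: "(\<gamma> has_vector_derivative g) (at 0)"
        using differentiable_has_vector_derivative[OF smooth_on_differentiable[OF sm(1), of 0]] \<epsilon> by auto
      have along: "((\<lambda>t. Y (m (\<gamma> t))) has_vector_derivative frechet_derivative (Y \<circ> m) (at y) g) (at 0)"
        if "smooth_along A Y" for Y :: "'l \<Rightarrow> 'w::real_normed_vector"
        using has_vector_derivative_frechet[OF \<gamma>, of "Y \<circ> m"] smooth_along_differentiable[OF that m y(1)] by (simp add: y_def)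
      obtain h where h: "frechet_derivative (\<iota> \<circ> m) (at y) g = frechet_derivative (\<iota> \<circ> k) (at x) h"
        using tangentL_chart[OF m y(1)] tangentL_chart[OF k] y(2) by (metis image_iff rangeI)
      obtain c1 c2 where hc: "h = c1 *\<^sub>R H1 x + c2 *\<^sub>R H2 x" using cramer_2[OF lframe_det[OF l x]] by blast
      have a': "a = c1 *\<^sub>R e x $ 1 + c2 *\<^sub>R e x $ 2"
      proof -
        have "((\<lambda>t. \<iota> (m (\<gamma> t))) has_vector_derivative frechet_derivative (\<iota> \<circ> m) (at y) g) (at 0)"
          using has_vector_derivative_frechet[OF \<gamma>, of "\<iota> \<circ> m"] smooth_along_differentiable[OF smooth_\<iota> m y(1)] by (simp add: y_def)
        from vector_derivative_unique_at[OF a this] show ?thesis using h hc lframe_d\<iota>[OF l x] by simp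
      qed
      note dF = along[OF smooth_F1] and d\<sigma> = along[OF \<sigma>s]
      \<comment> \<open>Only the existence of this derivative matters; it becomes the free
        coefficient \<open>d\<close>.\<close>
      obtain s' where ds: "((\<lambda>t. inner2 (w t) (F1 (m (\<gamma> t)))) has_vector_derivative s') (at 0)"
        using bounded_bilinear.has_vector_derivative[OF inner2_bilinear \<beta> dF] by blast
      have "((\<lambda>t. inner2 (w t) (F1 (m (\<gamma> t))) *\<^sub>R F1 (m (\<gamma> t)) + \<sigma> (m (\<gamma> t))) has_vector_derivative
          (s *\<^sub>R frechet_derivative (F1 \<circ> m) (at y) g + s' *\<^sub>R F1 (k x)) + frechet_derivative (\<sigma> \<circ> m) (at y) g) (at 0)"
        using has_vector_derivative_add[OF bounded_bilinear.has_vector_derivative[OF bounded_bilinear_scaleR ds dF] d\<sigma>] 0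
        by (simp add: s_def Fe)
      then have "(w has_vector_derivative
          (s *\<^sub>R frechet_derivative (F1 \<circ> m) (at y) g + s' *\<^sub>R F1 (k x)) + frechet_derivative (\<sigma> \<circ> m) (at y) g) (at 0)"
      proof (rule has_vector_derivative_transform_near[OF _ \<epsilon>])
        fix t :: real assume "dist t 0 < \<epsilon>"
        then have "(m (\<gamma> t), w t) \<in> E_plus X A \<iota> \<sigma>" using N by (auto simp: dist_real_def abs_less_iff)
        then show "inner2 (w t) (F1 (m (\<gamma> t))) *\<^sub>R F1 (m (\<gamma> t)) + \<sigma> (m (\<gamma> t)) = w t"
          using E_plus_iff[where \<sigma>=\<sigma>, OF \<sigma>F] by simp
      qed
      from vector_derivative_unique_at[OF \<beta> this]
      have "\<beta> = s' *\<^sub>R f1 (e x) + dE \<sigma> k s x h"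
        unfolding dE_def derivative_transfer[OF smooth_F1 k m y(1,2) h] derivative_transfer[OF \<sigma>s k m y(1,2) h] Fe by simp
      then have "restrict2 X (\<iota> (k x)) \<beta> = s' *\<^sub>R f1 (e x) + restrict2 X (\<iota> (k x)) (dE \<sigma> k s x h)"
        using restrict2_asd[OF F1_asd, of "k x"] by (simp add: rl Fe)
      then show "n \<in> ?R" using n a' hc by (auto simp: s_def)
    qed
    show "?R \<subseteq> ?L"
    proof
      fix n assume "n \<in> ?R"
      then obtain c1 c2 d where n: "n = (c1 *\<^sub>R e x $ 1 + c2 *\<^sub>R e x $ 2, d *\<^sub>R f1 (e x) +
         restrict2 X (\<iota> (k x)) (dE \<sigma> k s x (c1 *\<^sub>R H1 x + c2 *\<^sub>R H2 x)))" unfolding s_def by blast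
      define h where "h = c1 *\<^sub>R H1 x + c2 *\<^sub>R H2 x"
      obtain \<epsilon> where \<epsilon>: "\<epsilon> > 0" "\<forall>t\<in>{-\<epsilon><..<\<epsilon>}. x + t *\<^sub>R h \<in> U"
        using line_in_open[OF chart(1)[OF k(1)] k(2)] by blast
      let ?I = "{-\<epsilon><..<\<epsilon>}"
      define \<gamma> where "\<gamma> = (\<lambda>t. x + t *\<^sub>R h)"
      \<comment> \<open>Follows the base line and moves with speed \<open>d\<close> in the fibre
        direction \<open>F1\<close>.\<close>
      define w where "w = (\<lambda>t. (s + t * d) *\<^sub>R F1 (k (\<gamma> t)) + \<sigma> (k (\<gamma> t)))"
      have sm: "smooth_on ?I (\<lambda>t. Y (k (\<gamma> t)))" if "smooth_along A Y" for Y :: "'l \<Rightarrow> 'v form2"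
        using smooth_on_line[OF smooth_alongD[OF that k(1)], of ?I x h] \<epsilon>(2) by (simp add: \<gamma>_def)
      have lin: "smooth_on ?I (\<lambda>t. a + t *\<^sub>R b)" for a b :: "'z::real_normed_vector"
        by (intro smooth_on_add smooth_on_const smooth_on_linear bounded_linear_scaleR_left) auto
      have "smooth_on ?I w"
        unfolding w_def
        by (intro smooth_on_add[OF _ smooth_on_scaleR[OF _ lin[of s d, unfolded real_scaleR_def]]] sm smooth_F1 \<sigma>s) auto
      moreover have "smooth_on ?I \<gamma>" unfolding \<gamma>_def by (rule lin)
      moreover have "\<forall>t\<in>?I. \<gamma> t \<in> U \<and> (k (\<gamma> t), w t) \<in> E_plus X A \<iota> \<sigma>"
        using \<epsilon>(2) by (simp add: \<gamma>_def w_def E_plusI)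
      moreover have "(k (\<gamma> 0), w 0) = (k x, \<omega>)" by (simp add: \<gamma>_def w_def \<omega>_eq)
      moreover have along: "((\<lambda>t. Y (k (\<gamma> t))) has_vector_derivative frechet_derivative (Y \<circ> k) (at x) h) (at 0)"
        if "smooth_along A Y" for Y :: "'l \<Rightarrow> 'v form2"
        using has_vector_derivative_frechet[OF line_curve, of "Y \<circ> k" x h] smooth_along_differentiable[OF that k]
        by (simp add: \<gamma>_def)
      moreover have "((\<lambda>t. \<iota> (k (\<gamma> t))) has_vector_derivative c1 *\<^sub>R e x $ 1 + c2 *\<^sub>R e x $ 2) (at 0)"
        using has_vector_derivative_frechet[OF line_curve, of "\<iota> \<circ> k" x h] smooth_along_differentiable[OF smooth_\<iota> k]
        by (simp add: \<gamma>_def h_def lframe_d\<iota>[OF l x])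
      moreover have "(w has_vector_derivative d *\<^sub>R f1 (e x) + dE \<sigma> k s x h) (at 0)"
      proof -
        have "((\<lambda>t. s + t * d) has_vector_derivative d) (at 0)" by (auto intro!: derivative_eq_intros)
        from has_vector_derivative_add[OF bounded_bilinear.has_vector_derivative[OF bounded_bilinear_scaleR this along[OF smooth_F1]] along[OF \<sigma>s]]
        show ?thesis unfolding w_def by (simp add: dE_def Fe \<gamma>_def algebra_simps)
      qed
      moreover have "restrict2 X (\<iota> (k x)) (d *\<^sub>R f1 (e x) + dE \<sigma> k s x h) = d *\<^sub>R f1 (e x) + restrict2 X (\<iota> (k x)) (dE \<sigma> k s x h)"
        using restrict2_asd[OF F1_asd, of "k x"] by (simp add: rl Fe)
      ultimately show "n \<in> ?L"
        unfolding tangent_sub_def n h_def[symmetric] mem_Collect_eq fst_conv using k(1) \<epsilon>(1) by metis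
    qed
  qed
qed

text \<open>\<open>s\<close> is the coefficient of \<open>f1\<close> at the point considered. The
  \<open>f1\<close>-components of the last two vectors are left out, being multiples of the first
  vector.\<close>

definition basis_E :: "(real^2 \<Rightarrow> 'l) \<Rightarrow> (real^2 \<Rightarrow> 'v^4) \<Rightarrow> (real^2 \<Rightarrow> real^2) \<Rightarrow> (real^2 \<Rightarrow> real^2)
    \<Rightarrow> ('l \<Rightarrow> 'v form2) \<Rightarrow> real \<Rightarrow> real^2 \<Rightarrow> ('v \<times> 'v form2)^3" where
  "basis_E k e H1 H2 \<sigma> s x = vector [(0, f1 (e x)),
     (e x $ 1, inner2 (dE \<sigma> k s x (H1 x)) (f2 (e x)) *\<^sub>R f2 (e x) + inner2 (dE \<sigma> k s x (H1 x)) (f3 (e x)) *\<^sub>R f3 (e x)),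
     (e x $ 2, inner2 (dE \<sigma> k s x (H2 x)) (f2 (e x)) *\<^sub>R f2 (e x) + inner2 (dE \<sigma> k s x (H2 x)) (f3 (e x)) *\<^sub>R f3 (e x))]"

lemma smooth_section_F_asd: "smooth_section A (F_fib X A \<iota>) \<sigma> \<Longrightarrow> smooth_along A \<sigma> \<and> (\<forall>p. \<sigma> p \<in> asd X (\<iota> p))"
  by (auto simp: smooth_section_def F_fib_def)

lemma smooth_section_E_asd: "smooth_section A (E_fib X A \<iota>) \<eta> \<Longrightarrow> smooth_along A \<eta> \<and> (\<forall>p. \<eta> p \<in> asd X (\<iota> p))"
  by (auto simp: smooth_section_def E_fib_eq) (metis F1_asd imageE subspace_scale[OF subspace_asd])

lemma restrict2_expand:
  assumes l: "lframe U k W e H1 H2" and x: "x \<in> W" and r: "restrict2 X (\<iota> (k x)) \<beta> \<in> asd X (\<iota> (k x))"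
  shows "restrict2 X (\<iota> (k x)) \<beta> = inner2 \<beta> (f1 (e x)) *\<^sub>R f1 (e x) + inner2 \<beta> (f2 (e x)) *\<^sub>R f2 (e x) + inner2 \<beta> (f3 (e x)) *\<^sub>R f3 (e x)"
  using asd_expand[OF \<iota>_points adapted_frames(1)[OF lframeD(7)[OF l x]] r]
    inner2_restrict2[OF \<iota>_points oframe_tangent[OF adapted_frames(1)[OF lframeD(7)[OF l x]]], of \<beta>] by simp

lemma restrict2_dE_asd:
  assumes "smooth_section A (F_fib X A \<iota>) \<sigma>" "(U, k) \<in> A" "x \<in> U"
  shows "restrict2 X (\<iota> (k x)) (dE \<sigma> k s x h) \<in> asd X (\<iota> (k x))"
  using smooth_section_F_asd[OF assms(1)] assms(2,3) unfolding dE_def restrict2_linear[OF \<iota>_points]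
  by (intro subspace_add[OF subspace_asd] subspace_scale[OF subspace_asd] restrict2_derivative_asd smooth_F1 F1_asd) auto

lemma basis_of_basis_E:
  assumes l: "lframe U k W e H1 H2" and x: "x \<in> W" and \<sigma>: "smooth_section A (F_fib X A \<iota>) \<sigma>"
    and \<omega>: "(k x, \<omega>) \<in> E_plus X A \<iota> \<sigma>"
  shows "basis_of (tangent_sub X A \<iota> (E_plus X A \<iota> \<sigma>) (k x, \<omega>)) (basis_E k e H1 H2 \<sigma> (inner2 \<omega> (f1 (e x))) x)"
proof -
  note k = lframeD(1)[OF l] lframeD(10)[OF l x] and ad = adapted_frames[OF lframeD(7)[OF l x]]
  define s where "s = inner2 \<omega> (f1 (e x))"
  define D where "D = dE \<sigma> k s x"
  let ?B = "basis_E k e H1 H2 \<sigma> s x"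
  define d1 where "d1 = inner2 (D (H1 x)) (f1 (e x))"
  define d2 where "d2 = inner2 (D (H2 x)) (f1 (e x))"
  have lin: "linear D" unfolding D_def
    by (rule linear_dE[OF _ k]) (use \<sigma> in \<open>simp add: smooth_section_def\<close>)
  have R: "restrict2 X (\<iota> (k x)) (D h) = inner2 (D h) (f1 (e x)) *\<^sub>R f1 (e x) + inner2 (D h) (f2 (e x)) *\<^sub>R f2 (e x)
      + inner2 (D h) (f3 (e x)) *\<^sub>R f3 (e x)" for h
    unfolding D_def by (rule restrict2_expand[OF l x restrict2_dE_asd[OF \<sigma> k]])
  \<comment> \<open>The shift of the first coordinate by \<open>d1\<close> and \<open>d2\<close>
    restores the \<open>f1\<close>-components that \<open>basis_E\<close> omits.\<close>
  have lc: "lincomb ?B z = (z$2 *\<^sub>R e x $ 1 + z$3 *\<^sub>R e x $ 2, (z$1 - z$2 * d1 - z$3 * d2) *\<^sub>R f1 (e x)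
      + restrict2 X (\<iota> (k x)) (D (z$2 *\<^sub>R H1 x + z$3 *\<^sub>R H2 x)))" for z
    unfolding R
    by (simp add: lincomb_def sum_3 basis_E_def D_def[symmetric] linear_add[OF lin] linear_cmul[OF lin]
        inner2_add_left inner2_scale_left d1_def d2_def algebra_simps)
  have "tangent_sub X A \<iota> (E_plus X A \<iota> \<sigma>) (k x, \<omega>) = range (lincomb ?B)"
  proof (intro equalityI subsetI)
    fix n assume "n \<in> tangent_sub X A \<iota> (E_plus X A \<iota> \<sigma>) (k x, \<omega>)"
    then obtain c1 c2 d where n: "n = (c1 *\<^sub>R e x $ 1 + c2 *\<^sub>R e x $ 2, d *\<^sub>R f1 (e x) + restrict2 X (\<iota> (k x)) (D (c1 *\<^sub>R H1 x + c2 *\<^sub>R H2 x)))"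
      unfolding tangent_E_plus[OF l x \<sigma> \<omega>] D_def s_def by blast
    have "n = lincomb ?B (vector [d + c1 * d1 + c2 * d2, c1, c2])" unfolding lc n by simp
    then show "n \<in> range (lincomb ?B)" by blast
  next
    fix n assume "n \<in> range (lincomb ?B)"
    then obtain z where z: "n = lincomb ?B z" by blast
    show "n \<in> tangent_sub X A \<iota> (E_plus X A \<iota> \<sigma>) (k x, \<omega>)"
      unfolding tangent_E_plus[OF l x \<sigma> \<omega>] s_def[symmetric] D_def[symmetric]
      using z[unfolded lc] by blast
  qed
  moreover have "z = 0" if "lincomb ?B z = 0" for z
  proof -
    have 1: "z$2 *\<^sub>R e x $ 1 + z$3 *\<^sub>R e x $ 2 = 0" and
      2: "(z$1 - z$2 * d1 - z$3 * d2) *\<^sub>R f1 (e x) + restrict2 X (\<iota> (k x)) (D (z$2 *\<^sub>R H1 x + z$3 *\<^sub>R H2 x)) = 0"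
      using that unfolding lc by (simp_all add: zero_prod_def)
    have "(z$2 *\<^sub>R e x $ 1 + z$3 *\<^sub>R e x $ 2) \<bullet> e x $ 1 = 0" "(z$2 *\<^sub>R e x $ 1 + z$3 *\<^sub>R e x $ 2) \<bullet> e x $ 2 = 0"
      unfolding 1 by simp_all
    then have z: "z$2 = 0" "z$3 = 0" by (simp_all add: inner_add_left onf_simps[OF ad(3)])
    have "D 0 = 0" by (rule linear_0[OF lin])
    then have "restrict2 X (\<iota> (k x)) (D 0) = 0" using R[of 0] by simp
    then have 3: "z$1 *\<^sub>R f1 (e x) = 0" using 2 z by simp
    have "z$1 = inner2 (z$1 *\<^sub>R f1 (e x)) (f1 (e x))" by (simp add: inner2_scale_left f_orthonormal[OF ad(3)])
    also have "\<dots> = 0" by (simp only: 3 inner2_zero)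
    finally have "z$1 = 0" .
    with z show ?thesis by (simp add: vec_eq_iff forall_3)
  qed
  ultimately show ?thesis unfolding basis_of_iff s_def by blast
qed

text \<open>The \<open>f\<^sup>1\<close>-component of a tangent vector of \<open>\<eta> + F\<close> at \<open>\<eta> + \<tau>\<close>: differentiating
  \<open>\<langle>\<tau>, f\<^sup>1\<rangle> = 0\<close> replaces the derivative of \<open>\<tau>\<close> by that of \<open>f\<^sup>1\<close>.\<close>

definition tF :: "('l \<Rightarrow> 'v form2) \<Rightarrow> (real^2 \<Rightarrow> 'l) \<Rightarrow> 'v form2 \<Rightarrow> real^2 \<Rightarrow> real^2 \<Rightarrow> real" where
  "tF \<eta> k \<tau> x h = inner2 (frechet_derivative (\<eta> \<circ> k) (at x) h) (F1 (k x)) - inner2 \<tau> (frechet_derivative (F1 \<circ> k) (at x) h)"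

lemma linear_tF:
  assumes "smooth_along A \<eta>" "(U, k) \<in> A" "x \<in> U" shows "linear (tF \<eta> k \<tau> x)"
proof -
  note l1 = linear_frechet[OF assms] and l2 = linear_frechet[OF smooth_F1 assms(2,3)]
  show ?thesis unfolding tF_def
    by (rule linearI) (simp_all add: linear_add[OF l1] linear_cmul[OF l1] linear_add[OF l2] linear_cmul[OF l2]
        inner2_add_left inner2_add_right inner2_scale_left inner2_scale_right algebra_simps)
qed

text \<open>Only the \<open>f1\<close>-component is constrained, by orthogonality of the fibre part
  to \<open>F1\<close>; the components along \<open>f2\<close> and \<open>f3\<close> are free
  because the fibre of \<open>F\<close> is a vector space.\<close>

lemma tangent_plus_F:
  assumes l: "lframe U k W e H1 H2" and x: "x \<in> W" and \<eta>: "smooth_section A (E_fib X A \<iota>) \<eta>"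
    and \<omega>: "(k x, \<omega>) \<in> plus_F X A \<iota> \<eta>"
  shows "tangent_sub X A \<iota> (plus_F X A \<iota> \<eta>) (k x, \<omega>) =
    {(c1 *\<^sub>R e x $ 1 + c2 *\<^sub>R e x $ 2, tF \<eta> k (\<omega> - \<eta> (k x)) x (c1 *\<^sub>R H1 x + c2 *\<^sub>R H2 x) *\<^sub>R f1 (e x) + d2 *\<^sub>R f2 (e x) + d3 *\<^sub>R f3 (e x))
     | c1 c2 d2 d3. True}" (is "?L = ?R")
proof -
  note k = lframeD(1)[OF l] lframeD(10)[OF l x] and ad = adapted_frames[OF lframeD(7)[OF l x]]
  note fa = f_asd[OF \<iota>_points ad(1)] and o = f_orthonormal[OF ad(3)]
  have \<eta>s: "smooth_along A \<eta>" and \<eta>a: "\<And>p. \<eta> p \<in> asd X (\<iota> p)" using smooth_section_E_asd[OF \<eta>] by auto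
  have Fe: "F1 (k y) = f1 (e y)" if "y \<in> W" for y by (rule F1_eq[OF lframeD(7)[OF l that]])
  define \<tau> where "\<tau> = \<omega> - \<eta> (k x)"
  have \<tau>: "\<tau> \<in> asd X (\<iota> (k x))" "inner2 \<tau> (F1 (k x)) = 0"
    using \<omega> by (auto simp: plus_F_iff F_fib_eq \<tau>_def)
  note rl = restrict2_linear[OF \<iota>_points]
  show ?thesis
  proof
    show "?L \<subseteq> ?R"
    proof
      fix n assume "n \<in> ?L"
      then obtain a \<beta> V m \<epsilon> \<gamma> w where n: "n = (a, restrict2 X (\<iota> (k x)) \<beta>)" and m: "(V, m) \<in> A" and \<epsilon>: "\<epsilon> > (0::real)"
        and sm: "smooth_on {-\<epsilon><..<\<epsilon>} \<gamma>" "smooth_on {-\<epsilon><..<\<epsilon>} w"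
        and N: "\<forall>t\<in>{-\<epsilon><..<\<epsilon>}. \<gamma> t \<in> V \<and> (m (\<gamma> t), w t) \<in> plus_F X A \<iota> \<eta>" and 0: "(m (\<gamma> 0), w 0) = (k x, \<omega>)"
        and a: "((\<lambda>t. \<iota> (m (\<gamma> t))) has_vector_derivative a) (at 0)" and \<beta>: "(w has_vector_derivative \<beta>) (at 0)"
        unfolding tangent_sub_def by auto
      define y where "y = \<gamma> 0"
      have y: "y \<in> V" "m y = k x" using N \<epsilon> 0 by (auto simp: y_def)
      obtain g where \<gamma>: "(\<gamma> has_vector_derivative g) (at 0)"
        using differentiable_has_vector_derivative[OF smooth_on_differentiable[OF sm(1), of 0]] \<epsilon> by auto
      have along: "((\<lambda>t. Y (m (\<gamma> t))) has_vector_derivative frechet_derivative (Y \<circ> m) (at y) g) (at 0)"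
        if "smooth_along A Y" for Y :: "'l \<Rightarrow> 'w::real_normed_vector"
        using has_vector_derivative_frechet[OF \<gamma>, of "Y \<circ> m"] smooth_along_differentiable[OF that m y(1)] by (simp add: y_def)
      obtain h where h: "frechet_derivative (\<iota> \<circ> m) (at y) g = frechet_derivative (\<iota> \<circ> k) (at x) h"
        using tangentL_chart[OF m y(1)] tangentL_chart[OF k] y(2) by (metis image_iff rangeI)
      obtain c1 c2 where hc: "h = c1 *\<^sub>R H1 x + c2 *\<^sub>R H2 x" using cramer_2[OF lframe_det[OF l x]] by blast
      have a': "a = c1 *\<^sub>R e x $ 1 + c2 *\<^sub>R e x $ 2"
        using vector_derivative_unique_at[OF a along[OF smooth_\<iota>]] h hc lframe_d\<iota>[OF l x] by simp
      \<comment> \<open>\<open>curve_asd\<close> works with a local frame in the chart of the curve,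
        which may differ from \<open>k\<close>.\<close>
      have "adapted X A \<iota> (m y) (e x)" using lframeD(7)[OF l x] y(2) by simp
      then obtain W' e' H1' H2' where l': "lframe V m W' e' H1' H2'" "y \<in> W'" using lframe_ex[OF m y(1)] by blast
      have wa: "w t \<in> asd X (\<iota> (m (\<gamma> t)))" "inner2 (w t - \<eta> (m (\<gamma> t))) (F1 (m (\<gamma> t))) = 0" if "t \<in> {-\<epsilon><..<\<epsilon>}" for t
      proof -
        have d: "w t - \<eta> (m (\<gamma> t)) \<in> asd X (\<iota> (m (\<gamma> t)))" "inner2 (w t - \<eta> (m (\<gamma> t))) (F1 (m (\<gamma> t))) = 0"
          using N that by (auto simp: plus_F_iff F_fib_eq)
        show "inner2 (w t - \<eta> (m (\<gamma> t))) (F1 (m (\<gamma> t))) = 0" by (rule d(2))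
        show "w t \<in> asd X (\<iota> (m (\<gamma> t)))" using subspace_add[OF subspace_asd d(1) \<eta>a[of "m (\<gamma> t)"]] by simp
      qed
      have \<beta>a: "restrict2 X (\<iota> (k x)) \<beta> \<in> asd X (\<iota> (k x))"
        using curve_asd[OF l' \<gamma> y_def[symmetric] \<beta> \<epsilon> wa(1)] y(2) by simp
      have "((\<lambda>t. inner2 (w t - \<eta> (m (\<gamma> t))) (F1 (m (\<gamma> t)))) has_vector_derivative
         inner2 \<tau> (frechet_derivative (F1 \<circ> m) (at y) g) + inner2 (\<beta> - frechet_derivative (\<eta> \<circ> m) (at y) g) (F1 (k x))) (at 0)"
        using bounded_bilinear.has_vector_derivative[OF inner2_bilinear has_vector_derivative_diff[OF \<beta> along[OF \<eta>s]] along[OF smooth_F1]] 0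
        by (simp add: \<tau>_def)
      moreover have "((\<lambda>t. inner2 (w t - \<eta> (m (\<gamma> t))) (F1 (m (\<gamma> t)))) has_vector_derivative 0) (at 0)"
        by (rule has_vector_derivative_transform_near[OF has_vector_derivative_const \<epsilon>]) (use wa(2) in \<open>auto simp: dist_real_def abs_less_iff\<close>)
      ultimately have "inner2 \<tau> (frechet_derivative (F1 \<circ> m) (at y) g) + inner2 (\<beta> - frechet_derivative (\<eta> \<circ> m) (at y) g) (F1 (k x)) = 0"
        by (rule vector_derivative_unique_at)
      then have "inner2 \<beta> (f1 (e x)) = tF \<eta> k \<tau> x h"
        unfolding tF_def derivative_transfer[OF smooth_F1 k m y(1,2) h] derivative_transfer[OF \<eta>s k m y(1,2) h]
        by (simp add: inner2_diff_left Fe[OF x])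
      then show "n \<in> ?R" using n a' hc restrict2_expand[OF l x \<beta>a] unfolding \<tau>_def[symmetric] by auto
    qed
    show "?R \<subseteq> ?L"
    proof
      fix n assume "n \<in> ?R"
      then obtain c1 c2 d2 d3 where n: "n = (c1 *\<^sub>R e x $ 1 + c2 *\<^sub>R e x $ 2,
         tF \<eta> k \<tau> x (c1 *\<^sub>R H1 x + c2 *\<^sub>R H2 x) *\<^sub>R f1 (e x) + d2 *\<^sub>R f2 (e x) + d3 *\<^sub>R f3 (e x))" unfolding \<tau>_def by blast
      define h where "h = c1 *\<^sub>R H1 x + c2 *\<^sub>R H2 x"
      obtain \<epsilon> where \<epsilon>: "\<epsilon> > 0" "\<forall>t\<in>{-\<epsilon><..<\<epsilon>}. x + t *\<^sub>R h \<in> W"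
        using line_in_open[OF lframeD(2)[OF l] x] by blast
      let ?I = "{-\<epsilon><..<\<epsilon>}"
      define \<gamma> where "\<gamma> = (\<lambda>t. x + t *\<^sub>R h)"
      note fs = field_f_smooth[OF lframe_field[OF l]]
      let ?D2 = "frechet_derivative (\<lambda>y. f2 (e y)) (at x) h" and ?D3 = "frechet_derivative (\<lambda>y. f3 (e y)) (at x) h"
      define y0 where "y0 = inner2 \<tau> (f2 (e x))"
      define z0 where "z0 = inner2 \<tau> (f3 (e x))"
      \<comment> \<open>Derivative of the form when the coefficients \<open>y0\<close>,
        \<open>z0\<close> are held constant. The speeds \<open>y1\<close>, \<open>z1\<close> then
        correct its components along \<open>f2\<close> and \<open>f3\<close> to the prescribed
        \<open>d2\<close>, \<open>d3\<close>.\<close>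
      define B0 where "B0 = frechet_derivative (\<eta> \<circ> k) (at x) h + y0 *\<^sub>R ?D2 + z0 *\<^sub>R ?D3"
      define y1 where "y1 = d2 - inner2 B0 (f2 (e x))"
      define z1 where "z1 = d3 - inner2 B0 (f3 (e x))"
      define w where "w = (\<lambda>t. \<eta> (k (\<gamma> t)) + (y0 + t * y1) *\<^sub>R f2 (e (\<gamma> t)) + (z0 + t * z1) *\<^sub>R f3 (e (\<gamma> t)))"
      have \<tau>_eq: "\<tau> = y0 *\<^sub>R f2 (e x) + z0 *\<^sub>R f3 (e x)"
        using asd_expand[OF \<iota>_points ad(1) \<tau>(1)] \<tau>(2) by (simp add: Fe[OF x] y0_def z0_def)
      have lin: "smooth_on ?I (\<lambda>t. a + t *\<^sub>R b)" for a b :: "'z::real_normed_vector"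
        by (intro smooth_on_add smooth_on_const smooth_on_linear bounded_linear_scaleR_left) auto
      have smW: "smooth_on ?I (\<lambda>t. Y (\<gamma> t))" if "smooth_on W Y" for Y :: "real^2 \<Rightarrow> 'v form2"
        using smooth_on_line[OF that, of ?I x h] \<epsilon>(2) by (simp add: \<gamma>_def)
      have \<eta>W: "smooth_on W (\<lambda>y. \<eta> (k y))"
        using smooth_on_subset[OF smooth_alongD[OF \<eta>s k(1)] lframeD(3)[OF l]] by (simp add: o_def)
      have smw: "smooth_on ?I w"
        unfolding w_def
        by (intro smooth_on_add[OF _ smooth_on_add[OF _ smW[OF \<eta>W]]] smooth_on_scaleR[OF _ lin[of _ y1, unfolded real_scaleR_def]]
            smooth_on_scaleR[OF _ lin[of _ z1, unfolded real_scaleR_def]] smW fs) auto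
      have sm\<gamma>: "smooth_on ?I \<gamma>" unfolding \<gamma>_def by (rule lin)
      have mem: "\<gamma> t \<in> U \<and> (k (\<gamma> t), w t) \<in> plus_F X A \<iota> \<eta>" if "t \<in> ?I" for t
      proof -
        have W: "\<gamma> t \<in> W" using \<epsilon>(2) that by (simp add: \<gamma>_def)
        note adt = adapted_frames[OF lframeD(7)[OF l W]]
        have "w t - \<eta> (k (\<gamma> t)) \<in> asd X (\<iota> (k (\<gamma> t)))"
          unfolding w_def using f_asd[OF \<iota>_points adt(1)]
          by (simp add: add.assoc) (intro subspace_add[OF subspace_asd] subspace_scale[OF subspace_asd])
        moreover have "inner2 (w t - \<eta> (k (\<gamma> t))) (F1 (k (\<gamma> t))) = 0"
          by (simp add: w_def Fe[OF W] inner2_add_left inner2_scale_left f_orthonormal[OF adt(3)] inner2_diff_left)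
        ultimately show ?thesis using lframeD(10)[OF l W] by (simp add: plus_F_iff F_fib_eq)
      qed
      have w0: "(k (\<gamma> 0), w 0) = (k x, \<omega>)"
        using \<tau>_eq by (simp add: \<gamma>_def w_def \<tau>_def algebra_simps)
      have d\<iota>: "((\<lambda>t. \<iota> (k (\<gamma> t))) has_vector_derivative c1 *\<^sub>R e x $ 1 + c2 *\<^sub>R e x $ 2) (at 0)"
        using has_vector_derivative_frechet[OF line_curve, of "\<iota> \<circ> k" x h] smooth_along_differentiable[OF smooth_\<iota> k]
        by (simp add: \<gamma>_def h_def lframe_d\<iota>[OF l x])
      have alongW: "((\<lambda>t. Y (\<gamma> t)) has_vector_derivative frechet_derivative Y (at x) h) (at 0)" if "smooth_on W Y" for Y :: "real^2 \<Rightarrow> 'v form2"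
        using has_vector_derivative_frechet[OF line_curve, of Y x h] smooth_on_differentiable[OF that x] by (simp add: \<gamma>_def)
      have aff: "((\<lambda>t. a + t * b) has_vector_derivative b) (at 0)" for a b :: real by (auto intro!: derivative_eq_intros)
      have dw: "(w has_vector_derivative B0 + y1 *\<^sub>R f2 (e x) + z1 *\<^sub>R f3 (e x)) (at 0)"
        using has_vector_derivative_add[OF has_vector_derivative_add[OF alongW[OF \<eta>W]
            bounded_bilinear.has_vector_derivative[OF bounded_bilinear_scaleR aff[of y0 y1] alongW[OF fs(2)]]]
            bounded_bilinear.has_vector_derivative[OF bounded_bilinear_scaleR aff[of z0 z1] alongW[OF fs(3)]]]
        unfolding w_def by (simp add: B0_def \<gamma>_def o_def algebra_simps)
      let ?\<beta> = "B0 + y1 *\<^sub>R f2 (e x) + z1 *\<^sub>R f3 (e x)"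
      have \<beta>a: "restrict2 X (\<iota> (k x)) ?\<beta> \<in> asd X (\<iota> (k x))"
        unfolding B0_def rl restrict2_asd[OF fa(2)] restrict2_asd[OF fa(3)]
        using restrict2_derivative_asd[OF \<eta>s \<eta>a k] nabla_f_asd[OF lframe_field[OF l] x]
        by (intro subspace_add[OF subspace_asd] subspace_scale[OF subspace_asd] fa)
      have "inner2 ?\<beta> (f2 (e x)) = d2" "inner2 ?\<beta> (f3 (e x)) = d3"
        by (simp_all add: inner2_add_left inner2_scale_left o y1_def z1_def)
      moreover have "inner2 ?\<beta> (f1 (e x)) = tF \<eta> k \<tau> x h"
      proof -
        have "((\<lambda>t. inner2 (w t - \<eta> (k (\<gamma> t))) (F1 (k (\<gamma> t)))) has_vector_derivative
           inner2 \<tau> (frechet_derivative (F1 \<circ> k) (at x) h) + inner2 (?\<beta> - frechet_derivative (\<eta> \<circ> k) (at x) h) (F1 (k x))) (at 0)"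
        proof -
          have F1W: "smooth_on W (\<lambda>y. F1 (k y))"
            using smooth_on_subset[OF smooth_alongD[OF smooth_F1 k(1)] lframeD(3)[OF l]] by (simp add: o_def)
          show ?thesis
            using bounded_bilinear.has_vector_derivative[OF inner2_bilinear has_vector_derivative_diff[OF dw alongW[OF \<eta>W]] alongW[OF F1W]] w0
            by (simp add: \<tau>_def o_def)
        qed
        moreover have "((\<lambda>t. inner2 (w t - \<eta> (k (\<gamma> t))) (F1 (k (\<gamma> t)))) has_vector_derivative 0) (at 0)"
          by (rule has_vector_derivative_transform_near[OF has_vector_derivative_const \<epsilon>(1)])
            (use mem in \<open>auto simp: dist_real_def abs_less_iff plus_F_iff F_fib_eq\<close>)
        ultimately have "inner2 \<tau> (frechet_derivative (F1 \<circ> k) (at x) h) + inner2 (?\<beta> - frechet_derivative (\<eta> \<circ> k) (at x) h) (F1 (k x)) = 0"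
          by (rule vector_derivative_unique_at)
        then show ?thesis by (simp add: tF_def inner2_diff_left Fe[OF x])
      qed
      ultimately have "restrict2 X (\<iota> (k x)) ?\<beta> = tF \<eta> k \<tau> x h *\<^sub>R f1 (e x) + d2 *\<^sub>R f2 (e x) + d3 *\<^sub>R f3 (e x)"
        using restrict2_expand[OF l x \<beta>a] by simp
      then show "n \<in> ?L"
        unfolding tangent_sub_def n h_def[symmetric] mem_Collect_eq fst_conv
        using k(1) \<epsilon>(1) sm\<gamma> smw mem w0 d\<iota> dw by metis
    qed
  qed
qed

text \<open>The order of the first two vectors makes \<open>psi\<close> positive.\<close>

definition basis_F :: "(real^2 \<Rightarrow> 'l) \<Rightarrow> (real^2 \<Rightarrow> 'v^4) \<Rightarrow> (real^2 \<Rightarrow> real^2) \<Rightarrow> (real^2 \<Rightarrow> real^2)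
    \<Rightarrow> ('l \<Rightarrow> 'v form2) \<Rightarrow> 'v form2 \<Rightarrow> real^2 \<Rightarrow> ('v \<times> 'v form2)^4" where
  "basis_F k e H1 H2 \<eta> \<omega> x = vector [(e x $ 2, tF \<eta> k (\<omega> - \<eta> (k x)) x (H2 x) *\<^sub>R f1 (e x)),
     (e x $ 1, tF \<eta> k (\<omega> - \<eta> (k x)) x (H1 x) *\<^sub>R f1 (e x)), (0, f2 (e x)), (0, f3 (e x))]"

lemma basis_of_basis_F:
  assumes l: "lframe U k W e H1 H2" and x: "x \<in> W" and \<eta>: "smooth_section A (E_fib X A \<iota>) \<eta>"
    and \<omega>: "(k x, \<omega>) \<in> plus_F X A \<iota> \<eta>"
  shows "basis_of (tangent_sub X A \<iota> (plus_F X A \<iota> \<eta>) (k x, \<omega>)) (basis_F k e H1 H2 \<eta> \<omega> x)"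
proof -
  note k = lframeD(1)[OF l] lframeD(10)[OF l x] and ad = adapted_frames[OF lframeD(7)[OF l x]]
  define t where "t = tF \<eta> k (\<omega> - \<eta> (k x)) x"
  let ?B = "basis_F k e H1 H2 \<eta> \<omega> x"
  have lin: "linear t" unfolding t_def
    by (rule linear_tF[OF _ k]) (use \<eta> in \<open>simp add: smooth_section_def\<close>)
  have lc: "lincomb ?B z = (z$2 *\<^sub>R e x $ 1 + z$1 *\<^sub>R e x $ 2, t (z$2 *\<^sub>R H1 x + z$1 *\<^sub>R H2 x) *\<^sub>R f1 (e x) + z$3 *\<^sub>R f2 (e x) + z$4 *\<^sub>R f3 (e x))" for z
    by (simp add: lincomb_def sum_4 basis_F_def t_def[symmetric] linear_add[OF lin] linear_cmul[OF lin] algebra_simps)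
  have "tangent_sub X A \<iota> (plus_F X A \<iota> \<eta>) (k x, \<omega>) = range (lincomb ?B)"
  proof (intro equalityI subsetI)
    fix n assume "n \<in> tangent_sub X A \<iota> (plus_F X A \<iota> \<eta>) (k x, \<omega>)"
    then obtain c1 c2 d2 d3 where n: "n = (c1 *\<^sub>R e x $ 1 + c2 *\<^sub>R e x $ 2, t (c1 *\<^sub>R H1 x + c2 *\<^sub>R H2 x) *\<^sub>R f1 (e x) + d2 *\<^sub>R f2 (e x) + d3 *\<^sub>R f3 (e x))"
      unfolding tangent_plus_F[OF l x \<eta> \<omega>] t_def by blast
    have "n = lincomb ?B (vector [c2, c1, d2, d3])" unfolding lc n by simp
    then show "n \<in> range (lincomb ?B)" by blast
  next
    fix n assume "n \<in> range (lincomb ?B)"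
    then obtain z where z: "n = lincomb ?B z" by blast
    show "n \<in> tangent_sub X A \<iota> (plus_F X A \<iota> \<eta>) (k x, \<omega>)"
      unfolding tangent_plus_F[OF l x \<eta> \<omega>] t_def[symmetric] using z[unfolded lc] by blast
  qed
  moreover have "z = 0" if "lincomb ?B z = 0" for z
  proof -
    have 1: "z$2 *\<^sub>R e x $ 1 + z$1 *\<^sub>R e x $ 2 = 0" and
      2: "t (z$2 *\<^sub>R H1 x + z$1 *\<^sub>R H2 x) *\<^sub>R f1 (e x) + z$3 *\<^sub>R f2 (e x) + z$4 *\<^sub>R f3 (e x) = 0"
      using that unfolding lc by (simp_all add: zero_prod_def)
    have "(z$2 *\<^sub>R e x $ 1 + z$1 *\<^sub>R e x $ 2) \<bullet> e x $ 1 = 0" "(z$2 *\<^sub>R e x $ 1 + z$1 *\<^sub>R e x $ 2) \<bullet> e x $ 2 = 0"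
      unfolding 1 by simp_all
    then have z: "z$1 = 0" "z$2 = 0" by (simp_all add: inner_add_left onf_simps[OF ad(3)])
    have "inner2 (t (z$2 *\<^sub>R H1 x + z$1 *\<^sub>R H2 x) *\<^sub>R f1 (e x) + z$3 *\<^sub>R f2 (e x) + z$4 *\<^sub>R f3 (e x)) (f2 (e x)) = 0"
      "inner2 (t (z$2 *\<^sub>R H1 x + z$1 *\<^sub>R H2 x) *\<^sub>R f1 (e x) + z$3 *\<^sub>R f2 (e x) + z$4 *\<^sub>R f3 (e x)) (f3 (e x)) = 0"
      unfolding 2 by simp_all
    then have "z$3 = 0" "z$4 = 0" by (simp_all add: inner2_add_left inner2_scale_left f_orthonormal[OF ad(3)])
    with z show ?thesis by (simp add: vec_eq_iff forall_4)
  qed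
  ultimately show ?thesis unfolding basis_of_iff by blast
qed

end

section \<open>The second fundamental form and the induced connections\<close>

context surface_in
begin

text \<open>Differentiating the orthogonality of the normal field \<open>e y $ j\<close> to the
  coordinate fields turns both sides into second derivatives of \<open>\<iota>\<close> paired with
  it. The coordinate fields belong to the constant vectors \<open>H1 x\<close>, \<open>H2 x\<close>,
  so no bracket term appears and \<open>mixed_derivatives\<close> applies.\<close>

lemma \<Gamma>_symmetric:
  assumes l: "lframe U k W e H1 H2" and x: "x \<in> W" and j: "j = 3 \<or> j = 4"
  shows "\<Gamma> e x 1 j (H2 x) = \<Gamma> e x 2 j (H1 x)"
proof -
  note k = lframeD(1)[OF l] lframeD(10)[OF l x]
  let ?d = "\<lambda>h y. frechet_derivative (\<iota> \<circ> k) (at y) h"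
  have sd: "smooth_on U (?d h)" for h by (rule smooth_on_deriv[OF smooth_alongD[OF smooth_\<iota> k(1)]])
  let ?D = "frechet_derivative (\<lambda>y. e y $ j) (at x)"
  have dj: "((\<lambda>y. e y $ j) has_derivative ?D) (at x)"
    by (rule frechet_works[OF field_differentiable[OF lframe_field[OF l] x]])
  have eq: "?D g \<bullet> ?d h x + e x $ j \<bullet> frechet_derivative (?d h) (at x) g = 0" for g h
  proof -
    have "((\<lambda>y. e y $ j \<bullet> ?d h y) has_derivative (\<lambda>g. e x $ j \<bullet> frechet_derivative (?d h) (at x) g + ?D g \<bullet> ?d h x)) (at x)"
      by (rule has_derivative_inner[OF dj frechet_works[OF smooth_on_differentiable[OF sd k(2)]]])
    moreover have "((\<lambda>y. e y $ j \<bullet> ?d h y) has_derivative (\<lambda>g. 0)) (at x)"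
    proof (rule has_derivative_transform_within_open[OF has_derivative_const[of 0] lframeD(2)[OF l] x])
      fix y assume y: "y \<in> W"
      have "?d h y \<in> tangentL A \<iota> (k y)" using tangentL_chart[OF k(1) lframeD(10)[OF l y]] by blast
      then obtain c1 c2 where "?d h y = c1 *\<^sub>R e y $ 1 + c2 *\<^sub>R e y $ 2" using lframe_tangentL[OF l y] by blast
      then show "0 = e y $ j \<bullet> ?d h y"
        using j by (auto simp: inner_add_right onf_simps[OF adapted_frames(3)[OF lframeD(7)[OF l y]]])
    qed
    ultimately have "(\<lambda>g. e x $ j \<bullet> frechet_derivative (?d h) (at x) g + ?D g \<bullet> ?d h x) = (\<lambda>g. 0)"
      by (rule has_derivative_unique)
    then have "e x $ j \<bullet> frechet_derivative (?d h) (at x) g + ?D g \<bullet> ?d h x = 0" by meson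
    then show ?thesis by simp
  qed
  have "\<Gamma> e x 1 j g = e x $ j \<bullet> frechet_derivative (?d (H1 x)) (at x) g"
    "\<Gamma> e x 2 j g = e x $ j \<bullet> frechet_derivative (?d (H2 x)) (at x) g" for g
    using eq[of g "H1 x"] eq[of g "H2 x"] lframeD(8,9)[OF l x]
      \<Gamma>_skew[OF lframe_field[OF l] x, of 1 j g] \<Gamma>_skew[OF lframe_field[OF l] x, of 2 j g]
    by (simp_all add: \<Gamma>_def)
  then show ?thesis
    using mixed_derivatives[OF chart(1)[OF k(1)] smooth_alongD[OF smooth_\<iota> k(1)] k(2), of "H1 x" "H2 x"] by simp
qed

lemma tangentL_frame:
  assumes l: "lframe U k W e H1 H2" and x: "x \<in> W"
  shows "a *\<^sub>R e x $ 1 + b *\<^sub>R e x $ 2 \<in> tangentL A \<iota> (k x)"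
  using lframe_d\<iota>[OF l x, of a b] tangentL_chart[OF lframeD(1)[OF l] lframeD(10)[OF l x]] by (metis rangeI)

lemma shape_frame:
  assumes l: "lframe U k W e H1 H2" and x: "x \<in> W" and Y: "smooth_along A Y"
  shows "shape X A \<iota> Y (k x) (frechet_derivative (\<iota> \<circ> k) (at x) h) =
    (frechet_derivative (Y \<circ> k) (at x) h \<bullet> e x $ 1) *\<^sub>R e x $ 1 + (frechet_derivative (Y \<circ> k) (at x) h \<bullet> e x $ 2) *\<^sub>R e x $ 2"
proof -
  note k = lframeD(1)[OF l] lframeD(10)[OF l x] and ad = adapted_frames[OF lframeD(7)[OF l x]]
  let ?D = "frechet_derivative (Y \<circ> k) (at x) h"
  note s = onf_simps[OF ad(3)] and t = oframe_tangent[OF ad(1)]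
  have p: "tproj X (\<iota> (k x)) ?D \<bullet> e x $ i = ?D \<bullet> e x $ i" for i
    by (rule tproj_inner(2)[OF \<iota>_points t])
  show ?thesis
    unfolding shape_def nabla_T_def deriv_along_chart[OF Y k]
  proof (rule oproj_eqI)
    show "(?D \<bullet> e x $ 1) *\<^sub>R e x $ 1 + (?D \<bullet> e x $ 2) *\<^sub>R e x $ 2 \<in> tangentL A \<iota> (k x)"
      by (rule tangentL_frame[OF l x])
    fix z assume "z \<in> tangentL A \<iota> (k x)"
    then obtain c1 c2 where "z = c1 *\<^sub>R e x $ 1 + c2 *\<^sub>R e x $ 2" using lframe_tangentL[OF l x] by blast
    then show "(tproj X (\<iota> (k x)) ?D - ((?D \<bullet> e x $ 1) *\<^sub>R e x $ 1 + (?D \<bullet> e x $ 2) *\<^sub>R e x $ 2)) \<bullet> z = 0"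
      by (simp add: inner_diff_left inner_add_left inner_add_right p s)
  next
    fix a b assume "a \<in> tangentL A \<iota> (k x)" "b \<in> tangentL A \<iota> (k x)"
    then obtain a1 a2 b1 b2 where "a = a1 *\<^sub>R e x $ 1 + a2 *\<^sub>R e x $ 2" "b = b1 *\<^sub>R e x $ 1 + b2 *\<^sub>R e x $ 2"
      using lframe_tangentL[OF l x] by meson
    then have "a - b = (a1 - b1) *\<^sub>R e x $ 1 + (a2 - b2) *\<^sub>R e x $ 2" by (simp add: algebra_simps)
    then show "a - b \<in> tangentL A \<iota> (k x)" using tangentL_frame[OF l x] by metis
  qed (auto simp: inner_diff_left)
qed

lemma normal_fieldD:
  assumes "normal_field X A \<iota> Y"
  shows "smooth_along A Y" "Y p \<in> tangent X (\<iota> p)" "w \<in> tangentL A \<iota> p \<Longrightarrow> Y p \<bullet> w = 0"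
  using assms by (auto simp: normal_field_def)

text \<open>Differentiating the orthogonality of \<open>Y\<close> and the tangent field expresses
  the derivative by the value of \<open>Y\<close> at the point: the shape operator is tensorial in
  the normal field.\<close>

lemma normal_derivative:
  assumes l: "lframe U k W e H1 H2" and x: "x \<in> W" and Y: "normal_field X A \<iota> Y" and i: "i = 1 \<or> i = 2"
  shows "frechet_derivative (Y \<circ> k) (at x) h \<bullet> e x $ i =
    - ((Y (k x) \<bullet> e x $ 3) * \<Gamma> e x i 3 h + (Y (k x) \<bullet> e x $ 4) * \<Gamma> e x i 4 h)"
proof -
  note k = lframeD(1)[OF l] lframeD(10)[OF l x] and ad = adapted_frames[OF lframeD(7)[OF l x]]
  let ?D = "frechet_derivative (\<lambda>y. e y $ i) (at x)"
  have tL: "e y $ i \<in> tangentL A \<iota> (k y)" if "y \<in> W" for y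
    using oframeL_in_tangentL[OF adapted_frames(2)[OF lframeD(7)[OF l that]]] i by auto
  have "(((\<lambda>y. (Y \<circ> k) y \<bullet> e y $ i)) has_derivative (\<lambda>h. (Y \<circ> k) x \<bullet> ?D h + frechet_derivative (Y \<circ> k) (at x) h \<bullet> e x $ i)) (at x)"
    by (rule has_derivative_inner[OF smooth_along_has_derivative[OF normal_fieldD(1)[OF Y] k]
          frechet_works[OF field_differentiable[OF lframe_field[OF l] x]]])
  moreover have "((\<lambda>y. (Y \<circ> k) y \<bullet> e y $ i) has_derivative (\<lambda>h. 0)) (at x)"
    by (rule has_derivative_transform_within_open[OF has_derivative_const[of 0] lframeD(2)[OF l] x])
      (simp add: normal_fieldD(3)[OF Y tL])
  ultimately have "(\<lambda>h. (Y \<circ> k) x \<bullet> ?D h + frechet_derivative (Y \<circ> k) (at x) h \<bullet> e x $ i) = (\<lambda>h. 0)"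
    by (rule has_derivative_unique)
  then have 1: "(Y \<circ> k) x \<bullet> ?D h + frechet_derivative (Y \<circ> k) (at x) h \<bullet> e x $ i = 0" by meson
  have t12: "Y (k x) \<bullet> e x $ 1 = 0" "Y (k x) \<bullet> e x $ 2 = 0"
    using normal_fieldD(3)[OF Y] oframeL_in_tangentL[OF ad(2)] by auto
  have "Y (k x) = (Y (k x) \<bullet> e x $ 3) *\<^sub>R e x $ 3 + (Y (k x) \<bullet> e x $ 4) *\<^sub>R e x $ 4"
    using oframe_expand[OF \<iota>_points ad(1) normal_fieldD(2)[OF Y]] t12 by simp
  then have "Y (k x) \<bullet> ?D h = ((Y (k x) \<bullet> e x $ 3) *\<^sub>R e x $ 3 + (Y (k x) \<bullet> e x $ 4) *\<^sub>R e x $ 4) \<bullet> ?D h" by simp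
  then show ?thesis using 1 by (simp add: \<Gamma>_def inner_add_left inner_commute[of "?D h"])
qed

text \<open>Normal projection of a constant vector, expressed in a chosen adapted frame. It provides
  globally smooth normal fields with any prescribed normal value at one point, without cutoff
  functions.\<close>

definition normal_part :: "'v \<Rightarrow> 'l \<Rightarrow> 'v" where
  "normal_part n p = (let e = SOME e. adapted X A \<iota> p e in (n \<bullet> e$3) *\<^sub>R e$3 + (n \<bullet> e$4) *\<^sub>R e$4)"

lemma normal_part_eq:
  assumes "adapted X A \<iota> p e"
  shows "normal_part n p = (n \<bullet> e$3) *\<^sub>R e$3 + (n \<bullet> e$4) *\<^sub>R e$4"
proof -
  let ?e = "SOME e. adapted X A \<iota> p e"
  have "adapted X A \<iota> p ?e" using assms by (rule someI)
  then obtain g h where gh: "g\<^sup>2 + h\<^sup>2 = 1" "?e$3 = g *\<^sub>R e$3 + h *\<^sub>R e$4" "?e$4 = g *\<^sub>R e$4 - h *\<^sub>R e$3"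
    using adapted_rotation[OF assms] by metis
  have "normal_part n p = ((g * g + h * h) * (n \<bullet> e$3)) *\<^sub>R e$3 + ((g * g + h * h) * (n \<bullet> e$4)) *\<^sub>R e$4"
    unfolding normal_part_def Let_def gh(2,3) by (simp add: inner_add_right inner_diff_right algebra_simps)
  then show ?thesis using gh(1) by (simp add: power2_eq_square)
qed

lemma smooth_along_local:
  assumes "\<And>U k W e H1 H2. lframe U k W e H1 H2 \<Longrightarrow> smooth_on W (Y \<circ> k)"
  shows "smooth_along A Y"
  unfolding smooth_along_def
proof (clarify, rule smooth_on_local)
  fix U k x assume k: "(U, k) \<in> A" "x \<in> U"
  obtain e0 where "adapted X A \<iota> (k x) e0" using adapted_ex by blast
  then obtain W e H1 H2 where l: "lframe U k W e H1 H2" "x \<in> W" using lframe_ex[OF k] by blast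
  show "\<exists>T. open T \<and> x \<in> T \<and> smooth_on T (Y \<circ> k)"
    using assms[OF l(1)] lframeD(2)[OF l(1)] l(2) by blast
qed

lemma normal_field_normal_part: "normal_field X A \<iota> (normal_part n)"
  unfolding normal_field_def
proof (intro conjI allI ballI)
  show "smooth_along A (normal_part n)"
  proof (rule smooth_along_local)
    fix U k W e H1 H2 assume l: "lframe U k W e H1 H2"
    have "smooth_on W (\<lambda>y. (n \<bullet> e y$3) *\<^sub>R e y$3 + (n \<bullet> e y$4) *\<^sub>R e y$4)"
      by (intro smooth_on_add smooth_on_scaleR smooth_on_inner smooth_on_const lframeD(2,4)[OF l])
    then show "smooth_on W (normal_part n \<circ> k)"
      by (rule smooth_on_cong[OF lframeD(2)[OF l], rotated]) (simp add: normal_part_eq[OF lframeD(7)[OF l]])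
  qed
  fix p
  obtain e where e: "adapted X A \<iota> p e" using adapted_ex by blast
  note ad = adapted_frames[OF e]
  show "normal_part n p \<in> tangent X (\<iota> p)"
    unfolding normal_part_eq[OF e]
    by (intro subspace_add subspace_scale subspace_tangent \<iota>_points oframe_tangent[OF ad(1)])
  fix w assume w: "w \<in> tangentL A \<iota> p"
  obtain U k W e' H1 H2 x where l: "lframe U k W e' H1 H2" "x \<in> W" "k x = p" "e' x = e" using lframe_at[OF e] by blast
  then obtain c1 c2 where "w = c1 *\<^sub>R e $ 1 + c2 *\<^sub>R e $ 2" using lframe_tangentL[OF l(1,2)] w by metis
  then show "normal_part n p \<bullet> w = 0"
    unfolding normal_part_eq[OF e] by (simp add: inner_add_left inner_add_right onf_simps[OF ad(3)])
qed

lemma shape_normal: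
  assumes l: "lframe U k W e H1 H2" and x: "x \<in> W" and Y: "normal_field X A \<iota> Y"
  shows "shape X A \<iota> Y (k x) (frechet_derivative (\<iota> \<circ> k) (at x) h) =
    (- ((Y (k x) \<bullet> e x $ 3) * \<Gamma> e x 1 3 h + (Y (k x) \<bullet> e x $ 4) * \<Gamma> e x 1 4 h)) *\<^sub>R e x $ 1
    + (- ((Y (k x) \<bullet> e x $ 3) * \<Gamma> e x 2 3 h + (Y (k x) \<bullet> e x $ 4) * \<Gamma> e x 2 4 h)) *\<^sub>R e x $ 2"
  using normal_derivative[OF l x Y, of 1 h] normal_derivative[OF l x Y, of 2 h]
  by (simp add: shape_frame[OF l x normal_fieldD(1)[OF Y]])

text \<open>By \<open>shape_normal\<close> the trace is linear in the two normal components of the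
  field; \<open>normal_part\<close> of \<open>e x $ 3\<close> and of \<open>e x $ 4\<close> isolates
  the two coefficients.\<close>

lemma minimal_iff:
  "minimal X A \<iota> \<longleftrightarrow> (\<forall>U k W e H1 H2 x. lframe U k W e H1 H2 \<longrightarrow> x \<in> W \<longrightarrow>
     \<Gamma> e x 1 3 (H1 x) + \<Gamma> e x 2 3 (H2 x) = 0 \<and> \<Gamma> e x 1 4 (H1 x) + \<Gamma> e x 2 4 (H2 x) = 0)"
proof -
  have tr: "shape X A \<iota> Y (k x) (e x $ 1) \<bullet> e x $ 1 + shape X A \<iota> Y (k x) (e x $ 2) \<bullet> e x $ 2
     = - (Y (k x) \<bullet> e x $ 3) * (\<Gamma> e x 1 3 (H1 x) + \<Gamma> e x 2 3 (H2 x)) - (Y (k x) \<bullet> e x $ 4) * (\<Gamma> e x 1 4 (H1 x) + \<Gamma> e x 2 4 (H2 x))"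
    if l: "lframe U k W e H1 H2" and x: "x \<in> W" and Y: "normal_field X A \<iota> Y" for U k W e H1 H2 x Y
  proof -
    have "shape X A \<iota> Y (k x) (e x $ 1) \<bullet> e x $ 1 = - ((Y (k x) \<bullet> e x $ 3) * \<Gamma> e x 1 3 (H1 x) + (Y (k x) \<bullet> e x $ 4) * \<Gamma> e x 1 4 (H1 x))"
      "shape X A \<iota> Y (k x) (e x $ 2) \<bullet> e x $ 2 = - ((Y (k x) \<bullet> e x $ 3) * \<Gamma> e x 2 3 (H2 x) + (Y (k x) \<bullet> e x $ 4) * \<Gamma> e x 2 4 (H2 x))"
      using shape_normal[OF l x Y, of "H1 x"] shape_normal[OF l x Y, of "H2 x"] lframeD(8,9)[OF l x]
      by (simp_all add: inner_diff_left inner_add_left onf_simps[OF adapted_frames(3)[OF lframeD(7)[OF l x]]])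
    then show ?thesis by (simp add: algebra_simps)
  qed
  show ?thesis
  proof (intro iffI allI impI)
    fix U k W e H1 H2 x assume m: "minimal X A \<iota>" and l: "lframe U k W e H1 H2" and x: "x \<in> W"
    note ad = adapted_frames[OF lframeD(7)[OF l x]]
    have 0: "- (normal_part n (k x) \<bullet> e x $ 3) * (\<Gamma> e x 1 3 (H1 x) + \<Gamma> e x 2 3 (H2 x))
        - (normal_part n (k x) \<bullet> e x $ 4) * (\<Gamma> e x 1 4 (H1 x) + \<Gamma> e x 2 4 (H2 x)) = 0" for n
      unfolding tr[OF l x normal_field_normal_part, symmetric]
      using m ad(2) normal_field_normal_part unfolding minimal_def by blast
    show "\<Gamma> e x 1 3 (H1 x) + \<Gamma> e x 2 3 (H2 x) = 0 \<and> \<Gamma> e x 1 4 (H1 x) + \<Gamma> e x 2 4 (H2 x) = 0"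
      using 0[of "e x $ 3"] 0[of "e x $ 4"]
      by (simp add: normal_part_eq[OF lframeD(7)[OF l x]] onf_simps[OF ad(3)])
  next
    assume z: "\<forall>U k W e H1 H2 x. lframe U k W e H1 H2 \<longrightarrow> x \<in> W \<longrightarrow>
     \<Gamma> e x 1 3 (H1 x) + \<Gamma> e x 2 3 (H2 x) = 0 \<and> \<Gamma> e x 1 4 (H1 x) + \<Gamma> e x 2 4 (H2 x) = 0"
    show "minimal X A \<iota>"
      unfolding minimal_def
    proof (intro allI impI)
      fix Y p e1 e2 assume Y: "normal_field X A \<iota> Y" and o: "oframeL A \<iota> p e1 e2"
      obtain e0 where e0: "adapted X A \<iota> p e0" "e0 $ 1 = e1" "e0 $ 2 = e2" using oframeL_completion[OF o] by blast
      obtain U k W e H1 H2 x where l: "lframe U k W e H1 H2" "x \<in> W" "k x = p" "e x = e0" using lframe_at[OF e0(1)] by blast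
      have "\<Gamma> e x 1 3 (H1 x) + \<Gamma> e x 2 3 (H2 x) = 0" "\<Gamma> e x 1 4 (H1 x) + \<Gamma> e x 2 4 (H2 x) = 0" using z l(1,2) by blast+
      then show "shape X A \<iota> Y p e1 \<bullet> e1 + shape X A \<iota> Y p e2 \<bullet> e2 = 0"
        using tr[OF l(1,2) Y] l(3,4) e0(2,3) by simp
    qed
  qed
qed

text \<open>Plane rotations commute with the quarter turn, so all adapted frames give the same
  vector. The same reason makes \<open>J_T\<close> and \<open>J_F\<close> well defined.\<close>

lemma J_N_frame:
  assumes e: "adapted X A \<iota> p e" shows "J_N X A \<iota> p w = (w \<bullet> e$3) *\<^sub>R e$4 - (w \<bullet> e$4) *\<^sub>R e$3"
  unfolding J_N_def
proof (rule the_equality)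
  show "\<exists>e'. adapted X A \<iota> p e' \<and> (w \<bullet> e$3) *\<^sub>R e$4 - (w \<bullet> e$4) *\<^sub>R e$3 = (w \<bullet> e'$3) *\<^sub>R e'$4 - (w \<bullet> e'$4) *\<^sub>R e'$3"
    using e by blast
  fix w' assume "\<exists>e'. adapted X A \<iota> p e' \<and> w' = (w \<bullet> e'$3) *\<^sub>R e'$4 - (w \<bullet> e'$4) *\<^sub>R e'$3"
  then obtain e' where e': "adapted X A \<iota> p e'" "w' = (w \<bullet> e'$3) *\<^sub>R e'$4 - (w \<bullet> e'$4) *\<^sub>R e'$3" by blast
  obtain g h where gh: "g\<^sup>2 + h\<^sup>2 = 1" "e'$3 = g *\<^sub>R e$3 + h *\<^sub>R e$4" "e'$4 = g *\<^sub>R e$4 - h *\<^sub>R e$3"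
    using adapted_rotation[OF e e'(1)] by metis
  have "w' = ((g * g + h * h) * (w \<bullet> e$3)) *\<^sub>R e$4 - ((g * g + h * h) * (w \<bullet> e$4)) *\<^sub>R e$3"
    unfolding e'(2) gh(2,3) by (simp add: inner_add_right inner_diff_right algebra_simps)
  then show "w' = (w \<bullet> e$3) *\<^sub>R e$4 - (w \<bullet> e$4) *\<^sub>R e$3" using gh(1) by (simp add: power2_eq_square)
qed

lemma J_T_frame:
  assumes e: "adapted X A \<iota> p e" shows "J_T X A \<iota> p w = (w \<bullet> e$1) *\<^sub>R e$2 - (w \<bullet> e$2) *\<^sub>R e$1"
  unfolding J_T_def
proof (rule the_equality)
  show "\<exists>e'. adapted X A \<iota> p e' \<and> (w \<bullet> e$1) *\<^sub>R e$2 - (w \<bullet> e$2) *\<^sub>R e$1 = (w \<bullet> e'$1) *\<^sub>R e'$2 - (w \<bullet> e'$2) *\<^sub>R e'$1"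
    using e by blast
  fix w' assume "\<exists>e'. adapted X A \<iota> p e' \<and> w' = (w \<bullet> e'$1) *\<^sub>R e'$2 - (w \<bullet> e'$2) *\<^sub>R e'$1"
  then obtain e' where e': "adapted X A \<iota> p e'" "w' = (w \<bullet> e'$1) *\<^sub>R e'$2 - (w \<bullet> e'$2) *\<^sub>R e'$1" by blast
  obtain a b where ab: "a\<^sup>2 + b\<^sup>2 = 1" "e'$1 = a *\<^sub>R e$1 + b *\<^sub>R e$2" "e'$2 = a *\<^sub>R e$2 - b *\<^sub>R e$1"
    using adapted_rotation[OF e e'(1)] by metis
  have "w' = ((a * a + b * b) * (w \<bullet> e$1)) *\<^sub>R e$2 - ((a * a + b * b) * (w \<bullet> e$2)) *\<^sub>R e$1"
    unfolding e'(2) ab(2,3) by (simp add: inner_add_right inner_diff_right algebra_simps)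
  then show "w' = (w \<bullet> e$1) *\<^sub>R e$2 - (w \<bullet> e$2) *\<^sub>R e$1" using ab(1) by (simp add: power2_eq_square)
qed

lemma J_F_frame:
  assumes e: "adapted X A \<iota> p e"
  shows "J_F X A \<iota> p \<tau> = inner2 \<tau> (f2 e) *\<^sub>R f3 e - inner2 \<tau> (f3 e) *\<^sub>R f2 e"
  unfolding J_F_def
proof (rule the_equality)
  show "\<exists>e'. adapted X A \<iota> p e' \<and> inner2 \<tau> (f2 e) *\<^sub>R f3 e - inner2 \<tau> (f3 e) *\<^sub>R f2 e
      = inner2 \<tau> (f2 e') *\<^sub>R f3 e' - inner2 \<tau> (f3 e') *\<^sub>R f2 e'" using e by blast
  fix w' assume "\<exists>e'. adapted X A \<iota> p e' \<and> w' = inner2 \<tau> (f2 e') *\<^sub>R f3 e' - inner2 \<tau> (f3 e') *\<^sub>R f2 e'"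
  then obtain e' where e': "adapted X A \<iota> p e'" "w' = inner2 \<tau> (f2 e') *\<^sub>R f3 e' - inner2 \<tau> (f3 e') *\<^sub>R f2 e'" by blast
  obtain a b g h where "a\<^sup>2 + b\<^sup>2 = 1" "g\<^sup>2 + h\<^sup>2 = 1" "e'$1 = a *\<^sub>R e$1 + b *\<^sub>R e$2" "e'$2 = a *\<^sub>R e$2 - b *\<^sub>R e$1"
    "e'$3 = g *\<^sub>R e$3 + h *\<^sub>R e$4" "e'$4 = g *\<^sub>R e$4 - h *\<^sub>R e$3" using adapted_rotation[OF e e'(1)] by metis
  note r = rotation_f[OF this]
  define C S where "C = a * g + b * h" and "S = a * h - b * g"
  have CS: "C * C + S * S = 1" using r(4) by (simp add: C_def S_def power2_eq_square)
  have "w' = ((C * C + S * S) * inner2 \<tau> (f2 e)) *\<^sub>R f3 e - ((C * C + S * S) * inner2 \<tau> (f3 e)) *\<^sub>R f2 e"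
    unfolding e'(2) r(2,3) C_def[symmetric] S_def[symmetric]
    by (simp add: inner2_add_right inner2_diff_right inner2_scale_right algebra_simps)
  then show "w' = inner2 \<tau> (f2 e) *\<^sub>R f3 e - inner2 \<tau> (f3 e) *\<^sub>R f2 e" by (simp add: CS)
qed

lemma normal_field_J_N:
  assumes Y: "normal_field X A \<iota> Y" shows "normal_field X A \<iota> (\<lambda>p. J_N X A \<iota> p (Y p))"
  unfolding normal_field_def
proof (intro conjI allI ballI)
  show "smooth_along A (\<lambda>p. J_N X A \<iota> p (Y p))"
  proof (rule smooth_along_local)
    fix U k W e H1 H2 assume l: "lframe U k W e H1 H2"
    have "smooth_on W (\<lambda>y. Y (k y))"
      using smooth_on_subset[OF smooth_alongD[OF normal_fieldD(1)[OF Y] lframeD(1)[OF l]] lframeD(3)[OF l]] by (simp add: o_def)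
    then have "smooth_on W (\<lambda>y. (Y (k y) \<bullet> e y$3) *\<^sub>R e y$4 - (Y (k y) \<bullet> e y$4) *\<^sub>R e y$3)"
      by (intro smooth_on_diff smooth_on_scaleR smooth_on_inner lframeD(2,4)[OF l])
    then show "smooth_on W ((\<lambda>p. J_N X A \<iota> p (Y p)) \<circ> k)"
      by (rule smooth_on_cong[OF lframeD(2)[OF l], rotated]) (simp add: J_N_frame[OF lframeD(7)[OF l]])
  qed
  fix p
  obtain e where e: "adapted X A \<iota> p e" using adapted_ex by blast
  note ad = adapted_frames[OF e]
  show "J_N X A \<iota> p (Y p) \<in> tangent X (\<iota> p)"
    unfolding J_N_frame[OF e]
    by (intro subspace_diff subspace_scale subspace_tangent \<iota>_points oframe_tangent[OF ad(1)])
  fix w assume w: "w \<in> tangentL A \<iota> p"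
  obtain U k W e' H1 H2 x where l: "lframe U k W e' H1 H2" "x \<in> W" "k x = p" "e' x = e" using lframe_at[OF e] by blast
  then obtain c1 c2 where "w = c1 *\<^sub>R e $ 1 + c2 *\<^sub>R e $ 2" using lframe_tangentL[OF l(1,2)] w by metis
  then show "J_N X A \<iota> p (Y p) \<bullet> w = 0"
    unfolding J_N_frame[OF e] by (simp add: inner_diff_left inner_add_right onf_simps[OF ad(3)])
qed

text \<open>For fixed \<open>h\<close> the equation is linear in the normal components of the field,
  with the two coefficients of \<open>nabla_f1\<close>. So the condition says that the section
  \<open>F1\<close> is parallel along \<open>L\<close>.\<close>

lemma negative_superminimal_iff:
  "negative_superminimal X A \<iota> \<longleftrightarrow> (\<forall>U k W e H1 H2 x h. lframe U k W e H1 H2 \<longrightarrow> x \<in> W \<longrightarrow>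
     \<Gamma> e x 2 3 h - \<Gamma> e x 1 4 h = 0 \<and> \<Gamma> e x 2 4 h + \<Gamma> e x 1 3 h = 0)"
proof -
  have eq: "shape X A \<iota> (\<lambda>p'. J_N X A \<iota> p' (Y p')) (k x) w = - J_T X A \<iota> (k x) (shape X A \<iota> Y (k x) w) \<longleftrightarrow>
     (Y (k x) \<bullet> e x $ 4) * (\<Gamma> e x 2 4 h + \<Gamma> e x 1 3 h) + (Y (k x) \<bullet> e x $ 3) * (\<Gamma> e x 2 3 h - \<Gamma> e x 1 4 h) = 0 \<and>
     (Y (k x) \<bullet> e x $ 4) * (\<Gamma> e x 2 3 h - \<Gamma> e x 1 4 h) - (Y (k x) \<bullet> e x $ 3) * (\<Gamma> e x 2 4 h + \<Gamma> e x 1 3 h) = 0"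
    if l: "lframe U k W e H1 H2" and x: "x \<in> W" and Y: "normal_field X A \<iota> Y" and w: "w = frechet_derivative (\<iota> \<circ> k) (at x) h"
    for U k W e H1 H2 x Y h w
  proof -
    note s = onf_simps[OF adapted_frames(3)[OF lframeD(7)[OF l x]]]
    have comb: "a *\<^sub>R e x $ 1 + b *\<^sub>R e x $ 2 = a' *\<^sub>R e x $ 1 + b' *\<^sub>R e x $ 2 \<longleftrightarrow> a = a' \<and> b = b'" for a b a' b'
    proof
      assume "a *\<^sub>R e x $ 1 + b *\<^sub>R e x $ 2 = a' *\<^sub>R e x $ 1 + b' *\<^sub>R e x $ 2"
      then have "(a *\<^sub>R e x $ 1 + b *\<^sub>R e x $ 2) \<bullet> e x $ i = (a' *\<^sub>R e x $ 1 + b' *\<^sub>R e x $ 2) \<bullet> e x $ i" for i by simp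
      from this[of 1] this[of 2] show "a = a' \<and> b = b'" by (simp add: inner_add_left s)
    qed simp
    define n3 where "n3 = Y (k x) \<bullet> e x $ 3"
    define n4 where "n4 = Y (k x) \<bullet> e x $ 4"
    let ?G = "\<lambda>i j. \<Gamma> e x i j h"
    have J: "J_N X A \<iota> (k x) (Y (k x)) \<bullet> e x $ 3 = - n4" "J_N X A \<iota> (k x) (Y (k x)) \<bullet> e x $ 4 = n3"
      unfolding J_N_frame[OF lframeD(7)[OF l x]] by (simp_all add: inner_diff_left s n3_def n4_def)
    have 1: "shape X A \<iota> (\<lambda>p'. J_N X A \<iota> p' (Y p')) (k x) w = (n4 * ?G 1 3 - n3 * ?G 1 4) *\<^sub>R e x $ 1 + (n4 * ?G 2 3 - n3 * ?G 2 4) *\<^sub>R e x $ 2"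
      unfolding w shape_normal[OF l x normal_field_J_N[OF Y]] J by (simp add: algebra_simps)
    have "shape X A \<iota> Y (k x) w = (- (n3 * ?G 1 3 + n4 * ?G 1 4)) *\<^sub>R e x $ 1 + (- (n3 * ?G 2 3 + n4 * ?G 2 4)) *\<^sub>R e x $ 2"
      unfolding w shape_normal[OF l x Y] n3_def n4_def ..
    then have SW: "shape X A \<iota> Y (k x) w \<bullet> e x $ 1 = - (n3 * ?G 1 3 + n4 * ?G 1 4)"
      "shape X A \<iota> Y (k x) w \<bullet> e x $ 2 = - (n3 * ?G 2 3 + n4 * ?G 2 4)" by (simp_all only: inner_add_left inner_scaleR_left s) simp_all
    have 2: "- J_T X A \<iota> (k x) (shape X A \<iota> Y (k x) w) = (- (n3 * ?G 2 3 + n4 * ?G 2 4)) *\<^sub>R e x $ 1 + (n3 * ?G 1 3 + n4 * ?G 1 4) *\<^sub>R e x $ 2"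
      unfolding J_T_frame[OF lframeD(7)[OF l x]] SW by (simp add: algebra_simps)
    show ?thesis unfolding 1 2 comb n3_def[symmetric] n4_def[symmetric] by (auto simp: algebra_simps)
  qed
  show ?thesis
  proof (intro iffI allI impI)
    fix U k W e H1 H2 x h assume m: "negative_superminimal X A \<iota>" and l: "lframe U k W e H1 H2" and x: "x \<in> W"
    let ?w = "frechet_derivative (\<iota> \<circ> k) (at x) h"
    have "?w \<in> tangentL A \<iota> (k x)" using tangentL_chart[OF lframeD(1)[OF l] lframeD(10)[OF l x]] by blast
    then have "shape X A \<iota> (\<lambda>p'. J_N X A \<iota> p' (normal_part n p')) (k x) ?w = - J_T X A \<iota> (k x) (shape X A \<iota> (normal_part n) (k x) ?w)" for n
      using m normal_field_normal_part[of n] unfolding negative_superminimal_def by blast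
    \<comment> \<open>A single normal field, with value \<open>e x $ 3\<close> at the point, already
      yields both equations.\<close>
    from this[unfolded eq[OF l x normal_field_normal_part refl], of "e x $ 3"]
    show "\<Gamma> e x 2 3 h - \<Gamma> e x 1 4 h = 0 \<and> \<Gamma> e x 2 4 h + \<Gamma> e x 1 3 h = 0"
      by (simp add: normal_part_eq[OF lframeD(7)[OF l x]] onf_simps[OF adapted_frames(3)[OF lframeD(7)[OF l x]]])
  next
    assume z: "\<forall>U k W e H1 H2 x h. lframe U k W e H1 H2 \<longrightarrow> x \<in> W \<longrightarrow>
     \<Gamma> e x 2 3 h - \<Gamma> e x 1 4 h = 0 \<and> \<Gamma> e x 2 4 h + \<Gamma> e x 1 3 h = 0"
    show "negative_superminimal X A \<iota>"
      unfolding negative_superminimal_def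
    proof (intro allI impI ballI)
      fix Y p w assume Y: "normal_field X A \<iota> Y" and w: "w \<in> tangentL A \<iota> p"
      obtain e0 where e0: "adapted X A \<iota> p e0" using adapted_ex by blast
      obtain U k W e H1 H2 x where l: "lframe U k W e H1 H2" "x \<in> W" "k x = p" "e x = e0" using lframe_at[OF e0] by blast
      obtain h where h: "w = frechet_derivative (\<iota> \<circ> k) (at x) h"
        using w tangentL_chart[OF lframeD(1)[OF l(1)] lframeD(10)[OF l(1,2)]] l(3) by auto
      have "\<Gamma> e x 2 3 h - \<Gamma> e x 1 4 h = 0" "\<Gamma> e x 2 4 h + \<Gamma> e x 1 3 h = 0" using z l(1,2) by blast+
      then show "shape X A \<iota> (\<lambda>p'. J_N X A \<iota> p' (Y p')) p w = - J_T X A \<iota> p (shape X A \<iota> Y p w)"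
        using eq[OF l(1,2) Y h] l(3) by simp
    qed
  qed
qed

section \<open>Holomorphic and parallel sections in a local frame\<close>

lemma nabla_F_frame:
  assumes l: "lframe U k W e H1 H2" and x: "x \<in> W" and \<sigma>: "smooth_along A \<sigma>"
  defines "D \<equiv> \<lambda>h. frechet_derivative (\<sigma> \<circ> k) (at x) h"
  shows "nabla_F X A \<iota> \<sigma> (k x) (frechet_derivative (\<iota> \<circ> k) (at x) h) = inner2 (D h) (f2 (e x)) *\<^sub>R f2 (e x) + inner2 (D h) (f3 (e x)) *\<^sub>R f3 (e x)"
proof -
  note k = lframeD(1)[OF l] lframeD(10)[OF l x] and ad = adapted_frames[OF lframeD(7)[OF l x]]
  note o = f_orthonormal[OF ad(3)] and fa = f_asd[OF \<iota>_points ad(1)]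
  have Fe: "F1 (k x) = f1 (e x)" by (rule F1_eq[OF lframeD(7)[OF l x]])
  have sub: "subspace (F_fib X A \<iota> (k x))"
    unfolding F_fib_eq subspace_def using subspace_asd[of "\<iota> (k x)"]
    by (auto simp: subspace_def inner2_add_left inner2_scale_left)
  show ?thesis
    unfolding nabla_F_def nabla_forms_def deriv_along_chart[OF \<sigma> k] D_def[symmetric]
  proof (rule oproj_eqI)
    show "inner2 (D h) (f2 (e x)) *\<^sub>R f2 (e x) + inner2 (D h) (f3 (e x)) *\<^sub>R f3 (e x) \<in> F_fib X A \<iota> (k x)"
      unfolding F_fib_eq using fa
      by (simp add: Fe inner2_add_left inner2_scale_left o subspace_add[OF subspace_asd] subspace_scale[OF subspace_asd])
    fix z assume z: "z \<in> F_fib X A \<iota> (k x)"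
    then have z': "z = inner2 z (f2 (e x)) *\<^sub>R f2 (e x) + inner2 z (f3 (e x)) *\<^sub>R f3 (e x)"
      using asd_expand[OF \<iota>_points ad(1), of z] by (simp add: F_fib_eq Fe)
    show "inner2 (restrict2 X (\<iota> (k x)) (D h) - (inner2 (D h) (f2 (e x)) *\<^sub>R f2 (e x) + inner2 (D h) (f3 (e x)) *\<^sub>R f3 (e x))) z = 0"
      by (subst z') (simp add: inner2_diff_left inner2_add_left inner2_add_right inner2_scale_left inner2_scale_right o
          inner2_restrict2[OF \<iota>_points oframe_tangent[OF ad(1)]])
  qed (auto simp: inner2_diff_left inner2_eq_0 subspace_diff[OF sub])
qed

lemma nabla_E_frame:
  assumes l: "lframe U k W e H1 H2" and x: "x \<in> W" and \<eta>: "smooth_along A \<eta>"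
  defines "D \<equiv> \<lambda>h. frechet_derivative (\<eta> \<circ> k) (at x) h"
  shows "nabla_E X A \<iota> \<eta> (k x) (frechet_derivative (\<iota> \<circ> k) (at x) h) = inner2 (D h) (f1 (e x)) *\<^sub>R f1 (e x)"
proof -
  note k = lframeD(1)[OF l] lframeD(10)[OF l x] and ad = adapted_frames[OF lframeD(7)[OF l x]]
  note o = f_orthonormal[OF ad(3)]
  have Fe: "F1 (k x) = f1 (e x)" by (rule F1_eq[OF lframeD(7)[OF l x]])
  show ?thesis
    unfolding nabla_E_def nabla_forms_def deriv_along_chart[OF \<eta> k] D_def[symmetric]
    by (rule oproj_eqI)
      (auto simp: E_fib_eq Fe inner2_diff_left inner2_eq_0 inner2_scale_left inner2_scale_right o
        inner2_restrict2[OF \<iota>_points oframe_tangent[OF ad(1)]] simp flip: scaleR_diff_left)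
qed

lemma holomorphic_iff:
  assumes \<sigma>: "smooth_along A \<sigma>"
  shows "holomorphic_F X A \<iota> \<sigma> \<longleftrightarrow> (\<forall>U k W e H1 H2 x. lframe U k W e H1 H2 \<longrightarrow> x \<in> W \<longrightarrow>
     inner2 (frechet_derivative (\<sigma> \<circ> k) (at x) (H1 x)) (f2 (e x)) = inner2 (frechet_derivative (\<sigma> \<circ> k) (at x) (H2 x)) (f3 (e x)) \<and>
     inner2 (frechet_derivative (\<sigma> \<circ> k) (at x) (H1 x)) (f3 (e x)) = - inner2 (frechet_derivative (\<sigma> \<circ> k) (at x) (H2 x)) (f2 (e x)))"
proof -
  have eq: "nabla_F X A \<iota> \<sigma> (k x) (e x $ 1) + J_F X A \<iota> (k x) (nabla_F X A \<iota> \<sigma> (k x) (e x $ 2)) = 0 \<longleftrightarrow>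
     inner2 (frechet_derivative (\<sigma> \<circ> k) (at x) (H1 x)) (f2 (e x)) = inner2 (frechet_derivative (\<sigma> \<circ> k) (at x) (H2 x)) (f3 (e x)) \<and>
     inner2 (frechet_derivative (\<sigma> \<circ> k) (at x) (H1 x)) (f3 (e x)) = - inner2 (frechet_derivative (\<sigma> \<circ> k) (at x) (H2 x)) (f2 (e x))"
    if l: "lframe U k W e H1 H2" and x: "x \<in> W" for U k W e H1 H2 x
  proof -
    note o = f_orthonormal[OF adapted_frames(3)[OF lframeD(7)[OF l x]]]
    define a2 a3 b2 b3 where "a2 = inner2 (frechet_derivative (\<sigma> \<circ> k) (at x) (H1 x)) (f2 (e x))"
      and "a3 = inner2 (frechet_derivative (\<sigma> \<circ> k) (at x) (H1 x)) (f3 (e x))"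
      and "b2 = inner2 (frechet_derivative (\<sigma> \<circ> k) (at x) (H2 x)) (f2 (e x))"
      and "b3 = inner2 (frechet_derivative (\<sigma> \<circ> k) (at x) (H2 x)) (f3 (e x))"
    have 1: "nabla_F X A \<iota> \<sigma> (k x) (e x $ 1) = a2 *\<^sub>R f2 (e x) + a3 *\<^sub>R f3 (e x)"
      and 2: "nabla_F X A \<iota> \<sigma> (k x) (e x $ 2) = b2 *\<^sub>R f2 (e x) + b3 *\<^sub>R f3 (e x)"
      using nabla_F_frame[OF l x \<sigma>, of "H1 x"] nabla_F_frame[OF l x \<sigma>, of "H2 x"] lframeD(8,9)[OF l x]
      by (simp_all add: a2_def a3_def b2_def b3_def)
    have sum: "nabla_F X A \<iota> \<sigma> (k x) (e x $ 1) + J_F X A \<iota> (k x) (nabla_F X A \<iota> \<sigma> (k x) (e x $ 2))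
      = (a2 - b3) *\<^sub>R f2 (e x) + (a3 + b2) *\<^sub>R f3 (e x)"
      unfolding 1 2 J_F_frame[OF lframeD(7)[OF l x]]
      by (simp add: inner2_add_left inner2_scale_left o algebra_simps)
    have "(a2 - b3) *\<^sub>R f2 (e x) + (a3 + b2) *\<^sub>R f3 (e x) = 0 \<longleftrightarrow> a2 = b3 \<and> a3 = - b2"
    proof
      assume 0: "(a2 - b3) *\<^sub>R f2 (e x) + (a3 + b2) *\<^sub>R f3 (e x) = 0"
      have "inner2 ((a2 - b3) *\<^sub>R f2 (e x) + (a3 + b2) *\<^sub>R f3 (e x)) (f2 (e x)) = 0"
        "inner2 ((a2 - b3) *\<^sub>R f2 (e x) + (a3 + b2) *\<^sub>R f3 (e x)) (f3 (e x)) = 0" by (simp_all only: 0 inner2_zero)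
      then show "a2 = b3 \<and> a3 = - b2" by (simp add: inner2_add_left inner2_scale_left o)
    qed simp
    then show ?thesis unfolding sum a2_def a3_def b2_def b3_def .
  qed
  show ?thesis
  proof (intro iffI allI impI)
    fix U k W e H1 H2 x assume m: "holomorphic_F X A \<iota> \<sigma>" and l: "lframe U k W e H1 H2" and x: "x \<in> W"
    have "nabla_F X A \<iota> \<sigma> (k x) (e x $ 1) + J_F X A \<iota> (k x) (nabla_F X A \<iota> \<sigma> (k x) (e x $ 2)) = 0"
      using m adapted_frames(2)[OF lframeD(7)[OF l x]] unfolding holomorphic_F_def by blast
    then show "inner2 (frechet_derivative (\<sigma> \<circ> k) (at x) (H1 x)) (f2 (e x)) = inner2 (frechet_derivative (\<sigma> \<circ> k) (at x) (H2 x)) (f3 (e x)) \<and>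
     inner2 (frechet_derivative (\<sigma> \<circ> k) (at x) (H1 x)) (f3 (e x)) = - inner2 (frechet_derivative (\<sigma> \<circ> k) (at x) (H2 x)) (f2 (e x))"
      using eq[OF l x] by blast
  next
    assume z: "\<forall>U k W e H1 H2 x. lframe U k W e H1 H2 \<longrightarrow> x \<in> W \<longrightarrow>
     inner2 (frechet_derivative (\<sigma> \<circ> k) (at x) (H1 x)) (f2 (e x)) = inner2 (frechet_derivative (\<sigma> \<circ> k) (at x) (H2 x)) (f3 (e x)) \<and>
     inner2 (frechet_derivative (\<sigma> \<circ> k) (at x) (H1 x)) (f3 (e x)) = - inner2 (frechet_derivative (\<sigma> \<circ> k) (at x) (H2 x)) (f2 (e x))"
    show "holomorphic_F X A \<iota> \<sigma>"
      unfolding holomorphic_F_def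
    proof (intro allI impI)
      fix p e1 e2 assume o: "oframeL A \<iota> p e1 e2"
      obtain e0 where e0: "adapted X A \<iota> p e0" "e0 $ 1 = e1" "e0 $ 2 = e2" using oframeL_completion[OF o] by blast
      obtain U k W e H1 H2 x where l: "lframe U k W e H1 H2" "x \<in> W" "k x = p" "e x = e0" using lframe_at[OF e0(1)] by blast
      have "nabla_F X A \<iota> \<sigma> (k x) (e x $ 1) + J_F X A \<iota> (k x) (nabla_F X A \<iota> \<sigma> (k x) (e x $ 2)) = 0"
        using eq[OF l(1,2)] z l(1,2) by blast
      then show "nabla_F X A \<iota> \<sigma> p e1 + J_F X A \<iota> p (nabla_F X A \<iota> \<sigma> p e2) = 0" using l(3,4) e0(2,3) by simp
    qed
  qed
qed

lemma parallel_iff: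
  assumes \<eta>: "smooth_along A \<eta>"
  shows "parallel_E X A \<iota> \<eta> \<longleftrightarrow> (\<forall>U k W e H1 H2 x h. lframe U k W e H1 H2 \<longrightarrow> x \<in> W \<longrightarrow>
     inner2 (frechet_derivative (\<eta> \<circ> k) (at x) h) (f1 (e x)) = 0)"
proof -
  have eq: "nabla_E X A \<iota> \<eta> (k x) (frechet_derivative (\<iota> \<circ> k) (at x) h) = 0 \<longleftrightarrow> inner2 (frechet_derivative (\<eta> \<circ> k) (at x) h) (f1 (e x)) = 0"
    if l: "lframe U k W e H1 H2" and x: "x \<in> W" for U k W e H1 H2 x h
  proof -
    have "f1 (e x) \<noteq> 0" using f_orthonormal(1)[OF adapted_frames(3)[OF lframeD(7)[OF l x]]] by auto
    then show ?thesis by (simp add: nabla_E_frame[OF l x \<eta>])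
  qed
  show ?thesis
  proof (intro iffI allI impI)
    fix U k W e H1 H2 x h assume m: "parallel_E X A \<iota> \<eta>" and l: "lframe U k W e H1 H2" and x: "x \<in> W"
    have "frechet_derivative (\<iota> \<circ> k) (at x) h \<in> tangentL A \<iota> (k x)" using tangentL_chart[OF lframeD(1)[OF l] lframeD(10)[OF l x]] by blast
    then show "inner2 (frechet_derivative (\<eta> \<circ> k) (at x) h) (f1 (e x)) = 0"
      using m eq[OF l x] unfolding parallel_E_def by blast
  next
    assume z: "\<forall>U k W e H1 H2 x h. lframe U k W e H1 H2 \<longrightarrow> x \<in> W \<longrightarrow> inner2 (frechet_derivative (\<eta> \<circ> k) (at x) h) (f1 (e x)) = 0"
    show "parallel_E X A \<iota> \<eta>"
      unfolding parallel_E_def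
    proof (intro allI ballI)
      fix p w assume w: "w \<in> tangentL A \<iota> p"
      obtain e0 where e0: "adapted X A \<iota> p e0" using adapted_ex by blast
      obtain U k W e H1 H2 x where l: "lframe U k W e H1 H2" "x \<in> W" "k x = p" "e x = e0" using lframe_at[OF e0] by blast
      obtain h where h: "w = frechet_derivative (\<iota> \<circ> k) (at x) h"
        using w tangentL_chart[OF lframeD(1)[OF l(1)] lframeD(10)[OF l(1,2)]] l(3) by auto
      show "nabla_E X A \<iota> \<eta> p w = 0" using eq[OF l(1,2), of h] z l(1,2,3) h by blast
    qed
  qed
qed

end

section \<open>The calibration conditions\<close>

lemma continuous_on_vector_3:
  assumes "continuous_on S a" "continuous_on S b" "continuous_on S c"
  shows "continuous_on S (\<lambda>z. vector [a z, b z, c z] :: ('w::real_normed_vector)^3)"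
proof -
  have "(\<lambda>z. vector [a z, b z, c z] :: 'w^3) = (\<lambda>z. \<chi> i. if i = 1 then a z else if i = 2 then b z else c z)"
    by (simp add: fun_eq_iff vec_eq_iff forall_3)
  moreover have "continuous_on S (\<lambda>z. if i = 1 then a z else if i = 2 then b z else c z)" for i :: 3
    using assms by (cases "i = 1"; cases "i = 2"; simp)
  ultimately show ?thesis by (simp only: continuous_on_vec_lambda)
qed

lemma continuous_on_vector_4:
  assumes "continuous_on S a" "continuous_on S b" "continuous_on S c" "continuous_on S d"
  shows "continuous_on S (\<lambda>z. vector [a z, b z, c z, d z] :: ('w::real_normed_vector)^4)"
proof -
  have "(\<lambda>z. vector [a z, b z, c z, d z] :: 'w^4) = (\<lambda>z. \<chi> i. if i = 1 then a z else if i = 2 then b z else if i = 3 then c z else d z)"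
    by (simp add: fun_eq_iff vec_eq_iff forall_4)
  moreover have "continuous_on S (\<lambda>z. if i = 1 then a z else if i = 2 then b z else if i = 3 then c z else d z)" for i :: 4
    using assms by (cases "i = 1"; cases "i = 2"; cases "i = 3"; simp)
  ultimately show ?thesis by (simp only: continuous_on_vec_lambda)
qed

lemma basis_of_subset:
  assumes "basis_of T b" "\<And>i. b $ i \<in> S" "subspace S" shows "T \<subseteq> S"
  using assms(1) unfolding basis_of_iff lincomb_def
  by (auto intro!: subspace_sum subspace_scale assms(2,3))

lemma det_block_2_1_1:
  "det (vector [vector [a, b, 0, 0], vector [b', c, 0, 0], vector [0, 0, d, 0], vector [0, 0, 0, d']] :: real^4^4)
    = (a * c - b * b') * (d * d')"
proof -
  let ?x = "\<lambda>i. axis i 1 :: real^4"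
  have r: "vector [a, b, 0, 0] = a *\<^sub>R ?x 1 + b *\<^sub>R ?x 2" "vector [b', c, 0, 0] = b' *\<^sub>R ?x 1 + c *\<^sub>R ?x 2"
    "vector [0, 0, d, 0] = d *\<^sub>R ?x 3" "vector [0, 0, 0, d'] = d' *\<^sub>R ?x 4"
    by (simp_all add: vec_eq_iff forall_4 axis_def)
  note l = alt4_linear[OF alt4_det4]
  have "det4 (?x 2) (?x 1) (?x 3) (?x 4) = - 1"
    using alt4_swap(1)[OF alt4_det4, of "?x 1" "?x 2" "?x 3" "?x 4"] det4_axis by simp
  then show ?thesis
    unfolding det4_def[symmetric] r
    by (simp only: linear_add[OF l(1)] linear_cmul[OF l(1)] linear_add[OF l(2)] linear_cmul[OF l(2)]
        linear_cmul[OF l(3)] linear_cmul[OF l(4)] real_scaleR_def alt4_zero[OF alt4_det4 UNIV_I UNIV_I UNIV_I] det4_axis)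
      (simp add: algebra_simps)
qed

lemma gram_E:
  assumes e: "onf e"
  shows "gram_det c (y, \<omega>) (vector [(0, f1 e), (e$1, a1 *\<^sub>R f2 e + z1 *\<^sub>R f3 e), (e$2, a2 *\<^sub>R f2 e + z2 *\<^sub>R f3 e)] :: ('v::euclidean_space \<times> 'v form2)^3)
    = (bs_v c \<omega>)\<^sup>2 * (((bs_u c \<omega>)\<^sup>2 + (bs_v c \<omega>)\<^sup>2 * (a1 * a1 + z1 * z1)) * ((bs_u c \<omega>)\<^sup>2 + (bs_v c \<omega>)\<^sup>2 * (a2 * a2 + z2 * z2))
      - ((bs_v c \<omega>)\<^sup>2 * (a1 * a2 + z1 * z2)) * ((bs_v c \<omega>)\<^sup>2 * (a1 * a2 + z1 * z2)))"
  by (simp add: det_3 bs_metric_def inner2_add_left inner2_add_right inner2_scale_left inner2_scale_right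
      f_orthonormal[OF e] onf_simps[OF e]) (simp add: algebra_simps)

lemma gram_F:
  assumes e: "onf e"
  shows "gram_det c (y, \<omega>) (vector [(e$2, t2 *\<^sub>R f1 e), (e$1, t1 *\<^sub>R f1 e), (0, f2 e), (0, f3 e)] :: ('v::euclidean_space \<times> 'v form2)^4)
    = ((bs_v c \<omega>)\<^sup>2 * (bs_v c \<omega>)\<^sup>2) * ((bs_u c \<omega>)\<^sup>2 * (bs_u c \<omega>)\<^sup>2 + (bs_u c \<omega>)\<^sup>2 * (bs_v c \<omega>)\<^sup>2 * (t1 * t1 + t2 * t2))"
proof -
  let ?b = "vector [(e$2, t2 *\<^sub>R f1 e), (e$1, t1 *\<^sub>R f1 e), (0, f2 e), (0, f3 e)] :: ('v \<times> 'v form2)^4"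
  let ?u = "(bs_u c \<omega>)\<^sup>2" and ?v = "(bs_v c \<omega>)\<^sup>2"
  have "(\<chi> i j. bs_metric c (y, \<omega>) (?b $ i) (?b $ j))
    = vector [vector [?u + ?v * (t2 * t2), ?v * (t1 * t2), 0, 0], vector [?v * (t1 * t2), ?u + ?v * (t1 * t1), 0, 0],
       vector [0, 0, ?v, 0], vector [0, 0, 0, ?v]]"
    by (simp add: vec_eq_iff forall_4 bs_metric_def inner2_scale_left inner2_scale_right f_orthonormal[OF e] onf_simps[OF e] mult.commute)
  then show ?thesis by (simp only: det_block_2_1_1) (simp add: algebra_simps)
qed

text \<open>The Gram determinant exceeds the square of the form by a positive multiple of two
  squares, an instance of the associator equality. Where both vanish, \<open>q\<close> is itself a
  sum of squares, which makes the form positive.\<close>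

lemma calibrated_value_E:
  fixes u v a1 a2 z1 z2 :: real
  assumes "u > 0" "v > 0"
  defines "q \<equiv> a1 * z2 - z1 * a2"
  defines "G \<equiv> v\<^sup>2 * ((u\<^sup>2 + v\<^sup>2 * (a1 * a1 + z1 * z1)) * (u\<^sup>2 + v\<^sup>2 * (a2 * a2 + z2 * z2))
      - (v\<^sup>2 * (a1 * a2 + z1 * z2)) * (v\<^sup>2 * (a1 * a2 + z1 * z2)))"
  shows "(v^3 * q + u\<^sup>2 * v)\<^sup>2 = \<bar>G\<bar> \<longleftrightarrow> a1 = z2 \<and> z1 = - a2"
    and "a1 = z2 \<Longrightarrow> z1 = - a2 \<Longrightarrow> v^3 * q + u\<^sup>2 * v > 0 \<and> v^3 * q + u\<^sup>2 * v = sqrt G"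
proof -
  have diff: "G = (v^3 * q + u\<^sup>2 * v)\<^sup>2 + u\<^sup>2 * v\<^sup>2 * v\<^sup>2 * ((a1 - z2) * (a1 - z2) + (z1 + a2) * (z1 + a2))"
    by (simp add: G_def q_def power2_eq_square power3_eq_cube algebra_simps)
  have "G \<ge> 0" unfolding diff
    by (intro add_nonneg_nonneg mult_nonneg_nonneg[of "u\<^sup>2 * v\<^sup>2 * v\<^sup>2"]) simp_all
  then have "(v^3 * q + u\<^sup>2 * v)\<^sup>2 = \<bar>G\<bar> \<longleftrightarrow> u\<^sup>2 * v\<^sup>2 * v\<^sup>2 * ((a1 - z2) * (a1 - z2) + (z1 + a2) * (z1 + a2)) = 0"
    using diff by linarith
  also have "\<dots> \<longleftrightarrow> a1 = z2 \<and> z1 = - a2"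
    using assms(1,2) by (simp add: sum_squares_eq_zero_iff eq_neg_iff_add_eq_0)
  finally show "(v^3 * q + u\<^sup>2 * v)\<^sup>2 = \<bar>G\<bar> \<longleftrightarrow> a1 = z2 \<and> z1 = - a2" .
  assume a: "a1 = z2" "z1 = - a2"
  have "q = z2 * z2 + a2 * a2" by (simp add: q_def a)
  then have "q \<ge> 0" by simp
  then have pos: "v^3 * q + u\<^sup>2 * v > 0" using assms(1,2) by (intro add_nonneg_pos) auto
  have "G = (v^3 * q + u\<^sup>2 * v)\<^sup>2" using diff by (simp add: a)
  then show "v^3 * q + u\<^sup>2 * v > 0 \<and> v^3 * q + u\<^sup>2 * v = sqrt G" using pos by simp
qed

context surface_in
begin

lemma phi_E:
  assumes x: "x \<in> points X" and e: "oframe X x e"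
  shows "phi X c (x, \<omega>) (0, f1 e) (e$1, a1 *\<^sub>R f2 e + z1 *\<^sub>R f3 e) (e$2, a2 *\<^sub>R f2 e + z2 *\<^sub>R f3 e)
    = (bs_v c \<omega>)^3 * (a1 * z2 - z1 * a2) + (bs_u c \<omega>)\<^sup>2 * bs_v c \<omega>"
proof -
  note fa = f_asd[OF x e] and o = f_orthonormal[OF oframe_onf[OF e]] and s = onf_simps[OF oframe_onf[OF e]]
  have a: "r *\<^sub>R f2 e + t *\<^sub>R f3 e \<in> asd X x" for r t
    using fa by (intro subspace_add[OF subspace_asd] subspace_scale[OF subspace_asd])
  show ?thesis
    by (subst phi_frame[OF x e])
      (simp_all add: fa a det3_def det_3 asd_coords_def inner2_add_left inner2_scale_left o ev_simps ev_f s)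
qed

text \<open>The direction field is merely continuous; linearity of the derivative reduces it to two
  constant directions.\<close>

lemma continuous_derivative:
  assumes l: "lframe U k W e H1 H2" and Y: "smooth_along A Y" and H: "continuous_on W H"
  shows "continuous_on W (\<lambda>y. frechet_derivative (Y \<circ> k) (at y) (H y))"
proof -
  have c: "continuous_on W (\<lambda>y. frechet_derivative (Y \<circ> k) (at y) v)" for v
    using smooth_on_continuous[OF smooth_on_subset[OF smooth_on_deriv[OF smooth_alongD[OF Y lframeD(1)[OF l]]] lframeD(3)[OF l]]] .
  have "frechet_derivative (Y \<circ> k) (at y) (H y) = H y $ 1 *\<^sub>R frechet_derivative (Y \<circ> k) (at y) (axis 1 1)
      + H y $ 2 *\<^sub>R frechet_derivative (Y \<circ> k) (at y) (axis 2 1)" if "y \<in> W" for y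
  proof -
    note lin = linear_frechet[OF Y lframeD(1)[OF l] lframeD(10)[OF l that]]
    have "H y = H y $ 1 *\<^sub>R axis 1 1 + H y $ 2 *\<^sub>R axis 2 1" by (simp add: vec_eq_iff forall_2 axis_def)
    then have "frechet_derivative (Y \<circ> k) (at y) (H y) = frechet_derivative (Y \<circ> k) (at y) (H y $ 1 *\<^sub>R axis 1 1 + H y $ 2 *\<^sub>R axis 2 1)"
      by simp
    then show ?thesis by (simp add: linear_add[OF lin] linear_cmul[OF lin])
  qed
  moreover have "continuous_on W (\<lambda>y. H y $ 1 *\<^sub>R frechet_derivative (Y \<circ> k) (at y) (axis 1 1)
      + H y $ 2 *\<^sub>R frechet_derivative (Y \<circ> k) (at y) (axis 2 1))"
    by (intro continuous_on_add continuous_on_scaleR continuous_on_component H c)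
  ultimately show ?thesis by (simp cong: continuous_on_cong)
qed

text \<open>Neighbourhoods lying over a chart domain and unrestricted in the fibre; frame fields are
  pulled back to them by the inverse chart.\<close>

lemma chart_neighbourhood:
  assumes l: "lframe U k W e H1 H2"
  shows "open (k ` W \<times> (UNIV :: 'v form2 set))"
    and "continuous_on W g \<Longrightarrow> continuous_on (k ` W \<times> (UNIV :: 'v form2 set)) (\<lambda>z. g (inv_into U k (fst z)))"
proof -
  show "open (k ` W \<times> (UNIV :: 'v form2 set))"
    by (intro open_Times chart_open_image[OF lframeD(1)[OF l] lframeD(2)[OF l] lframeD(3)[OF l]] open_UNIV)
  have "continuous_on (k ` U) (inv_into U k)" using chart(3)[OF lframeD(1)[OF l]] by (simp add: homeomorphism_def)
  then have 1: "continuous_on (k ` W) (inv_into U k)" by (rule continuous_on_subset) (use lframeD(3)[OF l] in auto)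
  have 2: "continuous_on (k ` W \<times> (UNIV :: 'v form2 set)) (\<lambda>z. inv_into U k (fst z))"
    by (rule continuous_on_compose2[OF 1 continuous_on_fst[OF continuous_on_id]]) auto
  assume g: "continuous_on W g"
  show "continuous_on (k ` W \<times> (UNIV :: 'v form2 set)) (\<lambda>z. g (inv_into U k (fst z)))"
    by (rule continuous_on_compose2[OF g 2]) (use chart_inv[OF lframeD(1)[OF l]] lframeD(10)[OF l] in auto)
qed

lemma TT_zero: "0 \<in> tangent X (\<iota> p)" "0 \<in> asd X (\<iota> p)"
  using subspace_0[OF subspace_tangent[OF \<iota>_points]] subspace_0[OF subspace_asd] by auto

lemma basis_E_in_TT:
  assumes l: "lframe U k W e H1 H2" and x: "x \<in> W"
  shows "basis_E k e H1 H2 \<sigma> s x $ i \<in> TT (\<iota> (k x))"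
proof -
  note ad = adapted_frames[OF lframeD(7)[OF l x]]
  note fa = f_asd[OF \<iota>_points ad(1)]
  have "\<forall>i. basis_E k e H1 H2 \<sigma> s x $ i \<in> TT (\<iota> (k x))"
    unfolding forall_3 basis_E_def
    using fa oframe_tangent[OF ad(1)] TT_zero by (auto intro!: subspace_add[OF subspace_asd] subspace_scale[OF subspace_asd])
  then show ?thesis by blast
qed

text \<open>One direction evaluates the identity between squares on \<open>basis_E\<close>; the
  other uses \<open>basis_E\<close> itself as the continuous local basis required for an
  orientation.\<close>

lemma associative_iff_CR:
  assumes \<sigma>: "smooth_section A (F_fib X A \<iota>) \<sigma>" and c: "c > 0"
  shows "associative X c A \<iota> (E_plus X A \<iota> \<sigma>) \<longleftrightarrow>
    (\<forall>U k W e H1 H2 x \<omega>. lframe U k W e H1 H2 \<longrightarrow> x \<in> W \<longrightarrow> (k x, \<omega>) \<in> E_plus X A \<iota> \<sigma> \<longrightarrow>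
       inner2 (dE \<sigma> k (inner2 \<omega> (f1 (e x))) x (H1 x)) (f2 (e x)) = inner2 (dE \<sigma> k (inner2 \<omega> (f1 (e x))) x (H2 x)) (f3 (e x)) \<and>
       inner2 (dE \<sigma> k (inner2 \<omega> (f1 (e x))) x (H1 x)) (f3 (e x)) = - inner2 (dE \<sigma> k (inner2 \<omega> (f1 (e x))) x (H2 x)) (f2 (e x)))"
    (is "_ \<longleftrightarrow> (\<forall>U k W e H1 H2 x \<omega>. _ \<longrightarrow> _ \<longrightarrow> _ \<longrightarrow> ?CR k e H1 H2 x \<omega>)")
proof -
  let ?N = "E_plus X A \<iota> \<sigma>"
  let ?\<Phi> = "\<lambda>q (b::('v \<times> 'v form2)^3). phi X c q (b$1) (b$2) (b$3)"
  let ?B = "\<lambda>k e H1 H2 x \<omega>. basis_E k e H1 H2 \<sigma> (inner2 \<omega> (f1 (e x))) x"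
  have \<sigma>s: "smooth_along A \<sigma>" using \<sigma> by (simp add: smooth_section_def)
  \<comment> \<open>\<open>phi\<close> is known to alternate on \<open>TT\<close>, so the tangent
    space of the bundle has to be placed in it.\<close>
  have cv: "calib_value (tangent_sub X A \<iota> ?N (p, \<omega>)) (?\<Phi> (\<iota> p, \<omega>))" if n: "(p, \<omega>) \<in> ?N" for p \<omega>
  proof -
    obtain e0 where e0: "adapted X A \<iota> p e0" using adapted_ex by blast
    obtain U k W e H1 H2 x where l: "lframe U k W e H1 H2" "x \<in> W" "k x = p" "e x = e0" using lframe_at[OF e0] by blast
    have "tangent_sub X A \<iota> ?N (p, \<omega>) \<subseteq> TT (\<iota> p)"
      using basis_of_subset[OF basis_of_basis_E[OF l(1,2) \<sigma>] basis_E_in_TT[OF l(1,2)] subspace_TT[OF \<iota>_points]] n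
      unfolding l(3) by blast
    then show ?thesis by (rule calib_value_3[OF alt3_phi subspace_TT[OF \<iota>_points]])
  qed
  have gram: "(?\<Phi> (\<iota> (k x), \<omega>) (?B k e H1 H2 x \<omega>))\<^sup>2 = \<bar>gram_det c (\<iota> (k x), \<omega>) (?B k e H1 H2 x \<omega>)\<bar> \<longleftrightarrow> ?CR k e H1 H2 x \<omega>"
    "?CR k e H1 H2 x \<omega> \<Longrightarrow> ?\<Phi> (\<iota> (k x), \<omega>) (?B k e H1 H2 x \<omega>) > 0 \<and>
       ?\<Phi> (\<iota> (k x), \<omega>) (?B k e H1 H2 x \<omega>) = sqrt (gram_det c (\<iota> (k x), \<omega>) (?B k e H1 H2 x \<omega>))"
    if l: "lframe U k W e H1 H2" and x: "x \<in> W" for U k W e H1 H2 x \<omega>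
  proof -
    note ad = adapted_frames[OF lframeD(7)[OF l x]]
    have \<Phi>: "?\<Phi> (\<iota> (k x), \<omega>) (?B k e H1 H2 x \<omega>) =
       (bs_v c \<omega>)^3 * (inner2 (dE \<sigma> k (inner2 \<omega> (f1 (e x))) x (H1 x)) (f2 (e x)) * inner2 (dE \<sigma> k (inner2 \<omega> (f1 (e x))) x (H2 x)) (f3 (e x))
         - inner2 (dE \<sigma> k (inner2 \<omega> (f1 (e x))) x (H1 x)) (f3 (e x)) * inner2 (dE \<sigma> k (inner2 \<omega> (f1 (e x))) x (H2 x)) (f2 (e x)))
       + (bs_u c \<omega>)\<^sup>2 * bs_v c \<omega>"
      unfolding basis_E_def vector_3 by (rule phi_E[OF \<iota>_points ad(1)])
    show "(?\<Phi> (\<iota> (k x), \<omega>) (?B k e H1 H2 x \<omega>))\<^sup>2 = \<bar>gram_det c (\<iota> (k x), \<omega>) (?B k e H1 H2 x \<omega>)\<bar> \<longleftrightarrow> ?CR k e H1 H2 x \<omega>"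
      unfolding \<Phi> unfolding basis_E_def gram_E[OF ad(3)] by (rule calibrated_value_E(1)[OF bs_u_pos[OF c] bs_v_pos[OF c]])
    assume "?CR k e H1 H2 x \<omega>"
    then show "?\<Phi> (\<iota> (k x), \<omega>) (?B k e H1 H2 x \<omega>) > 0 \<and>
       ?\<Phi> (\<iota> (k x), \<omega>) (?B k e H1 H2 x \<omega>) = sqrt (gram_det c (\<iota> (k x), \<omega>) (?B k e H1 H2 x \<omega>))"
      unfolding \<Phi> unfolding basis_E_def gram_E[OF ad(3)]
      by (intro calibrated_value_E(2)[OF bs_u_pos[OF c] bs_v_pos[OF c]]) auto
  qed
  show ?thesis
  proof
    assume as: "associative X c A \<iota> ?N"
    show "\<forall>U k W e H1 H2 x \<omega>. lframe U k W e H1 H2 \<longrightarrow> x \<in> W \<longrightarrow> (k x, \<omega>) \<in> ?N \<longrightarrow> ?CR k e H1 H2 x \<omega>"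
    proof (intro allI impI)
      fix U k W e H1 H2 x \<omega> assume l: "lframe U k W e H1 H2" and x: "x \<in> W" and n: "(k x, \<omega>) \<in> ?N"
      show "?CR k e H1 H2 x \<omega>"
        using calibrated_necessary[OF as[unfolded associative_def] n basis_of_basis_E[OF l x \<sigma> n] cv[OF n]]
        unfolding gram(1)[OF l x] .
    qed
  next
    assume CR: "\<forall>U k W e H1 H2 x \<omega>. lframe U k W e H1 H2 \<longrightarrow> x \<in> W \<longrightarrow> (k x, \<omega>) \<in> ?N \<longrightarrow> ?CR k e H1 H2 x \<omega>"
    show "associative X c A \<iota> ?N"
      unfolding associative_def
    proof (rule calibrated_sufficient[OF cv])
      fix p \<omega> assume n: "(p, \<omega>) \<in> ?N"
      obtain e0 where e0: "adapted X A \<iota> p e0" using adapted_ex by blast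
      obtain U k W e H1 H2 x where l: "lframe U k W e H1 H2" and x: "x \<in> W" "k x = p" using lframe_at[OF e0] by blast
      let ?V = "k ` W \<times> (UNIV :: 'v form2 set)"
      let ?\<kappa> = "inv_into U k"
      let ?b = "\<lambda>z. ?B k e H1 H2 (?\<kappa> (fst z)) (snd z)"
      have \<kappa>: "?\<kappa> (k y) = y" if "y \<in> W" for y using chart_inv[OF lframeD(1)[OF l] lframeD(10)[OF l that]] .
      note c = chart_neighbourhood(2)[OF l]
      note cf = field_f_smooth[OF lframe_field[OF l], THEN smooth_on_continuous, THEN c]
      note ce = smooth_on_continuous[OF lframeD(4)[OF l], THEN c]
      note ci = bounded_bilinear.continuous_on[OF inner2_bilinear]
      note cs = ci[OF continuous_on_snd[OF continuous_on_id] cf(1)]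
      have cd: "continuous_on ?V (\<lambda>z. dE \<sigma> k (inner2 (snd z) (f1 (e (?\<kappa> (fst z))))) (?\<kappa> (fst z)) (H (?\<kappa> (fst z))))"
        if H: "continuous_on W H" for H
        unfolding dE_def
        by (intro continuous_on_add continuous_on_scaleR cs c[OF continuous_derivative[OF l smooth_F1 H]] c[OF continuous_derivative[OF l \<sigma>s H]])
      note cd1 = cd[OF lframeD(5)[OF l]] and cd2 = cd[OF lframeD(6)[OF l]]
      have "continuous_on ?V ?b"
        unfolding basis_E_def
        by (intro continuous_on_vector_3 continuous_on_Pair continuous_on_add continuous_on_scaleR continuous_on_const ci cd1 cd2 cf ce)
      then have cb: "continuous_on (?N \<inter> ?V) ?b" by (rule continuous_on_subset) auto
      have "basis_of (tangent_sub X A \<iota> ?N (p', \<omega>')) (?b (p', \<omega>')) \<and> ?\<Phi> (\<iota> p', \<omega>') (?b (p', \<omega>')) > 0 \<and>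
          ?\<Phi> (\<iota> p', \<omega>') (?b (p', \<omega>')) = sqrt (gram_det c (\<iota> p', \<omega>') (?b (p', \<omega>')))" if n': "(p', \<omega>') \<in> ?N \<inter> ?V" for p' \<omega>'
      proof -
        obtain y where y: "y \<in> W" "p' = k y" using n' by auto
        have n: "(k y, \<omega>') \<in> ?N" using n' y by simp
        have "?CR k e H1 H2 y \<omega>'" using CR l y(1) n by blast
        from basis_of_basis_E[OF l y(1) \<sigma> n] gram(2)[OF l y(1) this]
        show ?thesis unfolding y(2) fst_conv snd_conv \<kappa>[OF y(1)] by blast
      qed
      then show "\<exists>W b. open W \<and> (p, \<omega>) \<in> W \<and> continuous_on (?N \<inter> W) b \<and>
         (\<forall>(p', \<omega>')\<in>?N \<inter> W. basis_of (tangent_sub X A \<iota> ?N (p', \<omega>')) (b (p', \<omega>')) \<and>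
           ?\<Phi> (\<iota> p', \<omega>') (b (p', \<omega>')) > 0 \<and>
           ?\<Phi> (\<iota> p', \<omega>') (b (p', \<omega>')) = sqrt (gram_det c (\<iota> p', \<omega>') (b (p', \<omega>'))))"
        using chart_neighbourhood(1)[OF l] cb x by (intro exI[of _ ?V] exI[of _ ?b]) blast
    qed
  qed
qed

text \<open>On \<open>basis_F\<close> the value of \<open>psi\<close> is
  \<open>u\<^sup>2 v\<^sup>2\<close> whatever the vertical components along \<open>f1\<close>, while
  nonzero ones increase the Gram determinant.\<close>

lemma coassociative_iff_tF:
  assumes \<eta>: "smooth_section A (E_fib X A \<iota>) \<eta>" and c: "c > 0"
  shows "coassociative X c A \<iota> (plus_F X A \<iota> \<eta>) \<longleftrightarrow>
    (\<forall>U k W e H1 H2 x \<omega>. lframe U k W e H1 H2 \<longrightarrow> x \<in> W \<longrightarrow> (k x, \<omega>) \<in> plus_F X A \<iota> \<eta> \<longrightarrow>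
       tF \<eta> k (\<omega> - \<eta> (k x)) x (H1 x) = 0 \<and> tF \<eta> k (\<omega> - \<eta> (k x)) x (H2 x) = 0)"
proof -
  let ?N = "plus_F X A \<iota> \<eta>"
  let ?\<Phi> = "\<lambda>q (b::('v \<times> 'v form2)^4). psi X c q (b$1) (b$2) (b$3) (b$4)"
  let ?B = "\<lambda>k e H1 H2 x \<omega>. basis_F k e H1 H2 \<eta> \<omega> x"
  let ?T = "\<lambda>k (H1 :: real^2 \<Rightarrow> real^2) (H2 :: real^2 \<Rightarrow> real^2) x \<omega>. tF \<eta> k (\<omega> - \<eta> (k x)) x (H1 x) = 0 \<and> tF \<eta> k (\<omega> - \<eta> (k x)) x (H2 x) = 0"
  have cv: "calib_value S (?\<Phi> q)" for S q
    by (rule calib_value_4[OF alt4_psi subspace_UNIV]) simp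
  have \<Phi>: "?\<Phi> (\<iota> (k x), \<omega>) (?B k e H1 H2 x \<omega>) = (bs_u c \<omega>)\<^sup>2 * (bs_v c \<omega>)\<^sup>2"
    if l: "lframe U k W e H1 H2" and x: "x \<in> W" for U k W e H1 H2 x \<omega>
    unfolding basis_F_def vector_4
    by (subst alt4_swap(1)[OF alt4_psi UNIV_I UNIV_I UNIV_I UNIV_I])
      (simp add: psi_value[OF \<iota>_points adapted_frames(1)[OF lframeD(7)[OF l x]] c])
  have G: "gram_det c (\<iota> (k x), \<omega>) (?B k e H1 H2 x \<omega>) = ((bs_v c \<omega>)\<^sup>2 * (bs_v c \<omega>)\<^sup>2) * ((bs_u c \<omega>)\<^sup>2 * (bs_u c \<omega>)\<^sup>2
      + (bs_u c \<omega>)\<^sup>2 * (bs_v c \<omega>)\<^sup>2 * (tF \<eta> k (\<omega> - \<eta> (k x)) x (H1 x) * tF \<eta> k (\<omega> - \<eta> (k x)) x (H1 x)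
       + tF \<eta> k (\<omega> - \<eta> (k x)) x (H2 x) * tF \<eta> k (\<omega> - \<eta> (k x)) x (H2 x)))"
    if l: "lframe U k W e H1 H2" and x: "x \<in> W" for U k W e H1 H2 x \<omega>
    unfolding basis_F_def by (rule gram_F[OF adapted_frames(3)[OF lframeD(7)[OF l x]]])
  have pos: "bs_u c \<omega> > 0" "bs_v c \<omega> > 0" for \<omega> :: "'v form2" using bs_u_pos[OF c] bs_v_pos[OF c] by auto
  have gram: "(?\<Phi> (\<iota> (k x), \<omega>) (?B k e H1 H2 x \<omega>))\<^sup>2 = \<bar>gram_det c (\<iota> (k x), \<omega>) (?B k e H1 H2 x \<omega>)\<bar> \<Longrightarrow> ?T k H1 H2 x \<omega>"
    if l: "lframe U k W e H1 H2" and x: "x \<in> W" for U k W e H1 H2 x \<omega>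
  proof -
    assume eq: "(?\<Phi> (\<iota> (k x), \<omega>) (?B k e H1 H2 x \<omega>))\<^sup>2 = \<bar>gram_det c (\<iota> (k x), \<omega>) (?B k e H1 H2 x \<omega>)\<bar>"
    define t1 t2 where "t1 = tF \<eta> k (\<omega> - \<eta> (k x)) x (H1 x)" and "t2 = tF \<eta> k (\<omega> - \<eta> (k x)) x (H2 x)"
    let ?u = "(bs_u c \<omega>)\<^sup>2" and ?v = "(bs_v c \<omega>)\<^sup>2"
    have "(?v * ?v) * (?u * ?u + ?u * ?v * (t1 * t1 + t2 * t2)) \<ge> 0" by simp
    then have "(?u * ?v)\<^sup>2 = (?v * ?v) * (?u * ?u + ?u * ?v * (t1 * t1 + t2 * t2))"
      using eq unfolding \<Phi>[OF l x] G[OF l x] t1_def[symmetric] t2_def[symmetric] by simp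
    then have "?v * ?v * ?u * ?v * (t1 * t1 + t2 * t2) = 0" by (simp add: power2_eq_square algebra_simps)
    then have "t1 * t1 + t2 * t2 = 0" using pos[of \<omega>] by simp
    then show "?T k H1 H2 x \<omega>" unfolding t1_def[symmetric] t2_def[symmetric] by (simp add: sum_squares_eq_zero_iff)
  qed
  show ?thesis
  proof
    assume as: "coassociative X c A \<iota> ?N"
    show "\<forall>U k W e H1 H2 x \<omega>. lframe U k W e H1 H2 \<longrightarrow> x \<in> W \<longrightarrow> (k x, \<omega>) \<in> ?N \<longrightarrow> ?T k H1 H2 x \<omega>"
    proof (intro allI impI)
      fix U k W e H1 H2 x \<omega> assume l: "lframe U k W e H1 H2" and x: "x \<in> W" and n: "(k x, \<omega>) \<in> ?N"
      show "?T k H1 H2 x \<omega>"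
        using calibrated_necessary[OF as[unfolded coassociative_def] n basis_of_basis_F[OF l x \<eta> n] cv]
        by (rule gram[OF l x])
    qed
  next
    assume T: "\<forall>U k W e H1 H2 x \<omega>. lframe U k W e H1 H2 \<longrightarrow> x \<in> W \<longrightarrow> (k x, \<omega>) \<in> ?N \<longrightarrow> ?T k H1 H2 x \<omega>"
    show "coassociative X c A \<iota> ?N"
      unfolding coassociative_def
    proof (rule calibrated_sufficient[OF cv])
      fix p \<omega> assume n: "(p, \<omega>) \<in> ?N"
      obtain e0 where e0: "adapted X A \<iota> p e0" using adapted_ex by blast
      obtain U k W e H1 H2 x where l: "lframe U k W e H1 H2" and x: "x \<in> W" "k x = p" using lframe_at[OF e0] by blast
      let ?V = "k ` W \<times> (UNIV :: 'v form2 set)"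
      let ?\<kappa> = "inv_into U k"
      \<comment> \<open>This is \<open>basis_F\<close> once the \<open>f1\<close>-components vanish;
        in this form its continuity is immediate.\<close>
      let ?b = "\<lambda>z. vector [(e (?\<kappa> (fst z)) $ 2, 0), (e (?\<kappa> (fst z)) $ 1, 0), (0, f2 (e (?\<kappa> (fst z)))), (0, f3 (e (?\<kappa> (fst z))))] :: ('v \<times> 'v form2)^4"
      have \<kappa>: "?\<kappa> (k y) = y" if "y \<in> W" for y using chart_inv[OF lframeD(1)[OF l] lframeD(10)[OF l that]] .
      note c = chart_neighbourhood(2)[OF l]
      note cf = field_f_smooth[OF lframe_field[OF l], THEN smooth_on_continuous, THEN c]
      note ce = smooth_on_continuous[OF lframeD(4)[OF l], THEN c]
      have "continuous_on ?V ?b"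
        by (intro continuous_on_vector_4 continuous_on_Pair continuous_on_const cf ce)
      then have cb: "continuous_on (?N \<inter> ?V) ?b" by (rule continuous_on_subset) auto
      have "basis_of (tangent_sub X A \<iota> ?N (p', \<omega>')) (?b (p', \<omega>')) \<and> ?\<Phi> (\<iota> p', \<omega>') (?b (p', \<omega>')) > 0 \<and>
          ?\<Phi> (\<iota> p', \<omega>') (?b (p', \<omega>')) = sqrt (gram_det c (\<iota> p', \<omega>') (?b (p', \<omega>')))" if n': "(p', \<omega>') \<in> ?N \<inter> ?V" for p' \<omega>'
      proof -
        obtain y where y: "y \<in> W" "p' = k y" using n' by auto
        have n: "(k y, \<omega>') \<in> ?N" using n' y by simp
        have T': "?T k H1 H2 y \<omega>'" using T l y(1) n by blast
        have b: "?b (p', \<omega>') = ?B k e H1 H2 y \<omega>'" by (simp add: y(2) \<kappa>[OF y(1)] basis_F_def T')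
        have "sqrt (gram_det c (\<iota> p', \<omega>') (?B k e H1 H2 y \<omega>')) = (bs_u c \<omega>')\<^sup>2 * (bs_v c \<omega>')\<^sup>2"
        proof -
          have "gram_det c (\<iota> (k y), \<omega>') (?B k e H1 H2 y \<omega>') = ((bs_u c \<omega>')\<^sup>2 * (bs_v c \<omega>')\<^sup>2) * ((bs_u c \<omega>')\<^sup>2 * (bs_v c \<omega>')\<^sup>2)"
            unfolding G[OF l y(1)] by (simp only: T') (simp add: algebra_simps)
          then show ?thesis unfolding y(2) by (simp only: real_sqrt_abs2) simp
        qed
        moreover have "?\<Phi> (\<iota> p', \<omega>') (?B k e H1 H2 y \<omega>') = (bs_u c \<omega>')\<^sup>2 * (bs_v c \<omega>')\<^sup>2"
          unfolding y(2) by (rule \<Phi>[OF l y(1)])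
        moreover have "(bs_u c \<omega>')\<^sup>2 * (bs_v c \<omega>')\<^sup>2 > 0" using pos[of \<omega>'] by simp
        ultimately show ?thesis unfolding b using basis_of_basis_F[OF l y(1) \<eta> n] y(2) by simp
      qed
      then show "\<exists>W b. open W \<and> (p, \<omega>) \<in> W \<and> continuous_on (?N \<inter> W) b \<and>
         (\<forall>(p', \<omega>')\<in>?N \<inter> W. basis_of (tangent_sub X A \<iota> ?N (p', \<omega>')) (b (p', \<omega>')) \<and>
           ?\<Phi> (\<iota> p', \<omega>') (b (p', \<omega>')) > 0 \<and>
           ?\<Phi> (\<iota> p', \<omega>') (b (p', \<omega>')) = sqrt (gram_det c (\<iota> p', \<omega>') (b (p', \<omega>'))))"
        using chart_neighbourhood(1)[OF l] cb x by (intro exI[of _ ?V] exI[of _ ?b]) blast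
    qed
  qed
qed

section \<open>The two equivalences over a general ambient manifold\<close>

lemma associative_iff:
  assumes \<sigma>: "smooth_section A (F_fib X A \<iota>) \<sigma>" and c: "c > 0"
  shows "associative X c A \<iota> (E_plus X A \<iota> \<sigma>) \<longleftrightarrow> minimal X A \<iota> \<and> holomorphic_F X A \<iota> \<sigma>"
proof -
  have \<sigma>s: "smooth_along A \<sigma>" and \<sigma>F: "\<And>p. \<sigma> p \<in> F_fib X A \<iota> p" using \<sigma> by (auto simp: smooth_section_def)
  let ?P = "\<lambda>k e H1 H2 x. \<Gamma> e x 1 3 (H1 x) + \<Gamma> e x 2 3 (H2 x) = 0 \<and> \<Gamma> e x 1 4 (H1 x) + \<Gamma> e x 2 4 (H2 x) = 0 \<and>
     inner2 (frechet_derivative (\<sigma> \<circ> k) (at x) (H1 x)) (f2 (e x)) = inner2 (frechet_derivative (\<sigma> \<circ> k) (at x) (H2 x)) (f3 (e x)) \<and>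
     inner2 (frechet_derivative (\<sigma> \<circ> k) (at x) (H1 x)) (f3 (e x)) = - inner2 (frechet_derivative (\<sigma> \<circ> k) (at x) (H2 x)) (f2 (e x))"
  have eq: "(\<forall>\<omega>. (k x, \<omega>) \<in> E_plus X A \<iota> \<sigma> \<longrightarrow>
       inner2 (dE \<sigma> k (inner2 \<omega> (f1 (e x))) x (H1 x)) (f2 (e x)) = inner2 (dE \<sigma> k (inner2 \<omega> (f1 (e x))) x (H2 x)) (f3 (e x)) \<and>
       inner2 (dE \<sigma> k (inner2 \<omega> (f1 (e x))) x (H1 x)) (f3 (e x)) = - inner2 (dE \<sigma> k (inner2 \<omega> (f1 (e x))) x (H2 x)) (f2 (e x)))
     \<longleftrightarrow> ?P k e H1 H2 x"
    if l: "lframe U k W e H1 H2" and x: "x \<in> W" for U k W e H1 H2 x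
  proof -
    have Fe: "F1 (k x) = f1 (e x)" by (rule F1_eq[OF lframeD(7)[OF l x]])
    define a2 a3 b2 b3 where "a2 = inner2 (frechet_derivative (\<sigma> \<circ> k) (at x) (H1 x)) (f2 (e x))"
      and "a3 = inner2 (frechet_derivative (\<sigma> \<circ> k) (at x) (H1 x)) (f3 (e x))"
      and "b2 = inner2 (frechet_derivative (\<sigma> \<circ> k) (at x) (H2 x)) (f2 (e x))"
      and "b3 = inner2 (frechet_derivative (\<sigma> \<circ> k) (at x) (H2 x)) (f3 (e x))"
    define m3 m4 where "m3 = \<Gamma> e x 1 3 (H1 x) + \<Gamma> e x 2 3 (H2 x)" and "m4 = \<Gamma> e x 1 4 (H1 x) + \<Gamma> e x 2 4 (H2 x)"
    note sym = \<Gamma>_symmetric[OF l x, of 3, simplified] \<Gamma>_symmetric[OF l x, of 4, simplified]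
    \<comment> \<open>\<open>\<Gamma>_symmetric\<close> cancels the mixed terms, and what remains of
      the derivative of \<open>F1\<close> are the traces \<open>m3\<close> and
      \<open>m4\<close>.\<close>
    have d: "inner2 (dE \<sigma> k s x (H1 x)) (f2 (e x)) = inner2 (dE \<sigma> k s x (H2 x)) (f3 (e x)) \<longleftrightarrow> a2 - b3 = s * m4"
      "inner2 (dE \<sigma> k s x (H1 x)) (f3 (e x)) = - inner2 (dE \<sigma> k s x (H2 x)) (f2 (e x)) \<longleftrightarrow> a3 + b2 = - (s * m3)" for s
      unfolding dE_def m3_def m4_def a2_def a3_def b2_def b3_def
      by (auto simp: inner2_add_left inner2_scale_left inner2_dF1[OF l x] sym algebra_simps)
    have "(\<forall>\<omega>. (k x, \<omega>) \<in> E_plus X A \<iota> \<sigma> \<longrightarrow> a2 - b3 = inner2 \<omega> (f1 (e x)) * m4 \<and> a3 + b2 = - (inner2 \<omega> (f1 (e x)) * m3))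
       \<longleftrightarrow> m3 = 0 \<and> m4 = 0 \<and> a2 = b3 \<and> a3 = - b2"
    proof
      assume h: "\<forall>\<omega>. (k x, \<omega>) \<in> E_plus X A \<iota> \<sigma> \<longrightarrow> a2 - b3 = inner2 \<omega> (f1 (e x)) * m4 \<and> a3 + b2 = - (inner2 \<omega> (f1 (e x)) * m3)"
      have i: "inner2 (r *\<^sub>R F1 (k x) + \<sigma> (k x)) (f1 (e x)) = r" for r
        using \<sigma>F[of "k x"] inner2_F1[of "k x"] by (simp add: F_fib_eq inner2_add_left inner2_scale_left Fe)
      have "a2 - b3 = r * m4 \<and> a3 + b2 = - (r * m3)" for r
        using h[rule_format, OF E_plusI[of "k x" r \<sigma>]] unfolding i .
      \<comment> \<open>The parameter 0 gives the equations for \<open>\<sigma>\<close>; with these,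
        the parameter 1 makes both traces vanish.\<close>
      from this[of 0] this[of 1] show "m3 = 0 \<and> m4 = 0 \<and> a2 = b3 \<and> a3 = - b2" by auto
    qed auto
    then show ?thesis unfolding d m3_def m4_def a2_def a3_def b2_def b3_def .
  qed
  show ?thesis
    unfolding associative_iff_CR[OF \<sigma> c] minimal_iff holomorphic_iff[OF \<sigma>s] using eq by meson
qed

lemma coassociative_iff:
  assumes \<eta>: "smooth_section A (E_fib X A \<iota>) \<eta>" and c: "c > 0"
  shows "coassociative X c A \<iota> (plus_F X A \<iota> \<eta>) \<longleftrightarrow> negative_superminimal X A \<iota> \<and> parallel_E X A \<iota> \<eta>"
proof -
  have \<eta>s: "smooth_along A \<eta>" using \<eta> by (simp add: smooth_section_def)
  let ?P = "\<lambda>k e x h. (\<Gamma> e x 2 3 h - \<Gamma> e x 1 4 h = 0 \<and> \<Gamma> e x 2 4 h + \<Gamma> e x 1 3 h = 0) \<and>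
     inner2 (frechet_derivative (\<eta> \<circ> k) (at x) h) (f1 (e x)) = 0"
  have eq: "(\<forall>\<omega>. (k x, \<omega>) \<in> plus_F X A \<iota> \<eta> \<longrightarrow>
       tF \<eta> k (\<omega> - \<eta> (k x)) x (H1 x) = 0 \<and> tF \<eta> k (\<omega> - \<eta> (k x)) x (H2 x) = 0) \<longleftrightarrow> (\<forall>h. ?P k e x h)"
    if l: "lframe U k W e H1 H2" and x: "x \<in> W" for U k W e H1 H2 x
  proof -
    note k = lframeD(1)[OF l] lframeD(10)[OF l x] and ad = adapted_frames[OF lframeD(7)[OF l x]]
    note o = f_orthonormal[OF ad(3)] and fa = f_asd[OF \<iota>_points ad(1)]
    have Fe: "F1 (k x) = f1 (e x)" by (rule F1_eq[OF lframeD(7)[OF l x]])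
    let ?D = "\<lambda>h. inner2 (frechet_derivative (\<eta> \<circ> k) (at x) h) (f1 (e x))"
    have all: "tF \<eta> k \<tau> x (H1 x) = 0 \<and> tF \<eta> k \<tau> x (H2 x) = 0 \<longleftrightarrow> (\<forall>h. tF \<eta> k \<tau> x h = 0)" for \<tau>
    proof
      assume z: "tF \<eta> k \<tau> x (H1 x) = 0 \<and> tF \<eta> k \<tau> x (H2 x) = 0"
      note lin = linear_tF[OF \<eta>s k, of \<tau>]
      show "\<forall>h. tF \<eta> k \<tau> x h = 0"
      proof
        fix h obtain c1 c2 where "h = c1 *\<^sub>R H1 x + c2 *\<^sub>R H2 x" using cramer_2[OF lframe_det[OF l x]] by blast
        then show "tF \<eta> k \<tau> x h = 0" using z by (simp add: linear_add[OF lin] linear_cmul[OF lin])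
      qed
    qed simp
    \<comment> \<open>Affine in the fibre coordinates \<open>r\<close> and \<open>t\<close>: the
      constant part is the E-component of the derivative of \<open>\<eta>\<close>, and the linear
      coefficients are those of \<open>nabla_f1\<close>.\<close>
    have val: "tF \<eta> k (r *\<^sub>R f2 (e x) + t *\<^sub>R f3 (e x)) x h
       = ?D h - r * (\<Gamma> e x 2 3 h - \<Gamma> e x 1 4 h) - t * (\<Gamma> e x 2 4 h + \<Gamma> e x 1 3 h)" for r t h
      by (simp add: tF_def Fe inner2_add_left inner2_scale_left inner2_commute[of "f2 (e x)"] inner2_commute[of "f3 (e x)"] inner2_dF1[OF l x])
    have "(\<forall>\<omega>. (k x, \<omega>) \<in> plus_F X A \<iota> \<eta> \<longrightarrow> (\<forall>h. tF \<eta> k (\<omega> - \<eta> (k x)) x h = 0))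
      \<longleftrightarrow> (\<forall>r t h. tF \<eta> k (r *\<^sub>R f2 (e x) + t *\<^sub>R f3 (e x)) x h = 0)"
    proof (intro iffI allI impI)
      fix r t h assume a: "\<forall>\<omega>. (k x, \<omega>) \<in> plus_F X A \<iota> \<eta> \<longrightarrow> (\<forall>h. tF \<eta> k (\<omega> - \<eta> (k x)) x h = 0)"
      have "r *\<^sub>R f2 (e x) + t *\<^sub>R f3 (e x) \<in> F_fib X A \<iota> (k x)"
        unfolding F_fib_eq using fa
        by (simp add: Fe inner2_add_left inner2_scale_left o subspace_add[OF subspace_asd] subspace_scale[OF subspace_asd])
      then have "(k x, \<eta> (k x) + (r *\<^sub>R f2 (e x) + t *\<^sub>R f3 (e x))) \<in> plus_F X A \<iota> \<eta>" by (simp add: plus_F_iff)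
      from a[rule_format, OF this, of h] show "tF \<eta> k (r *\<^sub>R f2 (e x) + t *\<^sub>R f3 (e x)) x h = 0" by simp
    next
      fix \<omega> h assume a: "\<forall>r t h. tF \<eta> k (r *\<^sub>R f2 (e x) + t *\<^sub>R f3 (e x)) x h = 0" and n: "(k x, \<omega>) \<in> plus_F X A \<iota> \<eta>"
      have m: "\<omega> - \<eta> (k x) \<in> asd X (\<iota> (k x))" "inner2 (\<omega> - \<eta> (k x)) (f1 (e x)) = 0"
        using n by (simp_all add: plus_F_iff F_fib_eq Fe)
      have "\<omega> - \<eta> (k x) = inner2 (\<omega> - \<eta> (k x)) (f2 (e x)) *\<^sub>R f2 (e x) + inner2 (\<omega> - \<eta> (k x)) (f3 (e x)) *\<^sub>R f3 (e x)"
        using asd_expand[OF \<iota>_points ad(1) m(1)] unfolding m(2) by simp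
      then show "tF \<eta> k (\<omega> - \<eta> (k x)) x h = 0" using a by metis
    qed
    also have "\<dots> \<longleftrightarrow> (\<forall>h. ?P k e x h)"
    proof
      assume "\<forall>r t h. tF \<eta> k (r *\<^sub>R f2 (e x) + t *\<^sub>R f3 (e x)) x h = 0"
      then have v: "?D h - r * (\<Gamma> e x 2 3 h - \<Gamma> e x 1 4 h) - t * (\<Gamma> e x 2 4 h + \<Gamma> e x 1 3 h) = 0" for r t h
        unfolding val by blast
      show "\<forall>h. ?P k e x h"
      proof
        fix h show "?P k e x h" using v[where r=0 and t=0 and h=h] v[where r=1 and t=0 and h=h] v[where r=0 and t=1 and h=h] by simp
      qed
    qed (simp add: val)
    finally show ?thesis unfolding all .
  qed
  show ?thesis
    unfolding coassociative_iff_tF[OF \<eta> c] negative_superminimal_iff parallel_iff[OF \<eta>s] using eq by meson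
qed

end

section \<open>The four-sphere\<close>

lemma alt4_subset: "alt4 UNIV G \<Longrightarrow> alt4 T G"
  unfolding alt4_def by blast

text \<open>With \<open>q = w \<bullet> w\<close> this is the factor that brings
  \<open>x + t *\<^sub>R w\<close>, for \<open>w\<close> orthogonal to a unit vector
  \<open>x\<close>, back to the unit sphere. It is even in \<open>t\<close>, so the velocity at 0 is
  unchanged.\<close>

lemma inverse_sqrt_curve:
  fixes q :: real
  assumes "q \<ge> 0"
  shows "smooth_on I (\<lambda>t. 1 / sqrt (1 + t * t * q))"
    and "((\<lambda>t. 1 / sqrt (1 + t * t * q)) has_vector_derivative 0) (at 0)"
proof -
  have pos: "1 + t * t * q > 0" for t using assms by (intro add_pos_nonneg) auto
  have id: "smooth_on UNIV (\<lambda>t::real. t)" by (rule smooth_on_linear[OF bounded_linear_ident])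
  have "smooth_on UNIV (\<lambda>t. 1 + t * t * q)"
    by (intro smooth_on_add smooth_on_mult smooth_on_const id open_UNIV)
  then have "smooth_on UNIV (\<lambda>t. 1 / sqrt (1 + t * t * q))"
    by (rule smooth_on_inverse_sqrt[OF open_UNIV]) (rule pos)
  then show "smooth_on I (\<lambda>t. 1 / sqrt (1 + t * t * q))" by (rule smooth_on_subset) simp
  have "((\<lambda>t. 1 / sqrt (1 + t * t * q)) has_real_derivative 0) (at 0)"
    by (auto intro!: derivative_eq_intros)
  then show "((\<lambda>t. 1 / sqrt (1 + t * t * q)) has_vector_derivative 0) (at 0)"
    by (simp add: has_real_derivative_iff_has_vector_derivative)
qed

lemma points_S4: "points S4 = {x. x \<bullet> x = 1}"
  by (auto simp: S4_def norm_eq_1)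

lemma volform_S4: "volform S4 x a b c d = det (vector [x, a, b, c, d] :: real^5^5)"
  by (simp add: S4_def)

text \<open>Differentiating the squared norm gives one inclusion; for the other, the line in
  direction \<open>w\<close> is normalized.\<close>

lemma tangent_S4:
  assumes "x \<in> points S4" shows "tangent S4 x = {w. x \<bullet> w = 0}"
proof (intro equalityI subsetI)
  fix w assume "w \<in> tangent S4 x"
  then obtain \<epsilon> \<gamma> where g: "\<epsilon> > (0::real)" "\<gamma> ` {-\<epsilon><..<\<epsilon>} \<subseteq> points S4" "\<gamma> 0 = x" "(\<gamma> has_vector_derivative w) (at 0)"
    unfolding tangent_def by blast
  have "((\<lambda>t. \<gamma> t \<bullet> \<gamma> t) has_vector_derivative \<gamma> 0 \<bullet> w + w \<bullet> \<gamma> 0) (at 0)"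
    by (rule bounded_bilinear.has_vector_derivative[OF bounded_bilinear_inner g(4) g(4)])
  moreover have "((\<lambda>t. \<gamma> t \<bullet> \<gamma> t) has_vector_derivative 0) (at 0)"
    by (rule has_vector_derivative_transform_near[OF has_vector_derivative_const[of 1] g(1)])
      (use g(2) in \<open>force simp: points_S4 dist_real_def abs_less_iff\<close>)
  ultimately have "\<gamma> 0 \<bullet> w + w \<bullet> \<gamma> 0 = 0" by (rule vector_derivative_unique_at)
  then show "w \<in> {w. x \<bullet> w = 0}" using g(3) by (simp add: inner_commute)
next
  have xx: "x \<bullet> x = 1" using assms by (simp add: points_S4)
  fix w assume "w \<in> {w. x \<bullet> w = 0}"
  then have w: "x \<bullet> w = 0" "w \<bullet> x = 0" by (auto simp: inner_commute)
  let ?r = "\<lambda>t. 1 / sqrt (1 + t * t * (w \<bullet> w))"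
  define \<gamma> where "\<gamma> = (\<lambda>t. ?r t *\<^sub>R (x + t *\<^sub>R w))"
  have "smooth_on {-1<..<1} \<gamma>"
    unfolding \<gamma>_def
    by (intro smooth_on_scaleR smooth_on_add smooth_on_const inverse_sqrt_curve smooth_on_linear bounded_linear_scaleR_left) auto
  moreover have "\<gamma> t \<in> points S4" for t
  proof -
    have pos: "1 + t * t * (w \<bullet> w) > 0" by (intro add_pos_nonneg) auto
    have "(x + t *\<^sub>R w) \<bullet> (x + t *\<^sub>R w) = 1 + t * t * (w \<bullet> w)" by (simp add: inner_add_left inner_add_right w xx)
    then show ?thesis using pos by (simp add: points_S4 \<gamma>_def)
  qed
  moreover have "\<gamma> 0 = x" by (simp add: \<gamma>_def)
  moreover have "(\<gamma> has_vector_derivative w) (at 0)"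
  proof -
    have "((\<lambda>t. x + t *\<^sub>R w) has_vector_derivative w) (at (0::real))" by (auto intro!: derivative_eq_intros)
    from bounded_bilinear.has_vector_derivative[OF bounded_bilinear_scaleR inverse_sqrt_curve(2)[of "w \<bullet> w"] this]
    show ?thesis by (simp add: \<gamma>_def)
  qed
  ultimately show "w \<in> tangent S4 x" unfolding tangent_def
    by (intro CollectI exI[of _ 1] exI[of _ \<gamma>]) auto
qed

lemma subspace_tangent_S4: "x \<in> points S4 \<Longrightarrow> subspace (tangent S4 x)"
  by (simp add: tangent_S4 subspace_hyperplane)

lemma alt4_S4: "alt4 UNIV (volform S4 x)"
proof (rule alt4I)
  show "linear (\<lambda>a. volform S4 x a b c d)" for b c d
  proof (rule linearI)
    show "volform S4 x (a + a') b c d = volform S4 x a b c d + volform S4 x a' b c d" for a a'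
      unfolding volform_S4 by (rule det_rows_add[of _ 2]) (simp_all add: forall_5)
    show "volform S4 x (r *\<^sub>R a) b c d = r *\<^sub>R volform S4 x a b c d" for r a
      unfolding volform_S4 real_scaleR_def by (rule det_rows_scale[of _ 2]) (simp_all add: forall_5)
  qed
  show "volform S4 x b a c d = - volform S4 x a b c d" for a b c d
    unfolding volform_S4 by (rule det_rows_swap[of 2 3]) (simp_all add: forall_5)
  show "volform S4 x a c b d = - volform S4 x a b c d" for a b c d
    unfolding volform_S4 by (rule det_rows_swap[of 3 4]) (simp_all add: forall_5)
  show "volform S4 x a b d c = - volform S4 x a b c d" for a b c d
    unfolding volform_S4 by (rule det_rows_swap[of 4 5]) (simp_all add: forall_5)
qed

lemma frame_S4:
  assumes x: "x \<in> points S4"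
  shows "\<exists>e. oframe S4 x e \<and> tangent S4 x = span (range (($) e))"
proof -
  have xx: "x \<bullet> x = 1" using x by (simp add: points_S4)
  have ex: "\<exists>n::real^5. n \<bullet> n = 1 \<and> (\<forall>s\<in>S. n \<bullet> s = 0)" if "finite S" "card S \<le> 4" for S
    using unit_orthogonal_ex[OF subspace_UNIV, of S] that by simp
  have card: "card {p} \<le> 4" "card {p, q} \<le> 4" "card {p, q, r} \<le> 4" "card {p, q, r, t} \<le> 4" for p q r t :: "real^5"
    by (simp_all add: card_insert_if)
  obtain a where a: "a \<bullet> a = 1" "a \<bullet> x = 0" using ex[of "{x}"] card by auto
  obtain b where b: "b \<bullet> b = 1" "b \<bullet> x = 0" "b \<bullet> a = 0" using ex[of "{x, a}"] card by auto
  obtain c where c: "c \<bullet> c = 1" "c \<bullet> x = 0" "c \<bullet> a = 0" "c \<bullet> b = 0" using ex[of "{x, a, b}"] card by auto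
  obtain d where d: "d \<bullet> d = 1" "d \<bullet> x = 0" "d \<bullet> a = 0" "d \<bullet> b = 0" "d \<bullet> c = 0" using ex[of "{x, a, b, c}"] card by auto
  \<comment> \<open>With \<open>x\<close> as first row the volume form is the determinant of an
    orthogonal matrix, so it is 1 or -1.\<close>
  let ?M = "vector [x, a, b, c, d] :: real^5^5"
  have "\<forall>i j. ?M $ i \<bullet> ?M $ j = (if i = j then 1 else 0)"
    using xx a b c d by (simp add: forall_5 inner_commute)
  then have "?M ** transpose ?M = mat 1"
    by (simp add: vec_eq_iff matrix_matrix_mult_def transpose_def mat_def inner_vec_def)
  then have "orthogonal_matrix ?M" by (simp add: orthogonal_matrix_def matrix_left_right_inverse)
  then have det: "volform S4 x a b c d = 1 \<or> volform S4 x a b c d = - 1"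
    unfolding volform_S4 by (rule det_orthogonal_matrix)
  have "\<exists>d'. d' \<bullet> d' = 1 \<and> d' \<bullet> x = 0 \<and> d' \<bullet> a = 0 \<and> d' \<bullet> b = 0 \<and> d' \<bullet> c = 0 \<and> volform S4 x a b c d' = 1"
    using det
  proof
    assume "volform S4 x a b c d = - 1"
    then have "volform S4 x a b c (- d) = 1"
      using linear_neg[OF alt4_linear(4)[OF alt4_S4]] by simp
    then show ?thesis using d by (intro exI[of _ "- d"]) simp
  qed (use d in blast)
  then obtain d' where d': "d' \<bullet> d' = 1" "d' \<bullet> x = 0" "d' \<bullet> a = 0" "d' \<bullet> b = 0" "d' \<bullet> c = 0" "volform S4 x a b c d' = 1" by blast
  let ?e = "vector [a, b, c, d'] :: (real^5)^4"
  have on: "onf ?e" using a b c d' by (intro onfI) (simp_all add: inner_commute)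
  have T: "\<forall>i. ?e $ i \<in> tangent S4 x"
    by (simp add: forall_4 tangent_S4[OF x] a b c d' inner_commute[of x])
  have of: "oframe S4 x ?e"
    using on T d'(6) unfolding oframe_def onf_def by simp
  have "x \<noteq> 0" using xx by auto
  then have "dim (tangent S4 x) = 4" using dim_hyperplane[of x] by (simp add: tangent_S4[OF x])
  then have "tangent S4 x \<subseteq> span (range (($) ?e))"
    using onf_independent[OF on] T by (intro card_ge_dim_independent) auto
  moreover have "span (range (($) ?e)) \<subseteq> tangent S4 x"
    using T by (intro span_minimal subspace_tangent_S4 x) auto
  ultimately show ?thesis using of by blast
qed

lemma tproj_S4:
  assumes x: "x \<in> points S4" shows "tproj S4 x w = w - (x \<bullet> w) *\<^sub>R x"
proof (rule oproj_eqI)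
  have xx: "x \<bullet> x = 1" using x by (simp add: points_S4)
  show "w - (x \<bullet> w) *\<^sub>R x \<in> tangent S4 x" by (simp add: tangent_S4[OF x] inner_diff_right xx)
  show "(w - (w - (x \<bullet> w) *\<^sub>R x)) \<bullet> z = 0" if "z \<in> tangent S4 x" for z
    using that by (simp add: tangent_S4[OF x])
qed (auto simp: inner_diff_left subspace_diff[OF subspace_tangent_S4[OF x]])

lemma smooth_on_nth: "open S \<Longrightarrow> smooth_on S f \<Longrightarrow> smooth_on S (\<lambda>y. (f y :: 'b::euclidean_space^'n) $ i)"
  by (rule smooth_on_compose_linear[OF bounded_linear_vec_nth])

interpretation S4: ambient S4
proof
  fix x :: "real^5" assume x: "x \<in> points S4"
  show "\<exists>e. oframe S4 x e \<and> tangent S4 x = span (range (($) e))" by (rule frame_S4[OF x])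
  show "alt4 (tangent S4 x) (volform S4 x)" by (rule alt4_subset[OF alt4_S4])
next
  fix S :: "(real^2) set" and f w :: "real^2 \<Rightarrow> real^5"
  assume S: "open S" and f: "smooth_on S f" "f ` S \<subseteq> points S4" and w: "smooth_on S w"
  have "smooth_on S (\<lambda>y. w y - (f y \<bullet> w y) *\<^sub>R f y)"
    by (intro smooth_on_diff smooth_on_scaleR smooth_on_inner S f w)
  then show "smooth_on S (\<lambda>y. tproj S4 (f y) (w y))"
    by (rule smooth_on_cong[OF S, rotated]) (use f(2) tproj_S4 in auto)
next
  fix S :: "(real^2) set" and f a b c d :: "real^2 \<Rightarrow> real^5"
  assume S: "open S" and s: "smooth_on S f" "smooth_on S a" "smooth_on S b" "smooth_on S c" "smooth_on S d"
  have "smooth_on S (\<lambda>y. vector [f y, a y, b y, c y, d y] $ i $ j :: real)" for i j :: 5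
  proof -
    have "smooth_on S (\<lambda>y. (vector [f y, a y, b y, c y, d y] :: real^5^5) $ i)"
      using exhaust_5[of i] s by auto
    then show ?thesis by (rule smooth_on_nth[OF S])
  qed
  then show "smooth_on S (\<lambda>y. volform S4 (f y) (a y) (b y) (c y) (d y))"
    unfolding volform_S4 det_def
    by (intro smooth_on_sum smooth_on_mult smooth_on_prod smooth_on_const S)
qed

section \<open>The projective plane\<close>

text \<open>Conjugate transpose. Self-adjointness and idempotence are the equations differentiated
  to find the tangent spaces.\<close>

definition adj :: "complex^3^3 \<Rightarrow> complex^3^3" where
  "adj A = (\<chi> i j. cnj (A $ j $ i))"

lemma linear_adj: "linear adj"
  by (rule linearI) (simp_all add: adj_def vec_eq_iff)

lemma matrix_mult_bilinear: "bounded_bilinear (\<lambda>A B :: complex^3^3. A ** B)"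
proof -
  have "bilinear (\<lambda>A B :: complex^3^3. A ** B)"
    unfolding bilinear_def
    by (auto intro!: linearI simp: vec_eq_iff matrix_matrix_mult_def sum.distrib algebra_simps scaleR_sum_right)
  then show ?thesis by (simp add: bilinear_conv_bounded_bilinear)
qed

lemma cdot_linear:
  "cdot (a + b) c = cdot a c + cdot b c" "cdot (a - b) c = cdot a c - cdot b c"
  "cdot c (a + b) = cdot c a + cdot c b"
  by (simp_all add: cdot_def algebra_simps sum.distrib sum_subtractf)

lemma inner_cdot: "a \<bullet> b = Re (cdot a b)"
  by (simp add: cdot_def inner_vec_def inner_complex_def)

lemma line_proj_adj: "adj (line_proj z) = line_proj z"
  by (simp add: adj_def line_proj_def vec_eq_iff mult.commute)

lemma mult_line_proj: "(A ** line_proj z) $ i $ j = (A *v z) $ i * cnj (z $ j)"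
  by (simp add: matrix_matrix_mult_def line_proj_def matrix_vector_mult_def sum_distrib_right mult.assoc)

lemma line_proj_mult: "(line_proj z ** A) $ i $ j = z $ i * cnj ((adj A *v z) $ j)"
  by (simp add: matrix_matrix_mult_def line_proj_def matrix_vector_mult_def adj_def sum_distrib_left mult_ac)

lemma line_proj_vec: "line_proj z *v w = (\<chi> i. cdot w z * z $ i)"
  by (simp add: matrix_vector_mult_def line_proj_def cdot_def vec_eq_iff sum_distrib_left mult_ac)

lemma line_proj_idem:
  assumes "norm z = 1" shows "line_proj z ** line_proj z = line_proj z"
proof -
  have "cdot z z = 1" using assms cdot_self[of z] by simp
  then show ?thesis by (simp add: vec_eq_iff mult_line_proj line_proj_vec) (simp add: line_proj_def)
qed

lemma line_proj'_linear: "linear (line_proj' z)"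
  by (rule linearI) (simp_all add: line_proj'_def vec_eq_iff algebra_simps)

lemma points_CP2: "points CP2 = {line_proj z | z. norm z = 1}"
  by (auto simp: CP2_def)

text \<open>Up to the factor \<open>r * r\<close> the curve is polynomial in \<open>t\<close>, which
  exhibits its smoothness directly.\<close>

lemma line_proj_curve:
  "line_proj (r *\<^sub>R (z + t *\<^sub>R w)) = (r * r) *\<^sub>R (line_proj z + t *\<^sub>R line_proj' z w + (t * t) *\<^sub>R line_proj w)"
  by (simp add: line_proj_def line_proj'_def vec_eq_iff) (simp add: scaleR_conv_of_real algebra_simps)

text \<open>Differentiating idempotence and self-adjointness gives
  \<open>A = P ** A + A ** P\<close> with \<open>A\<close> self-adjoint, so \<open>A\<close> is
  determined by its value \<open>w\<close> on \<open>z\<close>. Conversely, \<open>w\<close> is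
  realized by the lines spanned by \<open>z + t *\<^sub>R w\<close>.\<close>

lemma tangent_CP2:
  assumes z: "norm z = 1"
  shows "tangent CP2 (line_proj z) = {line_proj' z w | w. cdot w z = 0}"
proof (intro equalityI subsetI)
  let ?P = "line_proj z"
  have zz: "cdot z z = 1" using z cdot_self[of z] by simp
  fix A assume "A \<in> tangent CP2 ?P"
  then obtain \<epsilon> \<gamma> where g: "\<epsilon> > (0::real)" "\<gamma> ` {-\<epsilon><..<\<epsilon>} \<subseteq> points CP2" "\<gamma> 0 = ?P" "(\<gamma> has_vector_derivative A) (at 0)"
    unfolding tangent_def by blast
  have \<gamma>: "adj (\<gamma> t) = \<gamma> t" "\<gamma> t ** \<gamma> t = \<gamma> t" if "dist t 0 < \<epsilon>" for t
  proof -
    have "\<gamma> t \<in> points CP2" using g(2) that by (force simp: dist_real_def abs_less_iff)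
    then show "adj (\<gamma> t) = \<gamma> t" "\<gamma> t ** \<gamma> t = \<gamma> t" by (auto simp: points_CP2 line_proj_adj line_proj_idem)
  qed
  have "((\<lambda>t. \<gamma> t ** \<gamma> t) has_vector_derivative \<gamma> 0 ** A + A ** \<gamma> 0) (at 0)"
    by (rule bounded_bilinear.has_vector_derivative[OF matrix_mult_bilinear g(4) g(4)])
  then have "(\<gamma> has_vector_derivative \<gamma> 0 ** A + A ** \<gamma> 0) (at 0)"
    by (rule has_vector_derivative_transform_near[OF _ g(1)]) (rule \<gamma>(2))
  then have A: "A = ?P ** A + A ** ?P" using vector_derivative_unique_at[OF g(4)] unfolding g(3) by blast
  have "((\<lambda>t. adj (\<gamma> t)) has_vector_derivative adj A) (at 0)"
    using bounded_linear.has_vector_derivative[OF _ g(4), of adj] linear_adj linear_conv_bounded_linear by blast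
  then have "(\<gamma> has_vector_derivative adj A) (at 0)"
    by (rule has_vector_derivative_transform_near[OF _ g(1)]) (rule \<gamma>(1))
  then have adjA: "adj A = A" by (rule vector_derivative_unique_at[OF _ g(4)])
  define w where "w = A *v z"
  have "A = line_proj' z w"
  proof -
    have "A $ i $ j = (?P ** A + A ** ?P) $ i $ j" for i j by (rule arg_cong[OF A, of "\<lambda>M. M $ i $ j"])
    then show ?thesis
      by (simp add: vec_eq_iff line_proj'_def mult_line_proj line_proj_mult adjA w_def add.commute)
  qed
  moreover have "cdot w z = 0"
  proof -
    \<comment> \<open>Applied to \<open>z\<close> the equation reads \<open>w = ?P *v w + w\<close>,
      so \<open>w\<close> has no component along \<open>z\<close>.\<close>
    have "w = (?P ** A + A ** ?P) *v z" unfolding w_def by (rule arg_cong[OF A, of "\<lambda>M. M *v z"])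
    also have "\<dots> = ?P *v w + A *v (?P *v z)"
      by (simp add: matrix_vector_mult_add_rdistrib matrix_vector_mul_assoc w_def)
    also have "?P *v z = z" by (simp add: line_proj_vec zz vec_eq_iff)
    finally have "?P *v w = 0" by (simp add: w_def)
    then have "\<forall>i. cdot w z * z $ i = 0" by (simp add: line_proj_vec vec_eq_iff)
    moreover have "\<exists>i. z $ i \<noteq> 0" using z by (metis norm_zero vec_eq_iff zero_index zero_neq_one)
    ultimately show ?thesis by auto
  qed
  ultimately show "A \<in> {line_proj' z w | w. cdot w z = 0}" by blast
next
  fix A assume "A \<in> {line_proj' z w | w. cdot w z = 0}"
  then obtain w where A: "A = line_proj' z w" and w: "cdot w z = 0" by blast
  have zz: "z \<bullet> z = 1" using z by (simp add: dot_square_norm)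
  have wz: "w \<bullet> z = 0" "z \<bullet> w = 0" using w by (simp_all add: inner_cdot cdot_cnj[of z w])
  let ?r = "\<lambda>t. 1 / sqrt (1 + t * t * (w \<bullet> w))"
  define \<gamma> where "\<gamma> = (\<lambda>t. (?r t * ?r t) *\<^sub>R (line_proj z + t *\<^sub>R A + (t * t) *\<^sub>R line_proj w))"
  have id: "smooth_on {-1<..<1} (\<lambda>t::real. t)" by (rule smooth_on_linear[OF bounded_linear_ident])
  have "smooth_on {-1<..<1} \<gamma>"
    unfolding \<gamma>_def
    by (intro smooth_on_scaleR smooth_on_mult smooth_on_add smooth_on_const inverse_sqrt_curve id) auto
  moreover have "\<gamma> t \<in> points CP2" for t
  proof -
    have pos: "1 + t * t * (w \<bullet> w) > 0" by (intro add_pos_nonneg) auto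
    have "(z + t *\<^sub>R w) \<bullet> (z + t *\<^sub>R w) = 1 + t * t * (w \<bullet> w)" by (simp add: inner_add_left inner_add_right wz zz)
    then have "(?r t *\<^sub>R (z + t *\<^sub>R w)) \<bullet> (?r t *\<^sub>R (z + t *\<^sub>R w)) = 1" using pos by simp
    then have "norm (?r t *\<^sub>R (z + t *\<^sub>R w)) = 1" by (simp only: norm_eq_1)
    moreover have "\<gamma> t = line_proj (?r t *\<^sub>R (z + t *\<^sub>R w))" unfolding \<gamma>_def line_proj_curve A ..
    ultimately show ?thesis by (auto simp only: points_CP2)
  qed
  moreover have "\<gamma> 0 = line_proj z" by (simp add: \<gamma>_def)
  moreover have "(\<gamma> has_vector_derivative A) (at 0)"
  proof -
    have "((\<lambda>t. line_proj z + t *\<^sub>R A + (t * t) *\<^sub>R line_proj w) has_vector_derivative A) (at (0::real))"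
      by (auto intro!: derivative_eq_intros)
    moreover have "((\<lambda>t. ?r t * ?r t) has_vector_derivative 0) (at 0)"
      using bounded_bilinear.has_vector_derivative[OF bounded_bilinear_mult inverse_sqrt_curve(2)[of "w \<bullet> w"] inverse_sqrt_curve(2)[of "w \<bullet> w"]] by simp
    ultimately show ?thesis
      unfolding \<gamma>_def using bounded_bilinear.has_vector_derivative[OF bounded_bilinear_scaleR] by fastforce
  qed
  ultimately show "A \<in> tangent CP2 (line_proj z)" unfolding tangent_def
    by (intro CollectI exI[of _ 1] exI[of _ \<gamma>]) auto
qed

lemma subspace_tangent_CP2:
  assumes "norm z = 1" shows "subspace (tangent CP2 (line_proj z))"
proof -
  have "subspace {w. cdot w z = 0}"
    by (auto simp: subspace_def cdot_linear) (simp_all add: cdot_def scaleR_sum_right[symmetric])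
  from linear_subspace_image[OF line_proj'_linear this, of z]
  show ?thesis by (simp add: tangent_CP2[OF assms] image_Collect)
qed

definition iv :: "complex^3 \<Rightarrow> complex^3" where "iv w = (\<chi> i. \<i> * w $ i)"

lemma cdot_iv: "cdot (iv a) b = \<i> * cdot a b" "cdot a (iv b) = - \<i> * cdot a b"
  by (simp_all add: cdot_def iv_def sum_distrib_left mult_ac sum_negf)

lemma kaehler_tangent:
  assumes "norm z = 1" "cdot w z = 0" "cdot w' z = 0"
  shows "kaehler (line_proj z) (line_proj' z w) (line_proj' z w') = 2 * (iv w \<bullet> w')"
proof -
  have "cdot (iv w) z = 0" using assms(2) by (simp add: cdot_iv)
  from line_proj_metric[OF assms(1) this assms(3)] show ?thesis
    by (simp add: kaehler_def CP2_J_line_proj[OF assms(1,2)] iv_def)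
qed

lemma CP2_J_bilinear: "bounded_bilinear CP2_J"
proof -
  note s = bounded_bilinear.add_left[OF matrix_mult_bilinear] bounded_bilinear.add_right[OF matrix_mult_bilinear]
    bounded_bilinear.scaleR_left[OF matrix_mult_bilinear] bounded_bilinear.scaleR_right[OF matrix_mult_bilinear]
  have "bilinear CP2_J"
    unfolding bilinear_def
    by (auto intro!: linearI simp: CP2_J_def vec_eq_iff s algebra_simps)
  then show ?thesis by (simp add: bilinear_conv_bounded_bilinear)
qed

lemma linear_kaehler: "linear (\<lambda>a. kaehler P a b)" "linear (\<lambda>b. kaehler P a b)"
  unfolding kaehler_def
  by (rule linearI; simp add: bounded_bilinear.add_right[OF CP2_J_bilinear] bounded_bilinear.scaleR_right[OF CP2_J_bilinear] inner_simps)+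

lemma volform_CP2: "volform CP2 P a b c d = kaehler P a b * kaehler P c d - kaehler P a c * kaehler P b d + kaehler P a d * kaehler P b c"
  by (simp add: CP2_def)

lemma kaehler_skew:
  assumes z: "norm z = 1" and a: "a \<in> tangent CP2 (line_proj z)" and b: "b \<in> tangent CP2 (line_proj z)"
  shows "kaehler (line_proj z) b a = - kaehler (line_proj z) a b"
proof -
  obtain v w where vw: "a = line_proj' z v" "cdot v z = 0" "b = line_proj' z w" "cdot w z = 0"
    using a b by (auto simp: tangent_CP2[OF z])
  have "iv w \<bullet> v = - (iv v \<bullet> w)"
    by (simp add: inner_cdot cdot_iv cdot_cnj[of w v])
  then show ?thesis by (simp only: vw(1,3) kaehler_tangent[OF z vw(2,4)] kaehler_tangent[OF z vw(4,2)] mult_minus_right)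
qed

text \<open>Everything reduces to skewness of \<open>kaehler\<close>, which is established on
  tangent vectors only.\<close>

lemma alt4_CP2:
  assumes z: "norm z = 1" shows "alt4 (tangent CP2 (line_proj z)) (volform CP2 (line_proj z))"
  unfolding alt4_def
proof (intro conjI allI ballI)
  let ?K = "kaehler (line_proj z)"
  note l = linear_add[OF linear_kaehler(1)] linear_add[OF linear_kaehler(2)] linear_cmul[OF linear_kaehler(1)] linear_cmul[OF linear_kaehler(2)]
  show "linear (\<lambda>a. volform CP2 (line_proj z) a b c d)" "linear (\<lambda>b. volform CP2 (line_proj z) a b c d)"
    "linear (\<lambda>c. volform CP2 (line_proj z) a b c d)" "linear (\<lambda>d. volform CP2 (line_proj z) a b c d)" for a b c d
    by (rule linearI; simp only: volform_CP2 l; simp add: algebra_simps)+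
  fix a b c d assume T: "a \<in> tangent CP2 (line_proj z)" "b \<in> tangent CP2 (line_proj z)" "c \<in> tangent CP2 (line_proj z)" "d \<in> tangent CP2 (line_proj z)"
  have k: "?K b a = - ?K a b" "?K c b = - ?K b c" "?K d c = - ?K c d"
    by (rule kaehler_skew[OF z] T)+
  show "volform CP2 (line_proj z) b a c d = - volform CP2 (line_proj z) a b c d"
    "volform CP2 (line_proj z) a c b d = - volform CP2 (line_proj z) a b c d"
    "volform CP2 (line_proj z) a b d c = - volform CP2 (line_proj z) a b c d"
    unfolding volform_CP2 k by (simp_all add: algebra_simps)
qed

text \<open>A matrix with unitary rows has unitary columns, and the latter is the completeness
  relation that expands \<open>y\<close>.\<close>

lemma unitary_expand:
  assumes u: "cdot z z = 1" "cdot v v = 1" "cdot w w = 1" "cdot v z = 0" "cdot w z = 0" "cdot w v = 0"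
  shows "y $ b = cdot y z * z $ b + cdot y v * v $ b + cdot y w * w $ b"
proof -
  have u': "cdot z v = 0" "cdot z w = 0" "cdot v w = 0"
    using u(4,5,6) cdot_cnj[of z v] cdot_cnj[of z w] cdot_cnj[of v w] by simp_all
  let ?U = "vector [z, v, w] :: complex^3^3"
  have "(?U ** adj ?U) $ i $ j = cdot (?U $ i) (?U $ j)" for i j
    by (simp add: matrix_matrix_mult_def adj_def cdot_def)
  moreover have "\<forall>i j. cdot (?U $ i) (?U $ j) = (if i = j then 1 else 0)"
    by (simp add: forall_3 u u')
  ultimately have "?U ** adj ?U = mat 1" by (simp add: vec_eq_iff mat_def)
  then have 1: "adj ?U ** ?U = mat 1" by (simp add: matrix_left_right_inverse)
  have "(adj ?U ** ?U) $ a $ b = cnj (z $ a) * z $ b + cnj (v $ a) * v $ b + cnj (w $ a) * w $ b" for a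
    by (simp add: matrix_matrix_mult_def adj_def sum_3)
  then have 2: "cnj (z $ a) * z $ b + cnj (v $ a) * v $ b + cnj (w $ a) * w $ b = (if a = b then 1 else 0)" for a
    unfolding 1 by (simp add: mat_def)
  have "cdot y z * z $ b + cdot y v * v $ b + cdot y w * w $ b
     = (\<Sum>a\<in>UNIV. y $ a * (cnj (z $ a) * z $ b + cnj (v $ a) * v $ b + cnj (w $ a) * w $ b))"
    by (simp add: cdot_def sum_distrib_left sum.distrib algebra_simps)
  also have "\<dots> = y $ b" by (simp add: 2 mult_delta_right)
  finally show ?thesis by simp
qed

lemma cdot_eq_0: "y \<bullet> z = 0 \<Longrightarrow> y \<bullet> iv z = 0 \<Longrightarrow> cdot y z = 0"
  by (simp add: inner_cdot cdot_iv complex_eq_iff)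

text \<open>A unitary basis \<open>z\<close>, \<open>v\<close>, \<open>w\<close> gives the tangent
  directions v, i v, w, i w, which in this order are positive for the complex orientation.\<close>

lemma frame_CP2:
  assumes z: "norm z = 1"
  shows "\<exists>e. oframe CP2 (line_proj z) e \<and> tangent CP2 (line_proj z) = span (range (($) e))"
proof -
  have zz: "cdot z z = 1" using z cdot_self[of z] by simp
  have ex: "\<exists>n::complex^3. n \<bullet> n = 1 \<and> (\<forall>s\<in>S. n \<bullet> s = 0)" if "finite S" "card S \<le> 4" for S
    using unit_orthogonal_ex[OF subspace_UNIV, of S] that by simp
  have card: "card {p, q} \<le> 4" "card {p, q, r, t} \<le> 4" for p q r t :: "complex^3"
    by (simp_all add: card_insert_if)
  obtain v where v: "v \<bullet> v = 1" "v \<bullet> z = 0" "v \<bullet> iv z = 0" using ex[of "{z, iv z}"] card by auto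
  obtain w where w: "w \<bullet> w = 1" "w \<bullet> z = 0" "w \<bullet> iv z = 0" "w \<bullet> v = 0" "w \<bullet> iv v = 0"
    using ex[of "{z, iv z, v, iv v}"] card by auto
  have c: "cdot v z = 0" "cdot w z = 0" "cdot w v = 0" using v w by (simp_all add: cdot_eq_0)
  then have c': "cdot z v = 0" "cdot z w = 0" "cdot v w = 0"
    using cdot_cnj[of z v] cdot_cnj[of z w] cdot_cnj[of v w] by simp_all
  have vv: "cdot v v = 1" and ww: "cdot w w = 1"
    using cdot_self[of v] cdot_self[of w] v(1) w(1) by (simp_all flip: norm_eq_1)
  let ?P = "line_proj z"
  \<comment> \<open>The factor compensates the 2 in \<open>line_proj_metric\<close> and
    \<open>kaehler_tangent\<close>.\<close>
  define L where "L = (\<lambda>u. (1 / sqrt 2) *\<^sub>R line_proj' z u)"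
  have L: "linear L" unfolding L_def by (rule linear_compose_scale_right[OF line_proj'_linear])
  have iL: "L a \<bullet> L b = Re (cdot a b)" if "cdot a z = 0" "cdot b z = 0" for a b
    using line_proj_metric[OF z that] by (simp add: L_def inner_cdot)
  have kL: "kaehler ?P (L a) (L b) = Re (cdot (iv a) b)" if "cdot a z = 0" "cdot b z = 0" for a b
    using kaehler_tangent[OF z that]
    by (simp add: L_def linear_cmul[OF linear_kaehler(1)] linear_cmul[OF linear_kaehler(2)] inner_cdot)
  have LT: "L a \<in> tangent CP2 ?P" if "cdot a z = 0" for a
    unfolding L_def using that by (intro subspace_scale subspace_tangent_CP2 z) (auto simp: tangent_CP2[OF z])
  have ic: "cdot (iv v) z = 0" "cdot (iv w) z = 0" by (simp_all add: cdot_iv c)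
  let ?e = "vector [L v, L (iv v), L w, L (iv w)] :: (complex^3^3)^4"
  have T: "\<forall>i. ?e $ i \<in> tangent CP2 ?P" by (simp add: forall_4 LT c ic)
  have on: "onf ?e"
    by (rule onfI) (simp_all add: iL c ic cdot_iv c' vv ww)
  have "volform CP2 ?P (L v) (L (iv v)) (L w) (L (iv w)) = 1"
    by (simp add: volform_CP2 kL c ic cdot_iv c' vv ww)
  then have of: "oframe CP2 ?P ?e" using on T unfolding oframe_def onf_def by simp
  have "tangent CP2 ?P \<subseteq> span (range (($) ?e))"
  proof
    fix A assume "A \<in> tangent CP2 ?P"
    then obtain y where y: "A = line_proj' z y" "cdot y z = 0" by (auto simp: tangent_CP2[OF z])
    have "y = Re (cdot y v) *\<^sub>R v + Im (cdot y v) *\<^sub>R iv v + Re (cdot y w) *\<^sub>R w + Im (cdot y w) *\<^sub>R iv w"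
    proof (unfold vec_eq_iff, rule allI)
      fix b
      have "(Re \<alpha> *\<^sub>R a + Im \<alpha> *\<^sub>R iv a) $ b = \<alpha> * a $ b" for \<alpha> and a :: "complex^3"
        by (simp add: iv_def complex_eq_iff)
      then have "(Re (cdot y v) *\<^sub>R v + Im (cdot y v) *\<^sub>R iv v + (Re (cdot y w) *\<^sub>R w + Im (cdot y w) *\<^sub>R iv w)) $ b = cdot y v * v $ b + cdot y w * w $ b"
        by (simp only: vector_add_component[of "_ + _" "_ + _"])
      then show "y $ b = (Re (cdot y v) *\<^sub>R v + Im (cdot y v) *\<^sub>R iv v + Re (cdot y w) *\<^sub>R w + Im (cdot y w) *\<^sub>R iv w) $ b"
        using unitary_expand[OF zz vv ww c, of y b] y(2) by (simp add: add.assoc)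
    qed
    then have "L y = Re (cdot y v) *\<^sub>R L v + Im (cdot y v) *\<^sub>R L (iv v) + Re (cdot y w) *\<^sub>R L w + Im (cdot y w) *\<^sub>R L (iv w)"
      using linear_add[OF L] linear_cmul[OF L] by metis
    then have "L y \<in> span (range (($) ?e))"
      using onf_sums_in_span[of "Re (cdot y v)" ?e "Im (cdot y v)" "Re (cdot y w)" "Im (cdot y w)"] by simp
    moreover have "A = sqrt 2 *\<^sub>R L y" by (simp add: L_def y)
    ultimately show "A \<in> span (range (($) ?e))" by (simp add: span_scale)
  qed
  moreover have "span (range (($) ?e)) \<subseteq> tangent CP2 ?P"
    using T by (intro span_minimal subspace_tangent_CP2 z) auto
  ultimately show ?thesis using of by blast
qed

text \<open>With H the self-adjoint part of \<open>A\<close> this is (1 - P) H P + P H (1 - P), the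
  off-diagonal blocks of H. Being polynomial in \<open>P\<close> and real linear in
  \<open>A\<close>, it shows that the projection is smooth.\<close>

definition CP2_proj :: "complex^3^3 \<Rightarrow> complex^3^3 \<Rightarrow> complex^3^3" where
  "CP2_proj P A = (let H = (1/2) *\<^sub>R (A + adj A) in H ** P + P ** H - 2 *\<^sub>R ((P ** H) ** P))"

lemma inner_line_proj': "A \<bullet> line_proj' z w = (A *v z) \<bullet> w + (adj A *v z) \<bullet> w"
proof -
  have c: "a \<bullet> b = Re (a * cnj b)" for a b :: complex by (simp add: inner_complex_def)
  have "A \<bullet> line_proj' z w = Re (\<Sum>i\<in>UNIV. \<Sum>j\<in>UNIV. A $ i $ j * cnj (w $ i * cnj (z $ j) + z $ i * cnj (w $ j)))"
    by (simp only: inner_vec_def c line_proj'_def vec_lambda_beta Re_sum)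
  also have "\<dots> = Re (\<Sum>i\<in>UNIV. \<Sum>j\<in>UNIV. A $ i $ j * z $ j * cnj (w $ i)) + Re (\<Sum>i\<in>UNIV. \<Sum>j\<in>UNIV. A $ i $ j * cnj (z $ i) * w $ j)"
    by (simp add: sum.distrib algebra_simps)
  also have "(\<Sum>i\<in>UNIV. \<Sum>j\<in>UNIV. A $ i $ j * z $ j * cnj (w $ i)) = cdot (A *v z) w"
    by (simp add: cdot_def matrix_vector_mult_def sum_distrib_right)
  also have "(\<Sum>i\<in>UNIV. \<Sum>j\<in>UNIV. A $ i $ j * cnj (z $ i) * w $ j) = cnj (cdot (adj A *v z) w)"
    by (subst sum.swap) (simp add: cdot_def matrix_vector_mult_def adj_def sum_distrib_right)
  finally show ?thesis by (simp add: inner_cdot)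
qed

lemma tproj_CP2:
  assumes z: "norm z = 1" shows "tproj CP2 (line_proj z) A = CP2_proj (line_proj z) A"
proof (rule oproj_eqI)
  let ?P = "line_proj z"
  have zz: "cdot z z = 1" using z cdot_self[of z] by simp
  define H where "H = (1/2) *\<^sub>R (A + adj A)"
  have aa: "adj (adj A) = A" by (simp add: adj_def vec_eq_iff)
  have H: "adj H = H" by (simp add: H_def linear_cmul[OF linear_adj] linear_add[OF linear_adj] aa add.commute)
  define h where "h = cdot (H *v z) z"
  have "cnj h = h"
  proof -
    have "cnj (cdot (H *v z) z) = cdot (adj H *v z) z"
    proof -
      have "cnj (cdot (H *v z) z) = (\<Sum>i\<in>UNIV. \<Sum>j\<in>UNIV. cnj (H $ i $ j) * cnj (z $ j) * z $ i)"
        by (simp add: cdot_def matrix_vector_mult_def sum_distrib_right)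
      also have "\<dots> = cdot (adj H *v z) z"
        by (subst sum.swap) (simp add: cdot_def matrix_vector_mult_def adj_def sum_distrib_left mult_ac)
      finally show ?thesis .
    qed
    then show ?thesis by (simp add: H h_def)
  qed
  \<comment> \<open>The component of \<open>H *v z\<close> orthogonal to \<open>z\<close>; it is the
    vector that represents the projection.\<close>
  define v where "v = H *v z - (\<chi> i. h * z $ i)"
  have "cdot (\<chi> i. h * z $ i) z = h * cdot z z" by (simp add: cdot_def sum_distrib_left mult.assoc)
  then have vz: "cdot v z = 0" by (simp add: v_def cdot_linear h_def[symmetric] zz)
  have PHP: "((?P ** H) ** ?P) $ i $ j = h * z $ i * cnj (z $ j)" for i j
    by (simp add: mult_line_proj matrix_vector_mul_assoc[symmetric] line_proj_vec h_def)
  have eq: "CP2_proj ?P A = line_proj' z v"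
    unfolding CP2_proj_def H_def[symmetric] Let_def
    by (simp add: vec_eq_iff PHP mult_line_proj[of H] line_proj_mult H line_proj'_def v_def \<open>cnj h = h\<close> algebra_simps scaleR_2)
  show "CP2_proj ?P A \<in> tangent CP2 ?P" unfolding eq tangent_CP2[OF z] using vz by blast
  fix Z assume "Z \<in> tangent CP2 ?P"
  then obtain w where w: "Z = line_proj' z w" "cdot w z = 0" by (auto simp: tangent_CP2[OF z])
  have "cdot (\<chi> i. h * z $ i) w = h * cdot z w" by (simp add: cdot_def sum_distrib_left mult.assoc)
  then have "(\<chi> i. h * z $ i) \<bullet> w = 0" using w(2) by (simp add: inner_cdot cdot_cnj[of z w])
  then have "line_proj' z v \<bullet> Z = 2 * ((H *v z) \<bullet> w)"
    using line_proj_metric[OF z vz w(2)] by (simp add: w(1)) (simp add: v_def inner_diff_left)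
  also have "\<dots> = A \<bullet> Z"
  proof -
    have "2 *\<^sub>R (H *v z) = A *v z + adj A *v z"
      by (simp add: H_def vec_eq_iff matrix_vector_mult_def sum.distrib scaleR_sum_right algebra_simps)
    then have "2 * ((H *v z) \<bullet> w) = (A *v z + adj A *v z) \<bullet> w" by (metis inner_scaleR_left)
    then show ?thesis by (simp add: w(1) inner_line_proj' inner_add_left)
  qed
  finally show "(A - CP2_proj ?P A) \<bullet> Z = 0" by (simp add: eq inner_diff_left)
qed (auto simp: inner_diff_left subspace_diff[OF subspace_tangent_CP2[OF z]])

interpretation CP2: ambient CP2
proof
  fix P assume "P \<in> points CP2"
  then obtain z where z: "P = line_proj z" "norm z = 1" by (auto simp: points_CP2)
  show "\<exists>e. oframe CP2 P e \<and> tangent CP2 P = span (range (($) e))" unfolding z(1) by (rule frame_CP2[OF z(2)])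
  show "alt4 (tangent CP2 P) (volform CP2 P)" unfolding z(1) by (rule alt4_CP2[OF z(2)])
next
  fix S :: "(real^2) set" and f w :: "real^2 \<Rightarrow> complex^3^3"
  assume S: "open S" and f: "smooth_on S f" "f ` S \<subseteq> points CP2" and w: "smooth_on S w"
  have "bounded_linear adj" using linear_adj linear_conv_bounded_linear by blast
  then have "smooth_on S (\<lambda>y. CP2_proj (f y) (w y))"
    unfolding CP2_proj_def Let_def
    by (intro smooth_on_diff smooth_on_add smooth_on_scaleR smooth_on_const smooth_on_bilinear[OF matrix_mult_bilinear]
        smooth_on_compose_linear[of adj] S f w)
  moreover have "CP2_proj (f y) (w y) = tproj CP2 (f y) (w y)" if "y \<in> S" for y
  proof -
    have "f y \<in> points CP2" using f(2) that by blast
    then obtain z where "f y = line_proj z" "norm z = 1" by (auto simp: points_CP2)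
    then show ?thesis by (simp add: tproj_CP2)
  qed
  ultimately show "smooth_on S (\<lambda>y. tproj CP2 (f y) (w y))" by (rule smooth_on_cong[OF S, rotated])
next
  fix S :: "(real^2) set" and f a b c d :: "real^2 \<Rightarrow> complex^3^3"
  assume S: "open S" and s: "smooth_on S f" "smooth_on S a" "smooth_on S b" "smooth_on S c" "smooth_on S d"
  show "smooth_on S (\<lambda>y. volform CP2 (f y) (a y) (b y) (c y) (d y))"
    unfolding volform_CP2 kaehler_def
    by (intro smooth_on_add smooth_on_diff smooth_on_mult smooth_on_inner smooth_on_bilinear[OF CP2_J_bilinear] S s)
qed

theorem theorem5p3:
  fixes A :: "'l::{t2_space, second_countable_topology} params" and c :: real
  assumes surface: "oriented_surface A" and c: "c > 0"
  shows
    "(\<forall>(\<iota> :: 'l \<Rightarrow> real^5) \<sigma> \<eta>.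
        immersed S4 A \<iota> \<longrightarrow> smooth_section A (F_fib S4 A \<iota>) \<sigma> \<longrightarrow> smooth_section A (E_fib S4 A \<iota>) \<eta> \<longrightarrow>
        (associative S4 c A \<iota> (E_plus S4 A \<iota> \<sigma>) \<longleftrightarrow> minimal S4 A \<iota> \<and> holomorphic_F S4 A \<iota> \<sigma>) \<and>
        (coassociative S4 c A \<iota> (plus_F S4 A \<iota> \<eta>) \<longleftrightarrow>
           negative_superminimal S4 A \<iota> \<and> parallel_E S4 A \<iota> \<eta>)) \<and>
     (\<forall>(\<iota> :: 'l \<Rightarrow> complex^3^3) \<sigma> \<eta>.
        immersed CP2 A \<iota> \<longrightarrow> smooth_section A (F_fib CP2 A \<iota>) \<sigma> \<longrightarrow> smooth_section A (E_fib CP2 A \<iota>) \<eta> \<longrightarrow>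
        (associative CP2 c A \<iota> (E_plus CP2 A \<iota> \<sigma>) \<longleftrightarrow> minimal CP2 A \<iota> \<and> holomorphic_F CP2 A \<iota> \<sigma>) \<and>
        (coassociative CP2 c A \<iota> (plus_F CP2 A \<iota> \<eta>) \<longleftrightarrow>
           negative_superminimal CP2 A \<iota> \<and> parallel_E CP2 A \<iota> \<eta>))"
proof (intro conjI allI impI)
  fix \<iota> :: "'l \<Rightarrow> real^5" and \<sigma> \<eta>
  assume i: "immersed S4 A \<iota>" and \<sigma>: "smooth_section A (F_fib S4 A \<iota>) \<sigma>" and \<eta>: "smooth_section A (E_fib S4 A \<iota>) \<eta>"
  interpret surface_in S4 A \<iota> by unfold_locales (rule surface, rule i)
  show "associative S4 c A \<iota> (E_plus S4 A \<iota> \<sigma>) \<longleftrightarrow> minimal S4 A \<iota> \<and> holomorphic_F S4 A \<iota> \<sigma>"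
    by (rule associative_iff[OF \<sigma> c])
  show "coassociative S4 c A \<iota> (plus_F S4 A \<iota> \<eta>) \<longleftrightarrow> negative_superminimal S4 A \<iota> \<and> parallel_E S4 A \<iota> \<eta>"
    by (rule coassociative_iff[OF \<eta> c])
next
  fix \<iota> :: "'l \<Rightarrow> complex^3^3" and \<sigma> \<eta>
  assume i: "immersed CP2 A \<iota>" and \<sigma>: "smooth_section A (F_fib CP2 A \<iota>) \<sigma>" and \<eta>: "smooth_section A (E_fib CP2 A \<iota>) \<eta>"
  interpret surface_in CP2 A \<iota> by unfold_locales (rule surface, rule i)
  show "associative CP2 c A \<iota> (E_plus CP2 A \<iota> \<sigma>) \<longleftrightarrow> minimal CP2 A \<iota> \<and> holomorphic_F CP2 A \<iota> \<sigma>"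
    by (rule associative_iff[OF \<sigma> c])
  show "coassociative CP2 c A \<iota> (plus_F CP2 A \<iota> \<eta>) \<longleftrightarrow> negative_superminimal CP2 A \<iota> \<and> parallel_E CP2 A \<iota> \<eta>"
    by (rule coassociative_iff[OF \<eta> c])
qed

end
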